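(* Let $1\le r<p,q<s\le\infty$, $m\in\mathbb N$ and $b\in L^1_{\rm loc}(\mathbb R^n)$. Assume that $\mu\in A_{p/r}$ and $\lambda\in A_{q/r}\cap\mathrm{RH}_{(s/q)'}$. Set $$\alpha:=-\tfrac1t:=\tfrac1{pm}-\tfrac1{qm},\qquad\alpha_+:=\max\{\alpha,0\},$$ and define the Bloom weight $\nu$ by $\nu^{1+\alpha}:=\mu^{\frac1{pm}}\lambda^{-\frac1{qm}}$. For any sparse family $\mathcal S\subset\mathscr D$, where $\mathscr D$ is a dyadic lattice, and any $f\in L^p(\mu)$ and $g\in L^{q'}(\lambda^{1-q'})$ we have $$\mathcal B^m_{\mathcal S,b,r,s}(f,g)\lesssim C(\mu,\lambda)\,\|f\|_{L^p(\mu)}\|g\|_{L^{q'}(\lambda^{1-q'})}\cdot\begin{cases}\|b\|_{\mathrm{BMO}_\nu^{\alpha n}}^m,&p\le q,\\ \|M_\nu^{\#}(b)\|_{L^t(\nu)}^m,&q\le p,\end{cases}$$ where $$C(\mu,\lambda)\le\begin{cases}[\mu]_{A_{p/r}}^{\beta_{\mu_1}}[\lambda]_{A_{q/r}}^{\beta_{\lambda_1}+\beta_{\lambda_2}}[\lambda]_{\mathrm{RH}_{(s/q)'}}^{\beta_{\lambda_2}}&\text{for any }p,q,m,\\[4pt] [\mu]_{A_{p/r}}^{\beta_{\mu_2}}[\lambda]_{A_{q/r}}^{\beta_{\lambda_2}}[\lambda]_{\mathrm{RH}_{(s/q)'}}^{\beta_{\lambda_2}}&\text{if }q\le p,\ m\ge2\end{cases}$$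 (so that, if $q\le p$ and $m\ge2$, the second bound is available in addition to the first), with $$\beta_{\mu_1}:=\max\big(\tfrac1r,\tfrac1{p-r}\big)+\big(1-\tfrac1{rm}\big)(rm-\lfloor rm\rfloor)\max\big(\tfrac{1-\alpha_+}{r-\alpha p},\tfrac1{(1+\alpha)p-r}\big)+\tfrac qp\sum_{j=1}^{\lfloor rm\rfloor-1}\tfrac j{rm}\max\big(\tfrac{1-\alpha_+}{r+jq\alpha},\tfrac1{(1-j\alpha)q-r}\big),$$ $$\beta_{\mu_2}:=\tfrac{rm}{p-r},$$ $$\beta_{\lambda_1}:=\tfrac pq\tfrac1{rm}(rm-\lfloor rm\rfloor)\max\big(\tfrac{1-\alpha_+}{r-\alpha p},\tfrac1{(1+\alpha)p-r}\big)+\sum_{j=1}^{\lfloor rm\rfloor-1}\big(1-\tfrac j{rm}\big)\max\big(\tfrac{1-\alpha_+}{r+jq\alpha},\tfrac1{(1-j\alpha)q-r}\big),$$ $$\beta_{\lambda_2}:=\max\Big(\tfrac{s(1-\frac\alpha r)-1}{s-q},\tfrac1{q-r}\Big).$$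
   Context: The symbol $\lesssim$ denotes an inequality up to an implicit multiplicative constant, which may depend on $p,q,n,m$ but not on any of the functions (in particular weights) under consideration; the sparseness number of $\mathcal S$ is regarded as fixed. If $s=\infty$, $\frac{s(1-\frac\alpha r)-1}{s-q}$ is read as its limit $1-\frac\alpha r$. Cubes in $\mathbb R^n$ have sides parallel to the axes; $\langle h\rangle_Q:=\frac1{|Q|}\int_Qh$ and, for $h\ge0$, $t>0$, $\langle h\rangle_{t,Q}:=\langle h^t\rangle_Q^{1/t}$. For a cube $Q$, $\mathcal D(Q)$ is the set of cubes obtained by repeated subdivision of $Q$ and its descendants into $2^n$ congruent subcubes. A dyadic lattice $\mathscr D$ is a collection of cubes such that (i) $\mathcal D(Q)\subseteq\mathscr D$ for each $Q\in\mathscr D$; (ii) any $Q',Q''\in\mathscr D$ have a common ancestor $Q\in\mathscr D$, i.e. $Q',Q''\in\mathcal D(Q)$; (iii) every compact set is contained in a cube of $\mathscr D$. A family $\mathcal S$ of cubes is $\eta$-sparse ($\eta\in(0,1)$) if for every $Q\in\mathcal S$ there is $E_Q\subseteq Q$ with $|E_Q|\ge\eta|Q|$ and the $E_Q$ are pairwise disjoint; sparse means $\eta$-sparse, with the sparseness number $\eta$ suppressed. The bilinear sparse form is $$\mathcal B^m_{\mathcal S,b,r,s}(f,g):=\sum_{Q\in\mathcal S}\big\langle|b-\langle b\rangle_Q|^m|f|\big\rangle_{r,Q}\langle|g|\rangle_{s',Q}|Q|.$$ A weight is a non-negative locally integrable function, $\nu(Q):=\int_Q\nu$, $\|f\|_{L^p(w)}:=(\int|f|^pw)^{1/p}$.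 For $1<p<\infty$, $[w]_{A_p}:=\sup_Q\langle w\rangle_{1,Q}\langle w^{-1}\rangle_{\frac1{p-1},Q}$, and for $1\le t<\infty$, $[w]_{\mathrm{RH}_t}:=\sup_Q\langle w\rangle_{t,Q}/\langle w\rangle_{1,Q}$; $A_p$, $\mathrm{RH}_t$ are the classes of weights with finite constant. Primes denote H\"older conjugates; for $s=\infty$, $(s/q)'=1$ and $[w]_{\mathrm{RH}_1}=1$. For $\gamma\ge0$ and a weight $\nu$, $$\|b\|_{\mathrm{BMO}_\nu^\gamma}:=\sup_Q\frac1{\nu(Q)^{1+\gamma/n}}\int_Q|b-\langle b\rangle_Q|,\qquad M_\nu^{\#}(b)(x):=\sup_{Q\ni x}\frac1{\nu(Q)}\int_Q|b-\langle b\rangle_Q|.$$ If $p=q$ then $t=\infty$, $L^t(\nu)$ is read as $L^\infty(\mathbb R^n)$, and the two norms of $b$ coincide.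
   Formalization: The implicit constant in ≲ is allowed to depend on r and s as well as on p, q, n, m and the sparseness number; a constant independent of r and s is impossible, since for p=q and μ=λ=1 it blows up as r→p or s→q. *)

theory Defs
  imports "HOL-Analysis.Analysis" "HOL-Probability.Essential_Supremum"
begin

text \<open>Cubes are half-open, so that the dyadic subcubes of a cube partition it.\<close>

definition cube :: "real ^ 'n \<Rightarrow> real \<Rightarrow> (real ^ 'n) set" where
  "cube a l = {x. \<forall>i. a $ i \<le> x $ i \<and> x $ i < a $ i + l}"

definition cubes :: "(real ^ 'n) set set" where
  "cubes = {cube a l | a l. l > 0}"

inductive_set dyadic_descendants :: "(real ^ 'n) set \<Rightarrow> (real ^ 'n) set set"
  for Q :: "(real ^ 'n) set" where
  self: "Q \<in> dyadic_descendants Q"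
| subdivide: "\<lbrakk>cube a l \<in> dyadic_descendants Q; l > 0; \<And>i. c $ i = a $ i \<or> c $ i = a $ i + l / 2\<rbrakk>
    \<Longrightarrow> cube c (l / 2) \<in> dyadic_descendants Q"

definition dyadic_lattice :: "(real ^ 'n) set set \<Rightarrow> bool" where
  "dyadic_lattice \<D> \<longleftrightarrow>
     \<D> \<subseteq> cubes \<and>
     (\<forall>Q\<in>\<D>. dyadic_descendants Q \<subseteq> \<D>) \<and>
     (\<forall>Q'\<in>\<D>. \<forall>Q''\<in>\<D>. \<exists>Q\<in>\<D>. Q' \<in> dyadic_descendants Q \<and> Q'' \<in> dyadic_descendants Q) \<and>
     (\<forall>K. compact K \<longrightarrow> (\<exists>Q\<in>\<D>. K \<subseteq> Q))"

definition sparse_family :: "real \<Rightarrow> (real ^ 'n) set set \<Rightarrow> bool" where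
  "sparse_family \<eta> S \<longleftrightarrow> S \<subseteq> cubes \<and>
     (\<exists>E. (\<forall>Q\<in>S. E Q \<subseteq> Q \<and> E Q \<in> sets lebesgue \<and> measure lebesgue (E Q) \<ge> \<eta> * measure lebesgue Q)
        \<and> disjoint_family_on E S)"

text \<open>
  Non-negative quantities are taken in the type \<^typ>\<open>ennreal\<close>.  The following power is only used
  for exponents \<open>a > 0\<close>, where \<open>\<infinity>\<close> to the power \<open>a\<close> is \<open>\<infinity>\<close>.
\<close>

definition epow :: "ennreal \<Rightarrow> real \<Rightarrow> ennreal" where
  "epow x a = (if x = \<infinity> then \<infinity> else ennreal (enn2real x powr a))"

definition avg :: "real \<Rightarrow> (real ^ 'n \<Rightarrow> ennreal) \<Rightarrow> (real ^ 'n) set \<Rightarrow> ennreal" where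
  "avg t h Q = epow ((\<integral>\<^sup>+x\<in>Q. epow (h x) t \<partial>lebesgue) / emeasure lebesgue Q) (1 / t)"

definition locally_integrable :: "(real ^ 'n \<Rightarrow> 'b::euclidean_space) \<Rightarrow> bool" where
  "locally_integrable h \<longleftrightarrow> (\<forall>K. compact K \<longrightarrow> set_integrable lebesgue K h)"

definition mean :: "(real ^ 'n \<Rightarrow> complex) \<Rightarrow> (real ^ 'n) set \<Rightarrow> complex" where
  "mean b Q = (1 / measure lebesgue Q) *\<^sub>R (LINT x:Q|lebesgue. b x)"

text \<open>The Hoelder conjugate of an exponent \<open>s\<close> with \<open>1 < s \<le> \<infinity>\<close>.\<close>

definition conjugate_exponent :: "ereal \<Rightarrow> real" where
  "conjugate_exponent s = (if s = \<infinity> then 1 else real_of_ereal s / (real_of_ereal s - 1))"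

definition sparse_form ::
  "(real ^ 'n) set set \<Rightarrow> nat \<Rightarrow> (real ^ 'n \<Rightarrow> complex) \<Rightarrow> real \<Rightarrow> ereal \<Rightarrow>
   (real ^ 'n \<Rightarrow> complex) \<Rightarrow> (real ^ 'n \<Rightarrow> complex) \<Rightarrow> ennreal" where
  "sparse_form S m b r s f g =
     (\<Sum>\<^sub>\<infinity>Q\<in>S. avg r (\<lambda>x. ennreal (norm (b x - mean b Q) ^ m * norm (f x))) Q
             * avg (conjugate_exponent s) (\<lambda>x. ennreal (norm (g x))) Q
             * emeasure lebesgue Q)"

definition weight :: "(real ^ 'n \<Rightarrow> real) \<Rightarrow> bool" where
  "weight w \<longleftrightarrow> (\<forall>x. w x \<ge> 0) \<and> locally_integrable w"

definition weight_measure :: "(real ^ 'n \<Rightarrow> real) \<Rightarrow> (real ^ 'n) set \<Rightarrow> ennreal" where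
  "weight_measure w Q = (\<integral>\<^sup>+x\<in>Q. ennreal (w x) \<partial>lebesgue)"

text \<open>
  For \<open>p = \<infinity>\<close> the weight plays no role: the norm is that of \<open>L\<^sup>\<infinity>\<close> with respect to Lebesgue measure.
\<close>

definition Lp_norm :: "ereal \<Rightarrow> (real ^ 'n \<Rightarrow> real) \<Rightarrow> (real ^ 'n \<Rightarrow> ennreal) \<Rightarrow> ennreal" where
  "Lp_norm p w h =
     (if p = \<infinity> then esssup lebesgue h
      else epow (\<integral>\<^sup>+x. epow (h x) (real_of_ereal p) * ennreal (w x) \<partial>lebesgue) (1 / real_of_ereal p))"

definition Lp_space :: "real \<Rightarrow> (real ^ 'n \<Rightarrow> real) \<Rightarrow> (real ^ 'n \<Rightarrow> complex) set" where
  "Lp_space p w = {f \<in> borel_measurable lebesgue. Lp_norm p w (\<lambda>x. ennreal (norm (f x))) < \<infinity>}"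

text \<open>Here \<open>w\<inverse>\<close> is \<open>\<infinity>\<close> where \<open>w\<close> vanishes.\<close>

definition Ap_const :: "real \<Rightarrow> (real ^ 'n \<Rightarrow> real) \<Rightarrow> ennreal" where
  "Ap_const p w =
     (SUP Q\<in>cubes. avg 1 (\<lambda>x. ennreal (w x)) Q * avg (1 / (p - 1)) (\<lambda>x. inverse (ennreal (w x))) Q)"

definition RH_const :: "real \<Rightarrow> (real ^ 'n \<Rightarrow> real) \<Rightarrow> ennreal" where
  "RH_const t w = (SUP Q\<in>cubes. avg t (\<lambda>x. ennreal (w x)) Q / avg 1 (\<lambda>x. ennreal (w x)) Q)"

text \<open>
  Since \<open>0 * \<infinity> = 0\<close> in \<^typ>\<open>ennreal\<close>, the almost everywhere vanishing weight has to be
  excluded from \<open>A\<^sub>p\<close> explicitly.  Any other weight vanishing on a set of positive measure has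
  infinite constant.
\<close>

definition Ap :: "real \<Rightarrow> (real ^ 'n \<Rightarrow> real) set" where
  "Ap p = {w. weight w \<and> \<not> (AE x in lebesgue. w x = 0) \<and> Ap_const p w < \<infinity>}"

definition RH :: "real \<Rightarrow> (real ^ 'n \<Rightarrow> real) set" where
  "RH t = {w. weight w \<and> RH_const t w < \<infinity>}"

definition oscillation :: "(real ^ 'n \<Rightarrow> complex) \<Rightarrow> (real ^ 'n) set \<Rightarrow> ennreal" where
  "oscillation b Q = (\<integral>\<^sup>+x\<in>Q. ennreal (norm (b x - mean b Q)) \<partial>lebesgue)"

definition BMO_norm :: "real \<Rightarrow> (real ^ 'n \<Rightarrow> real) \<Rightarrow> (real ^ 'n \<Rightarrow> complex) \<Rightarrow> ennreal" where
  "BMO_norm \<gamma> \<nu> b =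
     (SUP Q\<in>cubes. oscillation b Q / epow (weight_measure \<nu> Q) (1 + \<gamma> / real CARD('n)))"

definition sharp_maximal ::
  "(real ^ 'n \<Rightarrow> real) \<Rightarrow> (real ^ 'n \<Rightarrow> complex) \<Rightarrow> real ^ 'n \<Rightarrow> ennreal" where
  "sharp_maximal \<nu> b x = (SUP Q\<in>{Q\<in>cubes. x \<in> Q}. oscillation b Q / weight_measure \<nu> Q)"

definition bloom_alpha :: "real \<Rightarrow> real \<Rightarrow> nat \<Rightarrow> real" where
  "bloom_alpha p q m = 1 / (p * real m) - 1 / (q * real m)"

definition bloom_t :: "real \<Rightarrow> real \<Rightarrow> nat \<Rightarrow> ereal" where
  "bloom_t p q m = (if p = q then \<infinity> else ereal (- 1 / bloom_alpha p q m))"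

text \<open>
  The value \<open>0 powr a = 0\<close> for negative \<open>a\<close> is harmless, since the weights in \<open>A\<^sub>p\<close> are
  almost everywhere positive.
\<close>

definition bloom_weight ::
  "real \<Rightarrow> real \<Rightarrow> nat \<Rightarrow> (real ^ 'n \<Rightarrow> real) \<Rightarrow> (real ^ 'n \<Rightarrow> real) \<Rightarrow> real ^ 'n \<Rightarrow> real" where
  "bloom_weight p q m \<mu> lam x =
     (\<mu> x powr (1 / (p * real m)) * lam x powr (- 1 / (q * real m))) powr (1 / (1 + bloom_alpha p q m))"

definition beta_mu1 :: "real \<Rightarrow> real \<Rightarrow> real \<Rightarrow> nat \<Rightarrow> real" where
  "beta_mu1 p q r m =
     (let \<alpha> = bloom_alpha p q m; \<alpha>' = max \<alpha> 0; k = \<lfloor>r * real m\<rfloor> in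
        max (1 / r) (1 / (p - r))
      + (1 - 1 / (r * real m)) * (r * real m - of_int k)
          * max ((1 - \<alpha>') / (r - \<alpha> * p)) (1 / ((1 + \<alpha>) * p - r))
      + q / p * (\<Sum>j = 1..nat k - 1. real j / (r * real m)
          * max ((1 - \<alpha>') / (r + real j * q * \<alpha>)) (1 / ((1 - real j * \<alpha>) * q - r))))"

definition beta_mu2 :: "real \<Rightarrow> real \<Rightarrow> nat \<Rightarrow> real" where
  "beta_mu2 p r m = r * real m / (p - r)"

definition beta_lambda1 :: "real \<Rightarrow> real \<Rightarrow> real \<Rightarrow> nat \<Rightarrow> real" where
  "beta_lambda1 p q r m =
     (let \<alpha> = bloom_alpha p q m; \<alpha>' = max \<alpha> 0; k = \<lfloor>r * real m\<rfloor> in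
        p / q * (1 / (r * real m)) * (r * real m - of_int k)
          * max ((1 - \<alpha>') / (r - \<alpha> * p)) (1 / ((1 + \<alpha>) * p - r))
      + (\<Sum>j = 1..nat k - 1. (1 - real j / (r * real m))
          * max ((1 - \<alpha>') / (r + real j * q * \<alpha>)) (1 / ((1 - real j * \<alpha>) * q - r))))"

definition beta_lambda2 :: "real \<Rightarrow> real \<Rightarrow> real \<Rightarrow> ereal \<Rightarrow> nat \<Rightarrow> real" where
  "beta_lambda2 p q r s m =
     (let \<alpha> = bloom_alpha p q m in
        max (if s = \<infinity> then 1 - \<alpha> / r
             else (real_of_ereal s * (1 - \<alpha> / r) - 1) / (real_of_ereal s - q))
            (1 / (q - r)))"

end

theory Submission
  imports Defs
begin

text \<open>
  The oscillation of \<open>b\<close> on a cube \<open>Q\<close> of the sparse family is dominated pointwise, by a stopping time argument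
  and Lebesgue differentiation, by the sum of the mean oscillations of \<open>b\<close> over those cubes of an enlarged
  family that lie below \<open>Q\<close>. The oscillation over \<open>P\<close> is at most \<open>(\<integral>\<^sub>P h)\<^sup>e\<close> with \<open>e = 1 + max \<alpha> 0\<close>, where \<open>h\<close> is a
  multiple of \<open>\<nu>\<close> if \<open>p \<le> q\<close>, and \<open>\<nu>\<close> times a discrete form of the sharp maximal function if \<open>q \<le> p\<close>.
  It remains to integrate the \<open>rm\<close>-th power of \<open>\<Sum> (\<integral>\<^sub>P h)\<^sup>e / |P|\<close> against \<open>|f|\<^sup>r\<close>. Lowering the power by one
  replaces the integrand by a sparse operator applied to it; each of these operators is bounded on the space
  whose weight \<open>\<mu>\<close> to the \<open>(1 - \<theta>) r / p\<close> times \<open>\<lambda>\<close> to the \<open>\<theta> r / q\<close> interpolates between the two Muckenhoupt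
  conditions, and multiplication by \<open>h\<^sup>e\<close> raises \<open>\<theta>\<close> by \<open>1 / (rm)\<close>, so that the chain leads from \<open>\<theta> = 0\<close> to \<open>\<theta> = 1\<close>.
  The bounds for the operators and for the outer form are all instances of one off-diagonal estimate for a
  bilinear sparse form with a single weight. For the second bound, the chain is replaced by a single step, in
  which \<open>|f|\<^sup>r\<close> is majorized by an \<open>A\<^sub>1\<close> weight built by Rubio de Francia's algorithm.
\<close>

section \<open>Powers and Hoelder inequalities in the extended nonnegative reals\<close>

text \<open>Exponents are recorded by their reciprocals and weights act by multiplication:
  \<open>v0\<close> is \<mu> to the power r/p at reciprocal r/p, and \<open>v1\<close> is \<lambda>
  to the power r/q at reciprocal r/q. In this form the intermediate Muckenhoupt conditions depend
  log-linearly on \<theta>. Three obstacles shape the proof. The number rm need not be an integer,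
  so the chain starts from its fractional part, realized as a geometric mean of the powers 0 and 1.
  The enlarged family may be infinite, so it is built down to a finite generation N with constants
  independent of N, and N tends to infinity by Fatou's lemma; the finiteness of each family makes
  the absorption arguments legitimate. Finally, the powers of the weight constants are explicit: the
  one-weight estimate loses one factor L from sorting the cubes by the size of their characteristic,
  and a factor L^((1-i)/x) or L^((1-j)/y) from comparing a cube with its disjoint major part. These
  two exponents are the source of every maximum in the \<beta>'s. The bound with rm/(p-r) instead
  combines Buckley's exponent for the maximal function with the linear dependence of sparse
  operators on an A_1 constant.\<close>

abbreviation integ :: "'a measure \<Rightarrow> 'a set \<Rightarrow> ('a \<Rightarrow> ennreal) \<Rightarrow> ennreal" where
  "integ M A f \<equiv> \<integral>\<^sup>+x\<in>A. f x \<partial>M"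

lemma epow_ennreal: "0 \<le> x \<Longrightarrow> epow (ennreal x) a = ennreal (x powr a)" by (simp add: epow_def)

lemma epow_0 [simp]: "epow 0 a = 0" and epow_top [simp]: "epow top a = top" by (auto simp: epow_def)

lemma epow_1_left [simp]: "epow 1 a = 1" by (simp add: epow_def)

lemma epow_1 [simp]: "epow x 1 = x" by (cases x) (auto simp: epow_def)

lemma epow_mono: "x \<le> y \<Longrightarrow> 0 \<le> a \<Longrightarrow> epow x a \<le> epow y a"
  by (cases x; cases y) (auto simp: epow_ennreal top_unique intro!: ennreal_leI powr_mono2)

lemma epow_mult: "epow (x * y) a = epow x a * epow y a"
proof (cases "x = top \<or> y = top")
  case True
  then show ?thesis by (cases x; cases y) (auto simp: epow_ennreal ennreal_mult_top ennreal_top_mult)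
next
  case False
  then show ?thesis by (cases x; cases y) (auto simp: epow_ennreal powr_mult ennreal_mult[symmetric])
qed

lemma epow_epow [simp]: "epow (epow x a) b = epow x (a * b)" by (cases x) (auto simp: epow_ennreal powr_powr)

lemma epow_add: "epow x (a + b) = epow x a * epow x b"
  by (cases x) (auto simp: epow_ennreal powr_add ennreal_mult[symmetric])

lemma epow_less_top_iff [simp]: "epow x a < top \<longleftrightarrow> x < top" by (cases x) (auto simp: epow_ennreal)

lemma epow_eq_0_iff [simp]: "epow x a = 0 \<longleftrightarrow> x = 0" by (cases x) (auto simp: epow_ennreal ennreal_eq_0_iff)

lemma epow_eq_top_iff [simp]: "epow x a = top \<longleftrightarrow> x = top" by (cases x) (auto simp: epow_ennreal)

lemma epow_pos_iff [simp]: "0 < epow x a \<longleftrightarrow> 0 < x" by (metis epow_eq_0_iff not_gr_zero)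

lemma epow_le_iff: "0 < a \<Longrightarrow> epow x a \<le> epow y a \<longleftrightarrow> x \<le> y"
  using epow_mono[of x y a] epow_mono[of "epow x a" "epow y a" "1/a"] by auto

lemma epow_less_iff: "0 < a \<Longrightarrow> epow x a < epow y a \<longleftrightarrow> x < y" using epow_le_iff[of a y x] by (auto simp: not_le[symmetric])

lemma epow_mono_exponent: "1 \<le> x \<Longrightarrow> a \<le> b \<Longrightarrow> epow x a \<le> epow x b"
  by (cases x) (auto simp: epow_ennreal intro!: ennreal_leI powr_mono)

lemma epow_nat: "0 < n \<Longrightarrow> epow x (real n) = x ^ n"
  by (cases x) (auto simp: epow_ennreal powr_realpow' ennreal_power power_eq_top_ennreal)

lemma epow_divide:
  assumes "0 < c"
  shows "epow (x / ennreal c) a = epow x a / ennreal (c powr a)"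
proof -
  have "x / ennreal c = x * ennreal (1 / c)" "epow x a / ennreal (c powr a) = epow x a * ennreal (1 / c powr a)"
    using assms by (simp_all add: divide_ennreal_def inverse_ennreal inverse_eq_divide)
  then show ?thesis using assms by (simp add: epow_mult epow_ennreal powr_divide)
qed

lemma epow_measurable [measurable]: "(\<lambda>x. epow x a) \<in> borel_measurable borel" unfolding epow_def by measurable

lemma epow_measurable' [measurable (raw)]:
  "f \<in> borel_measurable M \<Longrightarrow> (\<lambda>x. epow (f x) a) \<in> borel_measurable M" by (rule measurable_compose[OF _ epow_measurable])

lemma ennreal_divide_mult: "0 < m \<Longrightarrow> t / ennreal m * ennreal m = t"
  by (simp add: divide_ennreal_def mult.assoc inverse_ennreal ennreal_mult[symmetric])

text \<open>Strict lower bounds persist eventually, and a positive power preserves them. This is the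
  half of continuity with which powers are moved past Fatou's lemma.\<close>

lemma epow_Liminf_le:
  assumes a: "0 < a"
  shows "epow (Liminf F u) a \<le> Liminf F (\<lambda>n. epow (u n) a)"
proof (subst le_Liminf_iff, intro allI impI)
  fix y assume "y < epow (Liminf F u) a"
  then have "epow y (1 / a) < epow (epow (Liminf F u) a) (1 / a)" using a by (subst epow_less_iff) auto
  then have "epow y (1 / a) < Liminf F u" using a by simp
  then have "\<forall>\<^sub>F n in F. epow y (1 / a) < u n" using less_LiminfD by blast
  then show "\<forall>\<^sub>F n in F. y < epow (u n) a"
  proof eventually_elim
    case (elim n)
    then have "epow (epow y (1 / a)) a < epow (u n) a" using a by (subst epow_less_iff) auto
    then show ?case using a by simp
  qed
qed

lemma Holder_nn_integral:
  assumes [measurable]: "f \<in> borel_measurable M" "g \<in> borel_measurable M"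
    and a: "0 < a" "a < 1"
  shows "(\<integral>\<^sup>+x. epow (f x) a * epow (g x) (1 - a) \<partial>M) \<le> epow (\<integral>\<^sup>+x. f x \<partial>M) a * epow (\<integral>\<^sup>+x. g x \<partial>M) (1 - a)"
proof -
  let ?A = "\<integral>\<^sup>+x. f x \<partial>M" and ?B = "\<integral>\<^sup>+x. g x \<partial>M"
  \<comment> \<open>Because \<open>0 * \<infinity> = 0\<close>, a vanishing factor is settled before
    an infinite one; in that case the integrand on the left vanishes almost everywhere.\<close>
  consider (0) "?A = 0 \<or> ?B = 0" | (top) "?A \<noteq> 0" "?B \<noteq> 0" "?A = top \<or> ?B = top"
    | (fin) "?A \<noteq> 0" "?B \<noteq> 0" "?A \<noteq> top" "?B \<noteq> top" by blast
  then show ?thesis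
  proof cases
    case 0
    then have "(AE x in M. f x = 0) \<or> (AE x in M. g x = 0)" by (auto simp: nn_integral_0_iff_AE)
    then have "AE x in M. epow (f x) a * epow (g x) (1 - a) = 0" by auto
    then show ?thesis by (subst nn_integral_cong_AE[where v = "\<lambda>_. 0"]) auto
  next
    case top
    then show ?thesis by (auto simp: ennreal_mult_top ennreal_top_mult)
  next
    case fin
    define A B where "A = enn2real ?A" and "B = enn2real ?B"
    have AB: "?A = ennreal A" "?B = ennreal B" "0 < A" "0 < B"
      using fin by (auto simp: A_def B_def less_top enn2real_positive_iff zero_less_iff_neq_zero)
    \<comment> \<open>Young's inequality for \<open>u / A\<close> and \<open>w / B\<close>; after
      integration the two terms contribute \<open>a\<close> and \<open>1 - a\<close>, which add up
      to 1.\<close>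
    have pt: "epow u a * epow w (1 - a)
      \<le> ennreal (A powr a * B powr (1 - a)) * (ennreal (a / A) * u + ennreal ((1 - a) / B) * w)" for u w
    proof (cases "u = top \<or> w = top \<or> u = 0 \<or> w = 0")
      case True
      then show ?thesis using a AB by (auto simp: ennreal_mult_top ennreal_top_mult ennreal_mult_eq_top_iff)
    next
      case False
      then obtain s t where st: "u = ennreal s" "w = ennreal t" "0 < s" "0 < t"
        by (cases u; cases w) (auto simp: less_le)
      have "(s / A) powr a * (t / B) powr (1 - a) \<le> a * (s / A) + (1 - a) * (t / B)"
        using a st AB by (intro Youngs_inequality_0) auto
      then have "s powr a * t powr (1 - a) \<le> A powr a * B powr (1 - a) * (a / A * s + (1 - a) / B * t)"
        using st AB by (simp add: powr_divide field_simps)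
      then show ?thesis
        using st AB a by (simp add: epow_ennreal ennreal_mult[symmetric] ennreal_plus[symmetric] del: ennreal_plus)
    qed
    have "(\<integral>\<^sup>+x. epow (f x) a * epow (g x) (1 - a) \<partial>M)
      \<le> (\<integral>\<^sup>+x. ennreal (A powr a * B powr (1 - a)) * (ennreal (a / A) * f x + ennreal ((1 - a) / B) * g x) \<partial>M)"
      by (intro nn_integral_mono pt)
    also have "\<dots> = ennreal (A powr a * B powr (1 - a)) * (ennreal (a / A) * ?A + ennreal ((1 - a) / B) * ?B)"
      by (simp add: nn_integral_cmult nn_integral_add)
    also have "\<dots> = ennreal (A powr a * B powr (1 - a))"
      unfolding AB using AB a by (simp add: ennreal_mult[symmetric] ennreal_plus[symmetric] del: ennreal_plus)
    also have "\<dots> = epow ?A a * epow ?B (1 - a)" unfolding AB using AB by (simp add: epow_ennreal ennreal_mult)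
    finally show ?thesis .
  qed
qed

text \<open>Absorption: a priori finiteness allows division by the power of \<open>I\<close> on the
  right. The maximal inequality, the Minkowski inequality and the operator bounds all end in this
  way.\<close>

lemma epow_self_improve:
  assumes "I < top" "0 < a" "I \<le> c * epow I (1 - a)"
  shows "I \<le> epow c (1 / a)"
proof (cases "I = 0")
  case False
  have "epow I a * epow I (1 - a) \<le> c * epow I (1 - a)" using assms epow_add[of I a "1 - a"] by simp
  moreover have "epow I (1 - a) \<noteq> 0" "epow I (1 - a) \<noteq> top" using False assms by auto
  ultimately have "epow I a \<le> c" by (metis ennreal_mult_le_mult_iff mult.commute)
  then have "epow (epow I a) (1 / a) \<le> epow c (1 / a)" using assms by (intro epow_mono) auto
  then show ?thesis using assms by simp
qed simp

lemma Holder_sum: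
  assumes "finite A" "\<And>i. i \<in> A \<Longrightarrow> 0 \<le> f i" "\<And>i. i \<in> A \<Longrightarrow> 0 \<le> g i" and a: "0 < a" "a < 1"
  shows "(\<Sum>i\<in>A. f i powr a * g i powr (1 - a)) \<le> (\<Sum>i\<in>A. f i) powr a * (\<Sum>i\<in>A. g i :: real) powr (1 - a)"
proof -
  have "(\<integral>\<^sup>+i. epow (ennreal (f i)) a * epow (ennreal (g i)) (1 - a) \<partial>count_space A)
    \<le> epow (\<integral>\<^sup>+i. f i \<partial>count_space A) a * epow (\<integral>\<^sup>+i. g i \<partial>count_space A) (1 - a)"
    by (rule Holder_nn_integral) (use a in auto)
  then have "(\<Sum>i\<in>A. ennreal (f i powr a * g i powr (1 - a)))
    \<le> epow (\<Sum>i\<in>A. ennreal (f i)) a * epow (\<Sum>i\<in>A. ennreal (g i)) (1 - a)"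
    using assms by (simp add: nn_integral_count_space_finite epow_ennreal ennreal_mult)
  then show ?thesis using assms by (simp add: sum_nonneg epow_ennreal ennreal_mult[symmetric])
qed

lemma Holder_sum3:
  assumes "finite A" "\<And>i. i \<in> A \<Longrightarrow> 0 \<le> f i" "\<And>i. i \<in> A \<Longrightarrow> 0 \<le> g i" "\<And>i. i \<in> A \<Longrightarrow> 0 \<le> h i"
    and abc: "0 < a" "0 < b" "0 < c" "a + b + c = 1"
  shows "(\<Sum>i\<in>A. f i powr a * g i powr b * h i powr c)
    \<le> (\<Sum>i\<in>A. f i) powr a * (\<Sum>i\<in>A. g i) powr b * (\<Sum>i\<in>A. h i :: real) powr c"
proof -
  have "(\<Sum>i\<in>A. f i powr a * g i powr b * h i powr c)
    = (\<Sum>i\<in>A. f i powr a * (g i powr (b / (1 - a)) * h i powr (c / (1 - a))) powr (1 - a))"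
    using assms by (intro sum.cong) (auto simp: powr_mult powr_powr)
  also have "\<dots> \<le> (\<Sum>i\<in>A. f i) powr a * (\<Sum>i\<in>A. g i powr (b / (1 - a)) * h i powr (c / (1 - a))) powr (1 - a)"
    using assms by (intro Holder_sum) auto
  also have "\<dots> \<le> (\<Sum>i\<in>A. f i) powr a * ((\<Sum>i\<in>A. g i) powr (b / (1 - a)) * (\<Sum>i\<in>A. h i) powr (c / (1 - a))) powr (1 - a)"
  proof -
    have e: "c / (1 - a) = 1 - b / (1 - a)" and "b / (1 - a) < 1" using abc by (auto simp: field_simps)
    then have "(\<Sum>i\<in>A. g i powr (b / (1 - a)) * h i powr (c / (1 - a)))
      \<le> (\<Sum>i\<in>A. g i) powr (b / (1 - a)) * (\<Sum>i\<in>A. h i) powr (c / (1 - a))"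
      unfolding e using assms by (intro Holder_sum) auto
    then show ?thesis using abc by (intro mult_left_mono powr_mono2 sum_nonneg) auto
  qed
  also have "\<dots> = (\<Sum>i\<in>A. f i) powr a * (\<Sum>i\<in>A. g i) powr b * (\<Sum>i\<in>A. h i) powr c"
    using assms by (simp add: powr_mult powr_powr sum_nonneg)
  finally show ?thesis .
qed

section \<open>Finite trees of sets\<close>

lemma powr_diff_upper:
  fixes a b s :: real
  assumes "0 \<le> a" "a \<le> b" "1 \<le> s"
  shows "b powr s - a powr s \<le> s * (b - a) * b powr (s - 1)"
proof (cases "a = 0 \<or> s = 1")
  case True
  then show ?thesis using assms by (cases "b = 0") (auto simp: powr_diff mult_le_cancel_right1 field_simps)
next
  case False
  then have pos: "0 < a" "0 < b" "1 < s" using assms by auto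
  \<comment> \<open>Young's inequality for \<open>(a / b) powr s\<close> and 1 is the tangent-line
    bound for the concave power 1/s; it stands in for the mean value theorem.\<close>
  have "((a / b) powr s) powr (1 / s) * 1 powr (1 - 1 / s) \<le> 1 / s * (a / b) powr s + (1 - 1 / s) * 1"
    using pos by (intro Youngs_inequality_0) auto
  then have "a / b \<le> 1 / s * (a / b) powr s + (1 - 1 / s)" using pos by (simp add: powr_powr)
  then have "s * (a / b) \<le> s * (1 / s * (a / b) powr s + (1 - 1 / s))" using pos by (intro mult_left_mono) auto
  also have "\<dots> = (a / b) powr s + (s - 1)" using pos by (simp add: algebra_simps)
  finally have "s * (a / b) \<le> (a / b) powr s + (s - 1)" .
  then have "b powr s * (s * (a / b)) \<le> b powr s * (a powr s / b powr s + (s - 1))"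
    using pos by (intro mult_left_mono) (auto simp: powr_divide)
  also have "\<dots> = a powr s + (s - 1) * b powr s" using pos by (simp add: algebra_simps)
  finally have "s * a * (b powr s / b) \<le> a powr s + (s - 1) * b powr s" by (simp add: algebra_simps)
  moreover have "b powr (s - 1) = b powr s / b" "b * (b powr s / b) = b powr s" using pos by (simp_all add: powr_diff)
  ultimately show ?thesis by (simp add: algebra_simps)
qed

text \<open>For \<open>s \<ge> 1\<close> it suffices that
  \<open>a powr s \<le> a * b powr (s - 1)\<close>; for \<open>s < 1\<close> concavity of the power
  costs 1/s. The resulting maximum reappears in the constant of the maximal inequality.\<close>

lemma powr_diff_lower:
  fixes a b s :: real
  assumes "0 \<le> a" "a \<le> b" "0 < b" "0 < s"
  shows "(b - a) * b powr (s - 1) \<le> max 1 (1 / s) * (b powr s - a powr s)"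
proof (cases "1 \<le> s \<or> a = 0")
  case True
  have "a powr s \<le> a * b powr (s - 1)"
  proof (cases "a = 0")
    case False
    then have "a powr s = a * a powr (s - 1)" using assms by (simp add: powr_diff)
    then show ?thesis using assms True False by (auto intro!: mult_left_mono powr_mono2)
  qed simp
  moreover have "b powr s = b * b powr (s - 1)" using assms by (simp add: powr_diff)
  ultimately have "(b - a) * b powr (s - 1) \<le> 1 * (b powr s - a powr s)" by (simp add: algebra_simps)
  also have "\<dots> \<le> max 1 (1 / s) * (b powr s - a powr s)" using assms by (intro mult_right_mono) (auto intro!: powr_mono2)
  finally show ?thesis .
next
  case False
  then have s: "0 < s" "s < 1" "0 < a" using assms by auto
  have "(a / b) powr s * 1 powr (1 - s) \<le> s * (a / b) + (1 - s) * 1" using s assms by (intro Youngs_inequality_0) auto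
  then have "b powr s * (a / b) powr s \<le> b powr s * (s * (a / b) + (1 - s))" by (intro mult_left_mono) auto
  then have "s * ((b - a) * b powr (s - 1)) \<le> b powr s - a powr s"
    using s assms by (simp add: powr_divide powr_diff field_simps)
  then have "(b - a) * b powr (s - 1) \<le> 1 / s * (b powr s - a powr s)" using s by (simp add: field_simps)
  then show ?thesis using s by simp
qed

text \<open>Along a chain, the maximum over the proper supersets of a member is the maximum over all
  supersets of the next larger member, so the differences telescope. The induction removes the
  smallest member, whose inclusive maximum is the total one.\<close>

lemma chain_telescope:
  fixes X :: "'a set \<Rightarrow> real" and g :: "real \<Rightarrow> real"
  assumes "finite C" and "\<And>A B. A \<in> C \<Longrightarrow> B \<in> C \<Longrightarrow> A \<subseteq> B \<or> B \<subseteq> A"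
  shows "(\<Sum>F\<in>C. g (Max (insert 0 (X ` {R\<in>C. F \<subseteq> R}))) - g (Max (insert 0 (X ` {R\<in>C. F \<subset> R}))))
    = g (Max (insert 0 (X ` C))) - g 0" using assms
proof (induction C rule: finite_psubset_induct)
  case (psubset C)
  show ?case
  proof (cases "C = {}")
    case False
    then obtain F0 where F0: "F0 \<in> C" "\<And>F. F \<in> C \<Longrightarrow> F \<subseteq> F0 \<Longrightarrow> F0 = F" using finite_has_minimal[OF psubset(1)] by metis
    then have sub: "F0 \<subset> F" if "F \<in> C - {F0}" for F using psubset.prems[of F F0] that by blast
    let ?D = "C - {F0}"
    have IH: "(\<Sum>F\<in>?D. g (Max (insert 0 (X ` {R\<in>?D. F \<subseteq> R}))) - g (Max (insert 0 (X ` {R\<in>?D. F \<subset> R}))))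
      = g (Max (insert 0 (X ` ?D))) - g 0" using F0 psubset.prems by (intro psubset.IH) auto
    have "(\<Sum>F\<in>?D. g (Max (insert 0 (X ` {R\<in>C. F \<subseteq> R}))) - g (Max (insert 0 (X ` {R\<in>C. F \<subset> R}))))
      = (\<Sum>F\<in>?D. g (Max (insert 0 (X ` {R\<in>?D. F \<subseteq> R}))) - g (Max (insert 0 (X ` {R\<in>?D. F \<subset> R}))))"
    proof (intro sum.cong refl)
      fix F assume "F \<in> ?D"
      then have "{R\<in>C. F \<subseteq> R} = {R\<in>?D. F \<subseteq> R}" "{R\<in>C. F \<subset> R} = {R\<in>?D. F \<subset> R}" using sub[of F] by auto
      then show "g (Max (insert 0 (X ` {R\<in>C. F \<subseteq> R}))) - g (Max (insert 0 (X ` {R\<in>C. F \<subset> R})))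
        = g (Max (insert 0 (X ` {R\<in>?D. F \<subseteq> R}))) - g (Max (insert 0 (X ` {R\<in>?D. F \<subset> R})))" by simp
    qed
    moreover have "{R\<in>C. F0 \<subseteq> R} = C" "{R\<in>C. F0 \<subset> R} = ?D" using sub F0 by auto
    ultimately show ?thesis using IH F0 psubset.hyps by (subst sum.remove[of _ F0]) auto
  qed simp
qed

text \<open>A finite family of dyadic cubes seen only through its nestedness and its measures. The
  measure is a parameter, so that the same family serves for Lebesgue measure and for the two
  weighted measures.\<close>

locale set_tree =
  fixes M :: "'a measure" and S :: "'a set set"
  assumes finite_S: "finite S"
    and sets_S: "Q \<in> S \<Longrightarrow> Q \<in> sets M"
    and laminar: "P \<in> S \<Longrightarrow> Q \<in> S \<Longrightarrow> P \<subseteq> Q \<or> Q \<subseteq> P \<or> P \<inter> Q = {}"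
    and emeasure_pos: "Q \<in> S \<Longrightarrow> 0 < emeasure M Q"
    and emeasure_finite: "Q \<in> S \<Longrightarrow> emeasure M Q < top"
begin

text \<open>The inclusive and the exclusive running maximum of \<open>X\<close> along the ancestors
  of \<open>F\<close>, with 0 as the value over no ancestors. The increment
  \<open>run_max X F - run_max' X F\<close> is positive exactly where \<open>X\<close> sets a new
  record; such record sets play the role of the principal cubes in a corona decomposition.\<close>

definition run_max :: "('a set \<Rightarrow> real) \<Rightarrow> 'a set \<Rightarrow> real" where
  "run_max X F = Max (insert 0 (X ` {R\<in>S. F \<subseteq> R}))"

definition run_max' :: "('a set \<Rightarrow> real) \<Rightarrow> 'a set \<Rightarrow> real" where
  "run_max' X F = Max (insert 0 (X ` {R\<in>S. F \<subset> R}))"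

definition pt_max :: "('a set \<Rightarrow> real) \<Rightarrow> 'a \<Rightarrow> real" where
  "pt_max X z = Max (insert 0 (X ` {R\<in>S. z \<in> R}))"

lemma nonempty: "Q \<in> S \<Longrightarrow> Q \<noteq> {}" using emeasure_pos by force

lemma measure_pos: "Q \<in> S \<Longrightarrow> 0 < measure M Q"
  using emeasure_pos emeasure_finite by (simp add: measure_def enn2real_positive_iff)

lemma emeasure_eq: "Q \<in> S \<Longrightarrow> emeasure M Q = ennreal (measure M Q)"
  using emeasure_finite by (intro emeasure_eq_ennreal_measure) (auto simp: less_top[symmetric])

lemma divide_emeasure_mult:
  "Q \<in> S \<Longrightarrow> t / emeasure M Q * emeasure M Q = t" "Q \<in> S \<Longrightarrow> emeasure M Q * (t / emeasure M Q) = t"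
  using ennreal_divide_mult[OF measure_pos, of Q t] by (simp_all add: emeasure_eq mult.commute)

lemma fmeasurable_S: "Q \<in> S \<Longrightarrow> Q \<in> fmeasurable M" using sets_S emeasure_finite by (simp add: fmeasurable_def)

lemma fmeasurable_Union: "T \<subseteq> S \<Longrightarrow> \<Union>T \<in> fmeasurable M"
  using finite_S fmeasurable_S by (intro fmeasurable.finite_Union) (auto intro: finite_subset)

lemma subtree: "S' \<subseteq> S \<Longrightarrow> set_tree M S'" using finite_S sets_S laminar emeasure_pos emeasure_finite
  by unfold_locales (auto intro: finite_subset, blast)

lemma run_max_ge: "F \<in> S \<Longrightarrow> X F \<le> run_max X F" unfolding run_max_def using finite_S by (intro Max_ge) auto

lemma run_max_nonneg: "0 \<le> run_max X F" and run_max'_nonneg: "0 \<le> run_max' X F"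
  and pt_max_nonneg: "0 \<le> pt_max X z"
  unfolding run_max_def run_max'_def pt_max_def using finite_S by (auto intro!: Max_ge)

lemma run_max'_le: "run_max' X F \<le> run_max X F"
  unfolding run_max_def run_max'_def using finite_S by (intro Max_mono) auto

lemma run_max_le_pt_max: "z \<in> F \<Longrightarrow> run_max X F \<le> pt_max X z"
  unfolding run_max_def pt_max_def using finite_S by (intro Max_mono) auto

lemma run_max_jump: "F \<in> S \<Longrightarrow> run_max' X F < run_max X F \<Longrightarrow> run_max X F = X F"
proof -
  assume F: "F \<in> S" "run_max' X F < run_max X F"
  have "{R\<in>S. F \<subseteq> R} = insert F {R\<in>S. F \<subset> R}" using F by auto
  then have "run_max X F = Max (insert (X F) (insert 0 (X ` {R\<in>S. F \<subset> R})))"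
    unfolding run_max_def by (simp add: insert_commute)
  also have "\<dots> = max (X F) (run_max' X F)" unfolding run_max'_def using finite_S by (subst Max_insert) auto
  finally show ?thesis using F by auto
qed

lemma comparable: "z \<in> A \<Longrightarrow> z \<in> B \<Longrightarrow> A \<in> S \<Longrightarrow> B \<in> S \<Longrightarrow> A \<subseteq> B \<or> B \<subseteq> A" using laminar[of A B] by auto

text \<open>Since \<open>C\<close> contains all ancestors of its members, running maxima taken in
  \<open>C\<close> and in \<open>S\<close> agree, and \<open>chain_telescope\<close> applies.
  Applying a function \<open>g\<close> first lets increments of powers telescope as well.\<close>

lemma sum_increments_chain:
  fixes g :: "real \<Rightarrow> real"
  assumes C: "C \<subseteq> S" "\<And>F R. F \<in> C \<Longrightarrow> R \<in> S \<Longrightarrow> F \<subseteq> R \<Longrightarrow> R \<in> C"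
    and z: "\<And>F. F \<in> C \<Longrightarrow> z \<in> F"
  shows "(\<Sum>F\<in>C. g (run_max X F) - g (run_max' X F)) = g (Max (insert 0 (X ` C))) - g 0"
proof -
  have "(\<Sum>F\<in>C. g (Max (insert 0 (X ` {R\<in>C. F \<subseteq> R}))) - g (Max (insert 0 (X ` {R\<in>C. F \<subset> R}))))
    = g (Max (insert 0 (X ` C))) - g 0"
  proof (rule chain_telescope)
    show "finite C" using C(1) finite_S by (rule finite_subset)
    show "A \<subseteq> B \<or> B \<subseteq> A" if "A \<in> C" "B \<in> C" for A B using that z C(1) comparable[of z A B] by auto
  qed
  moreover have "{R\<in>C. F \<subseteq> R} = {R\<in>S. F \<subseteq> R}" "{R\<in>C. F \<subset> R} = {R\<in>S. F \<subset> R}" if "F \<in> C" for F using that C by auto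
  ultimately show ?thesis by (simp add: run_max_def run_max'_def)
qed

lemma sum_increments:
  fixes g :: "real \<Rightarrow> real"
  assumes "Q \<in> S"
  shows "(\<Sum>F\<in>{F\<in>S. Q \<subseteq> F}. g (run_max X F) - g (run_max' X F)) = g (run_max X Q) - g 0"
proof -
  obtain z where "z \<in> Q" using nonempty[OF assms] by blast
  then show ?thesis by (subst sum_increments_chain[where z = z]) (auto simp: run_max_def)
qed

lemma sum_increments_pt:
  fixes g :: "real \<Rightarrow> real"
  shows "(\<Sum>F\<in>{F\<in>S. z \<in> F}. g (run_max X F) - g (run_max' X F)) = g (pt_max X z) - g 0"
  by (subst sum_increments_chain[where z = z]) (auto simp: pt_max_def)

lemma pt_max_alt: "pt_max X z = (\<Sum>F\<in>S. indicator F z * (run_max X F - run_max' X F))"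
proof -
  have "pt_max X z = (\<Sum>F\<in>{F\<in>S. z \<in> F}. run_max X F - run_max' X F)"
    using sum_increments_pt[where z = z and g = "\<lambda>x. x" and X = X] by simp
  also have "\<dots> = (\<Sum>F\<in>S. indicator F z * (run_max X F - run_max' X F))"
    using finite_S by (intro sum.mono_neutral_cong_left) auto
  finally show ?thesis .
qed

lemma pt_max_measurable [measurable]: "pt_max X \<in> borel_measurable M" unfolding pt_max_alt[abs_def] using sets_S
  by (intro borel_measurable_sum borel_measurable_times borel_measurable_indicator) auto

text \<open>Supplies the a priori finiteness for absorption: over a finite tree the maximal function
  is bounded and supported on a set of finite measure.\<close>

lemma nn_integral_pt_max_finite:
  assumes "0 < p"
  shows "(\<integral>\<^sup>+z. ennreal (pt_max X z powr p) \<partial>M) < top"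
proof -
  define B where "B = Max (insert 0 (X ` S))"
  have le: "pt_max X z powr p \<le> B powr p" for z unfolding pt_max_def B_def using assms finite_S
    by (intro powr_mono2 Max_mono) (auto intro!: Max_ge)
  have "ennreal (pt_max X z powr p) \<le> (\<Sum>F\<in>S. ennreal (B powr p) * indicator F z)" for z
  proof (cases "\<exists>F\<in>S. z \<in> F")
    case True
    then obtain F where F: "F \<in> S" "z \<in> F" by blast
    have "ennreal (pt_max X z powr p) \<le> ennreal (B powr p) * indicator F z" using F le by (simp add: ennreal_leI)
    also have "\<dots> \<le> (\<Sum>F\<in>S. ennreal (B powr p) * indicator F z)" using F finite_S by (intro member_le_sum) auto
    finally show ?thesis .
  next
    case False
    then have "{R\<in>S. z \<in> R} = {}" by auto
    then have "pt_max X z = 0" unfolding pt_max_def by (simp only: image_empty) simp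
    then show ?thesis using assms by simp
  qed
  then have "(\<integral>\<^sup>+z. ennreal (pt_max X z powr p) \<partial>M) \<le> (\<integral>\<^sup>+z. (\<Sum>F\<in>S. ennreal (B powr p) * indicator F z) \<partial>M)"
    by (intro nn_integral_mono)
  also have "\<dots> = (\<Sum>F\<in>S. ennreal (B powr p) * emeasure M F)"
    using sets_S by (subst nn_integral_sum) (auto simp: nn_integral_cmult_indicator)
  also have "\<dots> < top" using emeasure_finite finite_S by (simp add: ennreal_mult_less_top)
  finally show ?thesis .
qed

text \<open>Doob's inequality by summation along records: the p-th power telescopes into increments,
  each increment pays with the integral of \<open>f\<close> over its set, the remaining coefficients
  telescope to the power p - 1, and Hoelder with absorption closes the loop.\<close>

lemma maximal_inequality:
  fixes f :: "'a \<Rightarrow> ennreal"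
  assumes [measurable]: "f \<in> borel_measurable M" and p: "1 < p"
    and fin: "\<And>Q. Q \<in> S \<Longrightarrow> (integ M Q f) < top"
  defines "X \<equiv> \<lambda>Q. enn2real (integ M Q f) / measure M Q"
  shows "(\<integral>\<^sup>+z. ennreal (pt_max X z powr p) \<partial>M) \<le> ennreal ((p * max 1 (1 / (p - 1))) powr p) * (\<integral>\<^sup>+z. epow (f z) p \<partial>M)"
proof -
  define c where "c = p * max 1 (1 / (p - 1))"
  define I where "I = (\<integral>\<^sup>+z. ennreal (pt_max X z powr p) \<partial>M)"
  define D where "D F = run_max X F - run_max' X F" for F
  have c: "0 \<le> c" using p by (simp add: c_def)
  have D: "0 \<le> D F" for F using run_max'_le by (simp add: D_def)
  have setsS [measurable]: "F \<in> sets M" if "F \<in> S" for F using that sets_S by simp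
  have 1: "ennreal (pt_max X z powr p) \<le> (\<Sum>F\<in>S. ennreal (p * D F * run_max X F powr (p - 1)) * indicator F z)" for z
  proof -
    have "pt_max X z powr p = (\<Sum>F\<in>{F\<in>S. z \<in> F}. run_max X F powr p - run_max' X F powr p)"
      using sum_increments_pt[where z = z and g = "\<lambda>x. x powr p" and X = X] by simp
    also have "\<dots> \<le> (\<Sum>F\<in>{F\<in>S. z \<in> F}. p * D F * run_max X F powr (p - 1))"
      unfolding D_def using p by (intro sum_mono powr_diff_upper run_max'_nonneg run_max'_le) auto
    also have "\<dots> = (\<Sum>F\<in>S. p * D F * run_max X F powr (p - 1) * indicator F z)"
      using finite_S by (intro sum.mono_neutral_cong_left) auto
    finally have "ennreal (pt_max X z powr p) \<le> ennreal \<dots>" by (rule ennreal_leI)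
    also have "\<dots> = (\<Sum>F\<in>S. ennreal (p * D F * run_max X F powr (p - 1)) * indicator F z)"
      using p D by (subst sum_ennreal[symmetric]) (auto simp: ennreal_mult ennreal_indicator intro!: sum.cong)
    finally show ?thesis .
  qed
  \<comment> \<open>Only records contribute. At a record the running maximum is the average of
    \<open>f\<close> over \<open>F\<close>, so one power of it times the measure of \<open>F\<close>
    is the integral of \<open>f\<close> over \<open>F\<close>.\<close>
  have 2: "ennreal (p * D F * run_max X F powr (p - 1)) * emeasure M F
      = (\<integral>\<^sup>+z. ennreal (p * D F * run_max X F powr (p - 2)) * (f z * indicator F z) \<partial>M)"
    if F: "F \<in> S" for F
  proof (cases "D F = 0")
    case False
    then have "run_max' X F < run_max X F" using D[of F] by (simp add: D_def)
    then have XF: "run_max X F = X F" "0 < X F" using run_max_jump[OF F, of X] run_max'_nonneg[of X F] by auto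
    have "p * D F * run_max X F powr (p - 1) * measure M F = p * D F * run_max X F powr (p - 2) * (X F * measure M F)"
      using XF by (simp add: powr_diff power2_eq_square)
    also have "X F * measure M F = enn2real (integ M F f)" using measure_pos[OF F] by (simp add: X_def)
    finally have "ennreal (p * D F * run_max X F powr (p - 1)) * emeasure M F
      = ennreal (p * D F * run_max X F powr (p - 2)) * ennreal (enn2real (integ M F f))"
      using p D emeasure_eq[OF F] by (simp add: ennreal_mult[symmetric])
    then show ?thesis using fin[OF F] F by (simp add: nn_integral_cmult)
  qed simp
  \<comment> \<open>For fixed \<open>z\<close> the coefficients are increments of the power p - 1 up
    to the factor from \<open>powr_diff_lower\<close>, and these telescope a second time.\<close>
  have 3: "(\<Sum>F\<in>S. ennreal (p * D F * run_max X F powr (p - 2)) * (f z * indicator F z))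
      \<le> ennreal c * (f z * epow (ennreal (pt_max X z powr p)) (1 - 1 / p))" for z
  proof -
    have *: "(\<Sum>F\<in>{F\<in>S. z \<in> F}. p * D F * run_max X F powr (p - 2)) \<le> c * pt_max X z powr (p - 1)"
    proof -
      have "p * D F * run_max X F powr (p - 2) \<le> c * (run_max X F powr (p - 1) - run_max' X F powr (p - 1))" for F
      proof (cases "run_max X F = 0")
        case True
        then show ?thesis using run_max'_le[of X F] run_max'_nonneg[of X F] by simp
      next
        case False
        then show ?thesis using powr_diff_lower[of "run_max' X F" "run_max X F" "p - 1"] p
            run_max_nonneg[of X F] run_max'_le[of X F] run_max'_nonneg[of X F] by (simp add: D_def c_def mult.assoc)
      qed
      then have "(\<Sum>F\<in>{F\<in>S. z \<in> F}. p * D F * run_max X F powr (p - 2))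
        \<le> (\<Sum>F\<in>{F\<in>S. z \<in> F}. c * (run_max X F powr (p - 1) - run_max' X F powr (p - 1)))" by (intro sum_mono)
      also have "\<dots> = c * pt_max X z powr (p - 1)"
        using sum_increments_pt[where z = z and g = "\<lambda>x. x powr (p - 1)" and X = X] p by (simp add: sum_distrib_left[symmetric])
      finally show ?thesis .
    qed
    have "(\<Sum>F\<in>S. ennreal (p * D F * run_max X F powr (p - 2)) * (f z * indicator F z))
      = (\<Sum>F\<in>{F\<in>S. z \<in> F}. ennreal (p * D F * run_max X F powr (p - 2)) * f z)"
      using finite_S by (intro sum.mono_neutral_cong_right) auto
    also have "\<dots> = ennreal (\<Sum>F\<in>{F\<in>S. z \<in> F}. p * D F * run_max X F powr (p - 2)) * f z"
      using p D by (simp add: sum_distrib_right[symmetric] sum_ennreal)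
    also have "\<dots> \<le> ennreal (c * pt_max X z powr (p - 1)) * f z" using * by (intro mult_right_mono ennreal_leI) auto
    also have "\<dots> = ennreal c * (f z * epow (ennreal (pt_max X z powr p)) (1 - 1 / p))"
      using p c pt_max_nonneg[of X z] by (simp add: epow_ennreal powr_powr ennreal_mult algebra_simps)
    finally show ?thesis .
  qed
  have "I \<le> (\<integral>\<^sup>+z. (\<Sum>F\<in>S. ennreal (p * D F * run_max X F powr (p - 1)) * indicator F z) \<partial>M)"
    unfolding I_def by (intro nn_integral_mono 1)
  also have "\<dots> = (\<Sum>F\<in>S. ennreal (p * D F * run_max X F powr (p - 1)) * emeasure M F)"
    by (subst nn_integral_sum) (auto simp: nn_integral_cmult_indicator)
  also have "\<dots> = (\<Sum>F\<in>S. \<integral>\<^sup>+z. ennreal (p * D F * run_max X F powr (p - 2)) * (f z * indicator F z) \<partial>M)"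
    by (intro sum.cong refl 2)
  also have "\<dots> = (\<integral>\<^sup>+z. (\<Sum>F\<in>S. ennreal (p * D F * run_max X F powr (p - 2)) * (f z * indicator F z)) \<partial>M)"
    by (subst nn_integral_sum) auto
  also have "\<dots> \<le> (\<integral>\<^sup>+z. ennreal c * (f z * epow (ennreal (pt_max X z powr p)) (1 - 1 / p)) \<partial>M)"
    by (intro nn_integral_mono 3)
  also have "\<dots> = ennreal c * (\<integral>\<^sup>+z. epow (epow (f z) p) (1 / p) * epow (ennreal (pt_max X z powr p)) (1 - 1 / p) \<partial>M)"
    using p by (subst nn_integral_cmult) auto
  also have "\<dots> \<le> ennreal c * (epow (\<integral>\<^sup>+z. epow (f z) p \<partial>M) (1 / p) * epow I (1 - 1 / p))"
    unfolding I_def using p by (intro mult_left_mono Holder_nn_integral) auto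
  finally have "I \<le> ennreal c * epow (\<integral>\<^sup>+z. epow (f z) p \<partial>M) (1 / p) * epow I (1 - 1 / p)" by (simp add: mult.assoc)
  then have "I \<le> epow (ennreal c * epow (\<integral>\<^sup>+z. epow (f z) p \<partial>M) (1 / p)) (1 / (1 / p))"
    using nn_integral_pt_max_finite[of p X] p by (intro epow_self_improve) (auto simp: I_def)
  then show ?thesis using p c by (simp add: epow_mult epow_ennreal I_def c_def)
qed

end

section \<open>Sparse trees\<close>

text \<open>The constant 3/4 is what the stopping construction delivers further below: 1/4 from the
  stopping sets of \<open>Q\<close> and 1/2 from one further generation.\<close>

locale sparse_tree = set_tree +
  assumes sparse: "Q \<in> S \<Longrightarrow> measure M (\<Union>{P\<in>S. P \<subset> Q}) \<le> 3 / 4 * measure M Q"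
begin

lemma sparse_subtree: "S' \<subseteq> S \<Longrightarrow> sparse_tree M S'"
proof -
  assume sub: "S' \<subseteq> S"
  interpret T: set_tree M S' by (rule subtree) fact
  show ?thesis
  proof
    fix Q assume "Q \<in> S'"
    then have Q: "Q \<in> S" using sub by auto
    have "measure M (\<Union>{P\<in>S'. P \<subset> Q}) \<le> measure M (\<Union>{P\<in>S. P \<subset> Q})"
    proof (rule measure_mono_fmeasurable)
      show "\<Union>{P\<in>S. P \<subset> Q} \<in> fmeasurable M" by (rule fmeasurable_Union) auto
      have "\<Union>{P\<in>S'. P \<subset> Q} \<in> fmeasurable M" using sub by (intro fmeasurable_Union) auto
      then show "\<Union>{P\<in>S'. P \<subset> Q} \<in> sets M" by (rule fmeasurableD)
    qed (use sub in auto)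
    then show "measure M (\<Union>{P\<in>S'. P \<subset> Q}) \<le> 3 / 4 * measure M Q" using sparse[OF Q] by simp
  qed
qed

definition children :: "'a set \<Rightarrow> 'a set set" where
  "children Q = {P\<in>S. P \<subset> Q \<and> (\<forall>R\<in>S. R \<subset> Q \<longrightarrow> P \<subseteq> R \<longrightarrow> R = P)}"

definition core :: "'a set \<Rightarrow> 'a set" where
  "core Q = Q - \<Union>{P\<in>S. P \<subset> Q}"

lemma children_cover:
  assumes "P \<in> S" "P \<subset> Q"
  obtains R where "R \<in> children Q" "P \<subseteq> R"
proof -
  have "finite {R\<in>S. R \<subset> Q}" "P \<in> {R\<in>S. R \<subset> Q}" using finite_S assms by auto
  from finite_has_maximal2[OF this] obtain R where "R \<in> S" "R \<subset> Q" "P \<subseteq> R"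
    "\<forall>R'\<in>{R\<in>S. R \<subset> Q}. R \<subseteq> R' \<longrightarrow> R = R'" by blast
  then show thesis by (intro that[of R]) (auto simp: children_def)
qed

lemma children_S: "P \<in> children Q \<Longrightarrow> P \<in> S" and children_sub: "P \<in> children Q \<Longrightarrow> P \<subset> Q"
  and finite_children: "finite (children Q)" using finite_S by (auto simp: children_def)

lemma children_disjoint: "P \<in> children Q \<Longrightarrow> R \<in> children Q \<Longrightarrow> P \<noteq> R \<Longrightarrow> P \<inter> R = {}"
  using laminar[of P R] unfolding children_def by auto

lemma Union_children: "\<Union>(children Q) = \<Union>{P\<in>S. P \<subset> Q}"
proof
  show "\<Union>{P\<in>S. P \<subset> Q} \<subseteq> \<Union>(children Q)"
  proof
    fix x assume "x \<in> \<Union>{P\<in>S. P \<subset> Q}"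
    then obtain P where "x \<in> P" "P \<in> S" "P \<subset> Q" by auto
    then show "x \<in> \<Union>(children Q)" using children_cover[of P Q] by (metis UnionI subsetD)
  qed
qed (auto simp: children_def)

lemma sum_children:
  assumes "set_tree N S"
  shows "(\<Sum>P\<in>children Q. measure N P) = measure N (\<Union>{P\<in>S. P \<subset> Q})"
proof -
  interpret N: set_tree N S by fact
  have "measure N (\<Union>(children Q)) = (\<Sum>P\<in>children Q. measure N P)"
  proof (rule measure_Union')
    show "finite (children Q)" by (rule finite_children)
    show "P \<in> fmeasurable N" if "P \<in> children Q" for P using that children_S by (intro N.fmeasurable_S) auto
    show "pairwise disjnt (children Q)" using children_disjoint by (auto simp: pairwise_def disjnt_def)
  qed
  then show ?thesis by (simp add: Union_children)
qed

lemma sum_children_le: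
  assumes "set_tree N S" "Q \<in> S"
  shows "(\<Sum>P\<in>children Q. measure N P) \<le> measure N Q"
proof -
  interpret N: set_tree N S by fact
  show ?thesis unfolding sum_children[OF assms(1)]
  proof (rule measure_mono_fmeasurable)
    show "\<Union>{P\<in>S. P \<subset> Q} \<in> sets N" using N.fmeasurable_Union[of "{P\<in>S. P \<subset> Q}"] by (auto simp: fmeasurable_def)
    show "Q \<in> fmeasurable N" using assms(2) by (rule N.fmeasurable_S)
  qed auto
qed

lemma sets_core: "Q \<in> S \<Longrightarrow> core Q \<in> sets M" unfolding core_def using sets_S[of Q] fmeasurable_Union[of "{P\<in>S. P \<subset> Q}"]
  by (auto simp: fmeasurable_def)

lemma core_disjoint:
  assumes "P \<in> S" "Q \<in> S" "P \<noteq> Q"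
  shows "core P \<inter> core Q = {}"
proof -
  consider "P \<subset> Q" | "Q \<subset> P" | "P \<inter> Q = {}" using laminar[of P Q] assms by auto
  then show ?thesis using assms(1,2) unfolding core_def by cases auto
qed

lemma measure_core: "Q \<in> S \<Longrightarrow> measure M Q \<le> 4 * measure M (core Q)"
proof -
  assume Q: "Q \<in> S"
  have "measure M (core Q) = measure M Q - measure M (\<Union>{P\<in>S. P \<subset> Q})" unfolding core_def
  proof (rule measure_Diff)
    show "emeasure M Q \<noteq> \<infinity>" using emeasure_finite[OF Q] by auto
    show "\<Union>{P\<in>S. P \<subset> Q} \<in> sets M" using fmeasurable_Union[of "{P\<in>S. P \<subset> Q}"] by (auto simp: fmeasurable_def)
  qed (use sets_S[OF Q] in auto)
  then show ?thesis using sparse[OF Q] by simp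
qed

text \<open>\<open>V\<close> acts as a Bellman function: if it can pay \<open>K R\<close> and still
  cover the values of the children, it dominates the whole sum below \<open>R\<close>. The induction
  is on the number of proper descendants.\<close>

lemma tree_sum_le:
  fixes K V :: "'a set \<Rightarrow> real"
  assumes step: "\<And>R. R \<in> S \<Longrightarrow> K R + (\<Sum>P\<in>children R. V P) \<le> V R" and "R \<in> S"
  shows "(\<Sum>Q\<in>{Q\<in>S. Q \<subseteq> R}. K Q) \<le> V R" using assms(2)
proof (induction "card {P\<in>S. P \<subset> R}" arbitrary: R rule: less_induct)
  case less
  have IH: "(\<Sum>Q\<in>{Q\<in>S. Q \<subseteq> P}. K Q) \<le> V P" if P: "P \<in> children R" for P
  proof (rule less.hyps)
    show "P \<in> S" using P by (rule children_S)
    have "{Q\<in>S. Q \<subset> P} \<subset> {Q\<in>S. Q \<subset> R}" using P children_S[OF P] children_sub[OF P] by auto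
    then show "card {Q\<in>S. Q \<subset> P} < card {Q\<in>S. Q \<subset> R}" using finite_S by (intro psubset_card_mono) auto
  qed
  have "{Q\<in>S. Q \<subseteq> R} = insert R (\<Union>P\<in>children R. {Q\<in>S. Q \<subseteq> P})" (is "?L = ?R")
  proof (intro equalityI subsetI)
    fix Q assume "Q \<in> ?L"
    then consider "Q = R" | "Q \<in> S" "Q \<subset> R" by auto
    then show "Q \<in> ?R"
    proof cases
      case 2
      then obtain P where "P \<in> children R" "Q \<subseteq> P" by (rule children_cover)
      then show ?thesis using 2 by auto
    qed auto
  next
    fix Q assume "Q \<in> ?R"
    then show "Q \<in> ?L" using less.prems children_sub[of _ R] by (elim insertE UN_E) (simp, fastforce)
  qed
  moreover have "R \<notin> (\<Union>P\<in>children R. {Q\<in>S. Q \<subseteq> P})" using children_sub[of _ R] by auto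
  ultimately have "(\<Sum>Q\<in>{Q\<in>S. Q \<subseteq> R}. K Q) = K R + (\<Sum>Q\<in>(\<Union>P\<in>children R. {Q\<in>S. Q \<subseteq> P}). K Q)"
    using finite_S finite_children by simp
  also have "(\<Sum>Q\<in>(\<Union>P\<in>children R. {Q\<in>S. Q \<subseteq> P}). K Q) = (\<Sum>P\<in>children R. \<Sum>Q\<in>{Q\<in>S. Q \<subseteq> P}. K Q)"
  proof (intro sum.UNION_disjoint ballI impI)
    fix P P' assume PP: "P \<in> children R" "P' \<in> children R" "P \<noteq> P'"
    then have "P \<inter> P' = {}" by (rule children_disjoint)
    then have "Q = {}" if "Q \<subseteq> P" "Q \<subseteq> P'" for Q using that by auto
    then show "{Q\<in>S. Q \<subseteq> P} \<inter> {Q\<in>S. Q \<subseteq> P'} = {}" using nonempty by auto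
  qed (use finite_S finite_children in auto)
  also have "\<dots> \<le> (\<Sum>P\<in>children R. V P)" by (intro sum_mono IH)
  finally show ?case using step[OF less.prems] by simp
qed

text \<open>Hoelder with three exponents over the children: the first two factors are merely
  additive, while sparseness shrinks the third by \<open>(3 / 4) powr b3\<close> in each generation.
  The constant is the sum of the geometric series.\<close>

lemma tree_sum_powr_le:
  fixes s w :: "'a set \<Rightarrow> real"
  assumes b: "0 < b1" "0 < b2" "0 < b3" "b1 + b2 + b3 = 1"
    and s: "\<And>P. P \<in> S \<Longrightarrow> 0 \<le> s P" "\<And>P. P \<in> S \<Longrightarrow> (\<Sum>Q\<in>children P. s Q) \<le> s P"
    and w: "\<And>P. P \<in> S \<Longrightarrow> 0 \<le> w P" "\<And>P. P \<in> S \<Longrightarrow> (\<Sum>Q\<in>children P. w Q) \<le> w P"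
    and R: "R \<in> S"
  shows "(\<Sum>Q\<in>{Q\<in>S. Q \<subseteq> R}. s Q powr b1 * w Q powr b2 * measure M Q powr b3)
    \<le> 1 / (1 - (3 / 4) powr b3) * (s R powr b1 * w R powr b2 * measure M R powr b3)"
proof (rule tree_sum_le[OF _ R])
  fix R assume R: "R \<in> S"
  define t where "t = (3 / 4 :: real) powr b3"
  have t: "0 < t" "t < 1" using b powr_less_mono2[of b3 "3 / 4" 1] by (auto simp: t_def)
  have "(\<Sum>P\<in>children R. s P powr b1 * w P powr b2 * measure M P powr b3)
    \<le> (\<Sum>P\<in>children R. s P) powr b1 * (\<Sum>P\<in>children R. w P) powr b2 * (\<Sum>P\<in>children R. measure M P) powr b3"
    using b s w children_S finite_children by (intro Holder_sum3) auto
  also have "\<dots> \<le> s R powr b1 * w R powr b2 * (3 / 4 * measure M R) powr b3"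
    using b s w R children_S sum_children[OF set_tree_axioms, of R] sparse[OF R]
    by (intro mult_mono powr_mono2 sum_nonneg mult_nonneg_nonneg) auto
  finally have *: "(\<Sum>P\<in>children R. s P powr b1 * w P powr b2 * measure M P powr b3)
    \<le> t * (s R powr b1 * w R powr b2 * measure M R powr b3)"
    by (simp only: powr_mult t_def mult.assoc mult.left_commute)
  let ?K = "\<lambda>P. s P powr b1 * w P powr b2 * measure M P powr b3"
  have "?K R + (\<Sum>P\<in>children R. 1 / (1 - t) * ?K P) \<le> ?K R + 1 / (1 - t) * (t * ?K R)"
    unfolding sum_distrib_left[symmetric] using * t by (intro add_left_mono mult_left_mono) auto
  also have "\<dots> = 1 / (1 - t) * ?K R" using t by (simp add: field_simps)
  finally show "?K R + (\<Sum>P\<in>children R. 1 / (1 - (3 / 4) powr b3) * ?K P) \<le> 1 / (1 - (3 / 4) powr b3) * ?K R"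
    unfolding t_def .
qed

text \<open>The three uses of a maximal function bound with respect to any measure \<open>N\<close>
  on the same tree: cores are disjoint, a single set sees the maximum everywhere on it, and the
  increments at a point add up to the maximum there.\<close>

lemma sum_core_le:
  assumes N: "set_tree N S" and sets: "sets N = sets M" and p: "1 \<le> p"
    and I: "(\<integral>\<^sup>+z. ennreal (pt_max Y z powr p) \<partial>N) \<le> ennreal I" "0 \<le> I"
  shows "(\<Sum>F\<in>S. measure N (core F) * run_max Y F powr p) \<le> I"
    and "F \<in> S \<Longrightarrow> measure N F * run_max Y F powr p \<le> I"
    and "(\<Sum>F\<in>S. (run_max Y F - run_max' Y F) powr p * measure N F) \<le> I"
proof -
  interpret N: set_tree N S by fact
  have cN [measurable]: "core F \<in> sets N" if "F \<in> S" for F using sets_core[OF that] sets by simp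
  have sN [measurable]: "F \<in> sets N" if "F \<in> S" for F using N.sets_S that by simp
  have em: "emeasure N (core F) = ennreal (measure N (core F))" if F: "F \<in> S" for F
  proof -
    have "emeasure N (core F) \<le> emeasure N F" using F by (intro emeasure_mono) (auto simp: core_def)
    then show ?thesis using N.emeasure_finite[OF F] by (intro emeasure_eq_ennreal_measure) auto
  qed
  have "ennreal (\<Sum>F\<in>S. measure N (core F) * run_max Y F powr p)
    = (\<Sum>F\<in>S. ennreal (run_max Y F powr p) * emeasure N (core F))"
    by (subst sum_ennreal[symmetric]) (auto simp: ennreal_mult em mult.commute)
  also have "\<dots> = (\<integral>\<^sup>+z. (\<Sum>F\<in>S. ennreal (run_max Y F powr p) * indicator (core F) z) \<partial>N)"
    by (subst nn_integral_sum) (auto simp: nn_integral_cmult_indicator)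
  also have "\<dots> \<le> (\<integral>\<^sup>+z. ennreal (pt_max Y z powr p) \<partial>N)"
  proof (intro nn_integral_mono)
    fix z
    show "(\<Sum>F\<in>S. ennreal (run_max Y F powr p) * indicator (core F) z) \<le> ennreal (pt_max Y z powr p)"
    proof (cases "\<exists>F\<in>S. z \<in> core F")
      case True
      then obtain F where F: "F \<in> S" "z \<in> core F" by blast
      have "(\<Sum>F\<in>S. ennreal (run_max Y F powr p) * indicator (core F) z)
        = (\<Sum>F\<in>{F}. ennreal (run_max Y F powr p) * indicator (core F) z)"
        using F finite_S core_disjoint[of F] by (intro sum.mono_neutral_right) (auto simp: indicator_def)
      also have "\<dots> \<le> ennreal (pt_max Y z powr p)"
        using F p by (auto simp: core_def intro!: ennreal_leI powr_mono2 run_max_le_pt_max run_max_nonneg)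
      finally show ?thesis .
    next
      case False
      then show ?thesis by (subst sum.neutral) auto
    qed
  qed
  finally have "ennreal (\<Sum>F\<in>S. measure N (core F) * run_max Y F powr p) \<le> (\<integral>\<^sup>+z. ennreal (pt_max Y z powr p) \<partial>N)" .
  from order_trans[OF this I(1)] show "(\<Sum>F\<in>S. measure N (core F) * run_max Y F powr p) \<le> I"
    using I(2) by (simp only: ennreal_le_iff)
next
  interpret N: set_tree N S by fact
  assume F: "F \<in> S"
  have [measurable]: "F \<in> sets N" using N.sets_S F by simp
  have "ennreal (measure N F * run_max Y F powr p) = (\<integral>\<^sup>+z. ennreal (run_max Y F powr p) * indicator F z \<partial>N)"
    using N.emeasure_eq[OF F] by (subst nn_integral_cmult_indicator) (simp_all add: ennreal_mult mult.commute)
  also have "\<dots> \<le> (\<integral>\<^sup>+z. ennreal (pt_max Y z powr p) \<partial>N)" using p by (intro nn_integral_mono)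
      (auto simp: indicator_def intro!: ennreal_leI powr_mono2 run_max_le_pt_max run_max_nonneg)
  finally have "ennreal (measure N F * run_max Y F powr p) \<le> (\<integral>\<^sup>+z. ennreal (pt_max Y z powr p) \<partial>N)" .
  from order_trans[OF this I(1)] show "measure N F * run_max Y F powr p \<le> I" using I(2) by (simp only: ennreal_le_iff)
next
  interpret N: set_tree N S by fact
  have sN [measurable]: "F \<in> sets N" if "F \<in> S" for F using N.sets_S that by simp
  let ?D = "\<lambda>F. run_max Y F - run_max' Y F"
  have D: "0 \<le> ?D F" for F using run_max'_le[of Y F] by simp
  have "ennreal (\<Sum>F\<in>S. ?D F powr p * measure N F) = (\<Sum>F\<in>S. ennreal (?D F powr p) * emeasure N F)"
    by (subst sum_ennreal[symmetric]) (auto simp: ennreal_mult N.emeasure_eq)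
  also have "\<dots> = (\<integral>\<^sup>+z. (\<Sum>F\<in>S. ennreal (?D F powr p) * indicator F z) \<partial>N)"
    by (subst nn_integral_sum) (auto simp: nn_integral_cmult_indicator)
  also have "\<dots> \<le> (\<integral>\<^sup>+z. ennreal (pt_max Y z powr p) \<partial>N)"
  proof (intro nn_integral_mono)
    fix z
    let ?C = "{F\<in>S. z \<in> F}"
    have le: "?D F \<le> pt_max Y z" if "F \<in> ?C" for F
      using run_max_le_pt_max[of z F Y] run_max'_nonneg[of Y F] that by auto
    \<comment> \<open>Nonnegative increments with sum \<open>pt_max Y z\<close> satisfy the
      embedding of l^1 into l^p: each increment is at most the sum.\<close>
    have *: "(\<Sum>F\<in>?C. ?D F powr p) \<le> pt_max Y z powr p"
    proof (cases "pt_max Y z = 0")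
      case True
      then have "?D F = 0" if "F \<in> ?C" for F using le[OF that] D[of F] by simp
      then show ?thesis by simp
    next
      case False
      then have pos: "0 < pt_max Y z" using pt_max_nonneg[of Y z] by simp
      have "(\<Sum>F\<in>?C. ?D F powr p) \<le> (\<Sum>F\<in>?C. ?D F * pt_max Y z powr (p - 1))"
      proof (intro sum_mono)
        fix F assume F: "F \<in> ?C"
        have "?D F powr p = ?D F * ?D F powr (p - 1)" using D[of F] by (cases "?D F = 0") (auto simp: powr_diff)
        also have "\<dots> \<le> ?D F * pt_max Y z powr (p - 1)"
          using D[of F] le[OF F] p by (intro mult_left_mono powr_mono2) auto
        finally show "?D F powr p \<le> ?D F * pt_max Y z powr (p - 1)" .
      qed
      also have "\<dots> = pt_max Y z * pt_max Y z powr (p - 1)"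
        using sum_increments_pt[where z = z and g = "\<lambda>x. x" and X = Y] by (simp add: sum_distrib_right[symmetric])
      also have "\<dots> = pt_max Y z powr p" using pos by (simp add: powr_diff)
      finally show ?thesis .
    qed
    have "(\<Sum>F\<in>S. ennreal (?D F powr p) * indicator F z) = (\<Sum>F\<in>?C. ennreal (?D F powr p))"
      using finite_S by (intro sum.mono_neutral_cong_right) auto
    also have "\<dots> = ennreal (\<Sum>F\<in>?C. ?D F powr p)" by simp
    finally show "(\<Sum>F\<in>S. ennreal (?D F powr p) * indicator F z) \<le> ennreal (pt_max Y z powr p)"
      using * by (simp add: ennreal_leI)
  qed
  finally have "ennreal (\<Sum>F\<in>S. ?D F powr p * measure N F) \<le> (\<integral>\<^sup>+z. ennreal (pt_max Y z powr p) \<partial>N)" .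
  from order_trans[OF this I(1)] show "(\<Sum>F\<in>S. ?D F powr p * measure N F) \<le> I" using I(2) by (simp only: ennreal_le_iff)
qed

text \<open>The off-diagonal gain: if \<open>i + j > 1\<close>, the sum of the \<open>j / (1 - i)\<close>-th powers is controlled by
  the sum and the supremum, so the Carleson constant \<open>A\<close> enters only with the power \<open>1 - i\<close>.\<close>

lemma half_sum:
  fixes D s w Y :: "'b \<Rightarrow> real"
  assumes ij: "0 < i" "i < 1" "0 < j" "1 \<le> i + j" and fin: "finite U"
    and nn: "\<And>F. F \<in> U \<Longrightarrow> 0 \<le> D F" "\<And>F. F \<in> U \<Longrightarrow> 0 \<le> s F" "\<And>F. F \<in> U \<Longrightarrow> 0 \<le> w F" "\<And>F. F \<in> U \<Longrightarrow> 0 \<le> Y F"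
    and J: "(\<Sum>F\<in>U. D F powr (1 / i) * s F) \<le> J"
    and I: "\<And>F. F \<in> U \<Longrightarrow> w F * Y F powr (1 / j) \<le> I" "(\<Sum>F\<in>U. w F * Y F powr (1 / j)) \<le> A * I"
    and A: "0 \<le> A" "0 \<le> I"
  shows "(\<Sum>F\<in>U. D F * (s F powr i * w F powr j) * Y F) \<le> A powr (1 - i) * (J powr i * I powr j)"
proof -
  define g where "g = j / (1 - i)"
  have g: "1 \<le> g" using ij by (simp add: g_def field_simps)
  define t where "t F = w F * Y F powr (1 / j)" for F
  have t: "0 \<le> t F" if "F \<in> U" for F using nn that by (simp add: t_def)
  have tI: "t F \<le> I" if "F \<in> U" for F using I(1)[OF that] by (simp add: t_def)
  \<comment> \<open>The exponent \<open>g = j / (1 - i)\<close> is at least 1, so g - 1 powers of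
    each term are estimated by the supremum and only one is left to be summed.\<close>
  have "(\<Sum>F\<in>U. t F powr g) \<le> (\<Sum>F\<in>U. t F * I powr (g - 1))"
  proof (intro sum_mono)
    fix F assume F: "F \<in> U"
    have "t F powr g = t F * t F powr (g - 1)" using t[OF F] by (cases "t F = 0") (auto simp: powr_diff)
    also have "\<dots> \<le> t F * I powr (g - 1)" using t[OF F] tI[OF F] g by (intro mult_left_mono powr_mono2) auto
    finally show "t F powr g \<le> t F * I powr (g - 1)" .
  qed
  also have "\<dots> \<le> A * I * I powr (g - 1)"
    unfolding sum_distrib_right[symmetric] using I(2) by (intro mult_right_mono) (auto simp: t_def)
  also have "\<dots> = A * I powr g" using A by (cases "I = 0") (auto simp: powr_diff)
  finally have tg: "(\<Sum>F\<in>U. t F powr g) \<le> A * I powr g" .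
  have "(\<Sum>F\<in>U. D F * (s F powr i * w F powr j) * Y F)
    = (\<Sum>F\<in>U. (D F powr (1 / i) * s F) powr i * (t F powr g) powr (1 - i))"
  proof (intro sum.cong refl)
    fix F assume F: "F \<in> U"
    have "(D F powr (1 / i) * s F) powr i = D F * s F powr i" "(t F powr g) powr (1 - i) = w F powr j * Y F"
      using ij nn F by (simp_all add: t_def g_def powr_mult powr_powr)
    then show "D F * (s F powr i * w F powr j) * Y F = (D F powr (1 / i) * s F) powr i * (t F powr g) powr (1 - i)"
      by simp
  qed
  also have "\<dots> \<le> (\<Sum>F\<in>U. D F powr (1 / i) * s F) powr i * (\<Sum>F\<in>U. t F powr g) powr (1 - i)"
    using ij nn fin by (intro Holder_sum) auto
  also have "\<dots> \<le> J powr i * (A * I powr g) powr (1 - i)"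
    using ij nn J tg by (intro mult_mono powr_mono2 sum_nonneg) auto
  also have "\<dots> = A powr (1 - i) * (J powr i * I powr j)" using ij A by (simp add: powr_mult powr_powr g_def)
  finally show ?thesis .
qed

text \<open>A discrete form of parallel stopping cubes. Both \<open>X Q\<close> and
  \<open>Y Q\<close> are written as sums of increments over ancestors of \<open>Q\<close>; of two
  such ancestors one contains the other, and summing first over the cubes \<open>Q\<close> below the
  smaller one uses the testing hypothesis on \<open>K\<close>.\<close>

lemma sum_le_increments:
  assumes K: "\<And>Q. Q \<in> S \<Longrightarrow> 0 \<le> K Q" and T: "\<And>R. R \<in> S \<Longrightarrow> (\<Sum>Q\<in>{Q\<in>S. Q \<subseteq> R}. K Q) \<le> c * K R"
    and X: "\<And>Q. Q \<in> S \<Longrightarrow> 0 \<le> X Q" and Y: "\<And>Q. Q \<in> S \<Longrightarrow> 0 \<le> Y Q"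
  shows "(\<Sum>Q\<in>S. K Q * X Q * Y Q) \<le> c * ((\<Sum>F\<in>S. (run_max X F - run_max' X F) * K F * run_max Y F)
        + (\<Sum>F\<in>S. (run_max Y F - run_max' Y F) * K F * run_max X F))"
proof -
  let ?D = "\<lambda>X F. run_max X F - run_max' X F"
  have D: "0 \<le> ?D X F" for X F using run_max'_le[of X F] by simp
  have rm: "run_max X Q = (\<Sum>F\<in>{F\<in>S. Q \<subseteq> F}. ?D X F)" if "Q \<in> S" for X Q
    using sum_increments[where g = "\<lambda>x. x" and X = X, OF that] by simp
  have 1: "K Q * X Q * Y Q
      \<le> (\<Sum>F\<in>{F\<in>S. Q \<subseteq> F}. K Q * (?D X F * run_max Y F)) + (\<Sum>G\<in>{G\<in>S. Q \<subseteq> G}. K Q * (?D Y G * run_max X G))"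
    if Q: "Q \<in> S" for Q
  proof -
    let ?C = "{F\<in>S. Q \<subseteq> F}"
    obtain z where z: "z \<in> Q" using nonempty[OF Q] by blast
    have "X Q * Y Q \<le> run_max X Q * run_max Y Q"
      using run_max_ge[OF Q] X[OF Q] Y[OF Q] run_max_nonneg by (intro mult_mono) auto
    also have "\<dots> = (\<Sum>F\<in>?C. \<Sum>G\<in>?C. ?D X F * ?D Y G)" by (simp add: rm[OF Q] sum_product)
    \<comment> \<open>Ancestors of \<open>Q\<close> share a point and are therefore comparable; the
      diagonal is counted twice, which is harmless for an upper bound.\<close>
    also have "\<dots> \<le> (\<Sum>F\<in>?C. \<Sum>G\<in>?C. (if F \<subseteq> G then ?D X F * ?D Y G else 0) + (if G \<subseteq> F then ?D X F * ?D Y G else 0))"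
    proof (intro sum_mono)
      fix F G assume "F \<in> ?C" "G \<in> ?C"
      then have "F \<subseteq> G \<or> G \<subseteq> F" using comparable[of z F G] z by auto
      then show "?D X F * ?D Y G \<le> (if F \<subseteq> G then ?D X F * ?D Y G else 0) + (if G \<subseteq> F then ?D X F * ?D Y G else 0)"
        using D by auto
    qed
    also have "\<dots> = (\<Sum>F\<in>?C. \<Sum>G\<in>?C. if F \<subseteq> G then ?D X F * ?D Y G else 0)
        + (\<Sum>G\<in>?C. \<Sum>F\<in>?C. if G \<subseteq> F then ?D X F * ?D Y G else 0)"
      by (simp add: sum.distrib sum.swap[of "\<lambda>F G. if G \<subseteq> F then ?D X F * ?D Y G else 0" ?C ?C])
    also have "(\<Sum>F\<in>?C. \<Sum>G\<in>?C. if F \<subseteq> G then ?D X F * ?D Y G else 0) = (\<Sum>F\<in>?C. ?D X F * run_max Y F)"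
    proof (intro sum.cong refl)
      fix F assume F: "F \<in> ?C"
      then have "run_max Y F = (\<Sum>G\<in>{G\<in>S. F \<subseteq> G}. ?D Y G)" by (intro rm) auto
      also have "\<dots> = (\<Sum>G\<in>?C. if F \<subseteq> G then ?D Y G else 0)" using F finite_S by (intro sum.mono_neutral_cong_left) auto
      finally show "(\<Sum>G\<in>?C. if F \<subseteq> G then ?D X F * ?D Y G else 0) = ?D X F * run_max Y F"
        by (auto simp: sum_distrib_left intro!: sum.cong)
    qed
    also have "(\<Sum>G\<in>?C. \<Sum>F\<in>?C. if G \<subseteq> F then ?D X F * ?D Y G else 0) = (\<Sum>G\<in>?C. ?D Y G * run_max X G)"
    proof (intro sum.cong refl)
      fix G assume G: "G \<in> ?C"
      then have "run_max X G = (\<Sum>F\<in>{F\<in>S. G \<subseteq> F}. ?D X F)" by (intro rm) auto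
      also have "\<dots> = (\<Sum>F\<in>?C. if G \<subseteq> F then ?D X F else 0)" using G finite_S by (intro sum.mono_neutral_cong_left) auto
      finally show "(\<Sum>F\<in>?C. if G \<subseteq> F then ?D X F * ?D Y G else 0) = ?D Y G * run_max X G"
        by (auto simp: sum_distrib_left intro!: sum.cong)
    qed
    finally have "K Q * (X Q * Y Q) \<le> K Q * ((\<Sum>F\<in>?C. ?D X F * run_max Y F) + (\<Sum>G\<in>?C. ?D Y G * run_max X G))"
      using K[OF Q] by (intro mult_left_mono)
    then show ?thesis by (simp add: sum_distrib_left distrib_left mult.assoc)
  qed
  have 2: "(\<Sum>Q\<in>S. \<Sum>F\<in>{F\<in>S. Q \<subseteq> F}. K Q * (?D X F * run_max Y F)) \<le> c * (\<Sum>F\<in>S. ?D X F * K F * run_max Y F)" for X Y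
  proof -
    have "(\<Sum>Q\<in>S. \<Sum>F\<in>{F\<in>S. Q \<subseteq> F}. K Q * (?D X F * run_max Y F))
      = (\<Sum>F\<in>S. \<Sum>Q\<in>{Q\<in>S. Q \<subseteq> F}. K Q * (?D X F * run_max Y F))" using finite_S by (intro sum.swap_restrict)
    also have "\<dots> = (\<Sum>F\<in>S. (\<Sum>Q\<in>{Q\<in>S. Q \<subseteq> F}. K Q) * (?D X F * run_max Y F))" by (simp add: sum_distrib_right)
    also have "\<dots> \<le> (\<Sum>F\<in>S. c * K F * (?D X F * run_max Y F))"
      using D run_max_nonneg T by (intro sum_mono mult_right_mono mult_nonneg_nonneg) auto
    finally show ?thesis by (simp add: sum_distrib_left algebra_simps)
  qed
  have "(\<Sum>Q\<in>S. K Q * X Q * Y Q) \<le> (\<Sum>Q\<in>S. (\<Sum>F\<in>{F\<in>S. Q \<subseteq> F}. K Q * (?D X F * run_max Y F))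
      + (\<Sum>G\<in>{G\<in>S. Q \<subseteq> G}. K Q * (?D Y G * run_max X G)))" by (intro sum_mono 1)
  also have "\<dots> \<le> c * (\<Sum>F\<in>S. ?D X F * K F * run_max Y F) + c * (\<Sum>F\<in>S. ?D Y F * K F * run_max X F)"
    unfolding sum.distrib by (intro add_mono 2)
  finally show ?thesis by (simp add: distrib_left)
qed

end

text \<open>The number \<open>k\<close> is the power of the characteristic that is traded for
  Lebesgue measure. Its choice leaves at least half of 1 - j and of j as exponents of the two
  weighted measures; the denominator comes from a geometric series of ratio
  \<open>(3 / 4) powr (k * (x + y))\<close>.\<close>

definition sum_const :: "real \<Rightarrow> real \<Rightarrow> real \<Rightarrow> real \<Rightarrow> real" where
  "sum_const i j x y = (let k = min ((1 - j) / (2 * y)) (j / (2 * x)) in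
     2 powr k / (1 - (3 / 4) powr (k * (x + y))))"

lemma sum_const_pos: "0 < j \<Longrightarrow> j < 1 \<Longrightarrow> 0 < x \<Longrightarrow> 0 < y \<Longrightarrow> 0 < sum_const i j x y" unfolding sum_const_def Let_def
  using powr_less_mono2[of "min ((1 - j) / (2 * y)) (j / (2 * x)) * (x + y)" "3 / 4" 1]
  by (auto intro!: divide_pos_pos mult_pos_pos)

lemma powr_le_powr_cancel:
  fixes a b x :: real
  assumes "0 \<le> a" "0 \<le> b" "0 < x" "a powr x \<le> b powr x"
  shows "a \<le> b" using powr_less_mono2[of x b a] assms by (meson not_le)

context sparse_tree
begin

text \<open>On cubes whose characteristic is comparable to a fixed \<open>l\<close>, its k-th power
  may be replaced by that of \<open>l\<close> inside the testing sum, the resulting power of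
  Lebesgue measure gains from sparseness, and at the top cube the replacement is undone. The testing
  constant is thus independent of \<open>l\<close>. The full bound \<open>L\<close> enters only
  through the Carleson constants in \<open>half_sum\<close>.\<close>

lemma class_sum:
  assumes ij: "0 < i" "i < 1" "0 < j" "j < 1" "1 \<le> i + j" and xy: "0 < x" "0 < y"
    and \<sigma>: "set_tree \<sigma> S" "sets \<sigma> = sets M" and w: "set_tree w S" "sets w = sets M"
    and Holder: "\<And>Q E. Q \<in> S \<Longrightarrow> E \<in> sets M \<Longrightarrow> E \<subseteq> Q \<Longrightarrow>
        measure M E powr (x + y) \<le> measure w E powr x * measure \<sigma> E powr y"
    and l: "0 < l" "\<And>Q. Q \<in> S \<Longrightarrow> l * measure M Q powr (x + y) \<le> measure w Q powr x * measure \<sigma> Q powr y"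
      "\<And>Q. Q \<in> S \<Longrightarrow> measure w Q powr x * measure \<sigma> Q powr y \<le> 2 * l * measure M Q powr (x + y)"
    and L: "0 < L" "\<And>Q. Q \<in> S \<Longrightarrow> measure w Q powr x * measure \<sigma> Q powr y \<le> L * measure M Q powr (x + y)"
    and X: "\<And>Q. Q \<in> S \<Longrightarrow> 0 \<le> X Q" and Y: "\<And>Q. Q \<in> S \<Longrightarrow> 0 \<le> Y Q"
    and J: "(\<integral>\<^sup>+z. ennreal (pt_max X z powr (1 / i)) \<partial>\<sigma>) \<le> ennreal J" "0 \<le> J"
    and I: "(\<integral>\<^sup>+z. ennreal (pt_max Y z powr (1 / j)) \<partial>w) \<le> ennreal I" "0 \<le> I"
  shows "(\<Sum>Q\<in>S. measure \<sigma> Q powr i * measure w Q powr j * X Q * Y Q)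
    \<le> sum_const i j x y * (((4 powr (x + y) * L) powr (1 / x)) powr (1 - i)
        + ((4 powr (x + y) * L) powr (1 / y)) powr (1 - j)) * (J powr i * I powr j)"
proof -
  interpret \<sigma>: set_tree \<sigma> S by fact
  interpret w: set_tree w S by fact
  let ?s = "measure \<sigma>" and ?w = "measure w" and ?m = "measure M"
  define k where "k = min ((1 - j) / (2 * y)) (j / (2 * x))"
  define b1 b2 b3 where "b1 = 1 - j - k * y" and "b2 = j - k * x" and "b3 = k * (x + y)"
  have k: "0 < k" "k * y \<le> (1 - j) / 2" "k * x \<le> j / 2" using ij xy by (auto simp: k_def min_def field_simps)
  have "0 < k * (x + y)" using k xy by simp
  then have b: "0 < b1" "0 < b2" "0 < b3" "b1 + b2 + b3 = 1"
    using k ij xy by (auto simp: b1_def b2_def b3_def algebra_simps)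
  \<comment> \<open>The surplus i + j - 1 goes to the first measure, where monotonicity moves it to
    the top cube; what is left has total exponent 1 and contains the k-th power of the
    characteristic.\<close>
  have split: "s powr i * u powr j = s powr (i + j - 1) * (s powr b1 * u powr b2 * (u powr x * s powr y) powr k)"
    if "0 < s" "0 < u" for s u
  proof -
    have "s powr i = s powr (i + j - 1) * s powr b1 * s powr (y * k)" "u powr j = u powr b2 * u powr (x * k)"
      by (simp_all add: powr_add[symmetric] b1_def b2_def algebra_simps)
    moreover have "(u powr x * s powr y) powr k = u powr (x * k) * s powr (y * k)" by (simp add: powr_mult powr_powr)
    ultimately show ?thesis by simp
  qed
  have c: "sum_const i j x y = 2 powr k / (1 - (3 / 4) powr b3)" by (simp add: sum_const_def k_def b3_def Let_def)
  have c0: "0 < sum_const i j x y" using ij xy by (intro sum_const_pos) auto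
  have sp: "0 < ?s Q" and wp: "0 < ?w Q" and mp: "0 < ?m Q" if "Q \<in> S" for Q
    using \<sigma>.measure_pos w.measure_pos measure_pos that by auto
  have T: "(\<Sum>Q\<in>{Q\<in>S. Q \<subseteq> R}. ?s Q powr i * ?w Q powr j) \<le> sum_const i j x y * (?s R powr i * ?w R powr j)"
    if R: "R \<in> S" for R
  proof -
    have "(\<Sum>Q\<in>{Q\<in>S. Q \<subseteq> R}. ?s Q powr i * ?w Q powr j)
      \<le> (\<Sum>Q\<in>{Q\<in>S. Q \<subseteq> R}. ?s R powr (i + j - 1) * (2 * l) powr k * (?s Q powr b1 * ?w Q powr b2 * ?m Q powr b3))"
    proof (intro sum_mono)
      fix Q assume "Q \<in> {Q\<in>S. Q \<subseteq> R}"
      then have Q: "Q \<in> S" "Q \<subseteq> R" by auto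
      have sR: "?s Q \<le> ?s R" using Q R \<sigma>.fmeasurable_S \<sigma>.sets_S by (intro measure_mono_fmeasurable) auto
      have "?s Q powr i * ?w Q powr j = ?s Q powr (i + j - 1) * (?s Q powr b1 * ?w Q powr b2 * (?w Q powr x * ?s Q powr y) powr k)"
        using sp[OF Q(1)] wp[OF Q(1)] by (rule split)
      also have "\<dots> \<le> ?s R powr (i + j - 1) * (?s Q powr b1 * ?w Q powr b2 * (2 * l * ?m Q powr (x + y)) powr k)"
        using l(3)[OF Q(1)] ij k b sR by (intro mult_mono[OF powr_mono2 mult_left_mono[OF powr_mono2]]) auto
      also have "\<dots> = ?s R powr (i + j - 1) * (2 * l) powr k * (?s Q powr b1 * ?w Q powr b2 * ?m Q powr b3)"
        using l(1) by (simp add: powr_mult powr_powr b3_def mult_ac)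
      finally show "?s Q powr i * ?w Q powr j
        \<le> ?s R powr (i + j - 1) * (2 * l) powr k * (?s Q powr b1 * ?w Q powr b2 * ?m Q powr b3)" .
    qed
    also have "\<dots> = ?s R powr (i + j - 1) * (2 * l) powr k * (\<Sum>Q\<in>{Q\<in>S. Q \<subseteq> R}. ?s Q powr b1 * ?w Q powr b2 * ?m Q powr b3)"
      by (simp add: sum_distrib_left)
    also have "\<dots> \<le> ?s R powr (i + j - 1) * (2 * l) powr k * (1 / (1 - (3 / 4) powr b3) * (?s R powr b1 * ?w R powr b2 * ?m R powr b3))"
      using b R \<sigma> w by (intro mult_left_mono tree_sum_powr_le sum_children_le) auto
    also have "\<dots> = sum_const i j x y * (?s R powr (i + j - 1) * (?s R powr b1 * ?w R powr b2) * (l * ?m R powr (x + y)) powr k)"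
      using l(1) by (simp add: c powr_mult powr_powr b3_def mult_ac)
    also have "\<dots> \<le> sum_const i j x y * (?s R powr (i + j - 1) * (?s R powr b1 * ?w R powr b2) * (?w R powr x * ?s R powr y) powr k)"
      using l(1) l(2)[OF R] c0 k by (intro mult_left_mono powr_mono2) auto
    also have "\<dots> = sum_const i j x y * (?s R powr i * ?w R powr j)"
      using split[OF sp[OF R] wp[OF R]] by (simp add: mult.assoc)
    finally show ?thesis .
  qed
  define C where "C = 4 powr (x + y) * L"
  have C: "0 < C" using L by (simp add: C_def)
  \<comment> \<open>Hoelder on the core bounds its Lebesgue measure, which is a quarter of that of
    \<open>F\<close>, by its two weighted measures. Enlarging one of these to the measure of
    \<open>F\<close> and cancelling gives an A_\<infinity>-type comparison for the other.\<close>
  have core: "?w F \<le> C powr (1 / x) * ?w (core F)" "?s F \<le> C powr (1 / y) * ?s (core F)" if F: "F \<in> S" for F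
  proof -
    let ?E = "core F"
    have E: "?E \<in> sets M" "?E \<subseteq> F" using sets_core[OF F] by (auto simp: core_def)
    have sE: "?s ?E \<le> ?s F" using E F \<sigma>(2) \<sigma>.fmeasurable_S by (intro measure_mono_fmeasurable) auto
    have wE: "?w ?E \<le> ?w F" using E F w(2) w.fmeasurable_S by (intro measure_mono_fmeasurable) auto
    have "?w F powr x * ?s F powr y \<le> L * ?m F powr (x + y)" by (rule L(2)[OF F])
    also have "\<dots> \<le> L * (4 * ?m ?E) powr (x + y)"
      using L(1) xy measure_core[OF F] by (intro mult_left_mono powr_mono2) auto
    also have "\<dots> = C * ?m ?E powr (x + y)" by (simp add: powr_mult C_def)
    also have "\<dots> \<le> C * (?w ?E powr x * ?s ?E powr y)" using C Holder[OF F E] by (intro mult_left_mono) auto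
    finally have *: "?w F powr x * ?s F powr y \<le> C * (?w ?E powr x * ?s ?E powr y)" .
    have "?w F powr x * ?s F powr y \<le> (C * ?w ?E powr x) * ?s F powr y"
    proof -
      have "C * (?w ?E powr x * ?s ?E powr y) \<le> C * (?w ?E powr x * ?s F powr y)"
        using sE C xy by (intro mult_left_mono powr_mono2) auto
      then show ?thesis using * by (simp add: mult.assoc)
    qed
    then have "?w F powr x \<le> C * ?w ?E powr x" using sp[OF F] by simp
    also have "\<dots> = (C powr (1 / x) * ?w ?E) powr x" using xy C by (simp add: powr_mult powr_powr)
    finally show "?w F \<le> C powr (1 / x) * ?w ?E"
      using powr_le_powr_cancel[of "?w F" "C powr (1 / x) * ?w ?E" x] xy by simp
    have "?w F powr x * ?s F powr y \<le> ?w F powr x * (C * ?s ?E powr y)"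
    proof -
      have "C * (?w ?E powr x * ?s ?E powr y) \<le> C * (?w F powr x * ?s ?E powr y)"
        using wE C xy by (intro mult_left_mono mult_right_mono powr_mono2) auto
      then show ?thesis using * by (simp add: mult.left_commute)
    qed
    then have "?s F powr y \<le> C * ?s ?E powr y" using wp[OF F] by simp
    also have "\<dots> = (C powr (1 / y) * ?s ?E) powr y" using xy C by (simp add: powr_mult powr_powr)
    finally show "?s F \<le> C powr (1 / y) * ?s ?E"
      using powr_le_powr_cancel[of "?s F" "C powr (1 / y) * ?s ?E" y] xy by simp
  qed
  have car: "(\<Sum>F\<in>S. measure N F * run_max Z F powr p) \<le> A * I'"
    if "\<And>F. F \<in> S \<Longrightarrow> measure N F \<le> A * measure N (core F)" "0 \<le> A"
      "(\<Sum>F\<in>S. measure N (core F) * run_max Z F powr p) \<le> I'" for N :: "'a measure" and Z p A I'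
  proof -
    have "(\<Sum>F\<in>S. measure N F * run_max Z F powr p) \<le> (\<Sum>F\<in>S. A * measure N (core F) * run_max Z F powr p)"
      using that by (intro sum_mono mult_right_mono) auto
    also have "\<dots> = A * (\<Sum>F\<in>S. measure N (core F) * run_max Z F powr p)" by (simp add: sum_distrib_left mult.assoc)
    also have "\<dots> \<le> A * I'" using that by (intro mult_left_mono) auto
    finally show ?thesis .
  qed
  have pi: "1 \<le> 1 / i" "1 \<le> 1 / j" using ij by auto
  \<comment> \<open>In this half the increments belong to \<sigma> and the running maximum to
    \<open>w\<close>, so the Carleson constant of \<open>w\<close> enters; in the other half the
    roles are exchanged.\<close>
  have 1: "(\<Sum>F\<in>S. (run_max X F - run_max' X F) * (?s F powr i * ?w F powr j) * run_max Y F)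
    \<le> (C powr (1 / x)) powr (1 - i) * (J powr i * I powr j)"
    using ij finite_S run_max'_le[of X] run_max_nonneg[of Y] J(2) I(2)
      sum_core_le(3)[OF \<sigma> pi(1) J] sum_core_le(2)[OF w pi(2) I]
      car[OF core(1) _ sum_core_le(1)[OF w pi(2) I]] by (intro half_sum) auto
  have 2: "(\<Sum>F\<in>S. (run_max Y F - run_max' Y F) * (?w F powr j * ?s F powr i) * run_max X F)
    \<le> (C powr (1 / y)) powr (1 - j) * (I powr j * J powr i)"
    using ij finite_S run_max'_le[of Y] run_max_nonneg[of X] J(2) I(2)
      sum_core_le(3)[OF w pi(2) I] sum_core_le(2)[OF \<sigma> pi(1) J]
      car[OF core(2) _ sum_core_le(1)[OF \<sigma> pi(1) J]] by (intro half_sum) auto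
  have "(\<Sum>Q\<in>S. ?s Q powr i * ?w Q powr j * X Q * Y Q)
    \<le> sum_const i j x y * ((\<Sum>F\<in>S. (run_max X F - run_max' X F) * (?s F powr i * ?w F powr j) * run_max Y F)
        + (\<Sum>F\<in>S. (run_max Y F - run_max' Y F) * (?s F powr i * ?w F powr j) * run_max X F))"
    using T X Y by (intro sum_le_increments) auto
  also have "\<dots> \<le> sum_const i j x y * ((C powr (1 / x)) powr (1 - i) * (J powr i * I powr j)
      + (C powr (1 / y)) powr (1 - j) * (I powr j * J powr i))"
    using 1 2 c0 by (intro mult_left_mono add_mono) (auto simp: mult.commute)
  finally show ?thesis unfolding C_def[symmetric] by (simp add: algebra_simps)
qed

text \<open>The cubes are sorted by the dyadic size of their characteristic; within one class the
  testing sums in the proof above lose only a constant.\<close>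

lemma mixed_sum:
  assumes ij: "0 < i" "i < 1" "0 < j" "j < 1" "1 \<le> i + j" and xy: "0 < x" "0 < y"
    and \<sigma>: "set_tree \<sigma> S" "sets \<sigma> = sets M" and w: "set_tree w S" "sets w = sets M"
    and Holder: "\<And>Q E. Q \<in> S \<Longrightarrow> E \<in> sets M \<Longrightarrow> E \<subseteq> Q \<Longrightarrow>
        measure M E powr (x + y) \<le> measure w E powr x * measure \<sigma> E powr y"
    and L: "1 \<le> L" "\<And>Q. Q \<in> S \<Longrightarrow> measure w Q powr x * measure \<sigma> Q powr y \<le> L * measure M Q powr (x + y)"
    and X: "\<And>Q. Q \<in> S \<Longrightarrow> 0 \<le> X Q" and Y: "\<And>Q. Q \<in> S \<Longrightarrow> 0 \<le> Y Q"
    and J: "(\<integral>\<^sup>+z. ennreal (pt_max X z powr (1 / i)) \<partial>\<sigma>) \<le> ennreal J" "0 \<le> J"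
    and I: "(\<integral>\<^sup>+z. ennreal (pt_max Y z powr (1 / j)) \<partial>w) \<le> ennreal I" "0 \<le> I"
  shows "(\<Sum>Q\<in>S. measure \<sigma> Q powr (i + y) * measure w Q powr (j + x) / measure M Q powr (x + y) * X Q * Y Q)
    \<le> 4 * L * (sum_const i j x y * (((4 powr (x + y) * L) powr (1 / x)) powr (1 - i)
        + ((4 powr (x + y) * L) powr (1 / y)) powr (1 - j)) * (J powr i * I powr j))" (is "?lhs \<le> 4 * L * ?B")
proof -
  interpret \<sigma>: set_tree \<sigma> S by fact
  interpret w: set_tree w S by fact
  let ?s = "measure \<sigma>" and ?w = "measure w" and ?m = "measure M"
  have sp: "0 < ?s Q" and wp: "0 < ?w Q" and mp: "0 < ?m Q" if "Q \<in> S" for Q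
    using \<sigma>.measure_pos w.measure_pos measure_pos that by auto
  define q where "q Q = ?w Q powr x * ?s Q powr y / ?m Q powr (x + y)" for Q
  define \<kappa> where "\<kappa> Q = nat \<lfloor>log 2 (q Q)\<rfloor>" for Q
  define Sk where "Sk k = {Q\<in>S. \<kappa> Q = k}" for k
  have q: "1 \<le> q Q" "q Q \<le> L" if "Q \<in> S" for Q
    using Holder[of Q Q] L(2)[of Q] sets_S[of Q] mp[of Q] that by (auto simp: q_def field_simps)
  have \<kappa>: "2 ^ \<kappa> Q \<le> q Q" "q Q \<le> 2 * 2 ^ \<kappa> Q" if "Q \<in> S" for Q
  proof -
    have "0 \<le> log 2 (q Q)" using q[OF that] by simp
    then have e: "real (\<kappa> Q) = of_int \<lfloor>log 2 (q Q)\<rfloor>" by (simp add: \<kappa>_def)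
    have "real (\<kappa> Q) \<le> log 2 (q Q)" "log 2 (q Q) \<le> real (\<kappa> Q) + 1" unfolding e by linarith+
    then have "2 powr real (\<kappa> Q) \<le> 2 powr log 2 (q Q)" "2 powr log 2 (q Q) \<le> 2 powr (real (\<kappa> Q) + 1)" by simp_all
    then show "2 ^ \<kappa> Q \<le> q Q" "q Q \<le> 2 * 2 ^ \<kappa> Q" using q[OF that] by (simp_all add: powr_realpow powr_add)
  qed
  have B: "0 \<le> ?B" using sum_const_pos[of j x y i] ij xy by (intro mult_nonneg_nonneg) auto
  have cls: "(\<Sum>Q\<in>Sk k. q Q * (?s Q powr i * ?w Q powr j * X Q * Y Q)) \<le> 2 * 2 ^ k * ?B" for k
  proof -
    have sub: "Sk k \<subseteq> S" by (auto simp: Sk_def)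
    interpret T: sparse_tree M "Sk k" using sub by (rule sparse_subtree)
    \<comment> \<open>The maximal function of a class is dominated by the one of the full tree, so
      \<open>J\<close> and \<open>I\<close> serve all classes at once.\<close>
    have le: "T.pt_max Z z \<le> pt_max Z z" for Z z
      unfolding T.pt_max_def pt_max_def using sub finite_S by (intro Max_mono) auto
    have mono: "(\<integral>\<^sup>+z. ennreal (T.pt_max Z z powr p) \<partial>N) \<le> (\<integral>\<^sup>+z. ennreal (pt_max Z z powr p) \<partial>N)" if "0 < p"
      for Z p and N :: "'a measure"
      using that le T.pt_max_nonneg by (intro nn_integral_mono ennreal_leI powr_mono2) auto
    have "(\<Sum>Q\<in>Sk k. ?s Q powr i * ?w Q powr j * X Q * Y Q) \<le> ?B"
    proof (rule T.class_sum[OF ij xy \<sigma>.subtree[OF sub] \<sigma>(2) w.subtree[OF sub] w(2), where l = "2 ^ k"])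
      show "?m E powr (x + y) \<le> ?w E powr x * ?s E powr y" if "Q \<in> Sk k" "E \<in> sets M" "E \<subseteq> Q" for Q E
        using Holder that sub by auto
      fix Q assume "Q \<in> Sk k"
      then have Q: "Q \<in> S" "\<kappa> Q = k" by (auto simp: Sk_def)
      have e: "q Q * ?m Q powr (x + y) = ?w Q powr x * ?s Q powr y" using mp[OF Q(1)] by (simp add: q_def)
      show "2 ^ k * ?m Q powr (x + y) \<le> ?w Q powr x * ?s Q powr y"
        unfolding e[symmetric] using \<kappa>(1)[OF Q(1)] Q(2) by (intro mult_right_mono) auto
      show "?w Q powr x * ?s Q powr y \<le> 2 * 2 ^ k * ?m Q powr (x + y)"
        unfolding e[symmetric] using \<kappa>(2)[OF Q(1)] Q(2) by (intro mult_right_mono) auto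
    next
      show "(\<integral>\<^sup>+z. ennreal (T.pt_max X z powr (1 / i)) \<partial>\<sigma>) \<le> ennreal J"
        by (rule order_trans[OF mono J(1)]) (use ij in simp)
      show "(\<integral>\<^sup>+z. ennreal (T.pt_max Y z powr (1 / j)) \<partial>w) \<le> ennreal I"
        by (rule order_trans[OF mono I(1)]) (use ij in simp)
    qed (use L X Y J I sub in auto)
    then have "2 * 2 ^ k * (\<Sum>Q\<in>Sk k. ?s Q powr i * ?w Q powr j * X Q * Y Q) \<le> 2 * 2 ^ k * ?B"
      by (intro mult_left_mono) auto
    moreover have "(\<Sum>Q\<in>Sk k. q Q * (?s Q powr i * ?w Q powr j * X Q * Y Q))
      \<le> (\<Sum>Q\<in>Sk k. 2 * 2 ^ k * (?s Q powr i * ?w Q powr j * X Q * Y Q))"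
      using \<kappa>(2) X Y by (intro sum_mono mult_right_mono mult_nonneg_nonneg) (auto simp: Sk_def)
    ultimately show ?thesis unfolding sum_distrib_left by (rule order_trans[rotated])
  qed
  define K where "K = nat \<lfloor>log 2 L\<rfloor>"
  have \<kappa>K: "\<kappa> Q \<le> K" if "Q \<in> S" for Q unfolding \<kappa>_def K_def using q[OF that] by (intro nat_mono floor_mono) auto
  have "?lhs = (\<Sum>Q\<in>S. q Q * (?s Q powr i * ?w Q powr j * X Q * Y Q))" by (intro sum.cong) (auto simp: q_def powr_add)
  also have "\<dots> = (\<Sum>k\<in>{..K}. \<Sum>Q\<in>{Q\<in>S. \<kappa> Q = k}. q Q * (?s Q powr i * ?w Q powr j * X Q * Y Q))"
    using finite_S \<kappa>K by (intro sum.group[symmetric]) auto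
  also have "\<dots> \<le> (\<Sum>k\<in>{..K}. 2 * 2 ^ k * ?B)" using cls by (intro sum_mono) (simp add: Sk_def)
  \<comment> \<open>The class bounds grow geometrically up to the largest class, so the sorting
    costs a single factor \<open>L\<close> and no logarithm.\<close>
  also have "\<dots> = 2 * (2 * 2 ^ K - 1) * ?B"
  proof -
    have "(\<Sum>k\<le>K. 2 ^ k :: real) = 2 * 2 ^ K - 1" by (induction K) auto
    then show ?thesis unfolding sum_distrib_right[symmetric] sum_distrib_left[symmetric] by simp
  qed
  also have "\<dots> \<le> 4 * L * ?B"
  proof (intro mult_right_mono B)
    have "real K \<le> log 2 L" using L(1) by (simp add: K_def)
    then have "2 powr real K \<le> 2 powr log 2 L" by simp
    then have "2 ^ K \<le> L" using L(1) by (simp add: powr_realpow)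
    then show "2 * (2 * 2 ^ K - 1) \<le> 4 * L" by simp
  qed
  finally show ?thesis .
qed

end

section \<open>A one-weight estimate for the bilinear sparse form\<close>

definition max_const :: "real \<Rightarrow> real" where
  "max_const p = (p * max 1 (1 / (p - 1))) powr p"

section \<open>Passage to weighted maximal functions\<close>

context set_tree
begin

lemma nn_integral_le_Holder:
  assumes [measurable]: "\<phi> \<in> borel_measurable M" and Q: "Q \<in> sets M" and p: "1 < p"
  shows "integ M Q \<phi> \<le> epow (\<integral>\<^sup>+z. epow (\<phi> z) p \<partial>M) (1 / p) * epow (emeasure M Q) (1 - 1 / p)"
proof -
  note [measurable] = Q
  have "integ M Q \<phi> = (\<integral>\<^sup>+z. epow (epow (\<phi> z) p) (1 / p) * epow (indicator Q z) (1 - 1 / p) \<partial>M)"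
    using p by (intro nn_integral_cong) (auto simp: indicator_def)
  also have "\<dots> \<le> epow (\<integral>\<^sup>+z. epow (\<phi> z) p \<partial>M) (1 / p) * epow (\<integral>\<^sup>+z. indicator Q z \<partial>M) (1 - 1 / p)"
    using p by (intro Holder_nn_integral) auto
  finally show ?thesis using Q by simp
qed

lemma pt_max_powr:
  assumes "0 < e" "\<And>Q. Q \<in> S \<Longrightarrow> 0 \<le> X Q"
  shows "pt_max (\<lambda>Q. X Q powr e) z = pt_max X z powr e"
proof -
  let ?A = "insert 0 (X ` {R\<in>S. z \<in> R})"
  have A: "finite ?A" using finite_S by simp
  then have "Max ?A \<in> ?A" by (rule Max_in) simp
  note A = A this
  show ?thesis unfolding pt_max_def
  proof (rule Max_eqI)
    show "Max ?A powr e \<in> insert 0 ((\<lambda>Q. X Q powr e) ` {R\<in>S. z \<in> R})" using A(2) assms(1) by auto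
    fix t assume "t \<in> insert 0 ((\<lambda>Q. X Q powr e) ` {R\<in>S. z \<in> R})"
    then consider "t = 0" | Q where "t = X Q powr e" "Q \<in> S" "z \<in> Q" by auto
    then show "t \<le> Max ?A powr e"
    proof cases
      case 2
      then show ?thesis using A(1) assms by (auto intro!: powr_mono2)
    qed simp
  qed (use finite_S in simp)
qed

text \<open>The quantity in the form is the power i + y of an average, measured in reciprocal
  exponent i. This is the maximal inequality at exponent (i + y)/i, which exceeds 1 because y is
  positive.\<close>

lemma maximal_power:
  assumes [measurable]: "\<phi> \<in> borel_measurable M" and i: "0 < i" "0 < y"
    and fin: "(\<integral>\<^sup>+z. epow (\<phi> z) ((i + y) / i) \<partial>M) < top"
  defines "X \<equiv> \<lambda>Q. (enn2real (integ M Q \<phi>) / measure M Q) powr (i + y)"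
  shows "Q \<in> S \<Longrightarrow> (integ M Q \<phi>) < top"
    and "(\<integral>\<^sup>+z. ennreal (pt_max X z powr (1 / i)) \<partial>M)
      \<le> ennreal (max_const ((i + y) / i)) * (\<integral>\<^sup>+z. epow (\<phi> z) ((i + y) / i) \<partial>M)"
proof -
  have p: "1 < (i + y) / i" using i by (simp add: field_simps)
  show *: "integ M Q \<phi> < top" if Q: "Q \<in> S" for Q
  proof -
    have "(integ M Q \<phi>)
      \<le> epow (\<integral>\<^sup>+z. epow (\<phi> z) ((i + y) / i) \<partial>M) (1 / ((i + y) / i)) * epow (emeasure M Q) (1 - 1 / ((i + y) / i))"
      using Q p sets_S by (intro nn_integral_le_Holder) auto
    also have "\<dots> < top" using fin emeasure_finite[OF Q] by (simp add: ennreal_mult_less_top)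
    finally show ?thesis .
  qed
  have eq: "pt_max X z powr (1 / i) = pt_max (\<lambda>Q. enn2real (integ M Q \<phi>) / measure M Q) z powr ((i + y) / i)" for z
    unfolding X_def using i by (subst pt_max_powr) (auto simp: powr_powr)
  show "(\<integral>\<^sup>+z. ennreal (pt_max X z powr (1 / i)) \<partial>M)
      \<le> ennreal (max_const ((i + y) / i)) * (\<integral>\<^sup>+z. epow (\<phi> z) ((i + y) / i) \<partial>M)"
    unfolding max_const_def eq by (rule maximal_inequality[OF assms(1) p *])
qed

end

definition tree_const :: "real \<Rightarrow> real \<Rightarrow> real \<Rightarrow> real \<Rightarrow> real" where
  "tree_const i j x y = 4 * sum_const i j x y
     * (4 powr ((x + y) * (1 / x) * (1 - i)) + 4 powr ((x + y) * (1 / y) * (1 - j)))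
     * (max_const ((i + y) / i) powr i * max_const ((j + x) / j) powr j)"

text \<open>The Muckenhoupt condition for a weight that multiplies the function. For
  \<open>v\<close> = u^(1/P), x = 1/P and y = 1 - 1/P it is the A_P condition on u with constant
  L^P. For x + y different from 1 it is the condition attached to an off-diagonal form.\<close>

definition muckenhoupt :: "'a measure \<Rightarrow> real \<Rightarrow> real \<Rightarrow> ('a \<Rightarrow> real) \<Rightarrow> real \<Rightarrow> 'a set \<Rightarrow> bool" where
  "muckenhoupt M x y v L Q \<longleftrightarrow>
     epow (\<integral>\<^sup>+z\<in>Q. ennreal (v z powr (1 / x)) \<partial>M) x * epow (\<integral>\<^sup>+z\<in>Q. ennreal (v z powr (- 1 / y)) \<partial>M) y
       \<le> ennreal L * epow (emeasure M Q) (x + y)"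

definition form_const :: "real \<Rightarrow> real \<Rightarrow> real \<Rightarrow> real \<Rightarrow> real" where
  "form_const i j x y = 2 * tree_const i j x y"

lemma tree_const_nonneg: "0 < j \<Longrightarrow> j < 1 \<Longrightarrow> 0 < x \<Longrightarrow> 0 < y \<Longrightarrow> 0 \<le> tree_const i j x y"
  using sum_const_pos[of j x y i] by (simp add: tree_const_def)

lemma form_const_nonneg: "0 < j \<Longrightarrow> j < 1 \<Longrightarrow> 0 < x \<Longrightarrow> 0 < y \<Longrightarrow> 0 \<le> form_const i j x y"
  using tree_const_nonneg[of j x y i] by (simp add: form_const_def)

context set_tree
begin

lemma set_tree_density:
  assumes [measurable]: "u \<in> borel_measurable M" and u: "\<And>z. 0 < u z"
    and fin: "\<And>Q. Q \<in> S \<Longrightarrow> (\<integral>\<^sup>+z\<in>Q. ennreal (u z) \<partial>M) < top"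
  shows "set_tree (density M (\<lambda>z. ennreal (u z))) S"
proof
  fix Q assume Q: "Q \<in> S"
  note [measurable] = sets_S[OF Q]
  have e: "emeasure (density M (\<lambda>z. ennreal (u z))) Q = (\<integral>\<^sup>+z\<in>Q. ennreal (u z) \<partial>M)" by (intro emeasure_density) auto
  show "Q \<in> sets (density M (\<lambda>z. ennreal (u z)))" by simp
  show "emeasure (density M (\<lambda>z. ennreal (u z))) Q < top" unfolding e by (rule fin[OF Q])
  show "0 < emeasure (density M (\<lambda>z. ennreal (u z))) Q"
  proof (rule ccontr)
    assume "\<not> ?thesis"
    then have "(\<integral>\<^sup>+z\<in>Q. ennreal (u z) \<partial>M) = 0" by (simp add: e)
    then have "AE z in M. ennreal (u z) * indicator Q z = 0" by (subst (asm) nn_integral_0_iff_AE) auto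
    moreover have nu: "\<not> u z \<le> 0" for z using u[of z] by simp
    ultimately have "AE z in M. z \<notin> Q"
      by (elim eventually_mono) (auto simp: indicator_def ennreal_eq_0_iff nu split: if_splits)
    then have "emeasure M Q = 0"
      using sets_S[OF Q] sets.sets_into_space[OF sets_S[OF Q]] by (subst (asm) AE_iff_measurable[of Q]) auto
    then show False using emeasure_pos[OF Q] by simp
  qed
qed (use finite_S laminar in auto)

end

text \<open>Hoelder with the exponents x/(x+y) and y/(x+y), in which the two powers of
  \<open>v\<close> cancel. It is the inequality reverse to \<open>muckenhoupt\<close> and holds on
  every measurable subset.\<close>

lemma Holder_weight:
  assumes [measurable]: "v \<in> borel_measurable M" "E \<in> sets M" and v: "\<And>z. 0 < v z" and xy: "0 < x" "0 < y"
  shows "epow (emeasure M E) (x + y)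
    \<le> epow (\<integral>\<^sup>+z\<in>E. ennreal (v z powr (1 / x)) \<partial>M) x * epow (\<integral>\<^sup>+z\<in>E. ennreal (v z powr (- 1 / y)) \<partial>M) y"
proof -
  define e where "e = x / (x + y)"
  have e: "0 < e" "e < 1" "1 - e = y / (x + y)" using xy by (auto simp: e_def field_simps)
  let ?f = "\<lambda>z. ennreal (v z powr (1 / x)) * indicator E z" and ?g = "\<lambda>z. ennreal (v z powr (- 1 / y)) * indicator E z"
  have "emeasure M E = (\<integral>\<^sup>+z. epow (?f z) e * epow (?g z) (1 - e) \<partial>M)"
  proof -
    have "epow (?f z) e * epow (?g z) (1 - e) = indicator E z" for z
    proof -
      have "1 / x * e + - 1 / y * (1 - e) = 0" using xy unfolding e(3) by (simp add: e_def)
      then have "(v z powr (1 / x)) powr e * (v z powr (- 1 / y)) powr (1 - e) = 1"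
        using v[of z] by (simp only: powr_powr powr_add[symmetric] powr_zero_eq_one less_imp_neq[symmetric] if_False)
      then show ?thesis by (auto simp: indicator_def epow_ennreal ennreal_mult[symmetric])
    qed
    then show ?thesis by simp
  qed
  also have "\<dots> \<le> epow (\<integral>\<^sup>+z. ?f z \<partial>M) e * epow (\<integral>\<^sup>+z. ?g z \<partial>M) (1 - e)" using e by (intro Holder_nn_integral) auto
  finally have "epow (emeasure M E) (x + y) \<le> epow (epow (\<integral>\<^sup>+z. ?f z \<partial>M) e * epow (\<integral>\<^sup>+z. ?g z \<partial>M) (1 - e)) (x + y)"
    using xy by (intro epow_mono) auto
  moreover have "e * (x + y) = x" "(1 - e) * (x + y) = y" using xy unfolding e(3) by (auto simp: e_def)
  ultimately show ?thesis by (simp only: epow_mult epow_epow)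
qed

text \<open>The dual weight device: dividing by \<open>u\<close> and integrating against the density
  \<open>u\<close> leaves integrals over sets unchanged and moves the weight from the norm into the
  measure.\<close>

lemma density_dual:
  assumes [measurable]: "u \<in> borel_measurable M" "f \<in> borel_measurable M" and u: "\<And>z. 0 < u z"
  defines "N \<equiv> density M (\<lambda>z. ennreal (u z))" and "f' \<equiv> \<lambda>z. f z * ennreal (1 / u z)"
  shows "(\<integral>\<^sup>+z. epow (f' z) c \<partial>N) = (\<integral>\<^sup>+z. epow (f z) c * ennreal (u z powr (1 - c)) \<partial>M)"
    and "Q \<in> sets M \<Longrightarrow> integ N Q f' = integ M Q f"
proof -
  have "ennreal (u z) * epow (f' z) c = epow (f z) c * ennreal (u z powr (1 - c))" for z
  proof -
    have "u z * (1 / u z) powr c = u z powr (1 - c)" using u[of z] by (simp add: powr_diff powr_divide)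
    then have "ennreal (u z) * ennreal ((1 / u z) powr c) = ennreal (u z powr (1 - c))"
      using u[of z] by (simp add: ennreal_mult[symmetric])
    then show ?thesis
      using u[of z] by (simp add: f'_def epow_mult epow_ennreal less_imp_le mult.left_commute[of "ennreal (u z)"])
  qed
  then show "(\<integral>\<^sup>+z. epow (f' z) c \<partial>N) = (\<integral>\<^sup>+z. epow (f z) c * ennreal (u z powr (1 - c)) \<partial>M)"
    unfolding N_def by (subst nn_integral_density) (auto simp: f'_def)
  assume [measurable]: "Q \<in> sets M"
  have "ennreal (u z) * (f' z * indicator Q z) = f z * indicator Q z" for z
  proof -
    have "ennreal (1 / u z) * ennreal (u z) = 1" using u[of z] by (simp add: ennreal_mult[symmetric])
    then have "f z * indicator Q z * (ennreal (1 / u z) * ennreal (u z)) = f z * indicator Q z" by simp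
    then show ?thesis by (simp only: f'_def mult_ac)
  qed
  then show "integ N Q f' = integ M Q f" unfolding N_def by (subst nn_integral_density) (auto simp: f'_def)
qed

context sparse_tree
begin

text \<open>With the measures of density v^(-1/y) and v^(1/x), each integral in the form is a
  weighted measure times a weighted average, and the term becomes the one of
  \<open>mixed_sum\<close>. The two norms are then those to which the weighted maximal inequalities
  apply.\<close>

lemma tree_form_bound:
  fixes v :: "'a \<Rightarrow> real" and \<phi> G :: "'a \<Rightarrow> ennreal"
  assumes ij: "0 < i" "i < 1" "0 < j" "j < 1" "1 \<le> i + j" and xy: "0 < x" "0 < y"
    and [measurable]: "v \<in> borel_measurable M" "\<phi> \<in> borel_measurable M" "G \<in> borel_measurable M"
    and v: "\<And>z. 0 < v z" and L: "1 \<le> L" "\<And>Q. Q \<in> S \<Longrightarrow> muckenhoupt M x y v L Q"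
    and \<beta>: "1 + (1 - i) / x \<le> \<beta>" "1 + (1 - j) / y \<le> \<beta>"
    and N1: "(\<integral>\<^sup>+z. epow (epow (\<phi> z) (i + y) * ennreal (v z)) (1 / i) \<partial>M) < top"
    and N2: "(\<integral>\<^sup>+z. epow (epow (G z) (j + x) * ennreal (1 / v z)) (1 / j) \<partial>M) < top"
  shows "(\<Sum>Q\<in>S. epow (integ M Q \<phi>) (i + y) * epow (integ M Q G) (j + x) / epow (emeasure M Q) (x + y))
    \<le> ennreal (tree_const i j x y * L powr \<beta>) * epow (\<integral>\<^sup>+z. epow (epow (\<phi> z) (i + y) * ennreal (v z)) (1 / i) \<partial>M) i
      * epow (\<integral>\<^sup>+z. epow (epow (G z) (j + x) * ennreal (1 / v z)) (1 / j) \<partial>M) j"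
proof -
  define us uw where "us z = v z powr (- 1 / y)" and "uw z = v z powr (1 / x)" for z
  have [measurable]: "us \<in> borel_measurable M" "uw \<in> borel_measurable M" unfolding us_def uw_def by measurable
  have u: "0 < us z" "0 < uw z" for z using v[of z] by (auto simp: us_def uw_def)
  define \<sigma> w where "\<sigma> = density M (\<lambda>z. ennreal (us z))" and "w = density M (\<lambda>z. ennreal (uw z))"
  have sets\<sigma> [measurable_cong]: "sets \<sigma> = sets M" and setsw [measurable_cong]: "sets w = sets M"
    by (simp_all add: \<sigma>_def w_def)
  have em\<sigma>: "emeasure \<sigma> E = (\<integral>\<^sup>+z\<in>E. ennreal (us z) \<partial>M)" and emw: "emeasure w E = (\<integral>\<^sup>+z\<in>E. ennreal (uw z) \<partial>M)"
    if "E \<in> sets M" for E unfolding \<sigma>_def w_def using that by (auto intro!: emeasure_density)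
  have Hol: "epow (emeasure M E) (x + y) \<le> epow (emeasure w E) x * epow (emeasure \<sigma> E) y" if "E \<in> sets M" for E
    using Holder_weight[OF _ that v xy] that by (simp add: em\<sigma> emw us_def uw_def)
  have muck: "epow (emeasure w Q) x * epow (emeasure \<sigma> Q) y \<le> ennreal L * epow (emeasure M Q) (x + y)" if "Q \<in> S" for Q
    using L(2)[OF that] sets_S[OF that] by (simp add: muckenhoupt_def em\<sigma> emw us_def uw_def)
  \<comment> \<open>The product of the two weighted measures is finite by the Muckenhoupt condition
    and nonzero by Hoelder, so each factor is finite.\<close>
  have fin: "emeasure \<sigma> Q < top" "emeasure w Q < top" if Q: "Q \<in> S" for Q
  proof -
    have "ennreal L * epow (emeasure M Q) (x + y) < top"
      using emeasure_finite[OF Q] by (simp add: ennreal_mult_less_top)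
    then have "epow (emeasure w Q) x * epow (emeasure \<sigma> Q) y < top" using muck[OF Q] by simp
    moreover have "epow (emeasure w Q) x * epow (emeasure \<sigma> Q) y \<noteq> 0"
      using Hol[OF sets_S[OF Q]] emeasure_pos[OF Q] by (metis epow_pos_iff not_less_zero order_less_le_trans)
    ultimately show "emeasure \<sigma> Q < top" "emeasure w Q < top" by (auto simp: ennreal_mult_less_top)
  qed
  have t\<sigma>: "set_tree \<sigma> S" and tw: "set_tree w S"
    unfolding \<sigma>_def w_def using fin em\<sigma> emw sets_S u by (auto intro!: set_tree_density)
  interpret \<sigma>: set_tree \<sigma> S by fact
  interpret w: set_tree w S by fact
  define \<phi>' G' where "\<phi>' z = \<phi> z * ennreal (1 / us z)" and "G' z = G z * ennreal (1 / uw z)" for z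
  have [measurable]: "\<phi>' \<in> borel_measurable \<sigma>" "G' \<in> borel_measurable w" unfolding \<phi>'_def G'_def by measurable
  have fQ: "integ \<sigma> Q \<phi>' = integ M Q \<phi>" "integ w Q G' = integ M Q G" if "Q \<in> sets M" for Q
    unfolding \<sigma>_def w_def \<phi>'_def G'_def using that u by (auto intro!: density_dual(2))
  define A1 A2 where "A1 = (\<integral>\<^sup>+z. epow (epow (\<phi> z) (i + y) * ennreal (v z)) (1 / i) \<partial>M)"
    and "A2 = (\<integral>\<^sup>+z. epow (epow (G z) (j + x) * ennreal (1 / v z)) (1 / j) \<partial>M)"
  \<comment> \<open>The density is the power of \<open>v\<close> for which dualizing at exponent
    (i+y)/i returns v^(1/i).\<close>
  have nrm: "(\<integral>\<^sup>+z. epow (\<phi>' z) ((i + y) / i) \<partial>\<sigma>) = A1"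
  proof -
    have "- 1 / y * (1 - (i + y) / i) = 1 / i" using ij xy by (simp add: field_simps)
    then have "us z powr (1 - (i + y) / i) = v z powr (1 / i)" for z by (simp only: us_def powr_powr)
    then show ?thesis unfolding \<sigma>_def \<phi>'_def A1_def using u v
      by (subst density_dual(1)) (auto simp: epow_mult epow_ennreal less_imp_le)
  qed
  have nrm': "(\<integral>\<^sup>+z. epow (G' z) ((j + x) / j) \<partial>w) = A2"
  proof -
    have "1 / x * (1 - (j + x) / j) = - (1 / j)" using ij xy by (simp add: field_simps)
    then have "uw z powr (1 - (j + x) / j) = (1 / v z) powr (1 / j)" for z
      using v[of z] unfolding uw_def powr_powr by (simp add: powr_divide powr_minus_divide)
    then show ?thesis unfolding w_def G'_def A2_def using u v
      by (subst density_dual(1)) (auto simp: epow_mult epow_ennreal less_imp_le)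
  qed
  have A: "A1 < top" "A2 < top" using N1 N2 by (auto simp: A1_def A2_def)
  define X Y where "X Q = (enn2real (integ \<sigma> Q \<phi>') / measure \<sigma> Q) powr (i + y)"
    and "Y Q = (enn2real (integ w Q G') / measure w Q) powr (j + x)" for Q
  define J I where "J = max_const ((i + y) / i) * enn2real A1" and "I = max_const ((j + x) / j) * enn2real A2"
  have mc: "0 \<le> max_const p" for p by (simp add: max_const_def)
  have J: "(\<integral>\<^sup>+z. ennreal (pt_max X z powr (1 / i)) \<partial>\<sigma>) \<le> ennreal J" "0 \<le> J"
    using \<sigma>.maximal_power(2)[of \<phi>' i y] ij xy A mc unfolding nrm X_def J_def by (auto simp: ennreal_mult)
  have I: "(\<integral>\<^sup>+z. ennreal (pt_max Y z powr (1 / j)) \<partial>w) \<le> ennreal I" "0 \<le> I"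
    using w.maximal_power(2)[of G' j x] ij xy A mc unfolding nrm' Y_def I_def by (auto simp: ennreal_mult)
  have f\<phi>: "integ M Q \<phi> < top" and fG: "integ M Q G < top" if Q: "Q \<in> S" for Q
    using \<sigma>.maximal_power(1)[of \<phi>' i y Q] w.maximal_power(1)[of G' j x Q] ij xy A Q fQ[OF sets_S[OF Q]]
    by (auto simp: nrm nrm')
  have em: "emeasure \<sigma> E = ennreal (measure \<sigma> E)" "emeasure w E = ennreal (measure w E)"
    "emeasure M E = ennreal (measure M E)" if "Q \<in> S" "E \<in> sets M" "E \<subseteq> Q" for Q E
  proof -
    have "emeasure \<sigma> E \<le> emeasure \<sigma> Q" "emeasure w E \<le> emeasure w Q" "emeasure M E \<le> emeasure M Q"
      using that sets_S sets\<sigma> setsw by (auto intro!: emeasure_mono)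
    then show "emeasure \<sigma> E = ennreal (measure \<sigma> E)" "emeasure w E = ennreal (measure w E)"
      "emeasure M E = ennreal (measure M E)"
      using fin[OF that(1)] emeasure_finite[OF that(1)] by (auto intro!: emeasure_eq_ennreal_measure)
  qed
  have main: "(\<Sum>Q\<in>S. measure \<sigma> Q powr (i + y) * measure w Q powr (j + x) / measure M Q powr (x + y) * X Q * Y Q)
    \<le> 4 * L * (sum_const i j x y * (((4 powr (x + y) * L) powr (1 / x)) powr (1 - i)
        + ((4 powr (x + y) * L) powr (1 / y)) powr (1 - j)) * (J powr i * I powr j))"
  proof (rule mixed_sum[OF ij xy t\<sigma> sets\<sigma> tw setsw _ L(1) _ _ _ J I])
    show "measure M E powr (x + y) \<le> measure w E powr x * measure \<sigma> E powr y"
      if "Q \<in> S" "E \<in> sets M" "E \<subseteq> Q" for Q E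
      using Hol[OF that(2)] by (simp add: em[OF that] epow_ennreal ennreal_mult[symmetric])
    show "measure w Q powr x * measure \<sigma> Q powr y \<le> L * measure M Q powr (x + y)" if Q: "Q \<in> S" for Q
      using muck[OF Q] L(1) by (simp add: em[OF Q sets_S[OF Q]] epow_ennreal ennreal_mult[symmetric])
  qed (auto simp: X_def Y_def)
  have trm: "epow (integ M Q \<phi>) (i + y) * epow (integ M Q G) (j + x) / epow (emeasure M Q) (x + y)
    = ennreal (measure \<sigma> Q powr (i + y) * measure w Q powr (j + x) / measure M Q powr (x + y) * X Q * Y Q)"
    if Q: "Q \<in> S" for Q
  proof -
    define f g where "f = enn2real (integ M Q \<phi>)" and "g = enn2real (integ M Q G)"
    have f: "integ M Q \<phi> = ennreal f" "integ M Q G = ennreal g" "0 \<le> f" "0 \<le> g"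
      using f\<phi>[OF Q] fG[OF Q] by (auto simp: f_def g_def)
    have pos: "0 < measure \<sigma> Q" "0 < measure w Q" "0 < measure M Q"
      using \<sigma>.measure_pos w.measure_pos measure_pos Q by auto
    have XY: "X Q = f powr (i + y) / measure \<sigma> Q powr (i + y)" "Y Q = g powr (j + x) / measure w Q powr (j + x)"
      using fQ[OF sets_S[OF Q]] f pos by (auto simp: X_def Y_def powr_divide)
    have "epow (ennreal f) (i + y) * epow (ennreal g) (j + x) / epow (ennreal (measure M Q)) (x + y)
      = ennreal (f powr (i + y) * g powr (j + x) / measure M Q powr (x + y))"
      using f pos by (simp add: epow_ennreal ennreal_mult[symmetric] divide_ennreal)
    also have "f powr (i + y) * g powr (j + x) / measure M Q powr (x + y)
      = measure \<sigma> Q powr (i + y) * measure w Q powr (j + x) / measure M Q powr (x + y) * X Q * Y Q"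
      unfolding XY using pos by simp
    finally show ?thesis unfolding f(1,2) by (simp add: emeasure_eq[OF Q])
  qed
  have "(\<Sum>Q\<in>S. epow (integ M Q \<phi>) (i + y) * epow (integ M Q G) (j + x) / epow (emeasure M Q) (x + y))
    = ennreal (\<Sum>Q\<in>S. measure \<sigma> Q powr (i + y) * measure w Q powr (j + x) / measure M Q powr (x + y) * X Q * Y Q)"
    by (subst sum_ennreal[symmetric]) (auto simp: trm X_def Y_def)
  also have "\<dots> \<le> ennreal (tree_const i j x y * L powr \<beta> * (enn2real A1 powr i * enn2real A2 powr j))"
  proof (intro ennreal_leI order_trans[OF main])
    let ?c = "sum_const i j x y" and ?J = "J powr i * I powr j"
    let ?a = "4 powr ((x + y) * (1 / x) * (1 - i))" and ?b = "4 powr ((x + y) * (1 / y) * (1 - j))"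
    let ?l = "L powr (1 / x * (1 - i))" and ?k = "L powr (1 / y * (1 - j))"
    let ?U = "(4 powr (x + y) * L) powr (1 / x)" and ?V = "(4 powr (x + y) * L) powr (1 / y)"
    \<comment> \<open>The exponents 1 + (1-i)/x and 1 + (1-j)/y consist of the factor
      \<open>L\<close> from the sorting and the Carleson constant of one of the two
      measures.\<close>
    have "L * ?l \<le> L powr \<beta>" "L * ?k \<le> L powr \<beta>"
    proof -
      have "L * ?l = L powr (1 + (1 - i) / x)" "L * ?k = L powr (1 + (1 - j) / y)"
        using L(1) by (simp_all add: powr_add)
      then show "L * ?l \<le> L powr \<beta>" "L * ?k \<le> L powr \<beta>" using \<beta> L(1) by (simp_all add: powr_mono)
    qed
    then have "?a * (L * ?l) + ?b * (L * ?k) \<le> ?a * L powr \<beta> + ?b * L powr \<beta>" by (intro add_mono mult_left_mono) auto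
    then have *: "4 * ?c * (?J) * (?a * (L * ?l) + ?b * (L * ?k)) \<le> 4 * ?c * (?J) * (?a * L powr \<beta> + ?b * L powr \<beta>)"
      using sum_const_pos[of j x y i] ij xy by (intro mult_left_mono) auto
    have "(?U) powr (1 - i) = ?a * ?l"
      "(?V) powr (1 - j) = ?b * ?k" using L(1) by (simp_all only: powr_mult powr_powr)
    then have "4 * L * (?c * ((?U) powr (1 - i) + (?V) powr (1 - j)) * (?J)) = 4 * ?c * (?J) * (?a * (L * ?l)
        + ?b * (L * ?k))" by (simp only: distrib_left distrib_right mult_ac)
    moreover have JI: "?J = max_const ((i + y) / i) powr i * max_const ((j + x) / j) powr j * (enn2real A1 powr i * enn2real A2 powr j)"
      using mc by (simp add: J_def I_def powr_mult)
    have "4 * ?c * (?J) * (?a * L powr \<beta> + ?b * L powr \<beta>)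
      = tree_const i j x y * L powr \<beta> * (enn2real A1 powr i * enn2real A2 powr j)"
      unfolding JI tree_const_def by (simp only: distrib_left distrib_right mult_ac)
    ultimately show "4 * L * (?c * ((?U) powr (1 - i) + (?V) powr (1 - j)) * (?J))
      \<le> tree_const i j x y * L powr \<beta> * (enn2real A1 powr i * enn2real A2 powr j)" using * by (simp only:)
  qed
  also have "\<dots> = ennreal (tree_const i j x y * L powr \<beta>) * epow A1 i * epow A2 j"
  proof -
    have "epow A1 i = ennreal (enn2real A1 powr i)" "epow A2 j = ennreal (enn2real A2 powr j)"
      using A by (auto simp: epow_def)
    then show ?thesis using tree_const_nonneg[of j x y i] ij xy by (simp add: ennreal_mult mult.assoc)
  qed
  finally show ?thesis unfolding A1_def A2_def .
qed

end

text \<open>The family of stopping cubes is not sparse in the strong sense of \<^locale>\<open>sparse_tree\<close>, but it is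
  the union of two such families.\<close>

locale sparse_union = set_tree +
  assumes split: "\<exists>S1 S2. S = S1 \<union> S2 \<and> sparse_tree M S1 \<and> sparse_tree M S2"
begin

lemma form_bound:
  fixes v :: "'a \<Rightarrow> real" and \<phi> G :: "'a \<Rightarrow> ennreal"
  assumes ij: "0 < i" "i < 1" "0 < j" "j < 1" "1 \<le> i + j" and xy: "0 < x" "0 < y"
    and [measurable]: "v \<in> borel_measurable M" "\<phi> \<in> borel_measurable M" "G \<in> borel_measurable M"
    and v: "\<And>z. 0 < v z" and L: "1 \<le> L" "\<And>Q. Q \<in> S \<Longrightarrow> muckenhoupt M x y v L Q"
    and \<beta>: "1 + (1 - i) / x \<le> \<beta>" "1 + (1 - j) / y \<le> \<beta>"
    and N1: "(\<integral>\<^sup>+z. epow (epow (\<phi> z) (i + y) * ennreal (v z)) (1 / i) \<partial>M) < top"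
    and N2: "(\<integral>\<^sup>+z. epow (epow (G z) (j + x) * ennreal (1 / v z)) (1 / j) \<partial>M) < top"
  shows "(\<Sum>Q\<in>S. epow (integ M Q \<phi>) (i + y) * epow (integ M Q G) (j + x) / epow (emeasure M Q) (x + y))
    \<le> ennreal (form_const i j x y * L powr \<beta>) * epow (\<integral>\<^sup>+z. epow (epow (\<phi> z) (i + y) * ennreal (v z)) (1 / i) \<partial>M) i
      * epow (\<integral>\<^sup>+z. epow (epow (G z) (j + x) * ennreal (1 / v z)) (1 / j) \<partial>M) j"
proof -
  obtain S1 S2 where S: "S = S1 \<union> S2" "sparse_tree M S1" "sparse_tree M S2" using split by blast
  let ?f = "\<lambda>Q. epow (integ M Q \<phi>) (i + y) * epow (integ M Q G) (j + x) / epow (emeasure M Q) (x + y)"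
  let ?B = "ennreal (tree_const i j x y * L powr \<beta>)
      * epow (\<integral>\<^sup>+z. epow (epow (\<phi> z) (i + y) * ennreal (v z)) (1 / i) \<partial>M) i
      * epow (\<integral>\<^sup>+z. epow (epow (G z) (j + x) * ennreal (1 / v z)) (1 / j) \<partial>M) j"
  have "(\<Sum>Q\<in>S1. ?f Q) \<le> ?B" "(\<Sum>Q\<in>S2. ?f Q) \<le> ?B" using S(1) ij xy v L \<beta> N1 N2
    by (auto intro!: sparse_tree.tree_form_bound[OF S(2)] sparse_tree.tree_form_bound[OF S(3)])
  \<comment> \<open>The two sparse families may overlap; common cubes are counted twice, which only
    increases the right-hand side.\<close>
  moreover have "(\<Sum>Q\<in>S. ?f Q) \<le> (\<Sum>Q\<in>S1. ?f Q) + (\<Sum>Q\<in>S2. ?f Q)"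
    unfolding S(1) using finite_S S(1) by (subst sum.union_inter[symmetric]) (auto simp: add_increasing2)
  ultimately have "(\<Sum>Q\<in>S. ?f Q) \<le> ?B + ?B" by (meson add_mono order_trans)
  also have "?B + ?B = ennreal (form_const i j x y * L powr \<beta>)
      * epow (\<integral>\<^sup>+z. epow (epow (\<phi> z) (i + y) * ennreal (v z)) (1 / i) \<partial>M) i
      * epow (\<integral>\<^sup>+z. epow (epow (G z) (j + x) * ennreal (1 / v z)) (1 / j) \<partial>M) j"
    using tree_const_nonneg[of j x y i] ij xy
    by (simp add: form_const_def distrib_right[symmetric] ennreal_plus[symmetric] mult.assoc del: ennreal_plus)
  finally show ?thesis .
qed

end

section \<open>Sparse operators on weighted spaces\<close>

text \<open>The Lebesgue norm indexed by the reciprocal of its exponent, so that 0 stands for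
  L^\<infinity> and Hoelder's inequality simply adds indices.\<close>

definition nrm :: "'a measure \<Rightarrow> real \<Rightarrow> ('a \<Rightarrow> ennreal) \<Rightarrow> ennreal" where
  "nrm M i f = (if i = 0 then esssup M f else epow (\<integral>\<^sup>+z. epow (f z) (1 / i) \<partial>M) i)"

abbreviation wnrm :: "'a measure \<Rightarrow> real \<Rightarrow> ('a \<Rightarrow> real) \<Rightarrow> ('a \<Rightarrow> ennreal) \<Rightarrow> ennreal" where
  "wnrm M i v f \<equiv> nrm M i (\<lambda>z. f z * ennreal (v z))"

lemma nrm_pos: "0 < i \<Longrightarrow> nrm M i f = epow (\<integral>\<^sup>+z. epow (f z) (1 / i) \<partial>M) i" by (simp add: nrm_def)

lemma nrm_mono_AE:
  assumes "0 < i" "AE z in M. f z \<le> g z"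
  shows "nrm M i f \<le> nrm M i g" unfolding nrm_pos[OF assms(1)] using assms
  by (intro epow_mono nn_integral_mono_AE) (auto intro: epow_mono elim!: eventually_mono)

lemma nrm_cong: "(\<And>z. f z = g z) \<Longrightarrow> nrm M i f = nrm M i g" by (metis ext)

lemma nrm_cmult:
  assumes "0 < i" "f \<in> borel_measurable M"
  shows "nrm M i (\<lambda>z. c * f z) = c * nrm M i f" using assms by (simp add: nrm_pos epow_mult nn_integral_cmult)

lemma nrm_mult:
  assumes [measurable]: "f \<in> borel_measurable M" "g \<in> borel_measurable M" and a: "0 \<le> a" "0 < b"
  shows "nrm M (a + b) (\<lambda>z. f z * g z) \<le> nrm M a f * nrm M b g"
proof (cases "a = 0")
  case True
  have "nrm M (a + b) (\<lambda>z. f z * g z) \<le> nrm M b (\<lambda>z. esssup M f * g z)"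
    using True a esssup_AE[of f M] by (auto intro!: nrm_mono_AE mult_right_mono elim!: eventually_mono)
  then show ?thesis using True a by (simp add: nrm_cmult) (simp add: nrm_def)
next
  case False
  then have ab: "0 < a" "0 < a + b" using a by auto
  have "(\<integral>\<^sup>+z. epow (f z * g z) (1 / (a + b)) \<partial>M)
    = (\<integral>\<^sup>+z. epow (epow (f z) (1 / a)) (a / (a + b)) * epow (epow (g z) (1 / b)) (1 - a / (a + b)) \<partial>M)"
  proof (intro nn_integral_cong)
    fix z
    have "1 / b * (1 - a / (a + b)) = 1 / (a + b)" using ab a by (simp add: field_simps)
    then show "epow (f z * g z) (1 / (a + b))
      = epow (epow (f z) (1 / a)) (a / (a + b)) * epow (epow (g z) (1 / b)) (1 - a / (a + b))"
      using ab by (simp add: epow_mult)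
  qed
  also have "\<dots> \<le> epow (\<integral>\<^sup>+z. epow (f z) (1 / a) \<partial>M) (a / (a + b)) * epow (\<integral>\<^sup>+z. epow (g z) (1 / b) \<partial>M) (1 - a / (a + b))"
    using ab a by (intro Holder_nn_integral) (auto simp: field_simps)
  finally have "nrm M (a + b) (\<lambda>z. f z * g z)
    \<le> epow (epow (\<integral>\<^sup>+z. epow (f z) (1 / a) \<partial>M) (a / (a + b)) * epow (\<integral>\<^sup>+z. epow (g z) (1 / b) \<partial>M) (1 - a / (a + b))) (a + b)"
    unfolding nrm_pos[OF ab(2)] using ab by (intro epow_mono) auto
  moreover have "(1 - a / (a + b)) * (a + b) = b" using ab by (simp add: field_simps)
  ultimately show ?thesis using ab a by (simp add: nrm_pos epow_mult)
qed

lemma nrm_epow: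
  assumes "0 < c" "0 < i"
  shows "nrm M (c * i) (\<lambda>z. epow (f z) c) = epow (nrm M i f) c" using assms by (simp add: nrm_pos mult.commute)

lemma nrm_epow_le:
  assumes [measurable]: "f \<in> borel_measurable M" and "0 < c" "0 \<le> i"
  shows "nrm M (c * i) (\<lambda>z. epow (f z) c) \<le> epow (nrm M i f) c"
proof (cases "i = 0")
  case True
  then show ?thesis
    using assms esssup_AE[of f M] by (auto simp: nrm_def intro!: esssup_I epow_mono elim!: eventually_mono)
qed (use assms in \<open>simp add: nrm_epow\<close>)

lemma nrm_geometric:
  assumes [measurable]: "f \<in> borel_measurable M" "g \<in> borel_measurable M"
    and ab: "0 < a" "0 < b" and \<delta>: "0 < \<delta>" "\<delta> < 1"
  shows "nrm M (\<delta> * a + (1 - \<delta>) * b) (\<lambda>z. epow (f z) \<delta> * epow (g z) (1 - \<delta>))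
    \<le> epow (nrm M a f) \<delta> * epow (nrm M b g) (1 - \<delta>)"
  using nrm_mult[of "\<lambda>z. epow (f z) \<delta>" M "\<lambda>z. epow (g z) (1 - \<delta>)" "\<delta> * a" "(1 - \<delta>) * b"] ab \<delta> by (simp add: nrm_epow)

text \<open>Minkowski's integral inequality: the weighted l^e norm of the integrals over
  \<open>P\<close> is at most the integral of the l^e norm of the indicators. One factor of each
  e-th power is written as an integral, Hoelder is applied in \<open>P\<close>, and the remaining
  power of the sum is absorbed.\<close>

lemma Minkowski_sum:
  fixes x :: "'a set \<Rightarrow> ennreal"
  assumes T: "finite T" "\<And>P. P \<in> T \<Longrightarrow> P \<in> sets M" and [measurable]: "\<nu> \<in> borel_measurable M"
    and fin: "\<And>P. P \<in> T \<Longrightarrow> x P < top" "\<And>P. P \<in> T \<Longrightarrow> (integ M P \<nu>) < top" and e: "1 \<le> e"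
  shows "(\<Sum>P\<in>T. x P * epow (integ M P \<nu>) e) \<le> epow (\<integral>\<^sup>+z. \<nu> z * epow (\<Sum>P\<in>T. x P * indicator P z) (1 / e) \<partial>M) e"
proof -
  note [measurable] = T(2)
  define t where "t P = integ M P \<nu>" for P
  define T0 where "T0 = (\<Sum>P\<in>T. x P * epow (t P) e)"
  have e1: "(\<Sum>P\<in>T. x P * epow (t P) e) = (\<integral>\<^sup>+z. \<nu> z * (\<Sum>P\<in>T. x P * indicator P z * epow (t P) (e - 1)) \<partial>M)" if "1 < e"
  proof -
    have "(\<Sum>P\<in>T. x P * epow (t P) e) = (\<Sum>P\<in>T. x P * epow (t P) (e - 1) * (integ M P \<nu>))"
      using that epow_add[of _ "e - 1" 1] by (intro sum.cong) (auto simp: t_def mult.assoc)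
    also have "\<dots> = (\<Sum>P\<in>T. \<integral>\<^sup>+z. x P * epow (t P) (e - 1) * (\<nu> z * indicator P z) \<partial>M)"
      by (intro sum.cong) (auto simp: nn_integral_cmult)
    also have "\<dots> = (\<integral>\<^sup>+z. (\<Sum>P\<in>T. x P * epow (t P) (e - 1) * (\<nu> z * indicator P z)) \<partial>M)" by (subst nn_integral_sum) auto
    finally show ?thesis by (simp add: sum_distrib_left mult_ac)
  qed
  show ?thesis
  proof (cases "e = 1")
    case True
    have "(\<Sum>P\<in>T. x P * t P) = (\<Sum>P\<in>T. \<integral>\<^sup>+z. x P * (\<nu> z * indicator P z) \<partial>M)"
      unfolding t_def by (intro sum.cong) (auto simp: nn_integral_cmult)
    also have "\<dots> = (\<integral>\<^sup>+z. (\<Sum>P\<in>T. x P * (\<nu> z * indicator P z)) \<partial>M)" by (subst nn_integral_sum) auto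
    finally show ?thesis using True by (simp add: t_def sum_distrib_left mult_ac)
  next
    case False
    then have e: "1 < e" using e by simp
    have pt: "(\<Sum>P\<in>T. x P * indicator P z * epow (t P) (e - 1))
      \<le> epow (\<Sum>P\<in>T. x P * indicator P z) (1 / e) * epow T0 (1 - 1 / e)" for z
    proof -
      have "(\<Sum>P\<in>T. x P * indicator P z * epow (t P) (e - 1))
        = (\<integral>\<^sup>+P. epow (x P * indicator P z) (1 / e) * epow (x P * epow (t P) e) (1 - 1 / e) \<partial>count_space T)"
      proof -
        have *: "x P * indicator P z * epow (t P) (e - 1)
          = epow (x P * indicator P z) (1 / e) * epow (x P * epow (t P) e) (1 - 1 / e)" for P
        proof (cases "z \<in> P")
          case True
          have "x P = epow (x P) (1 / e) * epow (x P) (1 - 1 / e)" using epow_add[of "x P" "1 / e" "1 - 1 / e"] by simp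
          moreover have "e * (1 - 1 / e) = e - 1" using e by (simp add: field_simps)
          ultimately show ?thesis using True by (simp add: epow_mult mult.assoc[symmetric])
        qed simp
        show ?thesis unfolding nn_integral_count_space_finite[OF T(1)] by (intro sum.cong refl *)
      qed
      also have "\<dots> \<le> epow (\<integral>\<^sup>+P. x P * indicator P z \<partial>count_space T) (1 / e)
          * epow (\<integral>\<^sup>+P. x P * epow (t P) e \<partial>count_space T) (1 - 1 / e)" using e by (intro Holder_nn_integral) auto
      finally show ?thesis by (simp add: nn_integral_count_space_finite[OF T(1)] T0_def)
    qed
    have "T0 = (\<integral>\<^sup>+z. \<nu> z * (\<Sum>P\<in>T. x P * indicator P z * epow (t P) (e - 1)) \<partial>M)" unfolding T0_def by (rule e1[OF e])
    also have "\<dots> \<le> (\<integral>\<^sup>+z. \<nu> z * (epow (\<Sum>P\<in>T. x P * indicator P z) (1 / e) * epow T0 (1 - 1 / e)) \<partial>M)"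
      by (intro nn_integral_mono mult_left_mono pt) auto
    also have "\<dots> = (\<integral>\<^sup>+z. \<nu> z * epow (\<Sum>P\<in>T. x P * indicator P z) (1 / e) \<partial>M) * epow T0 (1 - 1 / e)"
      by (simp add: mult.assoc[symmetric] nn_integral_multc)
    finally have *: "T0 \<le> (\<integral>\<^sup>+z. \<nu> z * epow (\<Sum>P\<in>T. x P * indicator P z) (1 / e) \<partial>M) * epow T0 (1 - 1 / e)" .
    have "T0 < top" unfolding T0_def using T(1) fin by (auto simp: ennreal_mult_less_top t_def)
    from epow_self_improve[OF this _ *] show ?thesis using e by (simp add: T0_def t_def)
  qed
qed

context sparse_union
begin

text \<open>For \<open>e = 1\<close> this is the usual averaging sparse operator; for
  \<open>e = 1 + a\<close> with a > 0 it is of fractional type and lowers the reciprocal exponent by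
  a.\<close>

definition sparse_op :: "real \<Rightarrow> ('a \<Rightarrow> ennreal) \<Rightarrow> 'a \<Rightarrow> ennreal" where
  "sparse_op e \<phi> z = (\<Sum>P\<in>S. epow (integ M P \<phi>) e / emeasure M P * indicator P z)"

lemma sparse_op_measurable [measurable]: "sparse_op e \<phi> \<in> borel_measurable M"
  unfolding sparse_op_def[abs_def] using sets_S
  by (intro borel_measurable_sum borel_measurable_times_ennreal borel_measurable_indicator) auto

lemma nn_integral_weight_pos:
  assumes [measurable]: "u \<in> borel_measurable M" and u: "\<And>z. 0 < u z" and Q: "Q \<in> S"
  shows "0 < (\<integral>\<^sup>+z\<in>Q. ennreal (u z) \<partial>M)"
proof (rule ccontr)
  note [measurable] = sets_S[OF Q]
  assume "\<not> ?thesis"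
  then have "(\<integral>\<^sup>+z\<in>Q. ennreal (u z) \<partial>M) = 0" by simp
  then have "AE z in M. ennreal (u z) * indicator Q z = 0" by (subst (asm) nn_integral_0_iff_AE) auto
  moreover have nu: "\<not> u z \<le> 0" for z using u[of z] by simp
  ultimately have "AE z in M. z \<notin> Q"
    by (elim eventually_mono) (auto simp: indicator_def ennreal_eq_0_iff nu split: if_splits)
  then have "emeasure M Q = 0"
    using sets_S[OF Q] sets.sets_into_space[OF sets_S[OF Q]] by (subst (asm) AE_iff_measurable[of Q]) auto
  then show False using emeasure_pos[OF Q] by simp
qed

lemma muckenhoupt_finite:
  assumes [measurable]: "v \<in> borel_measurable M" and v: "\<And>z. 0 < v z" and Q: "Q \<in> S"
    and m: "muckenhoupt M x y v L Q"
  shows "(\<integral>\<^sup>+z\<in>Q. ennreal (v z powr (1 / x)) \<partial>M) < top" "(\<integral>\<^sup>+z\<in>Q. ennreal (v z powr (- 1 / y)) \<partial>M) < top"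
proof -
  have pos: "0 < (\<integral>\<^sup>+z\<in>Q. ennreal (v z powr (1 / x)) \<partial>M)" "0 < (\<integral>\<^sup>+z\<in>Q. ennreal (v z powr (- 1 / y)) \<partial>M)"
    by (rule nn_integral_weight_pos[OF _ _ Q]; use v in \<open>simp add: less_le\<close>)+
  have "epow (\<integral>\<^sup>+z\<in>Q. ennreal (v z powr (1 / x)) \<partial>M) x * epow (\<integral>\<^sup>+z\<in>Q. ennreal (v z powr (- 1 / y)) \<partial>M) y < top"
    using m unfolding muckenhoupt_def
    by (rule order_le_less_trans) (use emeasure_finite[OF Q] in \<open>simp add: ennreal_mult_less_top\<close>)
  then show "(\<integral>\<^sup>+z\<in>Q. ennreal (v z powr (1 / x)) \<partial>M) < top" "(\<integral>\<^sup>+z\<in>Q. ennreal (v z powr (- 1 / y)) \<partial>M) < top"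
    using pos by (auto simp: ennreal_mult_less_top)
qed

text \<open>Functions in the weighted space are integrable on every cube, by Hoelder against the
  dual weight. This makes the coefficients of all sparse operators finite.\<close>

lemma nn_integral_finite_weight:
  assumes [measurable]: "v \<in> borel_measurable M" "\<phi> \<in> borel_measurable M" and v: "\<And>z. 0 < v z" and Q: "Q \<in> S"
    and m: "muckenhoupt M x y v L Q" and iy: "0 < i" "0 < y"
    and N: "(\<integral>\<^sup>+z. epow (epow (\<phi> z) (i + y) * ennreal (v z)) (1 / i) \<partial>M) < top"
  shows "integ M Q \<phi> < top"
proof -
  note [measurable] = sets_S[OF Q]
  have "integ M Q \<phi> = (\<integral>\<^sup>+z. epow (epow (epow (\<phi> z) (i + y) * ennreal (v z)) (1 / i)) (i / (i + y))
      * epow (ennreal (v z powr (- 1 / y)) * indicator Q z) (1 - i / (i + y)) \<partial>M)"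
  proof (intro nn_integral_cong)
    fix z
    have e: "1 - i / (i + y) = y / (i + y)" using iy by (simp add: field_simps)
    have "v z powr (1 / (i + y)) * v z powr (- 1 / (i + y)) = 1" using v[of z] by (simp add: powr_add[symmetric])
    then have "ennreal (v z powr (1 / (i + y))) * ennreal (v z powr (- 1 / (i + y))) = 1"
      by (simp add: ennreal_mult[symmetric])
    then show "\<phi> z * indicator Q z = epow (epow (epow (\<phi> z) (i + y) * ennreal (v z)) (1 / i)) (i / (i + y))
      * epow (ennreal (v z powr (- 1 / y)) * indicator Q z) (1 - i / (i + y))" unfolding e using iy v[of z]
      by (auto simp: indicator_def epow_mult epow_ennreal powr_powr less_imp_le mult.assoc)
  qed
  also have "\<dots> \<le> epow (\<integral>\<^sup>+z. epow (epow (\<phi> z) (i + y) * ennreal (v z)) (1 / i) \<partial>M) (i / (i + y))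
      * epow (\<integral>\<^sup>+z\<in>Q. ennreal (v z powr (- 1 / y)) \<partial>M) (1 - i / (i + y))" using iy by (intro Holder_nn_integral) auto
  also have "\<dots> < top" using N muckenhoupt_finite[OF assms(1) v Q m] by (simp add: ennreal_mult_less_top)
  finally show ?thesis .
qed

text \<open>Duality: the operator is paired with its own extremizer, the pairing is a bilinear form
  covered by \<open>form_bound\<close> with i = x + a and j = y = 1 - x, and the norm of the
  extremizer is absorbed.\<close>

lemma op_bound:
  assumes x: "0 < x" "0 \<le> a" "x + a < 1"
    and [measurable]: "v \<in> borel_measurable M" "\<phi> \<in> borel_measurable M"
    and v: "\<And>z. 0 < v z" and L: "1 \<le> L" "\<And>Q. Q \<in> S \<Longrightarrow> muckenhoupt M x (1 - x) v L Q"
    and \<beta>: "(1 - a) / x \<le> \<beta>" "1 / (1 - x) \<le> \<beta>"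
    and N: "nrm M (x + a) (\<lambda>z. epow (\<phi> z) (1 + a) * ennreal (v z)) < top"
  shows "wnrm M x v (sparse_op (1 + a) \<phi>)
    \<le> ennreal (form_const (x + a) (1 - x) x (1 - x) * L powr \<beta>) * nrm M (x + a) (\<lambda>z. epow (\<phi> z) (1 + a) * ennreal (v z))"
proof -
  let ?\<Phi> = "sparse_op (1 + a) \<phi>"
  define Z where "Z = (\<integral>\<^sup>+z. epow (?\<Phi> z * ennreal (v z)) (1 / x) \<partial>M)"
  \<comment> \<open>The extremizer: both \<open>?\<Phi> * G\<close> and the 1/(1-x)-th power of
    \<open>G / v\<close> equal the 1/x-th power of \<open>?\<Phi> * v\<close>, so \<open>Z\<close>
    occurs on both sides.\<close>
  define G where "G z = epow (?\<Phi> z) (1 / x - 1) * ennreal (v z powr (1 / x))" for z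
  have [measurable]: "G \<in> borel_measurable M" unfolding G_def by measurable
  have [measurable]: "P \<in> S \<Longrightarrow> P \<in> sets M" for P by (rule sets_S)
  have xa: "0 < x + a" "x < 1" using x by auto
  have N': "(\<integral>\<^sup>+z. epow (epow (\<phi> z) (x + a + (1 - x)) * ennreal (v z)) (1 / (x + a)) \<partial>M) < top"
    using N xa by (simp add: nrm_pos add.commute[of a 1])
  have fin: "integ M Q \<phi> < top" if Q: "Q \<in> S" for Q
    using Q L(2)[OF Q] v xa N' by (intro nn_integral_finite_weight[where i = "x + a" and y = "1 - x" and v = v]) auto
  define c where "c P = epow (integ M P \<phi>) (1 + a) / emeasure M P" for P
  have c: "c P < top" if "P \<in> S" for P using fin[OF that] emeasure_pos[OF that] emeasure_finite[OF that]
    by (auto simp: c_def ennreal_divide_eq_top_iff less_top[symmetric])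
  \<comment> \<open>A priori finiteness for the absorption: the operator produces a bounded function
    supported on finitely many cubes, where v^(1/x) is integrable.\<close>
  have Z: "Z < top"
  proof -
    define K where "K = (\<Sum>P\<in>S. c P)"
    have K: "K < top" using c finite_S by (simp add: K_def)
    have "epow (?\<Phi> z * ennreal (v z)) (1 / x)
      \<le> (\<Sum>P\<in>S. epow K (1 / x) * (ennreal (v z powr (1 / x)) * indicator P z))" for z
    proof (cases "\<exists>P\<in>S. z \<in> P")
      case True
      then obtain P where P: "P \<in> S" "z \<in> P" by blast
      have "?\<Phi> z \<le> K" unfolding sparse_op_def K_def c_def by (intro sum_mono) (auto simp: indicator_def)
      then have "epow (?\<Phi> z * ennreal (v z)) (1 / x) \<le> epow (K * ennreal (v z)) (1 / x)"
        using x by (intro epow_mono mult_right_mono) auto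
      also have "\<dots> = epow K (1 / x) * (ennreal (v z powr (1 / x)) * indicator P z)"
        using P v[of z] by (simp add: epow_mult epow_ennreal less_imp_le)
      also have "\<dots> \<le> (\<Sum>P\<in>S. epow K (1 / x) * (ennreal (v z powr (1 / x)) * indicator P z))"
        using P finite_S by (intro member_le_sum) auto
      finally show ?thesis .
    next
      case False
      then have "?\<Phi> z = 0" by (auto simp: sparse_op_def)
      then show ?thesis by simp
    qed
    then have "Z \<le> (\<integral>\<^sup>+z. (\<Sum>P\<in>S. epow K (1 / x) * (ennreal (v z powr (1 / x)) * indicator P z)) \<partial>M)"
      unfolding Z_def by (intro nn_integral_mono)
    also have "\<dots> = (\<Sum>P\<in>S. epow K (1 / x) * (\<integral>\<^sup>+z\<in>P. ennreal (v z powr (1 / x)) \<partial>M))"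
      by (subst nn_integral_sum) (auto simp: nn_integral_cmult)
    also have "\<dots> < top"
      using K finite_S muckenhoupt_finite(1)[OF assms(4) v _ L(2)] by (auto simp: ennreal_mult_less_top)
    finally show ?thesis .
  qed
  have \<Phi>G: "?\<Phi> z * G z = epow (?\<Phi> z * ennreal (v z)) (1 / x)" for z using epow_add[of "?\<Phi> z" 1 "1 / x - 1"] v[of z]
    by (simp add: G_def epow_mult epow_ennreal less_imp_le mult.assoc[symmetric])
  have N2: "epow (G z * ennreal (1 / v z)) (1 / (1 - x)) = epow (?\<Phi> z * ennreal (v z)) (1 / x)" for z
  proof -
    have "v z powr (1 / x) * (1 / v z) = v z powr (1 / x - 1)" using v[of z] by (simp add: powr_diff)
    then have "G z * ennreal (1 / v z) = epow (?\<Phi> z * ennreal (v z)) (1 / x - 1)"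
      using v[of z] by (simp add: G_def epow_mult epow_ennreal less_imp_le mult.assoc ennreal_mult[symmetric])
    moreover have "(1 / x - 1) * (1 / (1 - x)) = 1 / x" using xa x by (simp add: field_simps)
    ultimately show ?thesis by simp
  qed
  \<comment> \<open>For these i, j and y the two exponents of \<open>form_bound\<close> simplify to
    (1-a)/x and 1/(1-x), the pair collected in \<open>op_exp\<close>.\<close>
  have \<beta>': "1 + (1 - (x + a)) / x \<le> \<beta>" "1 + (1 - (1 - x)) / (1 - x) \<le> \<beta>" using \<beta> x xa by (simp_all add: field_simps)
  have "Z = (\<integral>\<^sup>+z. ?\<Phi> z * G z \<partial>M)" by (simp add: Z_def \<Phi>G)
  also have "\<dots> = (\<integral>\<^sup>+z. (\<Sum>P\<in>S. c P * (G z * indicator P z)) \<partial>M)"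
    by (simp add: sparse_op_def c_def sum_distrib_left sum_distrib_right mult_ac)
  also have "\<dots> = (\<Sum>P\<in>S. c P * (integ M P G))" by (subst nn_integral_sum) (auto simp: nn_integral_cmult)
  also have "\<dots> = (\<Sum>P\<in>S. epow (integ M P \<phi>) (x + a + (1 - x)) * epow (integ M P G) ((1 - x) + x) / epow (emeasure M P) (x + (1 - x)))"
    by (intro sum.cong) (auto simp: c_def divide_ennreal_def mult_ac add.commute[of a 1])
  also have "\<dots> \<le> ennreal (form_const (x + a) (1 - x) x (1 - x) * L powr \<beta>)
      * epow (\<integral>\<^sup>+z. epow (epow (\<phi> z) (x + a + (1 - x)) * ennreal (v z)) (1 / (x + a)) \<partial>M) (x + a)
      * epow (\<integral>\<^sup>+z. epow (epow (G z) ((1 - x) + x) * ennreal (1 / v z)) (1 / (1 - x)) \<partial>M) (1 - x)"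
    using x xa v L \<beta>' N' Z by (intro form_bound) (auto simp: N2 Z_def[symmetric])
  also have "\<dots> = ennreal (form_const (x + a) (1 - x) x (1 - x) * L powr \<beta>)
      * nrm M (x + a) (\<lambda>z. epow (\<phi> z) (1 + a) * ennreal (v z)) * epow Z (1 - x)"
    using xa by (simp add: N2 Z_def nrm_pos add.commute[of a 1])
  finally have "Z \<le> epow (ennreal (form_const (x + a) (1 - x) x (1 - x) * L powr \<beta>)
      * nrm M (x + a) (\<lambda>z. epow (\<phi> z) (1 + a) * ennreal (v z))) (1 / x)" using Z x by (intro epow_self_improve) auto
  then have "epow Z x \<le> epow (epow (ennreal (form_const (x + a) (1 - x) x (1 - x) * L powr \<beta>)
      * nrm M (x + a) (\<lambda>z. epow (\<phi> z) (1 + a) * ennreal (v z))) (1 / x)) x" using x by (intro epow_mono) auto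
  then show ?thesis using x by (simp add: nrm_pos Z_def)
qed

end

section \<open>Powers of localized sparse sums\<close>

text \<open>Hoelder in each factor separately. Reciprocal exponents interpolate linearly and weights
  geometrically, so the characteristic is the geometric mean and the interpolated condition is again
  of the form (x, 1 - x).\<close>

lemma muckenhoupt_interpolate:
  assumes [measurable]: "v0 \<in> borel_measurable M" "v1 \<in> borel_measurable M" "Q \<in> sets M"
    and v: "\<And>z. 0 < v0 z" "\<And>z. 0 < v1 z"
    and x: "0 < x0" "x0 < 1" "0 < x1" "x1 < 1" and \<theta>: "0 \<le> \<theta>" "\<theta> \<le> 1"
    and m0: "muckenhoupt M x0 (1 - x0) v0 L0 Q" and m1: "muckenhoupt M x1 (1 - x1) v1 L1 Q"
    and L: "1 \<le> L0" "1 \<le> L1"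
  shows "muckenhoupt M ((1 - \<theta>) * x0 + \<theta> * x1) (1 - ((1 - \<theta>) * x0 + \<theta> * x1))
    (\<lambda>z. v0 z powr (1 - \<theta>) * v1 z powr \<theta>) (L0 powr (1 - \<theta>) * L1 powr \<theta>) Q"
proof -
  \<comment> \<open>The number \<open>s\<close> is 1 for the factor with v^(1/x) and -1 for the dual
    factor, so that one computation covers both.\<close>
  have int: "epow (\<integral>\<^sup>+z\<in>Q. ennreal ((v0 z powr (1 - \<theta>) * v1 z powr \<theta>) powr (s / ((1 - \<theta>) * y0 + \<theta> * y1))) \<partial>M) ((1 - \<theta>) * y0 + \<theta> * y1)
    \<le> epow (epow (\<integral>\<^sup>+z\<in>Q. ennreal (v0 z powr (s / y0)) \<partial>M) y0) (1 - \<theta>) * epow (epow (\<integral>\<^sup>+z\<in>Q. ennreal (v1 z powr (s / y1)) \<partial>M) y1) \<theta>"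
    if y: "0 < y0" "0 < y1" and \<theta>: "0 < \<theta>" "\<theta> < 1" for s y0 y1
  proof -
    define yt where "yt = (1 - \<theta>) * y0 + \<theta> * y1"
    have yt: "0 < yt" using y \<theta> by (auto simp: yt_def intro!: add_pos_pos)
    define t where "t = (1 - \<theta>) * y0 / yt"
    have t: "0 < t" "t < 1" "1 - t = \<theta> * y1 / yt" using y \<theta> yt by (auto simp: t_def yt_def field_simps)
    have "(\<integral>\<^sup>+z\<in>Q. ennreal ((v0 z powr (1 - \<theta>) * v1 z powr \<theta>) powr (s / yt)) \<partial>M)
      = (\<integral>\<^sup>+z. epow (ennreal (v0 z powr (s / y0)) * indicator Q z) t * epow (ennreal (v1 z powr (s / y1)) * indicator Q z) (1 - t) \<partial>M)"
    proof (intro nn_integral_cong)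
      fix z
      have "s / y0 * t = (1 - \<theta>) * (s / yt)" "s / y1 * (1 - t) = \<theta> * (s / yt)"
        unfolding t(3) using y yt by (simp_all add: t_def)
      then show "ennreal ((v0 z powr (1 - \<theta>) * v1 z powr \<theta>) powr (s / yt)) * indicator Q z
        = epow (ennreal (v0 z powr (s / y0)) * indicator Q z) t * epow (ennreal (v1 z powr (s / y1)) * indicator Q z) (1 - t)"
        by (cases "z \<in> Q") (simp_all add: epow_ennreal powr_powr powr_mult ennreal_mult)
    qed
    also have "\<dots> \<le> epow (\<integral>\<^sup>+z\<in>Q. ennreal (v0 z powr (s / y0)) \<partial>M) t * epow (\<integral>\<^sup>+z\<in>Q. ennreal (v1 z powr (s / y1)) \<partial>M) (1 - t)"
      using t by (intro Holder_nn_integral) auto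
    finally have "epow (\<integral>\<^sup>+z\<in>Q. ennreal ((v0 z powr (1 - \<theta>) * v1 z powr \<theta>) powr (s / yt)) \<partial>M) yt
      \<le> epow (epow (\<integral>\<^sup>+z\<in>Q. ennreal (v0 z powr (s / y0)) \<partial>M) t * epow (\<integral>\<^sup>+z\<in>Q. ennreal (v1 z powr (s / y1)) \<partial>M) (1 - t)) yt"
      using yt by (intro epow_mono) auto
    moreover have "t * yt = y0 * (1 - \<theta>)" "(1 - t) * yt = y1 * \<theta>" unfolding t(3) using yt by (simp_all add: t_def)
    ultimately show ?thesis by (simp add: epow_mult yt_def[symmetric])
  qed
  have nz: "v0 z \<noteq> 0" "v1 z \<noteq> 0" for z using v[of z] by auto
  consider "\<theta> = 0" | "\<theta> = 1" | "0 < \<theta>" "\<theta> < 1" using \<theta> by fastforce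
  then show ?thesis
  proof cases
    case 1
    then show ?thesis using m0 v L by (simp add: nz less_imp_le)
  next
    case 2
    then show ?thesis using m1 v L by (simp add: nz less_imp_le)
  next
    case 3
    define xt where "xt = (1 - \<theta>) * x0 + \<theta> * x1"
    have xt: "1 - xt = (1 - \<theta>) * (1 - x0) + \<theta> * (1 - x1)" by (simp add: xt_def algebra_simps)
    define vt where "vt z = v0 z powr (1 - \<theta>) * v1 z powr \<theta>" for z
    define A0 A1 B0 B1 where "A0 = epow (\<integral>\<^sup>+z\<in>Q. ennreal (v0 z powr (1 / x0)) \<partial>M) x0"
      and "A1 = epow (\<integral>\<^sup>+z\<in>Q. ennreal (v1 z powr (1 / x1)) \<partial>M) x1"
      and "B0 = epow (\<integral>\<^sup>+z\<in>Q. ennreal (v0 z powr (- 1 / (1 - x0))) \<partial>M) (1 - x0)"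
      and "B1 = epow (\<integral>\<^sup>+z\<in>Q. ennreal (v1 z powr (- 1 / (1 - x1))) \<partial>M) (1 - x1)"
    have "epow (\<integral>\<^sup>+z\<in>Q. ennreal (vt z powr (1 / xt)) \<partial>M) xt * epow (\<integral>\<^sup>+z\<in>Q. ennreal (vt z powr (- 1 / (1 - xt))) \<partial>M) (1 - xt)
      \<le> (epow A0 (1 - \<theta>) * epow A1 \<theta>) * (epow B0 (1 - \<theta>) * epow B1 \<theta>)"
      unfolding xt unfolding xt_def vt_def A0_def A1_def B0_def B1_def using x 3 by (intro mult_mono int) auto
    also have "\<dots> = epow (A0 * B0) (1 - \<theta>) * epow (A1 * B1) \<theta>" by (simp add: epow_mult mult_ac)
    also have "\<dots> \<le> epow (ennreal L0 * emeasure M Q) (1 - \<theta>) * epow (ennreal L1 * emeasure M Q) \<theta>"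
      using m0 m1 3 unfolding muckenhoupt_def A0_def A1_def B0_def B1_def
      by (intro mult_mono[OF epow_mono epow_mono]) auto
    also have "\<dots> = ennreal (L0 powr (1 - \<theta>) * L1 powr \<theta>) * emeasure M Q"
      using L epow_add[of "emeasure M Q" "1 - \<theta>" \<theta>] by (simp add: epow_mult epow_ennreal ennreal_mult mult_ac)
    finally show ?thesis unfolding muckenhoupt_def xt_def[symmetric] vt_def[symmetric] by simp
  qed
qed

text \<open>Summation by parts for a real power. Removing the largest set \<open>P0\<close> leaves
  the inductive sum, and the difference of the two powers is estimated by
  \<open>powr_diff_upper\<close>; the sum over the subsets of \<open>P0\<close> is the whole
  sum.\<close>

lemma chain_power_sum:
  fixes a :: "'a set \<Rightarrow> real"
  assumes "finite C" "\<And>A B. A \<in> C \<Longrightarrow> B \<in> C \<Longrightarrow> A \<subseteq> B \<or> B \<subseteq> A" "\<And>A. A \<in> C \<Longrightarrow> 0 \<le> a A" and \<kappa>: "0 < \<kappa>"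
  shows "(\<Sum>P\<in>C. a P) powr (\<kappa> + 1) \<le> (\<kappa> + 1) * (\<Sum>P\<in>C. a P * (\<Sum>R\<in>{R\<in>C. R \<subseteq> P}. a R) powr \<kappa>)" using assms(1-3)
proof (induction C rule: finite_psubset_induct)
  case (psubset C)
  show ?case
  proof (cases "C = {}")
    case False
    then obtain P0 where P0: "P0 \<in> C" "\<And>F. F \<in> C \<Longrightarrow> P0 \<subseteq> F \<Longrightarrow> P0 = F" using finite_has_maximal[OF psubset(1)] by metis
    let ?D = "C - {P0}"
    have sub: "R \<subseteq> P0" if "R \<in> C" for R using psubset.prems(1)[OF that P0(1)] P0(2)[OF that] by auto
    have eq: "{R\<in>C. R \<subseteq> P} = {R\<in>?D. R \<subseteq> P}" if "P \<in> ?D" for P using that P0(2)[of P] by auto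
    have eq0: "{R\<in>C. R \<subseteq> P0} = C" using sub by auto
    define s where "s = (\<Sum>P\<in>?D. a P)"
    have s: "0 \<le> s" using psubset.prems by (auto simp: s_def intro!: sum_nonneg)
    have C: "(\<Sum>P\<in>C. a P) = a P0 + s" using P0 psubset.hyps by (simp add: s_def sum.remove)
    have IH: "s powr (\<kappa> + 1) \<le> (\<kappa> + 1) * (\<Sum>P\<in>?D. a P * (\<Sum>R\<in>{R\<in>?D. R \<subseteq> P}. a R) powr \<kappa>)"
      unfolding s_def using P0 psubset.prems by (intro psubset.IH) auto
    have "(a P0 + s) powr (\<kappa> + 1) \<le> s powr (\<kappa> + 1) + (\<kappa> + 1) * a P0 * (a P0 + s) powr \<kappa>"
      using powr_diff_upper[of s "a P0 + s" "\<kappa> + 1"] s psubset.prems(2)[OF P0(1)] \<kappa> by simp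
    also have "\<dots> \<le> (\<kappa> + 1) * (\<Sum>P\<in>?D. a P * (\<Sum>R\<in>{R\<in>?D. R \<subseteq> P}. a R) powr \<kappa>) + (\<kappa> + 1) * a P0 * (a P0 + s) powr \<kappa>"
      using IH by simp
    also have "(\<Sum>P\<in>?D. a P * (\<Sum>R\<in>{R\<in>?D. R \<subseteq> P}. a R) powr \<kappa>) = (\<Sum>P\<in>?D. a P * (\<Sum>R\<in>{R\<in>C. R \<subseteq> P}. a R) powr \<kappa>)"
      using eq by (intro sum.cong) auto
    also have "(\<kappa> + 1) * \<dots> + (\<kappa> + 1) * a P0 * (a P0 + s) powr \<kappa> = (\<kappa> + 1) * (\<Sum>P\<in>C. a P * (\<Sum>R\<in>{R\<in>C. R \<subseteq> P}. a R) powr \<kappa>)"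
      using P0 psubset.hyps by (simp add: sum.remove[of C P0] eq0 C distrib_left)
    finally show ?thesis by (simp add: C)
  qed (use \<kappa> in simp)
qed

section \<open>Trading powers of a localized sum for sparse operators\<close>

context sparse_union
begin

definition coef :: "('a \<Rightarrow> ennreal) \<Rightarrow> real \<Rightarrow> 'a set \<Rightarrow> ennreal" where
  "coef \<nu> e P = epow (integ M P \<nu>) e / emeasure M P"

definition tail_sum :: "('a \<Rightarrow> ennreal) \<Rightarrow> real \<Rightarrow> 'a set \<Rightarrow> 'a \<Rightarrow> ennreal" where
  "tail_sum \<nu> e Q z = (\<Sum>P\<in>{P\<in>S. P \<subseteq> Q}. coef \<nu> e P * indicator P z)"

text \<open>The case \<kappa> = 0 is singled out because \<open>epow 0 0 = 0\<close>, whereas the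
  zeroth power has to be 1 also at points where the sum vanishes.\<close>

definition tail_int :: "('a \<Rightarrow> ennreal) \<Rightarrow> real \<Rightarrow> ('a \<Rightarrow> ennreal) \<Rightarrow> real \<Rightarrow> 'a set \<Rightarrow> ennreal" where
  "tail_int \<nu> e F \<kappa> Q = (\<integral>\<^sup>+z\<in>Q. (if \<kappa> = 0 then 1 else epow (tail_sum \<nu> e Q z) \<kappa>) * F z \<partial>M)"

lemma tail_sum_measurable [measurable]: "tail_sum \<nu> e Q \<in> borel_measurable M"
  unfolding tail_sum_def[abs_def] using sets_S
  by (intro borel_measurable_sum borel_measurable_times_ennreal borel_measurable_indicator) auto

lemma coef_finite:
  assumes "P \<in> S" "integ M P \<nu> < top"
  shows "coef \<nu> e P < top" using assms emeasure_pos[of P] emeasure_finite[of P]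
  by (auto simp: coef_def ennreal_divide_eq_top_iff less_top[symmetric])

lemma coef_mult: "Q \<in> S \<Longrightarrow> coef \<nu> e Q * emeasure M Q = epow (integ M Q \<nu>) e" by (simp add: coef_def divide_emeasure_mult)

text \<open>At a point the cubes containing it form a chain, so \<open>chain_power_sum\<close>
  lowers the power by one, and it leaves a power of the sum localized to the smaller cube
  \<open>P\<close>. Integration turns this into \<open>tail_int\<close> over
  \<open>P\<close>.\<close>

lemma tail_int_step:
  assumes [measurable]: "F \<in> borel_measurable M" and fin: "\<And>P. P \<in> S \<Longrightarrow> (integ M P \<nu>) < top" and \<kappa>: "0 \<le> \<kappa>"
    and Q: "Q \<in> S"
  shows "tail_int \<nu> e F (\<kappa> + 1) Q \<le> ennreal (\<kappa> + 1) * (\<Sum>P\<in>{P\<in>S. P \<subseteq> Q}. coef \<nu> e P * tail_int \<nu> e F \<kappa> P)"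
proof -
  have [measurable]: "P \<in> S \<Longrightarrow> P \<in> sets M" for P by (rule sets_S)
  define f where "f P z = (if \<kappa> = 0 then 1 else epow (tail_sum \<nu> e P z) \<kappa>)" for P z
  have [measurable]: "f P \<in> borel_measurable M" for P unfolding f_def[abs_def] by (cases "\<kappa> = 0") auto
  have pt: "epow (tail_sum \<nu> e Q z) (\<kappa> + 1)
    \<le> ennreal (\<kappa> + 1) * (\<Sum>P\<in>{P\<in>S. P \<subseteq> Q}. coef \<nu> e P * (f P z * indicator P z))" for z
  proof (cases "\<kappa> = 0")
    case True
    then show ?thesis by (simp add: tail_sum_def f_def)
  next
    case False
    then have \<kappa>: "0 < \<kappa>" using \<kappa> by simp
    define a where "a P = enn2real (coef \<nu> e P)" for P
    have a: "coef \<nu> e P = ennreal (a P)" "0 \<le> a P" if "P \<in> S" for P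
      using coef_finite[OF that fin[OF that]] by (auto simp: a_def)
    let ?C = "{P\<in>S. P \<subseteq> Q \<and> z \<in> P}"
    define A where "A P = (\<Sum>R\<in>{R\<in>?C. R \<subseteq> P}. a R)" for P
    have A: "0 \<le> A P" for P unfolding A_def using a by (intro sum_nonneg) auto
    have ts: "tail_sum \<nu> e P z = ennreal (A P)" if "P \<subseteq> Q" for P
    proof -
      have "tail_sum \<nu> e P z = (\<Sum>R\<in>{R\<in>?C. R \<subseteq> P}. coef \<nu> e R)" unfolding tail_sum_def using finite_S that
        by (intro sum.mono_neutral_cong_right) (auto simp: indicator_def split: if_splits)
      also have "\<dots> = (\<Sum>R\<in>{R\<in>?C. R \<subseteq> P}. ennreal (a R))" using a by (intro sum.cong) auto
      also have "\<dots> = ennreal (A P)" unfolding A_def using a by (intro sum_ennreal) auto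
      finally show ?thesis .
    qed
    have "A Q = (\<Sum>R\<in>?C. a R)" unfolding A_def by (intro sum.cong) auto
    then have "epow (tail_sum \<nu> e Q z) (\<kappa> + 1) = ennreal ((\<Sum>R\<in>?C. a R) powr (\<kappa> + 1))"
      using ts[of Q] epow_ennreal[OF A[of Q]] by simp
    also have "\<dots> \<le> ennreal ((\<kappa> + 1) * (\<Sum>P\<in>?C. a P * A P powr \<kappa>))"
      unfolding A_def using finite_S a \<kappa> comparable[of z] by (intro ennreal_leI chain_power_sum) auto
    also have "\<dots> = ennreal (\<kappa> + 1) * ennreal (\<Sum>P\<in>?C. a P * A P powr \<kappa>)"
      using \<kappa> a by (intro ennreal_mult sum_nonneg mult_nonneg_nonneg) auto
    also have "ennreal (\<Sum>P\<in>?C. a P * A P powr \<kappa>) = (\<Sum>P\<in>?C. ennreal (a P * A P powr \<kappa>))"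
      using a by (intro sum_ennreal[symmetric] mult_nonneg_nonneg) auto
    also have "\<dots> = (\<Sum>P\<in>?C. coef \<nu> e P * epow (tail_sum \<nu> e P z) \<kappa>)"
      using a A ts by (intro sum.cong) (auto simp: epow_ennreal ennreal_mult)
    also have "(\<Sum>P\<in>?C. coef \<nu> e P * epow (tail_sum \<nu> e P z) \<kappa>) = (\<Sum>P\<in>{P\<in>S. P \<subseteq> Q}. coef \<nu> e P * (f P z * indicator P z))"
      using finite_S False by (intro sum.mono_neutral_cong_left) (auto simp: f_def)
    finally show ?thesis .
  qed
  have "tail_int \<nu> e F (\<kappa> + 1) Q = (\<integral>\<^sup>+z. epow (tail_sum \<nu> e Q z) (\<kappa> + 1) * (F z * indicator Q z) \<partial>M)"
    using \<kappa> by (simp add: tail_int_def mult.assoc)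
  also have "\<dots> \<le> (\<integral>\<^sup>+z. ennreal (\<kappa> + 1) * (\<Sum>P\<in>{P\<in>S. P \<subseteq> Q}. coef \<nu> e P * (f P z * indicator P z)) * (F z * indicator Q z) \<partial>M)"
    by (intro nn_integral_mono mult_right_mono pt) auto
  also have "\<dots> \<le> (\<integral>\<^sup>+z. ennreal (\<kappa> + 1) * (\<Sum>P\<in>{P\<in>S. P \<subseteq> Q}. coef \<nu> e P * (f P z * F z * indicator P z)) \<partial>M)"
  proof (intro nn_integral_mono)
    fix z
    have "(\<Sum>P\<in>{P\<in>S. P \<subseteq> Q}. coef \<nu> e P * (f P z * indicator P z)) * (F z * indicator Q z)
      \<le> (\<Sum>P\<in>{P\<in>S. P \<subseteq> Q}. coef \<nu> e P * (f P z * indicator P z)) * F z"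
      by (intro mult_left_mono) (auto simp: indicator_def)
    also have "\<dots> = (\<Sum>P\<in>{P\<in>S. P \<subseteq> Q}. coef \<nu> e P * (f P z * F z * indicator P z))"
      unfolding sum_distrib_right by (intro sum.cong refl) (simp only: mult_ac)
    finally show "ennreal (\<kappa> + 1) * (\<Sum>P\<in>{P\<in>S. P \<subseteq> Q}. coef \<nu> e P * (f P z * indicator P z)) * (F z * indicator Q z)
      \<le> ennreal (\<kappa> + 1) * (\<Sum>P\<in>{P\<in>S. P \<subseteq> Q}. coef \<nu> e P * (f P z * F z * indicator P z))"
      unfolding mult.assoc[of "ennreal (\<kappa> + 1)"] by (intro mult_left_mono) auto
  qed
  also have "\<dots> = ennreal (\<kappa> + 1) * (\<Sum>P\<in>{P\<in>S. P \<subseteq> Q}. \<integral>\<^sup>+z. coef \<nu> e P * (f P z * F z * indicator P z) \<partial>M)"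
    by (subst nn_integral_cmult, measurable) (subst nn_integral_sum, measurable)
  also have "\<dots> = ennreal (\<kappa> + 1) * (\<Sum>P\<in>{P\<in>S. P \<subseteq> Q}. coef \<nu> e P * tail_int \<nu> e F \<kappa> P)"
    unfolding tail_int_def f_def[symmetric] by (intro arg_cong2[where f = "(*)"] refl sum.cong nn_integral_cmult) auto
  finally show ?thesis .
qed

definition next_fun :: "('a \<Rightarrow> ennreal) \<Rightarrow> real \<Rightarrow> ('a \<Rightarrow> ennreal) \<Rightarrow> 'a \<Rightarrow> ennreal" where
  "next_fun \<nu> e \<Phi> z = \<nu> z * epow (\<Phi> z) (1 / e)"

lemma next_fun_measurable [measurable]:
  "\<nu> \<in> borel_measurable M \<Longrightarrow> \<Phi> \<in> borel_measurable M \<Longrightarrow> next_fun \<nu> e \<Phi> \<in> borel_measurable M"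
  unfolding next_fun_def[abs_def] by (intro borel_measurable_times_ennreal epow_measurable')

text \<open>If the previous power is controlled by the measure of \<open>P\<close> times
  \<open>x P\<close>, that measure cancels the denominator of the coefficient, and Minkowski's
  inequality collapses the sum of powers into a power of one integral over \<open>Q\<close>. In this
  way one unit of the exponent becomes one multiplication by \<nu> and one sparse operator.\<close>

lemma tail_int_next:
  assumes [measurable]: "F \<in> borel_measurable M" "\<nu> \<in> borel_measurable M"
    and fin: "\<And>P. P \<in> S \<Longrightarrow> (integ M P \<nu>) < top" and \<kappa>: "0 \<le> \<kappa>" and e: "1 \<le> e"
    and Q: "Q \<in> S" and x: "\<And>P. P \<in> S \<Longrightarrow> tail_int \<nu> e F \<kappa> P \<le> c * (emeasure M P * x P)" "\<And>P. P \<in> S \<Longrightarrow> x P < top"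
    and \<Phi>: "\<And>z. (\<Sum>P\<in>S. x P * indicator P z) \<le> \<Phi> z" and [measurable]: "\<Phi> \<in> borel_measurable M"
  shows "tail_int \<nu> e F (\<kappa> + 1) Q \<le> ennreal (\<kappa> + 1) * c * epow (integ M Q (next_fun \<nu> e \<Phi>)) e"
proof -
  have [measurable]: "P \<in> S \<Longrightarrow> P \<in> sets M" for P by (rule sets_S)
  let ?T = "{P\<in>S. P \<subseteq> Q}"
  let ?I = "\<integral>\<^sup>+z. \<nu> z * epow (\<Sum>P\<in>?T. x P * indicator P z) (1 / e) \<partial>M"
  have int: "?I \<le> integ M Q (next_fun \<nu> e \<Phi>)"
  proof (intro nn_integral_mono)
    fix z
    show "\<nu> z * epow (\<Sum>P\<in>?T. x P * indicator P z) (1 / e) \<le> next_fun \<nu> e \<Phi> z * indicator Q z"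
    proof (cases "z \<in> Q")
      case True
      have "(\<Sum>P\<in>?T. x P * indicator P z) \<le> (\<Sum>P\<in>S. x P * indicator P z)" using finite_S by (intro sum_mono2) auto
      also have "\<dots> \<le> \<Phi> z" by (rule \<Phi>)
      finally show ?thesis using True e by (auto simp: next_fun_def intro!: mult_left_mono epow_mono)
    next
      case False
      then have "(\<Sum>P\<in>?T. x P * indicator P z) = 0" by (intro sum.neutral) (auto simp: indicator_def)
      then show ?thesis by simp
    qed
  qed
  have "(\<Sum>P\<in>?T. coef \<nu> e P * tail_int \<nu> e F \<kappa> P) \<le> (\<Sum>P\<in>?T. coef \<nu> e P * (c * (emeasure M P * x P)))"
    using x by (intro sum_mono mult_left_mono) auto
  also have "\<dots> = (\<Sum>P\<in>?T. c * (x P * epow (integ M P \<nu>) e))"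
  proof (intro sum.cong refl)
    fix P assume "P \<in> ?T"
    then have "coef \<nu> e P * emeasure M P = epow (integ M P \<nu>) e" by (intro coef_mult) auto
    from this[symmetric] show "coef \<nu> e P * (c * (emeasure M P * x P)) = c * (x P * epow (integ M P \<nu>) e)"
      by (simp only: mult_ac)
  qed
  also have "\<dots> = c * (\<Sum>P\<in>?T. x P * epow (integ M P \<nu>) e)" by (simp add: sum_distrib_left)
  also have "\<dots> \<le> c * epow ?I e" using finite_S x fin e by (intro mult_left_mono Minkowski_sum) auto
  also have "\<dots> \<le> c * epow (integ M Q (next_fun \<nu> e \<Phi>)) e" using int e by (intro mult_left_mono epow_mono) auto
  finally have "ennreal (\<kappa> + 1) * (\<Sum>P\<in>?T. coef \<nu> e P * tail_int \<nu> e F \<kappa> P)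
    \<le> ennreal (\<kappa> + 1) * (c * epow (integ M Q (next_fun \<nu> e \<Phi>)) e)" by (intro mult_left_mono) auto
  with tail_int_step[OF assms(1) fin \<kappa> Q] show ?thesis unfolding mult.assoc by (rule order_trans)
qed

lemma sparse_op_bounded:
  assumes "\<And>P. P \<in> S \<Longrightarrow> (integ M P \<phi>) < top"
  obtains K where "K < top" "\<And>z. sparse_op e \<phi> z \<le> K"
proof
  show "(\<Sum>P\<in>S. coef \<phi> e P) < top" using finite_S coef_finite assms by simp
  show "sparse_op e \<phi> z \<le> (\<Sum>P\<in>S. coef \<phi> e P)" for z
    unfolding sparse_op_def coef_def by (intro sum_mono) (auto simp: indicator_def)
qed

lemma next_fun_finite:
  assumes "\<And>z. \<Phi> z \<le> K" "K < top" "integ M P \<nu> < top" "0 < e" and [measurable]: "\<nu> \<in> borel_measurable M" "P \<in> sets M"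
  shows "integ M P (next_fun \<nu> e \<Phi>) < top"
proof -
  have "integ M P (next_fun \<nu> e \<Phi>) \<le> (\<integral>\<^sup>+z. epow K (1 / e) * (\<nu> z * indicator P z) \<partial>M)"
    unfolding next_fun_def using assms(1,4)
    by (intro nn_integral_mono) (auto simp: indicator_def mult.commute intro!: mult_left_mono epow_mono)
  also have "\<dots> < top" using assms(2,3) by (simp add: nn_integral_cmult ennreal_mult_less_top)
  finally show ?thesis .
qed

text \<open>The start of the chain for a fractional power \<delta>: the geometric mean of the
  operators that control the powers 1 and 0. The case \<delta> = 0 is separate because
  \<open>epow 0 0 = 0\<close>.\<close>

definition first_op :: "('a \<Rightarrow> ennreal) \<Rightarrow> real \<Rightarrow> ('a \<Rightarrow> ennreal) \<Rightarrow> real \<Rightarrow> 'a \<Rightarrow> ennreal" where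
  "first_op \<nu> e F \<delta> z = (if \<delta> = 0 then sparse_op 1 F z
     else epow (sparse_op e (next_fun \<nu> e (sparse_op 1 F)) z) \<delta> * epow (sparse_op 1 F z) (1 - \<delta>))"

fun chain_fun :: "('a \<Rightarrow> ennreal) \<Rightarrow> real \<Rightarrow> ('a \<Rightarrow> ennreal) \<Rightarrow> real \<Rightarrow> nat \<Rightarrow> 'a \<Rightarrow> ennreal" where
  "chain_fun \<nu> e F \<delta> 0 = next_fun \<nu> e (first_op \<nu> e F \<delta>)"
| "chain_fun \<nu> e F \<delta> (Suc n) = next_fun \<nu> e (sparse_op e (chain_fun \<nu> e F \<delta> n))"

lemma first_op_measurable [measurable]:
  "\<nu> \<in> borel_measurable M \<Longrightarrow> F \<in> borel_measurable M \<Longrightarrow> first_op \<nu> e F \<delta> \<in> borel_measurable M"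
  unfolding first_op_def[abs_def] by measurable

lemma chain_fun_measurable [measurable]:
  "\<nu> \<in> borel_measurable M \<Longrightarrow> F \<in> borel_measurable M \<Longrightarrow> chain_fun \<nu> e F \<delta> n \<in> borel_measurable M" by (induction n) auto

text \<open>The powers \<delta> + 1, \<delta> + 2, ... are reached one unit at a time by
  \<open>tail_int_next\<close>, starting from an estimate for the power \<delta>. The product
  collects the factors \<kappa> + 1 of the steps; finiteness of the integrals is carried along
  because each next operator requires it.\<close>

lemma tail_int_chain:
  assumes [measurable]: "F \<in> borel_measurable M" "\<nu> \<in> borel_measurable M"
    and fin: "\<And>P. P \<in> S \<Longrightarrow> (integ M P \<nu>) < top" "\<And>P. P \<in> S \<Longrightarrow> (integ M P F) < top"
    and e: "1 \<le> e" and \<delta>: "0 \<le> \<delta>" "\<delta> < 1"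
  shows "(\<forall>P\<in>S. (integ M P (chain_fun \<nu> e F \<delta> n)) < top) \<and>
    (\<forall>Q\<in>S. tail_int \<nu> e F (real n + \<delta> + 1) Q \<le> ennreal (\<Prod>l\<le>n. real l + \<delta> + 1) * epow (integ M Q (chain_fun \<nu> e F \<delta> n)) e)"
proof (induction n)
  case 0
  have [measurable]: "P \<in> S \<Longrightarrow> P \<in> sets M" for P by (rule sets_S)
  note inv = divide_emeasure_mult(2)
  define \<phi>0 where "\<phi>0 = next_fun \<nu> e (sparse_op 1 F)"
  obtain K where K: "K < top" "\<And>z. sparse_op 1 F z \<le> K" using sparse_op_bounded[OF fin(2), of 1] by blast
  have [measurable]: "\<phi>0 \<in> borel_measurable M" unfolding \<phi>0_def by measurable
  have \<phi>0: "integ M P \<phi>0 < top" if "P \<in> S" for P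
    unfolding \<phi>0_def using that K fin e by (intro next_fun_finite[where K = K]) auto
  obtain K' where K': "K' < top" "\<And>z. sparse_op e \<phi>0 z \<le> K'" using sparse_op_bounded[OF \<phi>0, of e] by blast
  have t0: "tail_int \<nu> e F 0 P = integ M P F" for P by (simp add: tail_int_def)
  have so1: "sparse_op 1 F z = (\<Sum>P\<in>S. (integ M P F) / emeasure M P * indicator P z)" for z by (simp add: sparse_op_def)
  have fs: "integ M P F / emeasure M P < top" if "P \<in> S" for P
    using coef_finite[OF that fin(2)[OF that], of 1] by (simp add: coef_def)
  have t1: "tail_int \<nu> e F 1 P \<le> epow (integ M P \<phi>0) e" if P: "P \<in> S" for P
  proof -
    have "tail_int \<nu> e F (0 + 1) P \<le> ennreal (0 + 1) * 1 * epow (\<integral>\<^sup>+z\<in>P. next_fun \<nu> e (sparse_op 1 F) z \<partial>M) e"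
      by (rule tail_int_next[OF assms(1,2) fin(1) _ e P, where x = "\<lambda>P. (integ M P F) / emeasure M P"])
        (auto simp: t0 inv fs so1)
    then show ?thesis by (simp add: \<phi>0_def)
  qed
  show ?case
  proof (cases "\<delta> = 0")
    case True
    then show ?thesis using \<phi>0 t1 unfolding \<phi>0_def by (simp add: first_op_def[abs_def])
  next
    case False
    then have \<delta>: "0 < \<delta>" "\<delta> < 1" using \<delta> by auto
    define x where "x P = epow (epow (integ M P \<phi>0) e / emeasure M P) \<delta> * epow ((integ M P F) / emeasure M P) (1 - \<delta>)" for P
    have x: "x P < top" if "P \<in> S" for P
      using fs[OF that] coef_finite[OF that \<phi>0[OF that], of e] by (simp add: x_def coef_def ennreal_mult_less_top)
    \<comment> \<open>On a single cube the power \<delta> lies between the powers 0 and 1, by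
      Hoelder; the measure of \<open>P\<close> factors out as the product of its powers \<delta> and
      1 - \<delta>.\<close>
    have t\<delta>: "tail_int \<nu> e F \<delta> P \<le> 1 * (emeasure M P * x P)" if P: "P \<in> S" for P
    proof -
      have "tail_int \<nu> e F \<delta> P = (\<integral>\<^sup>+z. epow (tail_sum \<nu> e P z * F z * indicator P z) \<delta> * epow (F z * indicator P z) (1 - \<delta>) \<partial>M)"
        unfolding tail_int_def
      proof (intro nn_integral_cong)
        fix z
        show "(if \<delta> = 0 then 1 else epow (tail_sum \<nu> e P z) \<delta>) * F z * indicator P z
          = epow (tail_sum \<nu> e P z * F z * indicator P z) \<delta> * epow (F z * indicator P z) (1 - \<delta>)"
          using \<delta> epow_add[of "F z" \<delta> "1 - \<delta>"] by (auto simp: indicator_def epow_mult mult.assoc)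
      qed
      also have "\<dots> \<le> epow (tail_int \<nu> e F 1 P) \<delta> * epow (integ M P F) (1 - \<delta>)"
        using \<delta> P Holder_nn_integral[of "\<lambda>z. tail_sum \<nu> e P z * F z * indicator P z" M "\<lambda>z. F z * indicator P z" \<delta>]
        by (simp add: tail_int_def)
      also have "\<dots> \<le> epow (epow (integ M P \<phi>0) e) \<delta> * epow (integ M P F) (1 - \<delta>)"
        using t1[OF P] \<delta> by (intro mult_right_mono epow_mono) auto
      also have "\<dots> = epow (emeasure M P * (epow (integ M P \<phi>0) e / emeasure M P)) \<delta>
          * epow (emeasure M P * ((integ M P F) / emeasure M P)) (1 - \<delta>)" by (simp only: inv[OF P])
      also have "\<dots> = (epow (emeasure M P) \<delta> * epow (emeasure M P) (1 - \<delta>)) * x P"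
        unfolding epow_mult x_def by (simp only: mult_ac)
      also have "epow (emeasure M P) \<delta> * epow (emeasure M P) (1 - \<delta>) = emeasure M P" by (simp add: epow_add[symmetric])
      finally show ?thesis by simp
    qed
    \<comment> \<open>A second Hoelder inequality, now over the cubes containing \<open>z\<close>,
      turns the sum of geometric means into the geometric mean of two sparse operators.\<close>
    have \<Phi>: "(\<Sum>P\<in>S. x P * indicator P z) \<le> first_op \<nu> e F \<delta> z" for z
    proof -
      have "(\<Sum>P\<in>S. x P * indicator P z) = (\<integral>\<^sup>+P. epow (epow (integ M P \<phi>0) e / emeasure M P * indicator P z) \<delta>
            * epow ((integ M P F) / emeasure M P * indicator P z) (1 - \<delta>) \<partial>count_space S)"
        unfolding nn_integral_count_space_finite[OF finite_S] by (intro sum.cong) (auto simp: x_def indicator_def)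
      also have "\<dots> \<le> epow (\<integral>\<^sup>+P. epow (integ M P \<phi>0) e / emeasure M P * indicator P z \<partial>count_space S) \<delta>
          * epow (\<integral>\<^sup>+P. (integ M P F) / emeasure M P * indicator P z \<partial>count_space S) (1 - \<delta>)"
        using \<delta> by (intro Holder_nn_integral) auto
      also have "\<dots> = first_op \<nu> e F \<delta> z"
        using False by (simp add: nn_integral_count_space_finite[OF finite_S] first_op_def so1 sparse_op_def \<phi>0_def[symmetric])
      finally show ?thesis .
    qed
    have "tail_int \<nu> e F (\<delta> + 1) Q \<le> ennreal (\<delta> + 1) * 1 * epow (\<integral>\<^sup>+z\<in>Q. next_fun \<nu> e (first_op \<nu> e F \<delta>) z \<partial>M) e" if Q: "Q \<in> S" for Q
      using \<delta> by (intro tail_int_next[OF assms(1,2) fin(1) _ e Q t\<delta> x \<Phi>]) auto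
    moreover have "(\<integral>\<^sup>+z\<in>P. next_fun \<nu> e (first_op \<nu> e F \<delta>) z \<partial>M) < top" if "P \<in> S" for P
    proof (rule next_fun_finite[where K = "epow K' \<delta> * epow K (1 - \<delta>)"])
      show "first_op \<nu> e F \<delta> z \<le> epow K' \<delta> * epow K (1 - \<delta>)" for z
        using False \<delta> K K' by (auto simp: first_op_def \<phi>0_def[symmetric] intro!: mult_mono epow_mono)
    qed (use K K' fin e that in \<open>auto simp: ennreal_mult_less_top\<close>)
    ultimately show ?thesis by (simp add: add.commute)
  qed
next
  case (Suc n)
  have [measurable]: "P \<in> S \<Longrightarrow> P \<in> sets M" for P by (rule sets_S)
  note inv = divide_emeasure_mult(2)
  let ?\<phi> = "chain_fun \<nu> e F \<delta> n"
  have IH1: "integ M P ?\<phi> < top" if "P \<in> S" for P using Suc that by auto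
  obtain K where K: "K < top" "\<And>z. sparse_op e ?\<phi> z \<le> K" using sparse_op_bounded[OF IH1, of e] by blast
  have "tail_int \<nu> e F (real n + \<delta> + 1 + 1) Q
    \<le> ennreal (real n + \<delta> + 1 + 1) * ennreal (\<Prod>l\<le>n. real l + \<delta> + 1) * epow (\<integral>\<^sup>+z\<in>Q. next_fun \<nu> e (sparse_op e ?\<phi>) z \<partial>M) e" if Q: "Q \<in> S" for Q
  proof (rule tail_int_next[OF assms(1,2) fin(1) _ e Q, where x = "\<lambda>P. epow (integ M P ?\<phi>) e / emeasure M P"])
    show "epow (integ M P ?\<phi>) e / emeasure M P < top" if "P \<in> S" for P
      using coef_finite[OF that IH1[OF that]] by (simp add: coef_def)
  qed (use \<delta> Suc in \<open>auto simp: inv sparse_op_def[symmetric]\<close>)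
  moreover have "(\<integral>\<^sup>+z\<in>P. chain_fun \<nu> e F \<delta> (Suc n) z \<partial>M) < top" if "P \<in> S" for P
    using that K fin e by (auto intro!: next_fun_finite[where K = K])
  moreover have "ennreal (real n + \<delta> + 1 + 1) * ennreal (\<Prod>l\<le>n. real l + \<delta> + 1) = ennreal (\<Prod>l\<le>Suc n. real l + \<delta> + 1)"
  proof -
    have "(\<Prod>l\<le>Suc n. real l + \<delta> + 1) = (real n + \<delta> + 1 + 1) * (\<Prod>l\<le>n. real l + \<delta> + 1)" by simp
    moreover have "0 \<le> (\<Prod>l\<le>n. real l + \<delta> + 1)" using \<delta> by (intro prod_nonneg) auto
    ultimately show ?thesis using \<delta> by (simp only: ennreal_mult[of "real n + \<delta> + 1 + 1"])
  qed
  moreover have "real (Suc n) + \<delta> + 1 = real n + \<delta> + 1 + 1" by simp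
  ultimately show ?case by (simp only: chain_fun.simps) blast
qed

end

section \<open>Norms and constants along the chain\<close>

definition mix_exp :: "real \<Rightarrow> real \<Rightarrow> real \<Rightarrow> real" where
  "mix_exp x0 x1 \<theta> = (1 - \<theta>) * x0 + \<theta> * x1"

definition op_exp :: "real \<Rightarrow> real \<Rightarrow> real" where
  "op_exp x a = max ((1 - a) / x) (1 / (1 - x))"

definition "op_const x a = form_const (x + a) (1 - x) x (1 - x)"

definition "chain_const x0 x1 a \<epsilon> \<delta> n = op_const x0 0 * (if \<delta> = 0 then 1 else op_const (mix_exp x0 x1 \<epsilon>) a powr \<delta>)
     * (\<Prod>l\<in>{1..n}. op_const (mix_exp x0 x1 ((\<delta> + real l) * \<epsilon>)) a)"

text \<open>An operator at parameter \<theta> carries the characteristic L0^(1-\<theta>) L1^\<theta>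
  to the power \<open>op_exp\<close>. The terms belong to the operator at \<theta> = 0, to the share
  \<delta> of the operator at \<theta> = \<epsilon> in the geometric mean, and to the operators at
  \<theta> = (\<delta> + l) \<epsilon>; here the powers of L0 are collected, in
  \<open>chain_exp1\<close> those of L1.\<close>

definition "chain_exp0 x0 x1 a \<epsilon> \<delta> n = op_exp x0 0 + \<delta> * (1 - \<epsilon>) * op_exp (mix_exp x0 x1 \<epsilon>) a
     + (\<Sum>l\<in>{1..n}. (1 - (\<delta> + real l) * \<epsilon>) * op_exp (mix_exp x0 x1 ((\<delta> + real l) * \<epsilon>)) a)"

definition "chain_exp1 x0 x1 a \<epsilon> \<delta> n = \<delta> * \<epsilon> * op_exp (mix_exp x0 x1 \<epsilon>) a
     + (\<Sum>l\<in>{1..n}. ((\<delta> + real l) * \<epsilon>) * op_exp (mix_exp x0 x1 ((\<delta> + real l) * \<epsilon>)) a)"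

lemma mix_exp_bounds:
  assumes "0 < x0" "x0 < 1" "0 < x1" "x1 < 1" "0 \<le> \<theta>" "\<theta> \<le> 1"
  shows "0 < mix_exp x0 x1 \<theta>" "mix_exp x0 x1 \<theta> < 1"
proof -
  have "min x0 x1 = (1 - \<theta>) * min x0 x1 + \<theta> * min x0 x1" by (simp add: algebra_simps)
  also have "\<dots> \<le> mix_exp x0 x1 \<theta>" unfolding mix_exp_def using assms by (intro add_mono mult_left_mono) auto
  finally show "0 < mix_exp x0 x1 \<theta>" using assms by (auto simp: min_def split: if_splits)
  have "mix_exp x0 x1 \<theta> \<le> (1 - \<theta>) * max x0 x1 + \<theta> * max x0 x1"
    unfolding mix_exp_def using assms by (intro add_mono mult_left_mono) auto
  also have "\<dots> = max x0 x1" by (simp add: algebra_simps)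
  finally show "mix_exp x0 x1 \<theta> < 1" using assms by (auto simp: max_def split: if_splits)
qed

lemma op_const_nonneg: "0 < x \<Longrightarrow> x < 1 \<Longrightarrow> 0 \<le> op_const x a" unfolding op_const_def by (intro form_const_nonneg) auto

context sparse_union
begin

text \<open>Two moves alternate. Multiplication by \<nu>^(1+a) is a Hoelder inequality with the
  L^(1/t) norm \<open>H\<close> and passes from \<theta> to \<theta> + \<epsilon>; the sparse
  operator then lowers the reciprocal exponent by a without changing the weight. Either a or t
  vanishes, according to which of the two target exponents is larger.\<close>

lemma chain_norm:
  fixes v0 v1 :: "'a \<Rightarrow> real" and \<nu> F :: "'a \<Rightarrow> ennreal"
  assumes [measurable]: "v0 \<in> borel_measurable M" "v1 \<in> borel_measurable M"
      "\<nu> \<in> borel_measurable M" "F \<in> borel_measurable M"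
    and v: "\<And>z. 0 < v0 z" "\<And>z. 0 < v1 z"
    and x: "0 < x0" "x0 < 1" "0 < x1" "x1 < 1" and a: "0 \<le> a" "0 \<le> t" "a = 0 \<or> t = 0" "\<epsilon> * (x1 - x0) + a = t"
    and \<epsilon>: "0 < \<epsilon>" and \<delta>: "0 \<le> \<delta>" "\<delta> < 1"
    and L: "1 \<le> L0" "1 \<le> L1" "\<And>Q. Q \<in> S \<Longrightarrow> muckenhoupt M x0 (1 - x0) v0 L0 Q"
      "\<And>Q. Q \<in> S \<Longrightarrow> muckenhoupt M x1 (1 - x1) v1 L1 Q"
    and H: "nrm M t (\<lambda>z. epow (\<nu> z) (1 + a) * ennreal ((v1 z / v0 z) powr \<epsilon>)) \<le> H" "H < top"
    and NF: "wnrm M x0 v0 F < top"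
    and n: "(\<delta> + real n + 1) * \<epsilon> \<le> 1"
  shows "nrm M (mix_exp x0 x1 ((\<delta> + real n + 1) * \<epsilon>) + a)
      (\<lambda>z. epow (chain_fun \<nu> (1 + a) F \<delta> n z) (1 + a)
        * ennreal (v0 z powr (1 - (\<delta> + real n + 1) * \<epsilon>) * v1 z powr ((\<delta> + real n + 1) * \<epsilon>)))
    \<le> ennreal (chain_const x0 x1 a \<epsilon> \<delta> n * L0 powr chain_exp0 x0 x1 a \<epsilon> \<delta> n * L1 powr chain_exp1 x0 x1 a \<epsilon> \<delta> n)
      * epow H (real n + 1 + \<delta>) * wnrm M x0 v0 F"
proof -
  define xs where "xs \<theta> = mix_exp x0 x1 \<theta>" for \<theta>
  define vs where "vs \<theta> z = v0 z powr (1 - \<theta>) * v1 z powr \<theta>" for \<theta> z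
  define D where "D \<theta> = op_const (xs \<theta>) a * (L0 powr (1 - \<theta>) * L1 powr \<theta>) powr op_exp (xs \<theta>) a" for \<theta>
  define D0 where "D0 = op_const x0 0 * L0 powr op_exp x0 0"
  define N where "N = wnrm M x0 v0 F"
  let ?N = "\<lambda>\<theta> f. nrm M (xs \<theta> + a) (\<lambda>z. epow (f z) (1 + a) * ennreal (vs \<theta> z))"
  let ?n = "\<lambda>\<theta> f. wnrm M (xs \<theta>) (vs \<theta>) f"
  let ?C = "chain_fun \<nu> (1 + a) F \<delta>" and ?S = "sparse_op (1 + a)"
    and ?M0 = "wnrm M x0 v0 (sparse_op 1 F)"
  have [measurable]: "vs \<theta> \<in> borel_measurable M" for \<theta> unfolding vs_def[abs_def] by measurable
  have vs_pos: "0 < vs \<theta> z" for \<theta> z unfolding vs_def using v[of z] by simp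
  have xs: "0 < xs \<theta>" "xs \<theta> < 1" if "0 \<le> \<theta>" "\<theta> \<le> 1" for \<theta> unfolding xs_def using mix_exp_bounds x that by auto
  \<comment> \<open>The balance of reciprocal exponents: a step of length \<epsilon> in \<theta>
    changes the exponent by t - a.\<close>
  have xs_step: "xs (\<theta> + \<epsilon>) + a = t + xs \<theta>" for \<theta> using a(4) by (simp add: xs_def mix_exp_def algebra_simps)
  have mult: "?N (\<theta> + \<epsilon>) (next_fun \<nu> (1 + a) \<Phi>) \<le> H * ?n \<theta> \<Phi>"
    if [measurable]: "\<Phi> \<in> borel_measurable M" and \<theta>: "0 \<le> \<theta>" "\<theta> \<le> 1" for \<Phi> \<theta>
  proof -
    have "epow (next_fun \<nu> (1 + a) \<Phi> z) (1 + a) * ennreal (vs (\<theta> + \<epsilon>) z)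
      = (epow (\<nu> z) (1 + a) * ennreal ((v1 z / v0 z) powr \<epsilon>)) * (\<Phi> z * ennreal (vs \<theta> z))" for z
    proof -
      have "v0 z powr (1 - (\<theta> + \<epsilon>)) = v0 z powr (1 - \<theta>) / v0 z powr \<epsilon>" "v1 z powr (\<theta> + \<epsilon>) = v1 z powr \<theta> * v1 z powr \<epsilon>"
        using v[of z] by (simp_all add: powr_diff[symmetric] powr_add algebra_simps)
      then have "vs (\<theta> + \<epsilon>) z = (v1 z / v0 z) powr \<epsilon> * vs \<theta> z" using v[of z] by (simp add: vs_def powr_divide)
      then have "ennreal (vs (\<theta> + \<epsilon>) z) = ennreal ((v1 z / v0 z) powr \<epsilon>) * ennreal (vs \<theta> z)"
        by (simp add: ennreal_mult vs_pos less_imp_le)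
      then show ?thesis using a by (simp add: next_fun_def epow_mult mult_ac)
    qed
    then have "?N (\<theta> + \<epsilon>) (next_fun \<nu> (1 + a) \<Phi>)
      = nrm M (t + xs \<theta>) (\<lambda>z. (epow (\<nu> z) (1 + a) * ennreal ((v1 z / v0 z) powr \<epsilon>)) * (\<Phi> z * ennreal (vs \<theta> z)))"
      unfolding xs_step by (intro nrm_cong)
    also have "\<dots> \<le> nrm M t (\<lambda>z. epow (\<nu> z) (1 + a) * ennreal ((v1 z / v0 z) powr \<epsilon>)) * ?n \<theta> \<Phi>"
      using a xs[OF \<theta>] by (intro nrm_mult) auto
    also have "\<dots> \<le> H * ?n \<theta> \<Phi>" using H by (intro mult_right_mono) auto
    finally show ?thesis .
  qed
  have muck: "muckenhoupt M (xs \<theta>) (1 - xs \<theta>) (vs \<theta>) (L0 powr (1 - \<theta>) * L1 powr \<theta>) Q"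
    if "Q \<in> S" "0 \<le> \<theta>" "\<theta> \<le> 1" for Q \<theta>
    unfolding xs_def mix_exp_def vs_def using x v L that sets_S by (intro muckenhoupt_interpolate) auto
  have op: "?n \<theta> (?S \<phi>) \<le> ennreal (D \<theta>) * ?N \<theta> \<phi>"
    if [measurable]: "\<phi> \<in> borel_measurable M" and \<theta>: "\<epsilon> \<le> \<theta>" "\<theta> \<le> 1"
      and fin: "?N \<theta> \<phi> < top" for \<phi> \<theta>
  proof -
    have \<theta>0: "0 \<le> \<theta>" using \<theta> \<epsilon> by simp
    \<comment> \<open>Trivial for a = 0; for t = 0 the balance identifies the left-hand side with
      the exponent at \<theta> - \<epsilon>, which is below 1.\<close>
    have "xs \<theta> + a < 1" using a(3) xs[OF \<theta>0 \<theta>(2)] xs[of "\<theta> - \<epsilon>"] xs_step[of "\<theta> - \<epsilon>"] \<theta> \<epsilon> by auto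
    moreover have "1 \<le> L0 powr (1 - \<theta>) * L1 powr \<theta>"
      using L \<theta> \<theta>0 ge_one_powr_ge_zero[of L0 "1 - \<theta>"] ge_one_powr_ge_zero[of L1 \<theta>]
        mult_mono[of 1 "L0 powr (1 - \<theta>)" 1 "L1 powr \<theta>"] by simp
    ultimately show ?thesis unfolding D_def op_const_def
      using xs[OF \<theta>0 \<theta>(2)] a muck \<theta> \<theta>0 vs_pos fin by (intro op_bound) (auto simp: op_exp_def)
  qed
  have vs0: "vs 0 z = v0 z" for z using v[of z] by (simp add: vs_def)
  have op0: "?M0 \<le> ennreal D0 * N"
    using op_bound[of x0 0 v0 F L0 "op_exp x0 0"] x v L NF by (simp add: D0_def op_const_def op_exp_def N_def)
  have D: "0 \<le> D \<theta>" if "0 \<le> \<theta>" "\<theta> \<le> 1" for \<theta> unfolding D_def using op_const_nonneg xs[OF that] by simp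
  have D0: "0 \<le> D0" unfolding D0_def using op_const_nonneg x by simp
  have Nfin: "N < top" using NF by (simp add: N_def)
  define R where "R n = (if \<delta> = 0 then D0 else D \<epsilon> powr \<delta> * D0) * (\<Prod>l\<in>{1..n}. D ((\<delta> + real l) * \<epsilon>))" for n
  \<comment> \<open>The geometric mean in \<open>first_op\<close> lives at parameter
    \<delta>\<epsilon>, between 0 and \<epsilon>; its norm is interpolated by
    \<open>nrm_geometric\<close>.\<close>
  have base: "?n (\<delta> * \<epsilon>) (first_op \<nu> (1 + a) F \<delta>) \<le> ennreal (R 0) * epow H \<delta> * N"
    if \<epsilon>1: "\<epsilon> \<le> 1" and H0: "\<delta> = 0 \<Longrightarrow> epow H \<delta> = 1"
  proof (cases "\<delta> = 0")
    case True
    then show ?thesis using op0 H0 by (simp add: first_op_def vs0 xs_def mix_exp_def R_def)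
  next
    case False
    then have \<delta>': "0 < \<delta>" using \<delta> by simp
    let ?\<phi>0 = "next_fun \<nu> (1 + a) (sparse_op 1 F)"
    have \<phi>0: "?N \<epsilon> ?\<phi>0 \<le> H * (ennreal D0 * N)"
    proof -
      have "?N (0 + \<epsilon>) ?\<phi>0 \<le> H * ?n 0 (sparse_op 1 F)" by (intro mult) auto
      also have "\<dots> \<le> H * (ennreal D0 * N)" using op0 by (intro mult_left_mono) (auto simp: vs0 xs_def mix_exp_def)
      finally show ?thesis by simp
    qed
    have op\<epsilon>: "?n \<epsilon> (?S ?\<phi>0) \<le> ennreal (D \<epsilon>) * (H * (ennreal D0 * N))"
    proof -
      have "H * (ennreal D0 * N) < top" using H Nfin by (simp add: ennreal_mult_less_top)
      then have "?n \<epsilon> (?S ?\<phi>0) \<le> ennreal (D \<epsilon>) * ?N \<epsilon> ?\<phi>0" using \<epsilon>1 \<phi>0 by (intro op) auto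
      also have "\<dots> \<le> ennreal (D \<epsilon>) * (H * (ennreal D0 * N))" using \<phi>0 by (intro mult_left_mono) auto
      finally show ?thesis .
    qed
    have "?n (\<delta> * \<epsilon>) (first_op \<nu> (1 + a) F \<delta>) = nrm M (\<delta> * xs \<epsilon> + (1 - \<delta>) * x0) (\<lambda>z. epow (?S ?\<phi>0 z * ennreal (vs \<epsilon> z)) \<delta>
          * epow (sparse_op 1 F z * ennreal (v0 z)) (1 - \<delta>))"
    proof -
      have "xs (\<delta> * \<epsilon>) = \<delta> * xs \<epsilon> + (1 - \<delta>) * x0" by (simp add: xs_def mix_exp_def algebra_simps)
      moreover have "ennreal (vs (\<delta> * \<epsilon>) z) = epow (ennreal (vs \<epsilon> z)) \<delta> * epow (ennreal (v0 z)) (1 - \<delta>)" for z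
      proof -
        have "vs (\<delta> * \<epsilon>) z = vs \<epsilon> z powr \<delta> * v0 z powr (1 - \<delta>)"
          using v[of z] by (simp add: vs_def powr_mult powr_powr powr_add[symmetric] mult_ac) (simp add: algebra_simps)
        then show ?thesis using v[of z] vs_pos[of \<epsilon> z] by (simp add: epow_ennreal ennreal_mult less_imp_le)
      qed
      ultimately show ?thesis
        using False by (intro arg_cong2[where f = "nrm M"]) (auto simp: first_op_def epow_mult mult_ac)
    qed
    also have "\<dots> \<le> epow (?n \<epsilon> (?S ?\<phi>0)) \<delta> * epow (?M0) (1 - \<delta>)" using xs[of \<epsilon>] \<epsilon> \<epsilon>1 x \<delta> \<delta>' by (intro nrm_geometric) auto
    also have "\<dots> \<le> epow (ennreal (D \<epsilon>) * (H * (ennreal D0 * N))) \<delta> * epow (ennreal D0 * N) (1 - \<delta>)"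
      using op\<epsilon> op0 \<delta> by (intro mult_mono[OF epow_mono epow_mono]) auto
    also have "\<dots> = epow (ennreal (D \<epsilon>)) \<delta> * epow H \<delta> * (epow (ennreal D0 * N) \<delta> * epow (ennreal D0 * N) (1 - \<delta>))"
      by (simp only: epow_mult mult_ac)
    also have "epow (ennreal D0 * N) \<delta> * epow (ennreal D0 * N) (1 - \<delta>) = ennreal D0 * N"
      by (simp only: epow_add[symmetric]) simp
    also have "epow (ennreal (D \<epsilon>)) \<delta> * epow H \<delta> * (ennreal D0 * N) = ennreal (R 0) * epow H \<delta> * N"
      using False D[of \<epsilon>] \<epsilon> \<epsilon>1 D0 by (simp add: R_def epow_ennreal ennreal_mult mult_ac)
    finally show ?thesis .
  qed
  have main: "?N ((\<delta> + real n + 1) * \<epsilon>) (?C n)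
    \<le> ennreal (R n) * epow H (real n + 1 + \<delta>) * N" if "(\<delta> + real n + 1) * \<epsilon> \<le> 1" for n using that
  proof (induction n)
    case 0
    have d\<epsilon>: "\<delta> * \<epsilon> + \<epsilon> \<le> 1" using 0 by (simp add: algebra_simps)
    then have \<epsilon>1: "\<epsilon> \<le> 1" using \<delta> \<epsilon> mult_nonneg_nonneg[of \<delta> \<epsilon>] by linarith
    have d\<epsilon>1: "\<delta> * \<epsilon> \<le> 1" using d\<epsilon> \<epsilon> by linarith
    have eq: "(\<delta> + real 0 + 1) * \<epsilon> = \<delta> * \<epsilon> + \<epsilon>" by (simp add: algebra_simps)
    have "?N (\<delta> * \<epsilon> + \<epsilon>) (?C 0) \<le> H * ?n (\<delta> * \<epsilon>) (first_op \<nu> (1 + a) F \<delta>)"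
      unfolding chain_fun.simps using d\<epsilon>1 \<delta> \<epsilon> by (intro mult) auto
    also have "\<dots> \<le> ennreal (R 0) * epow H (real 0 + 1 + \<delta>) * N"
    \<comment> \<open>For \<delta> = 0 the factor \<open>epow H \<delta>\<close> would be 0 when
      \<open>H\<close> is 0, so the first multiplication is estimated directly.\<close>
    proof (cases "\<delta> = 0")
      case True
      then have "xs (\<delta> * \<epsilon>) = x0" "vs (\<delta> * \<epsilon>) z = v0 z" "first_op \<nu> (1 + a) F \<delta> z = sparse_op 1 F z" for z
        by (auto simp: xs_def mix_exp_def vs0 first_op_def)
      moreover have "H * ?M0 \<le> H * (ennreal D0 * N)" using op0 by (intro mult_left_mono) auto
      ultimately show ?thesis using True by (simp add: R_def mult_ac)
    next
      case False
      then have "H * ?n (\<delta> * \<epsilon>) (first_op \<nu> (1 + a) F \<delta>)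
        \<le> H * (ennreal (R 0) * epow H \<delta> * N)" using base \<epsilon>1 by (intro mult_left_mono) auto
      also have "\<dots> = ennreal (R 0) * epow H (real 0 + 1 + \<delta>) * N" using epow_add[of H 1 \<delta>] by (simp add: mult_ac)
      finally show ?thesis .
    qed
    finally show ?case unfolding eq .
  next
    case (Suc n)
    define \<theta> where "\<theta> = (\<delta> + real n + 1) * \<epsilon>"
    have eq: "(\<delta> + real (Suc n) + 1) * \<epsilon> = \<theta> + \<epsilon>" by (simp add: \<theta>_def algebra_simps)
    have \<theta>: "\<epsilon> \<le> \<theta>" "\<theta> \<le> 1" using Suc.prems \<epsilon> \<delta> unfolding eq by (auto simp: \<theta>_def algebra_simps)
    have IH: "?N \<theta> (?C n) \<le> ennreal (R n) * epow H (real n + 1 + \<delta>) * N" using Suc.IH \<theta> by (simp add: \<theta>_def)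
    have "ennreal (R n) * epow H (real n + 1 + \<delta>) * N < top" using H Nfin by (simp add: ennreal_mult_less_top)
    then have op': "?n \<theta> (?S (?C n)) \<le> ennreal (D \<theta>) * ?N \<theta> (?C n)" using IH \<theta> by (intro op) auto
    have "?N (\<theta> + \<epsilon>) (?C (Suc n)) \<le> H * ?n \<theta> (?S (?C n))" unfolding chain_fun.simps using \<theta> \<epsilon> by (intro mult) auto
    also have "\<dots> \<le> H * (ennreal (D \<theta>) * (ennreal (R n) * epow H (real n + 1 + \<delta>) * N))"
      using order_trans[OF op' mult_left_mono[OF IH]] by (intro mult_left_mono) auto
    also have "\<dots> = (ennreal (R n) * ennreal (D \<theta>)) * (H * epow H (real n + 1 + \<delta>)) * N" by (simp only: mult_ac)
    also have "H * epow H (real n + 1 + \<delta>) = epow H (real (Suc n) + 1 + \<delta>)"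
      using epow_add[of H 1 "real n + 1 + \<delta>"] by (simp add: algebra_simps)
    also have "ennreal (R n) * ennreal (D \<theta>) = ennreal (R (Suc n))"
    proof -
      have "R (Suc n) = R n * D \<theta>" by (simp add: R_def \<theta>_def prod.nat_ivl_Suc' algebra_simps)
      then show ?thesis using D[of \<theta>] \<theta> \<epsilon> by (simp add: ennreal_mult'')
    qed
    finally show ?case unfolding eq .
  qed
  have R: "R n = chain_const x0 x1 a \<epsilon> \<delta> n * L0 powr chain_exp0 x0 x1 a \<epsilon> \<delta> n * L1 powr chain_exp1 x0 x1 a \<epsilon> \<delta> n"
  proof -
    have Dexp: "D \<theta> = op_const (xs \<theta>) a * (L0 powr ((1 - \<theta>) * op_exp (xs \<theta>) a) * L1 powr (\<theta> * op_exp (xs \<theta>) a))" for \<theta>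
      using L by (simp add: D_def powr_mult powr_powr)
    have D\<delta>: "D \<epsilon> powr \<delta> = op_const (xs \<epsilon>) a powr \<delta> * (L0 powr (\<delta> * (1 - \<epsilon>) * op_exp (xs \<epsilon>) a) * L1 powr (\<delta> * \<epsilon> * op_exp (xs \<epsilon>) a))"
      by (simp add: Dexp powr_mult powr_powr mult_ac)
    have pr: "(\<Prod>l\<in>{1..n}. D ((\<delta> + real l) * \<epsilon>)) = (\<Prod>l\<in>{1..n}. op_const (xs ((\<delta> + real l) * \<epsilon>)) a)
        * (L0 powr (\<Sum>l\<in>{1..n}. (1 - (\<delta> + real l) * \<epsilon>) * op_exp (xs ((\<delta> + real l) * \<epsilon>)) a)
          * L1 powr (\<Sum>l\<in>{1..n}. ((\<delta> + real l) * \<epsilon>) * op_exp (xs ((\<delta> + real l) * \<epsilon>)) a))" for n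
      using L by (simp only: Dexp prod.distrib) (simp add: powr_sum)
    show ?thesis unfolding R_def pr chain_const_def chain_exp0_def chain_exp1_def xs_def[symmetric]
      using L by (auto simp: D0_def D\<delta> powr_add mult_ac)
  qed
  show ?thesis using main[OF n] unfolding R xs_def vs_def N_def .
qed

end

section \<open>The Rubio de Francia majorant\<close>

definition buckley_const :: "real \<Rightarrow> real" where
  "buckley_const x = max 1 ((max_const (1 / (1 - x)) * max_const (1 / x)) powr x)"

context set_tree
begin

definition max_op :: "('a \<Rightarrow> ennreal) \<Rightarrow> 'a \<Rightarrow> ennreal" where
  "max_op f z = ennreal (pt_max (\<lambda>Q. enn2real (integ M Q f) / measure M Q) z)"

lemma max_op_measurable [measurable]: "max_op f \<in> borel_measurable M" unfolding max_op_def[abs_def] by measurable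

lemma pt_max_ge: "Q \<in> S \<Longrightarrow> z \<in> Q \<Longrightarrow> X Q \<le> pt_max X z" unfolding pt_max_def using finite_S by (intro Max_ge) auto

lemma pt_max_le: "0 \<le> c \<Longrightarrow> (\<And>Q. Q \<in> S \<Longrightarrow> z \<in> Q \<Longrightarrow> X Q \<le> c) \<Longrightarrow> pt_max X z \<le> c"
  unfolding pt_max_def using finite_S by (subst Max_le_iff) auto

lemma max_op_ge:
  assumes "Q \<in> S" "z \<in> Q" "integ M Q f < top"
  shows "integ M Q f \<le> emeasure M Q * max_op f z"
proof -
  have "integ M Q f = ennreal (measure M Q * (enn2real (integ M Q f) / measure M Q))"
    using assms measure_pos[of Q] by simp
  also have "\<dots> \<le> ennreal (measure M Q * pt_max (\<lambda>Q. enn2real (integ M Q f) / measure M Q) z)"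
    using pt_max_ge[OF assms(1,2), of "\<lambda>Q. enn2real (integ M Q f) / measure M Q"]
    by (intro ennreal_leI mult_left_mono) auto
  also have "\<dots> = emeasure M Q * max_op f z"
    unfolding max_op_def using pt_max_nonneg assms by (subst ennreal_mult) (auto simp: emeasure_eq)
  finally show ?thesis .
qed

end

context sparse_union
begin

text \<open>Lerner's proof of Buckley's bound: the unweighted maximal function is dominated by a composition
  of the two weighted ones.\<close>

lemma max_op_bound:
  assumes x: "0 < x" "x < 1" and [measurable]: "v \<in> borel_measurable M" "f \<in> borel_measurable M"
    and v: "\<And>z. 0 < v z" and L: "1 \<le> L" "\<And>Q. Q \<in> S \<Longrightarrow> muckenhoupt M x (1 - x) v L Q"
    and fin: "wnrm M x v f < top"
  shows "wnrm M x v (max_op f) \<le> ennreal (buckley_const x * L powr (1 / (1 - x))) * wnrm M x v f"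
proof -
  define y where "y = 1 - x"
  have y: "0 < y" "y < 1" using x by (auto simp: y_def)
  define us uw where "us z = v z powr (- 1 / y)" and "uw z = v z powr (1 / x)" for z
  have [measurable]: "us \<in> borel_measurable M" "uw \<in> borel_measurable M" unfolding us_def uw_def by measurable
  have u: "0 < us z" "0 < uw z" for z using v[of z] by (auto simp: us_def uw_def)
  define \<sigma> w where "\<sigma> = density M (\<lambda>z. ennreal (us z))" and "w = density M (\<lambda>z. ennreal (uw z))"
  have [measurable_cong]: "sets \<sigma> = sets M" "sets w = sets M" by (simp_all add: \<sigma>_def w_def)
  have [measurable]: "Q \<in> S \<Longrightarrow> Q \<in> sets M" for Q by (rule sets_S)
  have muck: "muckenhoupt M x y v L Q" if "Q \<in> S" for Q using L(2)[OF that] by (simp add: y_def)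
  have t\<sigma>: "set_tree \<sigma> S" and tw: "set_tree w S" unfolding \<sigma>_def w_def us_def uw_def
    using muckenhoupt_finite[OF assms(3) v _ muck] v by (auto intro!: set_tree_density simp: less_le)
  interpret \<sigma>: set_tree \<sigma> S by fact
  interpret w: set_tree w S by fact
  have em\<sigma>: "emeasure \<sigma> E = (\<integral>\<^sup>+z\<in>E. ennreal (us z) \<partial>M)" and emw: "emeasure w E = (\<integral>\<^sup>+z\<in>E. ennreal (uw z) \<partial>M)"
    if "E \<in> sets M" for E unfolding \<sigma>_def w_def using that by (auto intro!: emeasure_density)
  define A where "A = (\<integral>\<^sup>+z. epow (f z * ennreal (v z)) (1 / x) \<partial>M)"
  have A: "A < top" using fin x by (simp add: nrm_pos A_def)
  define f' where "f' z = f z * ennreal (1 / us z)" for z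
  have [measurable]: "f' \<in> borel_measurable \<sigma>" unfolding f'_def by measurable
  have f'Q: "integ \<sigma> Q f' = integ M Q f" if "Q \<in> S" for Q
    unfolding \<sigma>_def f'_def using that u by (auto intro!: density_dual(2))
  have f'A: "(\<integral>\<^sup>+z. epow (f' z) (1 / x) \<partial>\<sigma>) = A"
  proof -
    have "- 1 / y * (1 - 1 / x) = 1 / x" using x y by (simp add: field_simps) (simp add: y_def algebra_simps)
    then have "us z powr (1 - 1 / x) = v z powr (1 / x)" for z by (simp only: us_def powr_powr)
    then show ?thesis unfolding \<sigma>_def f'_def A_def using u v
      by (subst density_dual(1)) (auto simp: epow_mult epow_ennreal less_imp_le)
  qed
  have fQ: "integ M Q f < top" if Q: "Q \<in> S" for Q
    using \<sigma>.maximal_power(1)[of f' x y Q] x y A Q f'A f'Q[OF Q] by (simp add: y_def)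
  define X\<sigma> where "X\<sigma> Q = enn2real (integ \<sigma> Q f') / measure \<sigma> Q" for Q
  \<comment> \<open>The power y/x is chosen so that the L^(1/y) norm of \<open>G\<close> with
    respect to \<open>w\<close> equals the L^(1/x) norm of the \<sigma>-maximal function.\<close>
  define g where "g z = pt_max X\<sigma> z powr (y / x)" for z
  have [measurable]: "g \<in> borel_measurable M" unfolding g_def by measurable
  have g0: "0 \<le> g z" for z by (simp add: g_def)
  have I\<sigma>: "(\<integral>\<^sup>+z. ennreal (pt_max X\<sigma> z powr (1 / x)) \<partial>\<sigma>) \<le> ennreal (max_const (1 / x)) * A"
    using \<sigma>.maximal_inequality[of f' "1 / x"] x fQ f'Q unfolding f'A X\<sigma>_def max_const_def by auto
  define G where "G z = ennreal (g z) * ennreal (1 / uw z)" for z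
  have [measurable]: "G \<in> borel_measurable w" unfolding G_def by measurable
  have GQ: "integ w Q G = (\<integral>\<^sup>+z\<in>Q. ennreal (g z) \<partial>M)" if "Q \<in> S" for Q
    unfolding w_def G_def using that u by (auto intro!: density_dual(2))
  obtain B where B: "\<And>z. g z \<le> B"
  proof
    fix z
    show "g z \<le> Max (insert 0 (X\<sigma> ` S)) powr (y / x)" unfolding g_def pt_max_def using finite_S x y
      by (intro powr_mono2 Max_mono) (auto intro!: Max_ge)
  qed
  have GQfin: "integ w Q G < top" if Q: "Q \<in> S" for Q
  proof -
    have "(\<integral>\<^sup>+z\<in>Q. ennreal (g z) \<partial>M) \<le> (\<integral>\<^sup>+z. ennreal B * indicator Q z \<partial>M)"
      using B by (intro nn_integral_mono) (auto simp: indicator_def intro!: ennreal_leI)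
    also have "\<dots> < top" using Q emeasure_finite[OF Q] by (simp add: nn_integral_cmult_indicator ennreal_mult_less_top)
    finally show ?thesis using GQ[OF Q] by simp
  qed
  define Xw where "Xw Q = enn2real (integ w Q G) / measure w Q" for Q
  have Iw: "(\<integral>\<^sup>+z. ennreal (pt_max Xw z powr (1 / y)) \<partial>w) \<le> ennreal (max_const (1 / y)) * (\<integral>\<^sup>+z. epow (G z) (1 / y) \<partial>w)"
    using w.maximal_inequality[of G "1 / y"] y GQfin unfolding Xw_def max_const_def by auto
  have IG: "(\<integral>\<^sup>+z. epow (G z) (1 / y) \<partial>w) = (\<integral>\<^sup>+z. ennreal (pt_max X\<sigma> z powr (1 / x)) \<partial>\<sigma>)"
  proof -
    have e: "1 / x * (1 - 1 / y) = - 1 / y" using x y by (simp add: field_simps) (simp add: y_def algebra_simps)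
    have "uw z powr (1 - 1 / y) = us z" for z unfolding uw_def us_def powr_powr e ..
    moreover have "epow (ennreal (g z)) (1 / y) = ennreal (pt_max X\<sigma> z powr (1 / x))" for z
      using x y g0[of z] by (simp add: epow_ennreal) (simp add: g_def powr_powr)
    ultimately have "(\<integral>\<^sup>+z. epow (G z) (1 / y) \<partial>w) = (\<integral>\<^sup>+z. ennreal (us z) * ennreal (pt_max X\<sigma> z powr (1 / x)) \<partial>M)"
      unfolding w_def G_def using u by (subst density_dual(1)) (auto simp: mult.commute)
    also have "\<dots> = (\<integral>\<^sup>+z. ennreal (pt_max X\<sigma> z powr (1 / x)) \<partial>\<sigma>)"
      unfolding \<sigma>_def by (intro nn_integral_density[symmetric]) auto
    finally show ?thesis .
  qed
  define X where "X Q = enn2real (integ M Q f) / measure M Q" for Q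
  \<comment> \<open>On \<open>Q\<close> the function \<open>g\<close> is at least the (y/x)-th power
    of the \<sigma>-average of \<open>f'\<close>. Integrating this over \<open>Q\<close> and
    exchanging the two weighted measures for Lebesgue measure by the Muckenhoupt condition bounds
    the unweighted average by a \<open>w\<close>-average.\<close>
  have key: "X Q powr (y / x) \<le> L powr (1 / x) * Xw Q" if Q: "Q \<in> S" for Q
  proof -
    define fq where "fq = enn2real (integ M Q f)"
    define m s ww where "m = measure M Q" and "s = measure \<sigma> Q" and "ww = measure w Q"
    have pos: "0 < m" "0 < s" "0 < ww" "0 \<le> fq"
      using measure_pos[OF Q] \<sigma>.measure_pos[OF Q] w.measure_pos[OF Q] by (auto simp: m_def s_def ww_def fq_def)
    have mk: "ww powr x * s powr y \<le> L * m"
    proof -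
      have e: "(\<integral>\<^sup>+z\<in>Q. ennreal (us z) \<partial>M) = ennreal s" "(\<integral>\<^sup>+z\<in>Q. ennreal (uw z) \<partial>M) = ennreal ww"
        using em\<sigma>[OF sets_S[OF Q]] emw[OF sets_S[OF Q]] \<sigma>.emeasure_eq[OF Q] w.emeasure_eq[OF Q]
        unfolding s_def ww_def by simp_all
      have "epow (ennreal ww) x * epow (ennreal s) y \<le> ennreal L * epow (ennreal m) (x + y)"
        using muck[OF Q] emeasure_eq[OF Q] unfolding muckenhoupt_def us_def[symmetric] uw_def[symmetric] e m_def by simp
      then show ?thesis using L(1) pos by (simp add: y_def epow_ennreal ennreal_mult[symmetric])
    qed
    then have "(ww powr x * s powr y) powr (1 / x) \<le> (L * m) powr (1 / x)" using x by (intro powr_mono2) auto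
    then have "ww * s powr (y / x) \<le> L powr (1 / x) * m powr (1 / x)" using pos x L by (simp add: powr_mult powr_powr)
    moreover have "1 / x = 1 + y / x" using x by (simp add: y_def field_simps)
    then have "m powr (1 / x) = m * m powr (y / x)" using pos by (simp add: powr_add)
    ultimately have mk': "ww * s powr (y / x) \<le> L powr (1 / x) * m * m powr (y / x)" by simp
    have X\<sigma>Q: "X\<sigma> Q = fq / s" using f'Q[OF Q] by (simp add: X\<sigma>_def fq_def s_def)
    have "ennreal ((fq / s) powr (y / x) * m) = (\<integral>\<^sup>+z. ennreal ((fq / s) powr (y / x)) * indicator Q z \<partial>M)"
      using Q emeasure_eq[OF Q] by (simp add: nn_integral_cmult_indicator ennreal_mult m_def)
    also have "\<dots> \<le> (\<integral>\<^sup>+z\<in>Q. ennreal (g z) \<partial>M)"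
    proof (intro nn_integral_mono)
      fix z
      show "ennreal ((fq / s) powr (y / x)) * indicator Q z \<le> ennreal (g z) * indicator Q z"
      proof (cases "z \<in> Q")
        case True
        then have "fq / s \<le> pt_max X\<sigma> z" using pt_max_ge[OF Q True, of X\<sigma>] X\<sigma>Q by simp
        then show ?thesis unfolding g_def using x y pos by (intro mult_right_mono ennreal_leI powr_mono2) auto
      qed simp
    qed
    also have "\<dots> = ennreal (enn2real (integ w Q G))" using GQfin[OF Q] GQ[OF Q] by simp
    finally have "(fq / s) powr (y / x) * m \<le> enn2real (integ w Q G)" by simp
    then have gq: "(fq / s) powr (y / x) * m \<le> ww * Xw Q" using pos by (simp add: Xw_def ww_def)
    have "ww * (fq powr (y / x) * m) = (ww * s powr (y / x)) * ((fq / s) powr (y / x) * m)"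
      using pos by (simp add: powr_divide)
    also have "\<dots> \<le> (L powr (1 / x) * m * m powr (y / x)) * (ww * Xw Q)" using pos by (intro mult_mono[OF mk' gq]) auto
    finally have "ww * m * fq powr (y / x) \<le> ww * m * (L powr (1 / x) * Xw Q * m powr (y / x))" by (simp add: mult_ac)
    then have "fq powr (y / x) \<le> L powr (1 / x) * Xw Q * m powr (y / x)" using pos by (simp add: mult_le_cancel_left)
    then show ?thesis using pos by (simp add: X_def fq_def[symmetric] m_def[symmetric] powr_divide field_simps)
  qed
  have Xw0: "0 \<le> Xw Q" for Q by (simp add: Xw_def)
  have pt: "pt_max X z powr (1 / x) \<le> L powr (1 / (x * y)) * pt_max Xw z powr (1 / y)" for z
  proof -
    have "pt_max X z \<le> (L powr (1 / x) * pt_max Xw z) powr (x / y)"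
    proof (rule pt_max_le)
      fix Q assume Q: "Q \<in> S" "z \<in> Q"
      have "X Q = (X Q powr (y / x)) powr (x / y)" using x y by (simp add: powr_powr X_def)
      also have "\<dots> \<le> (L powr (1 / x) * pt_max Xw z) powr (x / y)" using key[OF Q(1)] pt_max_ge[OF Q, of Xw] x y
        by (intro powr_mono2 order_trans[OF key[OF Q(1)] mult_left_mono]) auto
      finally show "X Q \<le> (L powr (1 / x) * pt_max Xw z) powr (x / y)" .
    qed simp
    then have "pt_max X z powr (1 / x) \<le> ((L powr (1 / x) * pt_max Xw z) powr (x / y)) powr (1 / x)"
      using x pt_max_nonneg by (intro powr_mono2) auto
    also have "\<dots> = L powr (1 / (x * y)) * pt_max Xw z powr (1 / y)"
      using x y pt_max_nonneg[of Xw z] by (simp add: powr_mult powr_powr mult.commute[of y x])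
    finally show ?thesis .
  qed
  have "(\<integral>\<^sup>+z. epow (max_op f z * ennreal (v z)) (1 / x) \<partial>M) = (\<integral>\<^sup>+z. ennreal (pt_max X z powr (1 / x)) \<partial>w)"
    unfolding w_def by (subst nn_integral_density)
      (auto simp: max_op_def X_def[symmetric] epow_mult epow_ennreal pt_max_nonneg uw_def v less_imp_le mult.commute intro!: nn_integral_cong)
  also have "\<dots> \<le> (\<integral>\<^sup>+z. ennreal (L powr (1 / (x * y))) * ennreal (pt_max Xw z powr (1 / y)) \<partial>w)"
    using pt by (intro nn_integral_mono) (auto simp: ennreal_mult[symmetric] intro!: ennreal_leI)
  also have "\<dots> = ennreal (L powr (1 / (x * y))) * (\<integral>\<^sup>+z. ennreal (pt_max Xw z powr (1 / y)) \<partial>w)"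
    by (intro nn_integral_cmult) measurable
  also have "\<dots> \<le> ennreal (L powr (1 / (x * y))) * (ennreal (max_const (1 / y)) * (ennreal (max_const (1 / x)) * A))"
    using Iw I\<sigma> unfolding IG by (intro mult_left_mono order_trans[OF Iw] mult_left_mono) (auto simp: IG)
  also have "\<dots> = ennreal (L powr (1 / (x * y)) * (max_const (1 / y) * max_const (1 / x))) * A"
    by (simp add: ennreal_mult max_const_def mult_ac)
  finally have "wnrm M x v (max_op f)
    \<le> epow (ennreal (L powr (1 / (x * y)) * (max_const (1 / y) * max_const (1 / x))) * A) x"
    using x unfolding nrm_pos[OF x(1)] by (intro epow_mono) auto
  also have "\<dots> = ennreal (L powr (1 / y) * (max_const (1 / y) * max_const (1 / x)) powr x) * wnrm M x v f"
    using x y by (simp add: epow_mult epow_ennreal max_const_def powr_mult powr_powr nrm_pos A_def)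
  also have "\<dots> \<le> ennreal (buckley_const x * L powr (1 / (1 - x))) * wnrm M x v f"
    unfolding buckley_const_def y_def by (intro mult_right_mono ennreal_leI) (auto simp: mult.commute intro!: mult_left_mono)
  finally show ?thesis .
qed

end

section \<open>Rubio de Francia's iteration and the passage to an A_1 weight\<close>

definition rdf_const :: "real \<Rightarrow> real \<Rightarrow> real" where
  "rdf_const x \<kappa> = (op_const (1 / \<kappa>) 0) powr \<kappa> * (2 * buckley_const x) powr \<kappa>"

lemma suminf_half_ennreal: "(\<Sum>i. ennreal ((1 / 2) ^ i)) = 2"
proof -
  have "(\<lambda>i. (1 / 2 :: real) ^ i) sums 2" using geometric_sums[of "1 / 2 :: real"] by simp
  then have "(\<Sum>i. ennreal ((1 / 2) ^ i)) = ennreal 2" by (intro suminf_ennreal_eq) auto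
  then show ?thesis by simp
qed

context sparse_union
begin

fun max_iter :: "('a \<Rightarrow> ennreal) \<Rightarrow> nat \<Rightarrow> 'a \<Rightarrow> ennreal" where
  "max_iter f 0 = f"
| "max_iter f (Suc i) = max_op (max_iter f i)"

definition rdf :: "real \<Rightarrow> ('a \<Rightarrow> ennreal) \<Rightarrow> 'a \<Rightarrow> ennreal" where
  "rdf N f z = (\<Sum>i. ennreal ((1 / (2 * N)) ^ i) * max_iter f i z)"

lemma max_iter_measurable [measurable]: "f \<in> borel_measurable M \<Longrightarrow> max_iter f i \<in> borel_measurable M" by (cases i) auto

lemma rdf_measurable [measurable]: "f \<in> borel_measurable M \<Longrightarrow> rdf N f \<in> borel_measurable M"
  unfolding rdf_def[abs_def] by measurable

lemma rdf_ge: "f z \<le> rdf N f z"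
proof -
  have "(\<Sum>i\<in>{0}. ennreal ((1 / (2 * N)) ^ i) * max_iter f i z) \<le> rdf N f z"
    unfolding rdf_def by (intro sum_le_suminf) auto
  then show ?thesis by simp
qed

text \<open>\<open>N\<close> bounds the norm of \<open>max_op\<close>, so the i-th iterate divided
  by (2N)^i has norm at most 2^(-i) times that of \<open>f\<close>. For the second claim, averaging
  a term produces the next iterate, and the shift of the index costs the factor 2N.\<close>

lemma rdf_facts:
  assumes x: "0 < x" "x < 1" and [measurable]: "v \<in> borel_measurable M" "f \<in> borel_measurable M"
    and v: "\<And>z. 0 < v z" and L: "1 \<le> L" "\<And>Q. Q \<in> S \<Longrightarrow> muckenhoupt M x (1 - x) v L Q"
    and fin: "wnrm M x v f < top"
  defines "N \<equiv> buckley_const x * L powr (1 / (1 - x))"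
  shows "wnrm M x v (rdf N f) \<le> 2 * wnrm M x v f"
    and "Q \<in> S \<Longrightarrow> z \<in> Q \<Longrightarrow> (integ M Q (rdf N f)) \<le> ennreal (2 * N) * (emeasure M Q * rdf N f z)"
proof -
  have N: "1 \<le> N" unfolding N_def buckley_const_def using L x ge_one_powr_ge_zero[of L "1 / (1 - x)"]
      mult_mono[of 1 "max 1 ((max_const (1 / (1 - x)) * max_const (1 / x)) powr x)" 1 "L powr (1 / (1 - x))"] by simp
  define A where "A = wnrm M x v f"
  have it: "wnrm M x v (max_iter f i) \<le> ennreal (N ^ i) * A" for i
  proof (induction i)
    case (Suc i)
    have "ennreal (N ^ i) * A < top" using fin by (simp add: A_def ennreal_mult_less_top)
    then have "wnrm M x v (max_iter f i) < top" using Suc by simp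
    then have "wnrm M x v (max_iter f (Suc i)) \<le> ennreal N * wnrm M x v (max_iter f i)"
      unfolding max_iter.simps N_def using x v L by (intro max_op_bound) auto
    also have "\<dots> \<le> ennreal N * (ennreal (N ^ i) * A)" by (intro mult_left_mono Suc) auto
    also have "\<dots> = ennreal (N ^ Suc i) * A" using N by (simp add: ennreal_mult mult.assoc)
    finally show ?case .
  qed (simp add: A_def)
  define b where "b i z = ennreal ((1 / N) ^ i) * (max_iter f i z * ennreal (v z))" for i z
  have [measurable]: "b i \<in> borel_measurable M" for i unfolding b_def by measurable
  have bA: "(\<integral>\<^sup>+z. epow (b i z) (1 / x) \<partial>M) \<le> epow A (1 / x)" for i
  proof -
    have "nrm M x (b i) = ennreal ((1 / N) ^ i) * wnrm M x v (max_iter f i)"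
      unfolding b_def using x by (intro nrm_cmult) auto
    also have "\<dots> \<le> ennreal ((1 / N) ^ i) * (ennreal (N ^ i) * A)" by (intro mult_left_mono it) auto
    also have "\<dots> = ennreal ((1 / N) ^ i * N ^ i) * A" using N by (simp add: ennreal_mult mult.assoc)
    also have "\<dots> = A" using N by (simp add: power_mult_distrib[symmetric])
    finally have "epow (nrm M x (b i)) (1 / x) \<le> epow A (1 / x)" using x by (intro epow_mono) auto
    then show ?thesis using x by (simp add: nrm_pos)
  qed
  \<comment> \<open>Hoelder on the natural numbers with the weights 2^(-i), whose total mass is 2,
    moves the power 1/x inside the series.\<close>
  have pt: "epow (rdf N f z * ennreal (v z)) (1 / x) \<le> epow 2 ((1 - x) * (1 / x)) * (\<Sum>i. ennreal ((1 / 2) ^ i) * epow (b i z) (1 / x))" for z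
  proof -
    have "rdf N f z * ennreal (v z) = (\<Sum>i. ennreal ((1 / (2 * N)) ^ i) * max_iter f i z * ennreal (v z))"
      unfolding rdf_def by simp
    also have "\<dots> = (\<Sum>i. ennreal ((1 / 2) ^ i) * b i z)"
    proof (intro suminf_cong)
      fix i
      have "(1 / (2 * N)) ^ i = (1 / 2) ^ i * (1 / N) ^ i" by (simp add: power_mult_distrib[symmetric])
      then show "ennreal ((1 / (2 * N)) ^ i) * max_iter f i z * ennreal (v z) = ennreal ((1 / 2) ^ i) * b i z"
        using N by (simp add: b_def ennreal_mult mult.assoc)
    qed
    also have "\<dots> = (\<integral>\<^sup>+i. epow (ennreal ((1 / 2) ^ i) * epow (b i z) (1 / x)) x * epow (ennreal ((1 / 2) ^ i)) (1 - x) \<partial>count_space UNIV)"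
      unfolding nn_integral_count_space_nat
    proof (intro suminf_cong)
      fix i
      have "epow (ennreal ((1 / 2) ^ i)) x * epow (ennreal ((1 / 2) ^ i)) (1 - x) = ennreal ((1 / 2) ^ i)"
        by (simp only: epow_add[symmetric]) simp
      then show "ennreal ((1 / 2) ^ i) * b i z = epow (ennreal ((1 / 2) ^ i) * epow (b i z) (1 / x)) x * epow (ennreal ((1 / 2) ^ i)) (1 - x)"
        using x by (simp add: epow_mult mult_ac)
    qed
    also have "\<dots> \<le> epow (\<integral>\<^sup>+i. ennreal ((1 / 2) ^ i) * epow (b i z) (1 / x) \<partial>count_space UNIV) x
        * epow (\<integral>\<^sup>+i. ennreal ((1 / 2) ^ i) \<partial>count_space UNIV) (1 - x)" using x by (intro Holder_nn_integral) auto
    also have "\<dots> = epow (\<Sum>i. ennreal ((1 / 2) ^ i) * epow (b i z) (1 / x)) x * epow 2 (1 - x)"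
      by (simp add: nn_integral_count_space_nat suminf_half_ennreal)
    finally have "epow (rdf N f z * ennreal (v z)) (1 / x)
      \<le> epow (epow (\<Sum>i. ennreal ((1 / 2) ^ i) * epow (b i z) (1 / x)) x * epow 2 (1 - x)) (1 / x)"
      using x by (intro epow_mono) auto
    then show ?thesis using x by (simp add: epow_mult mult.commute)
  qed
  have "(\<integral>\<^sup>+z. epow (rdf N f z * ennreal (v z)) (1 / x) \<partial>M)
    \<le> (\<integral>\<^sup>+z. epow 2 ((1 - x) * (1 / x)) * (\<Sum>i. ennreal ((1 / 2) ^ i) * epow (b i z) (1 / x)) \<partial>M)"
    by (intro nn_integral_mono pt)
  also have "\<dots> = epow 2 ((1 - x) * (1 / x)) * (\<Sum>i. ennreal ((1 / 2) ^ i) * (\<integral>\<^sup>+z. epow (b i z) (1 / x) \<partial>M))"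
    by (simp add: nn_integral_cmult nn_integral_suminf)
  also have "\<dots> \<le> epow 2 ((1 - x) * (1 / x)) * (\<Sum>i. ennreal ((1 / 2) ^ i) * epow A (1 / x))"
    by (intro mult_left_mono suminf_le bA) auto
  also have "\<dots> = (epow 2 ((1 - x) * (1 / x)) * epow 2 1) * epow A (1 / x)" by (simp add: suminf_half_ennreal mult.assoc)
  also have "epow 2 ((1 - x) * (1 / x)) * epow 2 1 = epow 2 (1 / x)"
    using x by (subst epow_add[symmetric]) (simp add: field_simps)
  finally have "epow (\<integral>\<^sup>+z. epow (rdf N f z * ennreal (v z)) (1 / x) \<partial>M) x \<le> epow (epow 2 (1 / x) * epow A (1 / x)) x"
    using x by (intro epow_mono) auto
  then show "wnrm M x v (rdf N f) \<le> 2 * wnrm M x v f" using x by (simp add: nrm_pos epow_mult A_def)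
  show "integ M Q (rdf N f) \<le> ennreal (2 * N) * (emeasure M Q * rdf N f z)" if Q: "Q \<in> S" "z \<in> Q"
  proof -
    have [measurable]: "Q \<in> sets M" using sets_S Q by auto
    have itfin: "integ M Q (max_iter f i) < top" for i
    proof (rule nn_integral_finite_weight[OF assms(3) _ v Q(1) L(2)[OF Q(1)]])
      have "ennreal (N ^ i) * A < top" using fin by (simp add: A_def ennreal_mult_less_top)
      then have "wnrm M x v (max_iter f i) < top" using it[of i] by simp
      then show "(\<integral>\<^sup>+z. epow (epow (max_iter f i z) (x + (1 - x)) * ennreal (v z)) (1 / x) \<partial>M) < top"
        using x by (simp add: nrm_pos)
    qed (use x in auto)
    have "integ M Q (rdf N f) = (\<integral>\<^sup>+y. (\<Sum>i. ennreal ((1 / (2 * N)) ^ i) * (max_iter f i y * indicator Q y)) \<partial>M)"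
      unfolding rdf_def by (simp add: mult.assoc[symmetric])
    also have "\<dots> = (\<Sum>i. ennreal ((1 / (2 * N)) ^ i) * (integ M Q (max_iter f i)))"
      by (simp add: nn_integral_suminf nn_integral_cmult)
    also have "\<dots> \<le> (\<Sum>i. (ennreal (2 * N) * emeasure M Q) * (ennreal ((1 / (2 * N)) ^ Suc i) * max_iter f (Suc i) z))"
    proof (intro suminf_le)
      fix i
      have "integ M Q (max_iter f i) \<le> emeasure M Q * max_iter f (Suc i) z" using max_op_ge[OF Q itfin[of i]] by simp
      then have "ennreal ((1 / (2 * N)) ^ i) * (integ M Q (max_iter f i))
        \<le> ennreal ((1 / (2 * N)) ^ i) * (emeasure M Q * max_iter f (Suc i) z)" by (intro mult_left_mono) auto
      also have "\<dots> = (ennreal (2 * N) * ennreal ((1 / (2 * N)) ^ Suc i)) * (emeasure M Q * max_iter f (Suc i) z)"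
        using N by (subst ennreal_mult[symmetric]) auto
      also have "\<dots> = (ennreal (2 * N) * emeasure M Q) * (ennreal ((1 / (2 * N)) ^ Suc i) * max_iter f (Suc i) z)"
        by (simp only: mult_ac)
      finally show "ennreal ((1 / (2 * N)) ^ i) * (integ M Q (max_iter f i))
        \<le> (ennreal (2 * N) * emeasure M Q) * (ennreal ((1 / (2 * N)) ^ Suc i) * max_iter f (Suc i) z)" .
    qed auto
    also have "\<dots> = (ennreal (2 * N) * emeasure M Q) * (\<Sum>i. ennreal ((1 / (2 * N)) ^ Suc i) * max_iter f (Suc i) z)"
      by (rule ennreal_suminf_cmult)
    also have "\<dots> \<le> (ennreal (2 * N) * emeasure M Q) * rdf N f z"
    proof (intro mult_left_mono)
      let ?g = "\<lambda>i. ennreal ((1 / (2 * N)) ^ i) * max_iter f i z"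
      show "(\<Sum>i. ennreal ((1 / (2 * N)) ^ Suc i) * max_iter f (Suc i) z) \<le> rdf N f z" unfolding rdf_def
      proof (rule suminf_le_const)
        fix n
        have "(\<Sum>i<n. ?g (Suc i)) = (\<Sum>i\<in>Suc ` {..<n}. ?g i)" by (subst sum.reindex) auto
        also have "\<dots> \<le> (\<Sum>i. ?g i)" by (intro sum_le_suminf) auto
        finally show "(\<Sum>i<n. ?g (Suc i)) \<le> (\<Sum>i. ?g i)" .
      qed auto
    qed auto
    finally show ?thesis by (simp add: mult.assoc)
  qed
qed

text \<open>An A_1 weight is bounded below on \<open>Q\<close> by its average over D, which
  estimates the dual factor pointwise; the average then cancels against the other factor and only
  D^(1/\<kappa>) remains.\<close>

lemma A1_muckenhoupt:
  assumes \<kappa>: "1 < \<kappa>" and D: "1 \<le> D" and [measurable]: "u \<in> borel_measurable M" and u: "\<And>z. 0 < u z" and Q: "Q \<in> S"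
    and A1: "AE z in M. z \<in> Q \<longrightarrow> (\<integral>\<^sup>+y\<in>Q. ennreal (u y) \<partial>M) \<le> ennreal D * (emeasure M Q * ennreal (u z))"
  shows "muckenhoupt M (1 / \<kappa>) (1 - 1 / \<kappa>) (\<lambda>z. u z powr (1 / \<kappa>)) (D powr (1 / \<kappa>)) Q"
proof -
  have [measurable]: "Q \<in> sets M" using sets_S Q by auto
  define I where "I = (\<integral>\<^sup>+y\<in>Q. ennreal (u y) \<partial>M)"
  have I0: "0 < I" unfolding I_def using u Q by (intro nn_integral_weight_pos) auto
  define m where "m = measure M Q"
  have m: "emeasure M Q = ennreal m" "0 < m" using emeasure_eq[OF Q] measure_pos[OF Q] by (auto simp: m_def)
  \<comment> \<open>An infinite integral would force \<open>u\<close> to be infinite almost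
    everywhere on \<open>Q\<close>, but \<open>u\<close> is real-valued.\<close>
  have Ifin: "I < top"
  proof (rule ccontr)
    assume "\<not> I < top"
    then have "I = top" using top.not_eq_extremum by blast
    then have "AE z in M. z \<notin> Q"
      using A1 by (elim eventually_mono) (auto simp: I_def[symmetric] m ennreal_mult[symmetric] u less_imp_le top_unique ennreal_mult_eq_top_iff)
    then have "emeasure M Q = 0"
      using sets.sets_into_space[OF sets_S[OF Q]] by (subst (asm) AE_iff_measurable[of Q]) auto
    then show False using emeasure_pos[OF Q] by simp
  qed
  define i where "i = enn2real I"
  have i: "I = ennreal i" "0 < i" using I0 Ifin by (auto simp: i_def enn2real_positive_iff)
  define s where "s = 1 / \<kappa> / (1 - 1 / \<kappa>)"
  have s: "0 < s" using \<kappa> by (simp add: s_def)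
  have le: "AE z in M. z \<in> Q \<longrightarrow> u z powr (- s) \<le> (i / (D * m)) powr (- s)" using A1
  proof (elim eventually_mono, intro impI)
    fix z assume "z \<in> Q \<longrightarrow> (\<integral>\<^sup>+y\<in>Q. ennreal (u y) \<partial>M) \<le> ennreal D * (emeasure M Q * ennreal (u z))" "z \<in> Q"
    then have "ennreal i \<le> ennreal (D * (m * u z))"
      using D m u[of z] by (simp add: I_def[symmetric] i ennreal_mult less_imp_le)
    then have "i \<le> D * (m * u z)" using D m u[of z] by (simp add: ennreal_le_iff)
    then have "i / (D * m) \<le> u z" using D m by (simp add: field_simps)
    moreover have "0 < i / (D * m)" using i D m by simp
    ultimately show "u z powr (- s) \<le> (i / (D * m)) powr (- s)" using s by (intro powr_mono2') auto
  qed
  have e: "(u z powr (1 / \<kappa>)) powr (- 1 / (1 - 1 / \<kappa>)) = u z powr (- s)" for z by (simp add: powr_powr s_def)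
  have e': "(u z powr (1 / \<kappa>)) powr (1 / (1 / \<kappa>)) = u z" for z using \<kappa> u[of z] by (simp add: powr_powr)
  have "(\<integral>\<^sup>+z\<in>Q. ennreal ((u z powr (1 / \<kappa>)) powr (- 1 / (1 - 1 / \<kappa>))) \<partial>M)
    \<le> (\<integral>\<^sup>+z. ennreal ((i / (D * m)) powr (- s)) * indicator Q z \<partial>M)"
    unfolding e using le by (intro nn_integral_mono_AE) (auto simp: indicator_def elim!: eventually_mono intro!: ennreal_leI)
  also have "\<dots> = ennreal ((i / (D * m)) powr (- s) * m)" using m by (simp add: nn_integral_cmult_indicator ennreal_mult)
  finally have "epow (\<integral>\<^sup>+z\<in>Q. ennreal ((u z powr (1 / \<kappa>)) powr (1 / (1 / \<kappa>))) \<partial>M) (1 / \<kappa>)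
      * epow (\<integral>\<^sup>+z\<in>Q. ennreal ((u z powr (1 / \<kappa>)) powr (- 1 / (1 - 1 / \<kappa>))) \<partial>M) (1 - 1 / \<kappa>)
    \<le> epow I (1 / \<kappa>) * epow (ennreal ((i / (D * m)) powr (- s) * m)) (1 - 1 / \<kappa>)"
    unfolding e' I_def using \<kappa> by (intro mult_mono epow_mono) auto
  also have "\<dots> = ennreal (i powr (1 / \<kappa>) * ((i / (D * m)) powr (- (1 / \<kappa>)) * m powr (1 - 1 / \<kappa>)))"
  proof -
    have "- s * (1 - 1 / \<kappa>) = - (1 / \<kappa>)" using \<kappa> by (simp add: s_def)
    then have "((i / (D * m)) powr (- s) * m) powr (1 - 1 / \<kappa>) = (i / (D * m)) powr (- (1 / \<kappa>)) * m powr (1 - 1 / \<kappa>)"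
      by (simp only: powr_mult powr_powr)
    moreover have "epow (ennreal ((i / (D * m)) powr (- s) * m)) (1 - 1 / \<kappa>) = ennreal (((i / (D * m)) powr (- s) * m) powr (1 - 1 / \<kappa>))"
      using m by (intro epow_ennreal) auto
    ultimately show ?thesis unfolding i(1) using i(2) m by (simp add: epow_ennreal[of i] ennreal_mult')
  qed
  also have "i powr (1 / \<kappa>) * ((i / (D * m)) powr (- (1 / \<kappa>)) * m powr (1 - 1 / \<kappa>)) = D powr (1 / \<kappa>) * m"
    using i D m by (simp add: powr_minus powr_divide powr_mult powr_diff field_simps)
  finally show ?thesis unfolding muckenhoupt_def using m by (simp add: ennreal_mult)
qed

text \<open>Once F is majorized by an A_1 weight of comparable norm, the integral of the \<kappa>-th
  power of the sparse sum is a single weighted L^\<kappa> bound for the averaging sparse operator.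
  Its norm is linear in the A_1 constant 2N, and N carries the Buckley exponent 1/(1-x); the
  \<kappa>-th power of this is the stated power of L.\<close>

lemma tail_int_rdf:
  assumes x: "0 < x" "x < 1" and [measurable]: "v \<in> borel_measurable M" "F \<in> borel_measurable M" "h \<in> borel_measurable M"
    and v: "\<And>z. 0 < v z" and L: "1 \<le> L" "\<And>Q. Q \<in> S \<Longrightarrow> muckenhoupt M x (1 - x) v L Q"
    and fin: "wnrm M x v F < top" "0 < wnrm M x v F"
    and \<kappa>: "2 \<le> \<kappa>"
  obtains F' where "F' \<in> borel_measurable M" "wnrm M x v F' \<le> 4 * wnrm M x v F"
    "\<And>Q. Q \<in> S \<Longrightarrow> (\<integral>\<^sup>+z\<in>Q. epow (h z) \<kappa> * F' z \<partial>M) < top \<Longrightarrow>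
      tail_int h 1 F \<kappa> Q \<le> ennreal (rdf_const x \<kappa> * L powr (\<kappa> / (1 - x))) * (\<integral>\<^sup>+z\<in>Q. epow (h z) \<kappa> * F' z \<partial>M)"
proof -
  have [measurable]: "Q \<in> S \<Longrightarrow> Q \<in> sets M" for Q by (rule sets_S)
  define U where "U = \<Union>S"
  have [measurable]: "U \<in> sets M" unfolding U_def using finite_S by auto
  define A where "A = wnrm M x v F"
  define c where "c = wnrm M x v (indicator U)"
  have c: "c < top"
  proof -
    have "(\<integral>\<^sup>+z. epow (indicator U z * ennreal (v z)) (1 / x) \<partial>M) \<le> (\<integral>\<^sup>+z. (\<Sum>Q\<in>S. ennreal (v z powr (1 / x)) * indicator Q z) \<partial>M)"
    proof (intro nn_integral_mono)
      fix z
      show "epow (indicator U z * ennreal (v z)) (1 / x) \<le> (\<Sum>Q\<in>S. ennreal (v z powr (1 / x)) * indicator Q z)"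
      proof (cases "z \<in> U")
        case True
        then obtain Q where Q: "Q \<in> S" "z \<in> Q" by (auto simp: U_def)
        have "epow (indicator U z * ennreal (v z)) (1 / x) = ennreal (v z powr (1 / x)) * indicator Q z"
          using Q True v[of z] by (simp add: epow_ennreal less_imp_le)
        also have "\<dots> \<le> (\<Sum>Q\<in>S. ennreal (v z powr (1 / x)) * indicator Q z)"
          using Q finite_S by (intro member_le_sum) auto
        finally show ?thesis .
      qed simp
    qed
    also have "\<dots> = (\<Sum>Q\<in>S. \<integral>\<^sup>+z\<in>Q. ennreal (v z powr (1 / x)) \<partial>M)" by (subst nn_integral_sum) auto
    also have "\<dots> < top" using finite_S muckenhoupt_finite(1)[OF assms(3) v _ L(2)] by auto
    finally show ?thesis using x by (simp add: c_def nrm_pos)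
  qed
  \<comment> \<open>A small multiple of the indicator of the whole tree is added so that the
    majorant is positive there; \<epsilon> is chosen such that this at most doubles the norm, and
    the summand 1 keeps the denominator positive.\<close>
  define \<epsilon> where "\<epsilon> = enn2real A / (enn2real c + 1)"
  have A: "0 < A" "A < top" using fin by (auto simp: A_def)
  have \<epsilon>: "0 < \<epsilon>" using A by (auto simp: \<epsilon>_def enn2real_positive_iff intro!: divide_pos_pos add_nonneg_pos)
  have \<epsilon>c: "ennreal \<epsilon> * c \<le> A"
  proof -
    have "ennreal \<epsilon> * c = ennreal (\<epsilon> * enn2real c)" using c \<epsilon> by (simp add: ennreal_mult)
    also have "\<dots> \<le> ennreal (enn2real A)"
      unfolding \<epsilon>_def by (intro ennreal_leI) (simp add: pos_divide_le_eq add_nonneg_pos mult_left_mono)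
    finally show ?thesis using A by simp
  qed
  define F1 where "F1 z = max (F z) (ennreal \<epsilon> * indicator U z)" for z
  have [measurable]: "F1 \<in> borel_measurable M" unfolding F1_def by measurable
  have F1: "wnrm M x v F1 \<le> 2 * A"
  proof -
    have "(\<integral>\<^sup>+z. epow (F1 z * ennreal (v z)) (1 / x) \<partial>M)
      \<le> (\<integral>\<^sup>+z. epow (F z * ennreal (v z)) (1 / x) + epow (ennreal \<epsilon> * (indicator U z * ennreal (v z))) (1 / x) \<partial>M)"
      by (intro nn_integral_mono) (auto simp: F1_def max_def mult.assoc)
    also have "\<dots> = epow A (1 / x) + epow (ennreal \<epsilon> * c) (1 / x)"
      using x by (subst nn_integral_add) (auto simp: A_def c_def nrm_pos epow_mult nn_integral_cmult)
    also have "\<dots> \<le> epow A (1 / x) + epow A (1 / x)" using \<epsilon>c x by (intro add_left_mono epow_mono) auto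
    also have "\<dots> = 2 * epow A (1 / x)" by (simp add: mult_2)
    finally have "wnrm M x v F1 \<le> epow (2 * epow A (1 / x)) x"
      using x unfolding nrm_pos[OF x(1)] by (intro epow_mono) auto
    also have "\<dots> = epow 2 x * A" using x by (simp add: epow_mult)
    also have "\<dots> \<le> epow 2 1 * A" using x by (intro mult_right_mono epow_mono_exponent) auto
    finally show ?thesis by simp
  qed
  define N where "N = buckley_const x * L powr (1 / (1 - x))"
  have N: "1 \<le> N" unfolding N_def buckley_const_def using L x ge_one_powr_ge_zero[of L "1 / (1 - x)"]
      mult_mono[of 1 "max 1 ((max_const (1 / (1 - x)) * max_const (1 / x)) powr x)" 1 "L powr (1 / (1 - x))"] by simp
  define F' where "F' = rdf N F1"
  have [measurable]: "F' \<in> borel_measurable M" unfolding F'_def by measurable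
  have F1fin: "wnrm M x v F1 < top" using F1 by (rule order_le_less_trans) (use A in \<open>simp add: ennreal_mult_less_top\<close>)
  have rdf1: "wnrm M x v F' \<le> 2 * wnrm M x v F1" unfolding F'_def N_def using x v L F1fin by (intro rdf_facts(1)) auto
  have rdf2: "integ M Q F' \<le> ennreal (2 * N) * (emeasure M Q * F' z)" if "Q \<in> S" "z \<in> Q" for Q z
    unfolding F'_def N_def using x v L F1fin that by (intro rdf_facts(2)[where v = v]) auto
  have nF': "wnrm M x v F' \<le> 4 * A"
  proof -
    have "wnrm M x v F' \<le> 2 * wnrm M x v F1" by (rule rdf1)
    also have "\<dots> \<le> 2 * (2 * A)" using F1 by (intro mult_left_mono) auto
    finally show ?thesis by (simp add: mult.assoc[symmetric])
  qed
  have F'fin: "AE z in M. F' z < top"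
  proof -
    have "wnrm M x v F' < top" using nF' by (rule order_le_less_trans) (use A in \<open>simp add: ennreal_mult_less_top\<close>)
    then have "(\<integral>\<^sup>+z. epow (F' z * ennreal (v z)) (1 / x) \<partial>M) \<noteq> \<infinity>" using x by (simp add: nrm_pos)
    then have "AE z in M. epow (F' z * ennreal (v z)) (1 / x) \<noteq> \<infinity>" by (intro nn_integral_PInf_AE) auto
    then show ?thesis
      using v by (elim eventually_mono) (auto simp: ennreal_mult_eq_top_iff less_top ennreal_eq_0_iff not_le)
  qed
  \<comment> \<open>A real-valued, everywhere positive version of the majorant. Outside the tree,
    and on the null set where the majorant is infinite, the value 1 is a placeholder.\<close>
  define u where "u z = (if z \<in> U \<and> F' z < top then enn2real (F' z) else 1)" for z
  have F'pos: "0 < F' z" if "z \<in> U" for z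
  proof -
    have "ennreal \<epsilon> \<le> F1 z" using that by (simp add: F1_def)
    also have "\<dots> \<le> F' z" unfolding F'_def by (rule rdf_ge)
    finally show ?thesis using \<epsilon> by (metis ennreal_less_zero_iff order_less_le_trans)
  qed
  have u: "0 < u z" for z using F'pos[of z] by (auto simp: u_def enn2real_positive_iff)
  have [measurable]: "u \<in> borel_measurable M" unfolding u_def by measurable
  have uF': "AE z in M. z \<in> U \<longrightarrow> ennreal (u z) = F' z" using F'fin by (elim eventually_mono) (auto simp: u_def)
  have subU: "Q \<in> S \<Longrightarrow> z \<in> Q \<Longrightarrow> z \<in> U" for Q z by (auto simp: U_def)
  have intu: "(\<integral>\<^sup>+y\<in>Q. g y * ennreal (u y) \<partial>M) = (\<integral>\<^sup>+y\<in>Q. g y * F' y \<partial>M)" if "Q \<in> S" for Q g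
    using uF' that subU by (intro nn_integral_cong_AE) (auto elim!: eventually_mono simp: indicator_def)
  define D where "D = 2 * N"
  have D: "1 \<le> D" using N by (simp add: D_def)
  have muck: "muckenhoupt M (1 / \<kappa>) (1 - 1 / \<kappa>) (\<lambda>z. u z powr (1 / \<kappa>)) (D powr (1 / \<kappa>)) Q" if Q: "Q \<in> S" for Q
  proof (rule A1_muckenhoupt[OF _ D _ u Q])
    show "AE z in M. z \<in> Q \<longrightarrow> (\<integral>\<^sup>+y\<in>Q. ennreal (u y) \<partial>M) \<le> ennreal D * (emeasure M Q * ennreal (u z))" using uF'
    proof (elim eventually_mono, intro impI)
      fix z assume z: "z \<in> U \<longrightarrow> ennreal (u z) = F' z" "z \<in> Q"
      have "integ M Q F' \<le> ennreal (2 * N) * (emeasure M Q * F' z)" using Q z by (intro rdf2) auto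
      then show "(\<integral>\<^sup>+y\<in>Q. ennreal (u y) \<partial>M) \<le> ennreal D * (emeasure M Q * ennreal (u z))"
        using intu[OF Q, of "\<lambda>_. 1"] z subU[OF Q] by (simp add: D_def)
    qed
  qed (use \<kappa> in auto)
  show thesis
  proof (rule that[of F'])
    show "wnrm M x v F' \<le> 4 * wnrm M x v F" using nF' by (simp add: A_def)
    fix Q assume Q: "Q \<in> S" and Ifin: "(\<integral>\<^sup>+z\<in>Q. epow (h z) \<kappa> * F' z \<partial>M) < top"
    \<comment> \<open>Cutting off to \<open>Q\<close> lets the full operator dominate the sum
      localized to cubes below \<open>Q\<close>.\<close>
    define \<phi> where "\<phi> z = h z * indicator Q z" for z
    have [measurable]: "\<phi> \<in> borel_measurable M" unfolding \<phi>_def using Q by measurable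
    define I where "I = (\<integral>\<^sup>+z\<in>Q. epow (h z) \<kappa> * F' z \<partial>M)"
    have \<phi>I: "nrm M (1 / \<kappa> + 0) (\<lambda>z. epow (\<phi> z) (1 + 0) * ennreal (u z powr (1 / \<kappa>))) = epow I (1 / \<kappa>)"
    proof -
      have "(\<integral>\<^sup>+z. epow (\<phi> z * ennreal (u z powr (1 / \<kappa>))) \<kappa> \<partial>M) = (\<integral>\<^sup>+z\<in>Q. epow (h z) \<kappa> * ennreal (u z) \<partial>M)"
        using \<kappa> u by (intro nn_integral_cong) (auto simp: \<phi>_def indicator_def epow_mult epow_ennreal powr_powr less_imp_le)
      then show ?thesis using \<kappa> by (simp add: nrm_pos intu[OF Q] I_def)
    qed
    have "nrm M (1 / \<kappa>) (\<lambda>z. sparse_op (1 + 0) \<phi> z * ennreal (u z powr (1 / \<kappa>)))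
      \<le> ennreal (form_const (1 / \<kappa> + 0) (1 - 1 / \<kappa>) (1 / \<kappa>) (1 - 1 / \<kappa>) * (D powr (1 / \<kappa>)) powr \<kappa>)
        * nrm M (1 / \<kappa> + 0) (\<lambda>z. epow (\<phi> z) (1 + 0) * ennreal (u z powr (1 / \<kappa>)))"
    proof (rule op_bound)
      show "1 \<le> D powr (1 / \<kappa>)" using D \<kappa> by (intro ge_one_powr_ge_zero) auto
      \<comment> \<open>Here \<kappa> \<ge> 2 enters: the conjugate exponent of \<kappa> does not
        exceed \<kappa>, so the norm of the operator is linear in the A_1 constant.\<close>
      show "1 / (1 - 1 / \<kappa>) \<le> \<kappa>" using \<kappa> mult_left_mono[of 2 \<kappa> \<kappa>] by (simp add: field_simps)
      show "nrm M (1 / \<kappa> + 0) (\<lambda>z. epow (\<phi> z) (1 + 0) * ennreal (u z powr (1 / \<kappa>))) < top"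
        unfolding \<phi>I using Ifin by (simp add: I_def)
    qed (use \<kappa> u muck in \<open>auto simp: less_imp_neq[THEN not_sym]\<close>)
    then have op: "nrm M (1 / \<kappa>) (\<lambda>z. sparse_op 1 \<phi> z * ennreal (u z powr (1 / \<kappa>))) \<le> ennreal (op_const (1 / \<kappa>) 0 * D) * epow I (1 / \<kappa>)"
      unfolding \<phi>I using \<kappa> D by (simp add: op_const_def powr_powr)
    have "tail_int h 1 F \<kappa> Q \<le> (\<integral>\<^sup>+z. epow (sparse_op 1 \<phi> z * ennreal (u z powr (1 / \<kappa>))) \<kappa> \<partial>M)"
      unfolding tail_int_def using uF'
    proof (intro nn_integral_mono_AE, elim eventually_mono)
      fix z assume uz: "z \<in> U \<longrightarrow> ennreal (u z) = F' z"
      show "(if \<kappa> = 0 then 1 else epow (tail_sum h 1 Q z) \<kappa>) * F z * indicator Q z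
        \<le> epow (sparse_op 1 \<phi> z * ennreal (u z powr (1 / \<kappa>))) \<kappa>"
      proof (cases "z \<in> Q")
        case True
        have "tail_sum h 1 Q z \<le> sparse_op 1 \<phi> z"
        proof -
          have "integ M P h = integ M P \<phi>" if "P \<subseteq> Q" for P
            using that by (intro nn_integral_cong) (auto simp: \<phi>_def indicator_def)
          then have "tail_sum h 1 Q z = (\<Sum>P\<in>{P\<in>S. P \<subseteq> Q}. coef \<phi> 1 P * indicator P z)"
            unfolding tail_sum_def coef_def by (intro sum.cong) auto
          also have "\<dots> \<le> sparse_op 1 \<phi> z" unfolding sparse_op_def coef_def using finite_S by (intro sum_mono2) auto
          finally show ?thesis .
        qed
        moreover have "F z \<le> ennreal (u z)"
        proof -
          have "F z \<le> F1 z" by (simp add: F1_def)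
          also have "\<dots> \<le> F' z" unfolding F'_def by (rule rdf_ge)
          finally show ?thesis using uz subU[OF Q True] by simp
        qed
        ultimately have "epow (tail_sum h 1 Q z) \<kappa> * F z \<le> epow (sparse_op 1 \<phi> z) \<kappa> * ennreal (u z)"
          using \<kappa> by (intro mult_mono epow_mono) auto
        then show ?thesis using True \<kappa> u[of z] by (simp add: epow_mult epow_ennreal powr_powr less_imp_le)
      qed simp
    qed
    also have "\<dots> = epow (nrm M (1 / \<kappa>) (\<lambda>z. sparse_op 1 \<phi> z * ennreal (u z powr (1 / \<kappa>)))) \<kappa>"
      using \<kappa> by (simp add: nrm_pos)
    also have "\<dots> \<le> epow (ennreal (op_const (1 / \<kappa>) 0 * D) * epow I (1 / \<kappa>)) \<kappa>" using op \<kappa> by (intro epow_mono) auto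
    also have "\<dots> = ennreal ((op_const (1 / \<kappa>) 0 * D) powr \<kappa>) * I"
      using \<kappa> D op_const_nonneg[of "1 / \<kappa>" 0] by (simp add: epow_mult epow_ennreal)
    also have "(op_const (1 / \<kappa>) 0 * D) powr \<kappa> = rdf_const x \<kappa> * L powr (\<kappa> / (1 - x))"
      unfolding D_def N_def rdf_const_def by (simp add: powr_mult powr_powr mult_ac)
    finally show "tail_int h 1 F \<kappa> Q \<le> ennreal (rdf_const x \<kappa> * L powr (\<kappa> / (1 - x))) * (\<integral>\<^sup>+z\<in>Q. epow (h z) \<kappa> * F' z \<partial>M)"
      by (simp add: I_def)
  qed measurable
qed

end

section \<open>Stopping sets\<close>

text \<open>\<open>T Q\<close> stands for the cubes on which the oscillation relative to
  \<open>Q\<close> jumps, and \<open>S0\<close> for the given sparse cubes, each of which must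
  itself become a node of the tree.\<close>

locale stop_tree = set_tree +
  fixes T :: "'a set \<Rightarrow> 'a set set" and S0 :: "'a set set"
  assumes T: "Q \<in> S \<Longrightarrow> T Q \<subseteq> {P\<in>S. P \<subset> Q}" "Q \<in> S \<Longrightarrow> measure M (\<Union>(T Q)) \<le> 1 / 4 * measure M Q"
    and S0: "S0 \<subseteq> S" "Q \<in> S0 \<Longrightarrow> measure M (\<Union>{P\<in>S0. P \<subset> Q}) \<le> 1 / 4 * measure M Q"
begin

text \<open>Members of \<open>S0\<close> stop the descent even where the oscillation does not jump,
  so that every cube of \<open>S0\<close> is the root of its own stopping tree inside one common
  family.\<close>

definition cand :: "'a set \<Rightarrow> 'a set set" where
  "cand Q = T Q \<union> {P\<in>S0. P \<subset> Q}"

definition chs :: "'a set \<Rightarrow> 'a set set" where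
  "chs Q = {P\<in>cand Q. \<forall>R\<in>cand Q. P \<subseteq> R \<longrightarrow> R = P}"

inductive_set stree :: "'a set set" where
  base: "Q \<in> S0 \<Longrightarrow> Q \<in> stree"
| step: "Q \<in> stree \<Longrightarrow> P \<in> chs Q \<Longrightarrow> P \<in> stree"

lemma cand_sub: "Q \<in> S \<Longrightarrow> P \<in> cand Q \<Longrightarrow> P \<in> S \<and> P \<subset> Q" using T(1)[of Q] S0(1) by (auto simp: cand_def)

lemma stree_sub: "Q \<in> stree \<Longrightarrow> Q \<in> S"
proof (induction rule: stree.induct)
  case (step Q P)
  then show ?case using cand_sub[of Q P] by (auto simp: chs_def)
qed (use S0 in auto)

lemma chs_sub: "Q \<in> S \<Longrightarrow> P \<in> chs Q \<Longrightarrow> P \<in> S \<and> P \<subset> Q" using cand_sub[of Q P] by (simp add: chs_def)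

lemma cand_cover:
  assumes "Q \<in> S" "P \<in> cand Q"
  obtains R where "R \<in> chs Q" "P \<subseteq> R"
proof -
  have "cand Q \<subseteq> S" using cand_sub assms(1) by auto
  then have "finite (cand Q)" using finite_S by (rule finite_subset)
  from finite_has_maximal2[OF this assms(2)] obtain R where "R \<in> cand Q" "P \<subseteq> R" "\<forall>R'\<in>cand Q. R \<subseteq> R' \<longrightarrow> R = R'" by blast
  then show thesis by (intro that[of R]) (auto simp: chs_def)
qed

lemma chs_disjoint: "Q \<in> S \<Longrightarrow> P \<in> chs Q \<Longrightarrow> R \<in> chs Q \<Longrightarrow> P \<noteq> R \<Longrightarrow> P \<inter> R = {}"
  using laminar[of P R] chs_sub[of Q] unfolding chs_def by auto

text \<open>Induction on the number of ancestors of \<open>P\<close>. Either \<open>P\<close> is a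
  member of \<open>S0\<close> and hence a candidate below \<open>Q\<close>, or it is a child of some
  \<open>R\<close> comparable with \<open>Q\<close>. The case \<open>Q \<subset> R\<close>
  contradicts the disjointness of the children of \<open>R\<close>.\<close>

lemma stree_cover:
  assumes "P \<in> stree" "Q \<in> stree" "P \<subset> Q"
  shows "\<exists>C\<in>chs Q. P \<subseteq> C" using assms
proof (induction "card {R\<in>S. P \<subset> R}" arbitrary: P Q rule: less_induct)
  case less
  have QS: "Q \<in> S" using less.prems(2) by (rule stree_sub)
  have PS: "P \<in> S" using less.prems(1) by (rule stree_sub)
  have smaller: "card {R\<in>S. P' \<subset> R} < card {R\<in>S. P \<subset> R}" if "P' \<in> S" "P \<subset> P'" for P'
    using that finite_S by (intro psubset_card_mono) auto
  from less.prems(1) show ?case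
  proof (cases rule: stree.cases)
    case base
    then have "P \<in> cand Q" using less.prems by (simp add: cand_def)
    then show ?thesis using cand_cover[OF QS] by metis
  next
    case (step R)
    have RS: "R \<in> S" using step(1) by (rule stree_sub)
    have PR: "P \<subset> R" using chs_sub[OF RS step(2)] by simp
    obtain z where "z \<in> P" using nonempty[OF PS] by blast
    then consider "R = Q" | "R \<subset> Q" | "Q \<subset> R" using comparable[of z R Q] RS QS PR less.prems(3) by blast
    then show ?thesis
    proof cases
      case 1
      then show ?thesis using step by auto
    next
      case 2
      then obtain C where "C \<in> chs Q" "R \<subseteq> C" using less.hyps[OF smaller[OF RS PR] step(1) less.prems(2)] by blast
      moreover have "P \<subseteq> R" using PR by simp
      ultimately show ?thesis by (meson order_trans)
    next
      case 3
      then obtain C where C: "C \<in> chs R" "Q \<subseteq> C"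
        using less.hyps[OF smaller[OF QS less.prems(3)] less.prems(2) step(1)] by blast
      then have "P \<noteq> C" "P \<inter> C \<noteq> {}" using less.prems(3) \<open>z \<in> P\<close> by auto
      then show ?thesis using chs_disjoint[OF RS step(2) C(1)] by blast
    qed
  qed
qed

lemma fmeasurable_sub: "A \<subseteq> S \<Longrightarrow> \<Union>A \<in> fmeasurable M" by (rule fmeasurable_Union)

lemma measure_chs:
  assumes "Q \<in> S0"
  shows "measure M (\<Union>(chs Q)) \<le> 1 / 2 * measure M Q"
proof -
  have Q: "Q \<in> S" using assms S0 by auto
  have sub: "T Q \<subseteq> S" "{P\<in>S0. P \<subset> Q} \<subseteq> S" using T(1)[OF Q] S0 by auto
  have "measure M (\<Union>(chs Q)) \<le> measure M (\<Union>(T Q) \<union> \<Union>{P\<in>S0. P \<subset> Q})"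
  proof (rule measure_mono_fmeasurable)
    have "\<Union>(chs Q) \<in> fmeasurable M" using chs_sub[OF Q] by (intro fmeasurable_sub) auto
    then show "\<Union>(chs Q) \<in> sets M" by (rule fmeasurableD)
    show "\<Union>(T Q) \<union> \<Union>{P\<in>S0. P \<subset> Q} \<in> fmeasurable M"
      using fmeasurable_sub[OF sub(1)] fmeasurable_sub[OF sub(2)] by (rule fmeasurable.Un)
  qed (auto simp: chs_def cand_def)
  also have "\<dots> \<le> measure M (\<Union>(T Q)) + measure M (\<Union>{P\<in>S0. P \<subset> Q})"
    using fmeasurable_sub[OF sub(1)] fmeasurable_sub[OF sub(2)] by (intro measure_Un_le fmeasurableD)
  also have "\<dots> \<le> 1 / 2 * measure M Q" using T(2)[OF Q] S0(2)[OF assms] by simp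
  finally show ?thesis .
qed

text \<open>Below a cube outside \<open>S0\<close> the cubes of \<open>S0\<close> may fill
  everything, so the whole tree need not be sparse. Away from \<open>S0\<close> the mass is counted
  over two generations: a child of \<open>Q\<close> either lies in \<open>T Q\<close>, or it belongs
  to \<open>S0\<close>, and then the next generation fills at most half of it. This gives 1/4 +
  1/2.\<close>

lemma sparse_union_stree: "sparse_union M stree"
proof -
  have sub: "stree \<subseteq> S" using stree_sub by auto
  interpret U: set_tree M stree by (rule subtree[OF sub])
  have S0s: "sparse_tree M S0"
  proof -
    interpret A: set_tree M S0 by (rule subtree[OF S0(1)])
    show ?thesis
    proof
      fix Q assume "Q \<in> S0"
      then show "measure M (\<Union>{P\<in>S0. P \<subset> Q}) \<le> 3 / 4 * measure M Q" using S0(2)[of Q] measure_nonneg[of M Q] by linarith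
    qed
  qed
  have T': "sparse_tree M (stree - S0)"
  proof -
    interpret A: set_tree M "stree - S0" using sub by (intro subtree) auto
    show ?thesis
    proof
      fix Q assume Q: "Q \<in> stree - S0"
      then have QS: "Q \<in> S" using stree_sub by auto
      define CC where "CC = chs Q \<inter> S0"
      have CC: "CC \<subseteq> S" using S0 by (auto simp: CC_def)
      have CCfin: "finite CC" using CC finite_S by (rule finite_subset)
      have chsS: "chs C \<subseteq> S" if "C \<in> CC" for C using chs_sub[of C] CC that by auto
      have incl: "\<Union>{P\<in>stree - S0. P \<subset> Q} \<subseteq> \<Union>(T Q) \<union> (\<Union>C\<in>CC. \<Union>(chs C))"
      proof
        fix x assume "x \<in> \<Union>{P\<in>stree - S0. P \<subset> Q}"
        then obtain P where P: "x \<in> P" "P \<in> stree" "P \<notin> S0" "P \<subset> Q" by auto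
        obtain C where C: "C \<in> chs Q" "P \<subseteq> C" using stree_cover[of P Q] P Q by auto
        show "x \<in> \<Union>(T Q) \<union> (\<Union>C\<in>CC. \<Union>(chs C))"
        proof (cases "C \<in> T Q")
          case False
          then have C0: "C \<in> S0" using C by (auto simp: chs_def cand_def)
          then have "P \<subset> C" using P C by auto
          then obtain C' where "C' \<in> chs C" "P \<subseteq> C'" using stree_cover[of P C] P stree.base[OF C0] by auto
          then show ?thesis using P C C0 by (auto simp: CC_def)
        qed (use P C in auto)
      qed
      have m1: "\<Union>(T Q) \<in> fmeasurable M" using T(1)[OF QS] by (intro fmeasurable_sub) auto
      have mC: "\<Union>(chs C) \<in> fmeasurable M" if "C \<in> CC" for C by (intro fmeasurable_sub chsS that)
      have m2: "(\<Union>C\<in>CC. \<Union>(chs C)) \<in> fmeasurable M" using mC CCfin by (intro fmeasurable.finite_UN) auto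
      have "measure M (\<Union>{P\<in>stree - S0. P \<subset> Q}) \<le> measure M (\<Union>(T Q) \<union> (\<Union>C\<in>CC. \<Union>(chs C)))"
      proof (rule measure_mono_fmeasurable[OF incl])
        have "\<Union>{P\<in>stree - S0. P \<subset> Q} \<in> fmeasurable M" using sub by (intro fmeasurable_sub) auto
        then show "\<Union>{P\<in>stree - S0. P \<subset> Q} \<in> sets M" by (rule fmeasurableD)
        show "\<Union>(T Q) \<union> (\<Union>C\<in>CC. \<Union>(chs C)) \<in> fmeasurable M" using m1 m2 by (rule fmeasurable.Un)
      qed
      also have "\<dots> \<le> measure M (\<Union>(T Q)) + measure M (\<Union>C\<in>CC. \<Union>(chs C))" using m1 m2 by (intro measure_Un_le fmeasurableD)
      also have "measure M (\<Union>C\<in>CC. \<Union>(chs C)) \<le> (\<Sum>C\<in>CC. measure M (\<Union>(chs C)))"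
        using CCfin mC by (intro measure_UNION_le) (auto intro: fmeasurableD)
      also have "\<dots> \<le> (\<Sum>C\<in>CC. 1 / 2 * measure M C)" using measure_chs by (intro sum_mono) (auto simp: CC_def)
      also have "\<dots> = 1 / 2 * measure M (\<Union>CC)"
      proof -
        have "measure M (\<Union>CC) = (\<Sum>C\<in>CC. measure M C)"
        proof (rule measure_Union')
          show "pairwise disjnt CC" using chs_disjoint[OF QS] by (auto simp: CC_def pairwise_def disjnt_def)
        qed (use CCfin CC fmeasurable_S in auto)
        then show ?thesis by (simp add: sum_distrib_left)
      qed
      also have "\<dots> \<le> 1 / 2 * measure M Q"
      proof (intro mult_left_mono measure_mono_fmeasurable)
        show "\<Union>CC \<subseteq> Q" using chs_sub[OF QS] by (auto simp: CC_def)
        show "\<Union>CC \<in> sets M" using fmeasurable_sub[OF CC] by (rule fmeasurableD)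
        show "Q \<in> fmeasurable M" using QS by (rule fmeasurable_S)
      qed simp
      finally show "measure M (\<Union>{P\<in>stree - S0. P \<subset> Q}) \<le> 3 / 4 * measure M Q" using T(2)[OF QS] by simp
    qed
  qed
  show ?thesis
  proof
    have "S0 \<union> (stree - S0) = stree" using stree.base by auto
    then show "\<exists>S1 S2. stree = S1 \<union> S2 \<and> sparse_tree M S1 \<and> sparse_tree M S2" using S0s T' by metis
  qed
qed

text \<open>Here \<open>P\<close> is the smallest cube of the finite tree containing
  \<open>z\<close>. One descends through the children containing \<open>z\<close> and telescopes the
  deviations by the triangle inequality; each passage to a child costs a multiple of the oscillation
  over the parent node.\<close>

lemma stree_domination:
  fixes dev :: "'a set \<Rightarrow> 'a set \<Rightarrow> real"
  assumes dev0: "\<And>Q P. 0 \<le> dev Q P" and K: "4 \<le> K"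
    and tri: "\<And>Q C P. Q \<in> S \<Longrightarrow> C \<in> S \<Longrightarrow> P \<in> S \<Longrightarrow> P \<subseteq> C \<Longrightarrow> C \<subseteq> Q \<Longrightarrow> dev Q P \<le> dev C P + dev Q C"
    and Tdev: "\<And>Q P. Q \<in> S \<Longrightarrow> P \<in> S \<Longrightarrow> P \<subset> Q \<Longrightarrow> P \<notin> T Q \<Longrightarrow> dev Q P \<le> 4 * dev Q Q"
    and parent: "\<And>Q C. Q \<in> S \<Longrightarrow> C \<in> S \<Longrightarrow> C \<subset> Q \<Longrightarrow> \<exists>C'\<in>S. C \<subset> C' \<and> C' \<subseteq> Q \<and> dev Q C \<le> K / 4 * dev Q C'"
    and P: "P \<in> S" "\<And>R. R \<in> S \<Longrightarrow> z \<in> R \<Longrightarrow> P \<subseteq> R" "z \<in> P" and Q: "Q \<in> stree" "z \<in> Q"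
  shows "dev Q P \<le> K * (\<Sum>R\<in>{R\<in>stree. R \<subseteq> Q}. dev R R * indicator R z)" using Q
proof (induction "card {R\<in>S. R \<subset> Q}" arbitrary: Q rule: less_induct)
  case less
  have QS: "Q \<in> S" using less.prems(1) by (rule stree_sub)
  have fin: "finite {R\<in>stree. R \<subseteq> Q'}" for Q' using finite_S stree_sub by (auto intro: finite_subset[of _ S])
  show ?case
  proof (cases "\<exists>C\<in>chs Q. z \<in> C")
    case True
    then obtain C where C: "C \<in> chs Q" "z \<in> C" by blast
    have CS: "C \<in> S" "C \<subset> Q" using chs_sub[OF QS C(1)] by auto
    have "{R\<in>S. R \<subset> C} \<subset> {R\<in>S. R \<subset> Q}" using CS by auto
    then have "card {R\<in>S. R \<subset> C} < card {R\<in>S. R \<subset> Q}" using finite_S by (intro psubset_card_mono) auto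
    then have IH: "dev C P \<le> K * (\<Sum>R\<in>{R\<in>stree. R \<subseteq> C}. dev R R * indicator R z)"
      using stree.step[OF less.prems(1) C(1)] C(2) by (rule less.hyps)
    \<comment> \<open>\<open>C\<close> itself may be a stopping cube, but a set strictly above the
      maximal candidate \<open>C\<close> is not one; passing from \<open>C\<close> to
      \<open>C'\<close> costs the doubling factor K/4.\<close>
    obtain C' where C': "C' \<in> S" "C \<subset> C'" "C' \<subseteq> Q" "dev Q C \<le> K / 4 * dev Q C'" using parent[OF QS CS] by blast
    have "dev Q C' \<le> 4 * dev Q Q"
    proof (cases "C' = Q")
      case False
      have "C' \<notin> T Q" using C(1) C'(2) by (auto simp: chs_def cand_def)
      then show ?thesis using Tdev[OF QS C'(1)] C'(3) False by auto
    qed (use dev0[of Q Q] in simp)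
    then have "K / 4 * dev Q C' \<le> K / 4 * (4 * dev Q Q)" using K by (intro mult_left_mono) auto
    then have QC: "dev Q C \<le> K * dev Q Q" using C'(4) by simp
    have "dev Q P \<le> dev C P + dev Q C" using QS CS P C(2) by (intro tri) auto
    also have "\<dots> \<le> K * ((\<Sum>R\<in>{R\<in>stree. R \<subseteq> C}. dev R R * indicator R z) + dev Q Q)"
      using IH QC by (simp add: distrib_left)
    also have "(\<Sum>R\<in>{R\<in>stree. R \<subseteq> C}. dev R R * indicator R z) + dev Q Q
      = (\<Sum>R\<in>insert Q {R\<in>stree. R \<subseteq> C}. dev R R * indicator R z)"
      using CS less.prems fin[of C] by (subst sum.insert) auto
    also have "K * \<dots> \<le> K * (\<Sum>R\<in>{R\<in>stree. R \<subseteq> Q}. dev R R * indicator R z)"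
      using K CS less.prems fin[of Q] dev0 by (intro mult_left_mono sum_mono2) auto
    finally show ?thesis .
  next
    case False
    have PQ: "P \<subseteq> Q" using P(2)[OF QS less.prems(2)] .
    have "dev Q P \<le> 4 * dev Q Q"
    proof (cases "P = Q")
      case False
      have "P \<notin> T Q"
      proof
        assume "P \<in> T Q"
        then obtain C where "C \<in> chs Q" "P \<subseteq> C" using cand_cover[OF QS, of P] by (auto simp: cand_def)
        then show False using \<open>\<not> (\<exists>C\<in>chs Q. z \<in> C)\<close> P(3) by auto
      qed
      then show ?thesis using Tdev[OF QS P(1)] PQ False by auto
    qed (use dev0[of Q Q] in simp)
    also have "\<dots> \<le> K * dev Q Q" using K dev0 by (intro mult_right_mono) auto
    also have "\<dots> = K * (\<Sum>R\<in>{Q}. dev R R * indicator R z)" using less.prems by simp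
    also have "\<dots> \<le> K * (\<Sum>R\<in>{R\<in>stree. R \<subseteq> Q}. dev R R * indicator R z)"
      using K less.prems fin[of Q] dev0 by (intro mult_left_mono sum_mono2) auto
    finally show ?thesis .
  qed
qed

end

section \<open>Dyadic cubes and differentiation\<close>

declare emeasure_completion [simp del]

lemma borel_measurable_component: "(\<lambda>x::real ^ 'n. x $ i) \<in> borel_measurable borel"
  by (intro borel_measurable_continuous_onI continuous_intros)

lemma cube_borel: "cube (a :: real ^ 'n) l \<in> sets borel"
proof -
  note [measurable] = borel_measurable_component
  have "{x \<in> space borel. \<forall>i. a $ i \<le> x $ i \<and> x $ i < a $ i + l} \<in> sets (borel :: (real ^ 'n) measure)" by measurable
  then show ?thesis by (simp add: cube_def)
qed

lemma cube_lebesgue [measurable]: "cube (a :: real ^ 'n) l \<in> sets lebesgue"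
  using cube_borel[of a l] by (simp add: sets_completionI_sets)

lemma emeasure_cube:
  fixes a :: "real ^ 'n"
  assumes "0 < l"
  shows "emeasure lebesgue (cube a l) = ennreal (l ^ CARD('n))"
proof -
  let ?u = "a + (\<chi> i. l)"
  have sub: "box a ?u \<subseteq> cube a l" "cube a l \<subseteq> cbox a ?u" by (auto simp: cube_def mem_box_cart) (meson less_imp_le)+
  have "cbox a ?u \<noteq> {}" using assms by (auto simp: interval_ne_empty_cart less_imp_le)
  then have "measure lborel (cbox a ?u) = l ^ CARD('n)" by (subst content_cbox_cart) auto
  then have c: "emeasure lborel (cbox a ?u) = ennreal (l ^ CARD('n))"
    by (metis emeasure_eq_ennreal_measure emeasure_lborel_cbox_finite less_irrefl infinity_ennreal_def)
  have b: "emeasure lborel (box a ?u) = emeasure lborel (cbox a ?u)"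
    by (simp only: emeasure_lborel_box_eq emeasure_lborel_cbox_eq)
  have "emeasure lborel (cube a l) = ennreal (l ^ CARD('n))"
    using emeasure_mono[OF sub(1), of lborel] emeasure_mono[OF sub(2), of lborel] cube_borel[of a l] b c
    by (intro antisym) auto
  then show ?thesis using cube_borel[of a l] by (simp add: emeasure_completion)
qed

lemma cube_not_empty: "0 < l \<Longrightarrow> a \<in> cube a l" by (simp add: cube_def)

lemma cube_subset_cbox: "cube (a :: real ^ 'n) l \<subseteq> cbox a (a + (\<chi> i. l))"
  by (auto simp: cube_def mem_box_cart) (meson less_imp_le)

lemma cube_inject:
  fixes a a' :: "real ^ 'n"
  assumes "cube a l = cube a' l'" "0 < l" "0 < l'"
  shows "a = a'" "l = l'"
proof -
  have sub: "a' $ i \<le> a $ i \<and> a $ i + l \<le> a' $ i + l'" if c: "cube a l \<subseteq> cube a' l'" and l: "0 < l"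
    for a a' :: "real ^ 'n" and l l' i
  proof
    show "a' $ i \<le> a $ i" using c cube_not_empty[OF l, of a] by (auto simp: cube_def)
    show "a $ i + l \<le> a' $ i + l'"
    proof (rule ccontr)
      assume "\<not> ?thesis"
      then have lt: "a' $ i + l' < a $ i + l" by simp
      define t where "t = max 0 (a' $ i + l' - a $ i)"
      have t: "0 \<le> t" "t < l" using l lt by (auto simp: t_def)
      have "a + (\<chi> i. t) \<in> cube a l" using t l by (simp add: cube_def)
      then have "a + (\<chi> i. t) \<in> cube a' l'" using c by auto
      then have "a $ i + t < a' $ i + l'" by (simp add: cube_def)
      then show False by (simp add: t_def)
    qed
  qed
  have 1: "a' $ i \<le> a $ i \<and> a $ i + l \<le> a' $ i + l'" for i using assms by (intro sub) auto
  have 2: "a $ i \<le> a' $ i \<and> a' $ i + l' \<le> a $ i + l" for i using assms by (intro sub) auto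
  show "a = a'" using 1 2 by (simp add: vec_eq_iff antisym)
  show "l = l'" using 1[of undefined] 2[of undefined] by simp
qed

text \<open>Dyadic cells of generation \<open>k\<close> are the fibres of the integer key, so that
  partition and nestedness reduce to arithmetic of floors; a coarser key is the integer quotient of
  a finer one.\<close>

definition dkey :: "real ^ 'n \<Rightarrow> real \<Rightarrow> nat \<Rightarrow> real ^ 'n \<Rightarrow> 'n \<Rightarrow> int" where
  "dkey a l k x = (\<lambda>i. \<lfloor>(x $ i - a $ i) * 2 ^ k / l\<rfloor>)"

definition dcube :: "real ^ 'n \<Rightarrow> real \<Rightarrow> nat \<Rightarrow> real ^ 'n \<Rightarrow> (real ^ 'n) set" where
  "dcube a l k x = {y. dkey a l k y = dkey a l k x}"

lemma mem_dcube [simp]: "x \<in> dcube a l k x" by (simp add: dcube_def)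

lemma dcube_eq_iff: "y \<in> dcube a l k x \<Longrightarrow> dcube a l k y = dcube a l k x" by (auto simp: dcube_def)

lemma dcube_eq_cube:
  assumes "0 < l"
  shows "dcube a l k x = cube (\<chi> i. a $ i + l / 2 ^ k * of_int (dkey a l k x i)) (l / 2 ^ k)"
proof -
  have "\<lfloor>(y $ i - a $ i) * 2 ^ k / l\<rfloor> = K \<longleftrightarrow>
    a $ i + l / 2 ^ k * of_int K \<le> y $ i \<and> y $ i < a $ i + l / 2 ^ k * of_int K + l / 2 ^ k" for y i K
    unfolding floor_eq_iff using assms by (simp add: field_simps)
  then show ?thesis by (simp add: dcube_def cube_def dkey_def fun_eq_iff)
qed

lemma dkey_mono:
  assumes "k \<le> k'" "dkey a l k' x = dkey a l k' y"
  shows "dkey a l k x = dkey a l k y"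
proof
  fix i
  have e: "dkey a l k x i = dkey a l k' x i div 2 ^ (k' - k)" for x
  proof -
    have "(2::real) ^ k' = 2 ^ k * 2 ^ (k' - k)" using assms(1) by (simp add: power_add[symmetric])
    then have "(x $ i - a $ i) * 2 ^ k / l = ((x $ i - a $ i) * 2 ^ k' / l) / real_of_int (2 ^ (k' - k))" by simp
    then show ?thesis
      unfolding dkey_def by (simp only: floor_divide_real_eq_div[of "2 ^ (k' - k)"] zero_le_power zero_le_numeral)
  qed
  show "dkey a l k x i = dkey a l k y i" unfolding e assms(2) ..
qed

lemma dcube_mono: "k \<le> k' \<Longrightarrow> dcube a l k' x \<subseteq> dcube a l k x"
  unfolding dcube_def by (intro Collect_mono impI) (rule dkey_mono)

lemma dcube_nested:
  assumes "k \<le> k'"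
  shows "dcube a l k' x \<subseteq> dcube a l k y \<or> dcube a l k' x \<inter> dcube a l k y = {}"
proof (cases "dcube a l k' x \<inter> dcube a l k y = {}")
  case False
  then obtain z where "z \<in> dcube a l k' x" "z \<in> dcube a l k y" by auto
  then show ?thesis using dcube_mono[OF assms, of a l z] dcube_eq_iff by metis
qed simp

lemma dcube_laminar:
  "dcube a l k x \<subseteq> dcube a l k' y \<or> dcube a l k' y \<subseteq> dcube a l k x \<or> dcube a l k x \<inter> dcube a l k' y = {}"
  using dcube_nested[of k k' a l y x] dcube_nested[of k' k a l x y] by (cases "k \<le> k'") auto

lemma dcube_0: "0 < l \<Longrightarrow> x \<in> cube a l \<Longrightarrow> dcube a l 0 x = cube a l"
proof -
  assume "0 < l" "x \<in> cube a l"
  then have "dkey a l 0 x i = 0" for i by (auto simp: dkey_def cube_def floor_eq_iff field_simps)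
  then show ?thesis using \<open>0 < l\<close> by (simp add: dcube_eq_cube vec_lambda_eta)
qed

lemma dcube_sub: "0 < l \<Longrightarrow> x \<in> cube a l \<Longrightarrow> dcube a l k x \<subseteq> cube a l"
  using dcube_mono[of 0 k a l x] dcube_0[of l x a] by auto

lemma emeasure_dcube: "0 < l \<Longrightarrow> emeasure lebesgue (dcube a l k (x :: real ^ 'n)) = ennreal ((l / 2 ^ k) ^ CARD('n))"
  unfolding dcube_eq_cube by (rule emeasure_cube) simp

lemma measure_dcube: "0 < l \<Longrightarrow> measure lebesgue (dcube a l k (x :: real ^ 'n)) = (l / 2 ^ k) ^ CARD('n)"
  unfolding measure_def emeasure_dcube by simp

lemma dcube_lebesgue [measurable]: "0 < l \<Longrightarrow> dcube a l k (x :: real ^ 'n) \<in> sets lebesgue"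
  unfolding dcube_eq_cube by (rule cube_lebesgue)

lemma finite_dcubes:
  fixes a :: "real ^ 'n"
  assumes "0 < l"
  shows "finite (dcube a l k ` cube a l)"
proof -
  let ?K = "Pi UNIV (\<lambda>_. {0..<2 ^ k}) :: ('n \<Rightarrow> int) set"
  have "finite (PiE (UNIV :: 'n set) (\<lambda>_. {0..<2 ^ k :: int}))" by (intro finite_PiE) auto
  then have "finite ?K" by (simp add: PiE_UNIV_domain)
  moreover have "dkey a l k ` cube a l \<subseteq> ?K"
  proof clarsimp
    fix x i assume x: "x \<in> cube a l"
    then have x: "a $ i \<le> x $ i" "x $ i < a $ i + l" by (auto simp: cube_def)
    have "(x $ i - a $ i) / l < 1" using x assms by simp
    then have "(x $ i - a $ i) / l * 2 ^ k < 1 * 2 ^ k" by (intro mult_strict_right_mono) auto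
    then have "0 \<le> (x $ i - a $ i) * 2 ^ k / l" "(x $ i - a $ i) * 2 ^ k / l < 2 ^ k" using x assms by auto
    then show "0 \<le> dkey a l k x i \<and> dkey a l k x i < 2 ^ k" unfolding dkey_def by (simp add: floor_less_iff)
  qed
  ultimately have "finite (dkey a l k ` cube a l)" by (rule finite_subset[rotated])
  then have "finite ((\<lambda>K. {y. dkey a l k y = K}) ` dkey a l k ` cube a l)" by simp
  then show ?thesis by (simp add: image_image dcube_def)
qed

text \<open>Links the inductively defined descendants with the cells given by keys; for finite
  families this places everything in a tree with finitely many generations.\<close>

lemma dyadic_descendants_dcube:
  fixes a :: "real ^ 'n"
  assumes P: "P \<in> dyadic_descendants (cube a l)" and l: "0 < l"
  shows "\<exists>k x. x \<in> cube a l \<and> P = dcube a l k x" using P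
proof (induction rule: dyadic_descendants.induct)
  case self
  show ?case using cube_not_empty[OF l, of a] dcube_0[OF l, of a a] by metis
next
  case (subdivide a' l' c)
  then obtain k x where x: "x \<in> cube a l" "cube a' l' = dcube a l k x" by blast
  define K where "K = dkey a l k x"
  have "cube a' l' = cube (\<chi> i. a $ i + l / 2 ^ k * of_int (K i)) (l / 2 ^ k)"
    unfolding x(2) K_def by (rule dcube_eq_cube[OF l])
  \<comment> \<open>The inductive definition speaks of corners and side lengths, which are recovered
    from the set: half-open cubes of positive side determine both.\<close>
  then have e: "a' = (\<chi> i. a $ i + l / 2 ^ k * of_int (K i))" "l' = l / 2 ^ k"
    using cube_inject[of a' l' _ "l / 2 ^ k"] subdivide.hyps l by auto
  have c: "c \<in> cube a' l'"
  proof -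
    have "a' $ i \<le> c $ i \<and> c $ i < a' $ i + l'" for i using subdivide.hyps(2) subdivide.hyps(3)[of i] by auto
    then show ?thesis by (simp add: cube_def)
  qed
  then have c': "c \<in> cube a l" using x dcube_sub[OF l x(1), of k] by auto
  have "c $ i = a $ i + l / 2 ^ Suc k * of_int (dkey a l (Suc k) c i)" for i
  proof -
    have "c $ i = a' $ i \<or> c $ i = a' $ i + l' / 2" using subdivide.hyps by blast
    \<comment> \<open>Subdivision doubles the integer coordinate and adds 1 if the corner lies in
      the upper half.\<close>
    then obtain j :: int where j: "c $ i = a $ i + l / 2 ^ Suc k * of_int j"
    proof
      assume "c $ i = a' $ i"
      then show ?thesis by (intro that[of "2 * K i"]) (simp add: e)
    next
      assume "c $ i = a' $ i + l' / 2"
      then show ?thesis by (intro that[of "2 * K i + 1"]) (simp add: e field_simps)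
    qed
    then have "(c $ i - a $ i) * 2 ^ Suc k / l = of_int j" using l by simp
    then have "dkey a l (Suc k) c i = j" by (simp only: dkey_def floor_of_int)
    then show ?thesis using j by simp
  qed
  then have "(\<chi> i. a $ i + l / 2 ^ Suc k * of_int (dkey a l (Suc k) c i)) = c" by (simp add: vec_eq_iff)
  then have "dcube a l (Suc k) c = cube c (l' / 2)"
    using dcube_eq_cube[OF l, of a "Suc k" c] e(2) by (simp add: mult.commute)
  then show ?case using c' by metis
qed

lemma dist_dcube:
  fixes x y :: "real ^ 'n"
  assumes l: "0 < l" and y: "y \<in> dcube a l k x"
  shows "dist x y \<le> real CARD('n) * (l / 2 ^ k)"
proof -
  let ?c = "\<chi> i. a $ i + l / 2 ^ k * of_int (dkey a l k x i)"
  have "x \<in> cube ?c (l / 2 ^ k)" "y \<in> cube ?c (l / 2 ^ k)"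
    using y mem_dcube[of x a l k] unfolding dcube_eq_cube[OF l] by auto
  then have "\<bar>(x - y) $ i\<bar> \<le> l / 2 ^ k" for i unfolding cube_def by (auto simp: abs_le_iff) (smt (verit))+
  then have "(\<Sum>i\<in>UNIV. \<bar>(x - y) $ i\<bar>) \<le> (\<Sum>i\<in>(UNIV :: 'n set). l / 2 ^ k)" by (intro sum_mono)
  then show ?thesis using norm_le_l1_cart[of "x - y"] by (simp add: dist_norm)
qed

section \<open>Differentiation along dyadic cubes\<close>

definition dyadic_avg :: "real ^ 'n \<Rightarrow> real \<Rightarrow> (real ^ 'n \<Rightarrow> ennreal) \<Rightarrow> nat \<Rightarrow> real ^ 'n \<Rightarrow> ennreal" where
  "dyadic_avg a l \<phi> k x = integ lebesgue (dcube a l k x) \<phi> / emeasure lebesgue (dcube a l k x)"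

lemma dyadic_avg_simple:
  assumes l: "0 < l" and x: "x \<in> cube a l"
  shows "dyadic_avg a l \<phi> k x = (\<Sum>P\<in>dcube a l k ` cube a l. (integ lebesgue P \<phi>) / emeasure lebesgue P * indicator P x)"
proof -
  have "(\<Sum>P\<in>dcube a l k ` cube a l. (integ lebesgue P \<phi>) / emeasure lebesgue P * indicator P x)
    = (\<Sum>P\<in>{dcube a l k x}. (integ lebesgue P \<phi>) / emeasure lebesgue P * indicator P x)"
    using x dcube_eq_iff[of x a l k] by (intro sum.mono_neutral_right finite_dcubes l) (auto simp: indicator_def)
  then show ?thesis by (simp add: dyadic_avg_def)
qed

lemma dyadic_avg_measurable:
  assumes l: "0 < l"
  shows "(\<lambda>x. dyadic_avg a l \<phi> k x * indicator (cube a l) x) \<in> borel_measurable (lebesgue :: (real ^ 'n) measure)"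
proof -
  have "(\<lambda>x. dyadic_avg a l \<phi> k x * indicator (cube a l) x)
    = (\<lambda>x. (\<Sum>P\<in>dcube a l k ` cube a l. (integ lebesgue P \<phi>) / emeasure lebesgue P * indicator P x) * indicator (cube a l) x)"
    using dyadic_avg_simple[OF l, of _ a \<phi> k] by (auto simp: indicator_def fun_eq_iff)
  also have "\<dots> \<in> borel_measurable lebesgue"
    using l by (intro borel_measurable_times_ennreal borel_measurable_sum borel_measurable_indicator borel_measurable_const) auto
  finally show ?thesis .
qed

text \<open>On the set where \<open>\<phi> > c\<close> but the averages drop
  below \<open>c\<close> infinitely often, maximal dyadic cubes inside an open neighbourhood show that
  \<open>\<phi>\<close> has integral at most \<open>c\<close> times the measure of the set.\<close>

lemma dyadic_differentiation:
  fixes \<phi> :: "real ^ 'n \<Rightarrow> ennreal"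
  assumes l: "0 < l" and [measurable]: "\<phi> \<in> borel_measurable lebesgue"
  shows "AE x in lebesgue. x \<in> cube a l \<longrightarrow> \<phi> x \<le> liminf (\<lambda>k. dyadic_avg a l \<phi> k x)"
proof -
  let ?Q = "cube a l"
  define A where "A k x = dyadic_avg a l \<phi> k x * indicator ?Q x" for k x
  have [measurable]: "A k \<in> borel_measurable lebesgue" for k
    unfolding A_def[abs_def] by (rule dyadic_avg_measurable[OF l])
  have A: "A k x = dyadic_avg a l \<phi> k x" if "x \<in> ?Q" for k x using that by (simp add: A_def)
  have null: "AE x in lebesgue. \<not> (x \<in> ?Q \<and> ennreal c < \<phi> x \<and> liminf (\<lambda>k. A k x) < ennreal c)" if c: "0 < c" for c :: real
  proof -
    define Z where "Z = {x\<in>space lebesgue. x \<in> ?Q \<and> ennreal c < \<phi> x \<and> liminf (\<lambda>k. A k x) < ennreal c}"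
    have Z [measurable]: "Z \<in> sets lebesgue" unfolding Z_def by measurable
    have Zfin: "emeasure lebesgue Z < top"
    proof -
      have "emeasure lebesgue Z \<le> emeasure lebesgue ?Q" by (intro emeasure_mono) (auto simp: Z_def)
      also have "\<dots> < top" using l by (simp add: emeasure_cube)
      finally show ?thesis .
    qed
    have le: "integ lebesgue Z \<phi> \<le> ennreal c * emeasure lebesgue Z + ennreal c * ennreal e" if e: "0 < e" for e
    proof -
      obtain U where U: "open U" "Z \<subseteq> U" "U - Z \<in> lmeasurable" "emeasure lebesgue (U - Z) < ennreal e"
        using sets_lebesgue_outer_open[OF Z e] by blast
      have [measurable]: "U \<in> sets lebesgue" using U(1) by (simp add: borel_open)
      define good where "good k x \<longleftrightarrow> dcube a l k x \<subseteq> U \<and> A k x < ennreal c" for k x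
      \<comment> \<open>Points whose first good generation is \<open>k\<close>; the cells making up
        all the sets \<open>V k\<close> are the maximal good cubes and hence disjoint.\<close>
      define V where "V k = {x\<in>?Q. good k x \<and> (\<forall>j<k. \<not> good j x)}" for k
      have good_eq: "good j x = good j y" if "y \<in> dcube a l k x" "j \<le> k" "x \<in> ?Q" for j k x y
      proof -
        have "y \<in> dcube a l j x" using dcube_mono[OF that(2)] that(1) by auto
        then have "dcube a l j y = dcube a l j x" by (rule dcube_eq_iff)
        moreover have "y \<in> ?Q" using dcube_sub[OF l that(3), of k] that(1) by auto
        ultimately show ?thesis using that(3) by (simp add: good_def A dyadic_avg_def)
      qed
      have VU: "V k = \<Union>(dcube a l k ` V k)" for k
      proof
        show "\<Union>(dcube a l k ` V k) \<subseteq> V k"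
        proof clarify
          fix x y assume x: "x \<in> V k" and y: "y \<in> dcube a l k x"
          then have xQ: "x \<in> ?Q" by (simp add: V_def)
          have "y \<in> ?Q" using dcube_sub[OF l xQ, of k] y by auto
          then show "y \<in> V k" using x good_eq[OF y _ xQ] by (auto simp: V_def)
        qed
      qed auto
      have finV: "finite (dcube a l k ` V k)" for k
        by (rule finite_subset[OF _ finite_dcubes[OF l, of a k]]) (auto simp: V_def)
      have [measurable]: "V k \<in> sets lebesgue" for k using finV l by (subst VU) (auto intro!: sets.finite_Union)
      have disjC: "disjoint_family_on (\<lambda>P. P) (dcube a l k ` V k)" for k
      proof (clarsimp simp: disjoint_family_on_def)
        fix x y assume "dcube a l k x \<noteq> dcube a l k y"
        then show "dcube a l k x \<inter> dcube a l k y = {}" using dcube_eq_iff[of _ a l k] by blast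
      qed
      have VA: "integ lebesgue (V k) \<phi> \<le> ennreal c * emeasure lebesgue (V k)" for k
      proof -
        have ind: "indicator (V k) x = (\<Sum>P\<in>dcube a l k ` V k. indicator P x :: ennreal)" for x
          using disjC finV by (subst VU) (auto intro!: indicator_UN_disjoint[of _ "\<lambda>P. P", simplified])
        have P: "integ lebesgue P \<phi> \<le> ennreal c * emeasure lebesgue P" if P: "P \<in> dcube a l k ` V k" for P
        proof -
          obtain x where x: "x \<in> V k" "P = dcube a l k x" using P by blast
          then have "integ lebesgue P \<phi> / emeasure lebesgue P \<le> ennreal c"
            using A[of x k] by (simp add: V_def good_def dyadic_avg_def less_imp_le)
          then have "integ lebesgue P \<phi> / emeasure lebesgue P * emeasure lebesgue P \<le> ennreal c * emeasure lebesgue P"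
            by (rule mult_right_mono) simp
          moreover have "integ lebesgue P \<phi> / emeasure lebesgue P * emeasure lebesgue P = integ lebesgue P \<phi>"
            unfolding x(2) emeasure_dcube[OF l] using l by (intro ennreal_divide_mult) auto
          ultimately show ?thesis by simp
        qed
        have Ps: "P \<in> sets lebesgue" if "P \<in> dcube a l k ` V k" for P using that l by auto
        have "integ lebesgue (V k) \<phi> = (\<Sum>P\<in>dcube a l k ` V k. \<integral>\<^sup>+x\<in>P. \<phi> x \<partial>lebesgue)"
          unfolding ind sum_distrib_left using Ps by (intro nn_integral_sum) auto
        also have "\<dots> \<le> (\<Sum>P\<in>dcube a l k ` V k. ennreal c * emeasure lebesgue P)" by (intro sum_mono P)
        also have "\<dots> = ennreal c * emeasure lebesgue (\<Union>(dcube a l k ` V k))"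
        proof -
          have "(\<Sum>P\<in>dcube a l k ` V k. emeasure lebesgue P) = emeasure lebesgue (\<Union>P\<in>dcube a l k ` V k. P)"
            using disjC finV Ps by (intro sum_emeasure) auto
          then show ?thesis by (simp add: sum_distrib_left[symmetric])
        qed
        finally show ?thesis using VU by simp
      qed
      have disjV: "disjoint_family V" by (auto simp: disjoint_family_on_def V_def) (metis linorder_neqE_nat)
      have ZV: "Z \<subseteq> (\<Union>k. V k)"
      proof
        fix x assume x: "x \<in> Z"
        then have xQ: "x \<in> ?Q" and xU: "x \<in> U" using U by (auto simp: Z_def)
        obtain r where r: "0 < r" "ball x r \<subseteq> U" using U(1) xU open_contains_ball by blast
        have "(\<lambda>k. real CARD('n) * (l / 2 ^ k)) \<longlonglongrightarrow> real CARD('n) * 0"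
          by (intro tendsto_mult tendsto_const LIMSEQ_divide_realpow_zero) auto
        then have "\<forall>\<^sub>F k in sequentially. real CARD('n) * (l / 2 ^ k) < r"
          using r by (intro order_tendstoD(2)[where y = "real CARD('n) * 0"]) auto
        then have ev: "\<forall>\<^sub>F k in sequentially. dcube a l k x \<subseteq> U"
        proof eventually_elim
          case (elim k)
          have "y \<in> U" if "y \<in> dcube a l k x" for y using dist_dcube[OF l that] elim r by (auto simp: subset_iff)
          then show ?case by blast
        qed
        have lim: "liminf (\<lambda>k. A k x) < ennreal c" using x by (simp add: Z_def)
        have "\<exists>\<^sub>F k in sequentially. A k x < ennreal c" unfolding frequently_def
        proof
          assume "\<forall>\<^sub>F k in sequentially. \<not> A k x < ennreal c"
          then have "\<forall>\<^sub>F k in sequentially. ennreal c \<le> A k x" by (simp only: not_less)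
          then have "ennreal c \<le> liminf (\<lambda>k. A k x)" by (rule Liminf_bounded)
          with lim show False by (meson not_less)
        qed
        then have "\<exists>\<^sub>F k in sequentially. good k x" using frequently_eventually_frequently[OF _ ev] unfolding good_def
          by (simp add: conj_commute)
        then obtain k where "good k x" by (auto dest: frequently_ex)
        then have g: "good (LEAST k. good k x) x" by (rule LeastI)
        have "\<forall>j<(LEAST k. good k x). \<not> good j x" using not_less_Least[of _ "\<lambda>k. good k x"] by blast
        with g xQ have "x \<in> V (LEAST k. good k x)" unfolding V_def by blast
        then show "x \<in> (\<Union>k. V k)" by blast
      qed
      have VsubU: "(\<Union>k. V k) \<subseteq> U" using mem_dcube by (auto simp: V_def good_def subset_iff)
      have "integ lebesgue Z \<phi> \<le> (\<integral>\<^sup>+x\<in>(\<Union>k. V k). \<phi> x \<partial>lebesgue)"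
        using ZV by (intro nn_integral_mono) (auto simp: indicator_def)
      also have "\<dots> = (\<Sum>k. \<integral>\<^sup>+x\<in>V k. \<phi> x \<partial>lebesgue)" using disjV by (intro nn_integral_disjoint_family) auto
      also have "\<dots> \<le> (\<Sum>k. ennreal c * emeasure lebesgue (V k))" by (intro suminf_le VA) auto
      also have "\<dots> = ennreal c * emeasure lebesgue (\<Union>k. V k)"
        using disjV by (simp add: suminf_emeasure image_subset_iff)
      also have "\<dots> \<le> ennreal c * emeasure lebesgue (Z \<union> (U - Z))"
        using VsubU by (intro mult_left_mono emeasure_mono) auto
      also have "\<dots> \<le> ennreal c * (emeasure lebesgue Z + emeasure lebesgue (U - Z))"
        by (intro mult_left_mono emeasure_subadditive) auto
      also have "\<dots> \<le> ennreal c * (emeasure lebesgue Z + ennreal e)"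
        using U(4) by (intro mult_left_mono add_left_mono) auto
      finally show ?thesis by (simp add: distrib_left)
    qed
    have le': "integ lebesgue Z \<phi> \<le> ennreal c * emeasure lebesgue Z"
    proof (rule ennreal_le_epsilon)
      fix e :: real assume e: "0 < e"
      then have "0 < e / c" using c by simp
      moreover have "ennreal c * ennreal (e / c) = ennreal e" using c e by (simp add: ennreal_mult[symmetric])
      ultimately show "integ lebesgue Z \<phi> \<le> ennreal c * emeasure lebesgue Z + ennreal e" using le[of "e / c"] by simp
    qed
    have "integ lebesgue Z \<phi> = (\<integral>\<^sup>+x. (\<phi> x - ennreal c) * indicator Z x + ennreal c * indicator Z x \<partial>lebesgue)"
      by (intro nn_integral_cong) (auto simp: indicator_def Z_def diff_add_cancel_ennreal less_imp_le)
    also have "\<dots> = (\<integral>\<^sup>+x\<in>Z. (\<phi> x - ennreal c) \<partial>lebesgue) + ennreal c * emeasure lebesgue Z"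
      by (subst nn_integral_add) (auto simp: nn_integral_cmult_indicator)
    finally have "ennreal c * emeasure lebesgue Z + (\<integral>\<^sup>+x\<in>Z. (\<phi> x - ennreal c) \<partial>lebesgue) \<le> ennreal c * emeasure lebesgue Z + 0"
      using le' by (simp add: add.commute)
    \<comment> \<open>The finite measure of \<open>Z\<close> allows cancellation, so \<phi> - c has
      zero integral over \<open>Z\<close>. Since it is positive there, \<open>Z\<close> is a null
      set.\<close>
    moreover have "ennreal c * emeasure lebesgue Z \<noteq> top" using Zfin by (simp add: ennreal_mult_eq_top_iff)
    ultimately have "(\<integral>\<^sup>+x\<in>Z. (\<phi> x - ennreal c) \<partial>lebesgue) = 0" unfolding ennreal_add_left_cancel_le by simp
    then have "AE x in lebesgue. (\<phi> x - ennreal c) * indicator Z x = 0" by (subst (asm) nn_integral_0_iff_AE) auto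
    then show ?thesis by (elim eventually_mono) (auto simp: Z_def indicator_def diff_eq_0_iff_ennreal split: if_splits)
  qed
  \<comment> \<open>Rational thresholds are countable and separate any two distinct values, so the
    exceptional null sets can be united.\<close>
  have "AE x in lebesgue. \<forall>c\<in>{c\<in>\<rat>. 0 < c}. \<not> (x \<in> ?Q \<and> ennreal c < \<phi> x \<and> liminf (\<lambda>k. A k x) < ennreal c)"
    using null countable_rat by (intro AE_ball_countable') (auto intro: countable_subset[OF _ countable_rat])
  then show ?thesis
  proof eventually_elim
    case *: (elim x)
    show ?case
    proof (intro impI, rule ccontr)
    assume x: "x \<in> ?Q" and "\<not> \<phi> x \<le> liminf (\<lambda>k. dyadic_avg a l \<phi> k x)"
    then have lt: "liminf (\<lambda>k. A k x) < \<phi> x" using A[OF x] by simp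
    then obtain d where d: "liminf (\<lambda>k. A k x) < d" "d < \<phi> x" using dense by blast
    have "liminf (\<lambda>k. A k x) \<noteq> top" "d \<noteq> top" using d by auto
    then obtain s t where s: "liminf (\<lambda>k. A k x) = ennreal s" "0 \<le> s" and t: "d = ennreal t" "0 \<le> t"
      by (meson ennreal_cases)
    have "s < t" using d s t by (simp add: ennreal_less_iff)
    then obtain c where c: "c \<in> \<rat>" "s < c" "c < t" using Rats_dense_in_real by blast
    then have c': "0 < c" "ennreal s < ennreal c" "ennreal c < ennreal t" using s t by (auto simp: ennreal_less_iff)
    then have "ennreal c < \<phi> x" using d t by (meson order_less_trans)
    then show False using * x c(1) c' s by auto
    qed
  qed
qed

section \<open>Domination of oscillations by sparse sums\<close>

text \<open>Chebyshev's inequality for a laminar family: the maximal members are disjoint and have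
  the same union.\<close>

lemma (in set_tree) Union_le_nn_integral:
  assumes A: "A \<subseteq> S" "\<And>P. P \<in> A \<Longrightarrow> P \<subseteq> Q" "\<And>P. P \<in> A \<Longrightarrow> c * emeasure M P \<le> integ M P \<psi>"
    and [measurable]: "\<psi> \<in> borel_measurable M"
  shows "c * emeasure M (\<Union>A) \<le> integ M Q \<psi>"
proof -
  define B where "B = {P\<in>A. \<forall>R\<in>A. P \<subseteq> R \<longrightarrow> P = R}"
  have fin: "finite A" "finite B" using finite_subset[OF A(1) finite_S] by (auto simp: B_def)
  have BS: "P \<in> sets M" if "P \<in> B" for P using that A(1) sets_S by (auto simp: B_def)
  have "\<Union>A \<subseteq> \<Union>B"
  proof
    fix z assume "z \<in> \<Union>A"
    then obtain P where P: "P \<in> A" "z \<in> P" by blast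
    from finite_has_maximal2[OF fin(1) P(1)] obtain R where "R \<in> A" "P \<subseteq> R" "\<forall>R'\<in>A. R \<subseteq> R' \<longrightarrow> R = R'" by blast
    then show "z \<in> \<Union>B" using P by (auto simp: B_def)
  qed
  then have AB: "\<Union>A = \<Union>B" by (auto simp: B_def)
  have disj: "disjoint_family_on (\<lambda>P. P) B" unfolding disjoint_family_on_def
  proof (intro ballI impI)
    fix P R assume "P \<in> B" "R \<in> B" "P \<noteq> R"
    then show "P \<inter> R = {}" using laminar[of P R] A(1) by (auto simp: B_def)
  qed
  have "emeasure M (\<Union>B) = (\<Sum>P\<in>B. emeasure M P)"
    using sum_emeasure[of "\<lambda>P. P" B M] disj BS fin by (auto simp: subset_iff)
  then have "c * emeasure M (\<Union>B) = (\<Sum>P\<in>B. c * emeasure M P)" by (simp add: sum_distrib_left)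
  also have "\<dots> \<le> (\<Sum>P\<in>B. \<integral>\<^sup>+z\<in>P. \<psi> z \<partial>M)" using A(3) by (intro sum_mono) (auto simp: B_def)
  also have "\<dots> = (\<integral>\<^sup>+z. (\<Sum>P\<in>B. \<psi> z * indicator P z) \<partial>M)" using BS by (intro nn_integral_sum[symmetric]) auto
  also have "\<dots> \<le> integ M Q \<psi>"
  proof (intro nn_integral_mono)
    fix z
    show "(\<Sum>P\<in>B. \<psi> z * indicator P z) \<le> \<psi> z * indicator Q z"
    proof (cases "\<exists>P\<in>B. z \<in> P")
      case True
      then obtain P where P: "P \<in> B" "z \<in> P" by blast
      have "z \<notin> R" if "R \<in> B" "R \<noteq> P" for R using disj that P unfolding disjoint_family_on_def by blast
      then have "(\<Sum>P\<in>B. \<psi> z * indicator P z) = (\<Sum>R\<in>{P}. \<psi> z * indicator R z)"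
        using fin P by (intro sum.mono_neutral_right) auto
      moreover have "z \<in> Q" using P A(2) by (auto simp: B_def)
      ultimately show ?thesis using P by simp
    next
      case False
      then have "(\<Sum>P\<in>B. \<psi> z * indicator P z) = 0" by (intro sum.neutral) auto
      then show ?thesis by simp
    qed
  qed
  finally show ?thesis by (simp add: AB)
qed

text \<open>The union on the left is covered by at least \<open>k\<close> members of \<open>S\<close> below \<open>Q\<close>, whereas the
  sparseness of \<open>S\<close> is a Carleson packing condition.\<close>

lemma (in set_tree) sparse_generation:
  assumes E: "\<And>Q. Q \<in> S \<Longrightarrow> E Q \<subseteq> Q" "\<And>Q. Q \<in> S \<Longrightarrow> E Q \<in> sets M"
      "\<And>Q. Q \<in> S \<Longrightarrow> \<eta> * measure M Q \<le> measure M (E Q)" "disjoint_family_on E S"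
    and \<eta>: "0 < \<eta>" "4 \<le> \<eta> * real k"
  assumes S': "S' = {R\<in>S. card {P\<in>S. R \<subset> P} mod k = i}" and Q: "Q \<in> S'"
  shows "measure M (\<Union>{P\<in>S'. P \<subset> Q}) \<le> 1 / 4 * measure M Q"
proof -
  let ?U = "\<Union>{P\<in>S'. P \<subset> Q}" and ?B = "{R\<in>S. R \<subseteq> Q}"
  have QS: "Q \<in> S" using Q by (simp add: S')
  have fB: "finite ?B" using finite_S by simp
  have k: "0 < k" using \<eta> by (intro gr0I) simp
  have Uf: "?U \<in> fmeasurable M" by (intro fmeasurable_Union) (auto simp: S')
  have count_le: "real k * indicator ?U z \<le> (\<Sum>R\<in>?B. indicator R z)" for z
  proof (cases "z \<in> ?U")
    case True
    then obtain P where P: "P \<in> S'" "P \<subset> Q" "z \<in> P" by blast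
    have PS: "P \<in> S" using P by (simp add: S')
    have fin: "finite {R\<in>S. R' \<subset> R}" for R' using finite_S by simp
    have sub: "{R\<in>S. Q \<subset> R} \<subset> {R\<in>S. P \<subset> R}" using P(2) QS by auto
    then have lt: "card {R\<in>S. Q \<subset> R} < card {R\<in>S. P \<subset> R}" using fin by (intro psubset_card_mono)
    \<comment> \<open>Within a residue class depths differ by a multiple of k, so at least k cubes
      that contain \<open>P\<close> lie inside \<open>Q\<close>.\<close>
    have "card {R\<in>S. P \<subset> R} mod k = card {R\<in>S. Q \<subset> R} mod k" using P(1) Q by (simp add: S')
    then have "k dvd card {R\<in>S. P \<subset> R} - card {R\<in>S. Q \<subset> R}" using lt by (simp add: mod_eq_dvd_iff_nat)
    then have "k \<le> card {R\<in>S. P \<subset> R} - card {R\<in>S. Q \<subset> R}" using lt by (intro dvd_imp_le) auto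
    also have "\<dots> = card ({R\<in>S. P \<subset> R} - {R\<in>S. Q \<subset> R})" using sub fin by (intro card_Diff_subset[symmetric]) auto
    also have "\<dots> \<le> card {R\<in>?B. z \<in> R}"
    proof (rule card_mono)
      show "{R\<in>S. P \<subset> R} - {R\<in>S. Q \<subset> R} \<subseteq> {R\<in>?B. z \<in> R}"
      proof
        fix R assume R: "R \<in> {R\<in>S. P \<subset> R} - {R\<in>S. Q \<subset> R}"
        have "R \<subseteq> Q \<or> Q \<subseteq> R" using comparable[of z R Q] R QS P by auto
        then show "R \<in> {R\<in>?B. z \<in> R}" using R P by auto
      qed
    qed (use finite_S in auto)
    finally have "k \<le> card {R\<in>?B. z \<in> R}" .
    also have "real (card {R\<in>?B. z \<in> R}) = (\<Sum>R\<in>?B. indicator R z)"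
      using fB by (simp add: indicator_def sum.If_cases Int_def del: mem_Collect_eq) simp
    finally show ?thesis using True by simp
  qed (simp add: sum_nonneg)
  have "real k * measure M ?U = (\<integral>z. real k * indicator ?U z \<partial>M)" using Uf by (simp add: fmeasurableD)
  also have "\<dots> \<le> (\<integral>z. (\<Sum>R\<in>?B. indicator R z) \<partial>M)"
  proof (rule integral_mono[OF _ _ count_le])
    show "integrable M (\<lambda>z. real k * indicator ?U z :: real)"
      using Uf by (intro integrable_mult_right integrable_real_indicator) (auto simp: fmeasurable_def)
    show "integrable M (\<lambda>z. (\<Sum>R\<in>?B. indicator R z) :: real)"
      using sets_S emeasure_finite by (intro Bochner_Integration.integrable_sum integrable_real_indicator) auto
  qed
  also have "\<dots> = (\<Sum>R\<in>?B. measure M R)"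
  proof -
    have "(\<integral>z. (\<Sum>R\<in>?B. indicator R z) \<partial>M) = (\<Sum>R\<in>?B. (\<integral>z. indicator R z \<partial>M :: real))"
      using sets_S emeasure_finite by (intro Bochner_Integration.integral_sum integrable_real_indicator) auto
    also have "\<dots> = (\<Sum>R\<in>?B. measure M R)" using sets_S by (intro sum.cong) auto
    finally show ?thesis .
  qed
  finally have 1: "real k * measure M ?U \<le> (\<Sum>R\<in>?B. measure M R)" .
  \<comment> \<open>The Carleson packing bound: the disjoint sets \<open>E R\<close> fit into
    \<open>Q\<close>.\<close>
  have "\<eta> * (\<Sum>R\<in>?B. measure M R) \<le> (\<Sum>R\<in>?B. measure M (E R))"
    unfolding sum_distrib_left using E(3) by (intro sum_mono) auto
  also have "\<dots> = measure M (\<Union>R\<in>?B. E R)"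
  proof (rule measure_finite_Union[symmetric])
    show "disjoint_family_on E ?B" using E(4) by (auto simp: disjoint_family_on_def)
    show "emeasure M (E R) \<noteq> \<infinity>" if "R \<in> ?B" for R
      using emeasure_mono[OF E(1)[of R] sets_S] emeasure_finite[of R] that by (auto simp: top_unique)
  qed (use fB E in auto)
  also have "\<dots> \<le> measure M Q" using E fB QS by (intro measure_mono_fmeasurable[OF _ _ fmeasurable_S]) (fastforce, auto)
  finally have 2: "\<eta> * (\<Sum>R\<in>?B. measure M R) \<le> measure M Q" .
  have "4 * measure M ?U \<le> \<eta> * real k * measure M ?U" using \<eta> by (intro mult_right_mono) auto
  also have "\<dots> \<le> \<eta> * (\<Sum>R\<in>?B. measure M R)" using 1 \<eta> by (simp add: mult.assoc)
  finally show ?thesis using 2 by simp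
qed

section \<open>Mean oscillation over cubes and its stopping cubes\<close>

lemma cube_in_cubes: "0 < l \<Longrightarrow> cube a l \<in> cubes" by (auto simp: cubes_def)

lemma cubes_sets: "P \<in> cubes \<Longrightarrow> P \<in> sets lebesgue" by (auto simp: cubes_def)

lemma cubes_emeasure: "P \<in> cubes \<Longrightarrow> 0 < emeasure lebesgue P" "P \<in> cubes \<Longrightarrow> emeasure lebesgue P < top"
  by (auto simp: cubes_def emeasure_cube)

lemma cubes_measure:
  assumes "P \<in> cubes"
  shows "0 < measure lebesgue P" "emeasure lebesgue P = ennreal (measure lebesgue P)"
proof -
  show e: "emeasure lebesgue P = ennreal (measure lebesgue P)"
    using cubes_emeasure(2)[OF assms] by (intro emeasure_eq_ennreal_measure) simp
  show "0 < measure lebesgue P" using cubes_emeasure(1)[OF assms] unfolding e by simp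
qed

lemma cubes_integrable:
  fixes h :: "real ^ 'n \<Rightarrow> 'b::euclidean_space"
  assumes "locally_integrable h" "P \<in> cubes"
  shows "set_integrable lebesgue P h"
proof -
  obtain a l where P: "P = cube a l" using assms(2) by (auto simp: cubes_def)
  have "set_integrable lebesgue (cbox a (a + (\<chi> i. l))) h"
    using assms(1) compact_cbox by (auto simp: locally_integrable_def)
  then show ?thesis unfolding P using cube_subset_cbox by (rule set_integrable_subset[OF _ cube_lebesgue])
qed

lemma mean_deviation:
  fixes b :: "real ^ 'n \<Rightarrow> complex"
  assumes b: "locally_integrable b" and P: "P \<in> cubes"
  shows "(\<integral>\<^sup>+y\<in>P. ennreal (norm (b y - c)) \<partial>lebesgue) < top"
    and "ennreal (norm (mean b P - c)) * emeasure lebesgue P \<le> (\<integral>\<^sup>+y\<in>P. ennreal (norm (b y - c)) \<partial>lebesgue)"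
proof -
  define u where "u y = indicator P y *\<^sub>R b y - indicator P y *\<^sub>R c" for y
  have i1: "integrable lebesgue (\<lambda>y. indicator P y *\<^sub>R b y)"
    using cubes_integrable[OF b P] by (simp add: set_integrable_def)
  have i2: "integrable lebesgue (\<lambda>y. indicator P y *\<^sub>R c)"
    using cubes_sets[OF P] cubes_emeasure(2)[OF P] by (intro integrable_scaleR_left integrable_real_indicator) auto
  have u: "integrable lebesgue u" unfolding u_def using i1 i2 by (rule Bochner_Integration.integrable_diff)
  have "(\<integral>\<^sup>+y\<in>P. ennreal (norm (b y - c)) \<partial>lebesgue) = (\<integral>\<^sup>+y. ennreal (norm (u y)) \<partial>lebesgue)"
    by (intro nn_integral_cong) (auto simp: u_def indicator_def)
  also have "\<dots> = ennreal (\<integral>y. norm (u y) \<partial>lebesgue)" using u by (intro nn_integral_eq_integral) auto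
  finally have eq: "(\<integral>\<^sup>+y\<in>P. ennreal (norm (b y - c)) \<partial>lebesgue) = ennreal (\<integral>y. norm (u y) \<partial>lebesgue)" .
  show "(\<integral>\<^sup>+y\<in>P. ennreal (norm (b y - c)) \<partial>lebesgue) < top" unfolding eq by simp
  have "(\<integral>y. u y \<partial>lebesgue) = (\<integral>y. indicator P y *\<^sub>R b y \<partial>lebesgue) - (\<integral>y. indicator P y *\<^sub>R c \<partial>lebesgue)"
    unfolding u_def using i1 i2 by (rule Bochner_Integration.integral_diff)
  also have "(\<integral>y. indicator P y *\<^sub>R c \<partial>lebesgue) = measure lebesgue P *\<^sub>R c"
    using cubes_sets[OF P] cubes_emeasure(2)[OF P] by (subst integral_scaleR_left) auto
  also have "(\<integral>y. indicator P y *\<^sub>R b y \<partial>lebesgue) = measure lebesgue P *\<^sub>R mean b P"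
    using cubes_measure(1)[OF P] by (simp add: mean_def set_lebesgue_integral_def)
  finally have "norm (\<integral>y. u y \<partial>lebesgue) = norm (measure lebesgue P *\<^sub>R (mean b P - c))" by (simp only: scaleR_diff_right)
  then have "norm (mean b P - c) * measure lebesgue P = norm (\<integral>y. u y \<partial>lebesgue)" by (simp add: mult.commute)
  also have "\<dots> \<le> (\<integral>y. norm (u y) \<partial>lebesgue)" by (rule integral_norm_bound)
  finally show "ennreal (norm (mean b P - c)) * emeasure lebesgue P \<le> (\<integral>\<^sup>+y\<in>P. ennreal (norm (b y - c)) \<partial>lebesgue)"
    unfolding eq cubes_measure(2)[OF P] by (simp add: ennreal_mult[symmetric] ennreal_leI)
qed

text \<open>The average over \<open>P\<close> of the deviation from the mean over \<open>Q\<close>.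
  It is the quantity compared in the stopping argument; on the diagonal it is the mean
  oscillation.\<close>

definition mean_dev :: "(real ^ 'n \<Rightarrow> complex) \<Rightarrow> (real ^ 'n) set \<Rightarrow> (real ^ 'n) set \<Rightarrow> real" where
  "mean_dev b Q P = enn2real (\<integral>\<^sup>+y\<in>P. ennreal (norm (b y - mean b Q)) \<partial>lebesgue) / measure lebesgue P"

lemma mean_dev_nonneg: "0 \<le> mean_dev b Q P" by (simp add: mean_dev_def)

lemma mean_dev_mult:
  assumes "locally_integrable b" "P \<in> cubes"
  shows "ennreal (mean_dev b Q P) * emeasure lebesgue P = (\<integral>\<^sup>+y\<in>P. ennreal (norm (b y - mean b Q)) \<partial>lebesgue)"
  using mean_deviation(1)[OF assms, of "mean b Q"] cubes_measure[OF assms(2)]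
  by (simp add: mean_dev_def ennreal_mult[symmetric] ennreal_enn2real_if)

lemma mean_dev_eq:
  assumes "locally_integrable b" "P \<in> cubes"
  shows "ennreal (mean_dev b Q P) = (\<integral>\<^sup>+y\<in>P. ennreal (norm (b y - mean b Q)) \<partial>lebesgue) / emeasure lebesgue P"
  unfolding mean_dev_mult[OF assms, symmetric] using cubes_emeasure[OF assms(2)] by (simp add: ennreal_mult_divide_eq)

lemma mean_dev_le:
  assumes b: "locally_integrable b" "P \<in> cubes" and "0 \<le> t"
    and le: "(\<integral>\<^sup>+y\<in>P. ennreal (norm (b y - mean b Q)) \<partial>lebesgue) \<le> ennreal t * emeasure lebesgue P"
  shows "mean_dev b Q P \<le> t"
proof -
  have "ennreal (mean_dev b Q P * measure lebesgue P) \<le> ennreal (t * measure lebesgue P)"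
    using le unfolding mean_dev_mult[OF b, symmetric] cubes_measure(2)[OF b(2)]
    using assms(3) mean_dev_nonneg[of b Q P] by (simp add: ennreal_mult)
  then show ?thesis using cubes_measure(1)[OF b(2)] assms(3) by (simp add: ennreal_le_iff)
qed

text \<open>The means over \<open>Q\<close> and \<open>C\<close> differ by at most the average over
  \<open>C\<close> of the deviation from the mean over \<open>Q\<close>.\<close>

lemma mean_dev_triangle:
  assumes b: "locally_integrable b" and P: "P \<in> cubes" and C: "C \<in> cubes"
  shows "mean_dev b Q P \<le> mean_dev b C P + mean_dev b Q C"
proof (rule mean_dev_le[OF b P])
  have [measurable]: "(\<lambda>y. ennreal (norm (b y - c)) * indicator P y) \<in> borel_measurable lebesgue" for c
  proof -
    have [measurable]: "(\<lambda>y. indicator P y *\<^sub>R b y) \<in> borel_measurable lebesgue"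
      using cubes_integrable[OF b P] by (auto simp: set_integrable_def)
    have "(\<lambda>y. ennreal (norm (indicator P y *\<^sub>R b y - c)) * indicator P y) \<in> borel_measurable lebesgue"
      using cubes_sets[OF P] by measurable
    also have "(\<lambda>y. ennreal (norm (indicator P y *\<^sub>R b y - c)) * indicator P y) = (\<lambda>y. ennreal (norm (b y - c)) * indicator P y)"
      by (auto simp: indicator_def)
    finally show ?thesis .
  qed
  have le: "norm (mean b C - mean b Q) \<le> mean_dev b Q C"
  proof -
    have "ennreal (norm (mean b C - mean b Q)) * emeasure lebesgue C \<le> ennreal (mean_dev b Q C) * emeasure lebesgue C"
      unfolding mean_dev_mult[OF b C] using b C by (rule mean_deviation)
    then show ?thesis
      using cubes_measure[OF C] mean_dev_nonneg[of b Q C] by (simp add: ennreal_mult[symmetric] ennreal_le_iff)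
  qed
  have "(\<integral>\<^sup>+y\<in>P. ennreal (norm (b y - mean b Q)) \<partial>lebesgue)
    \<le> (\<integral>\<^sup>+y. ennreal (norm (b y - mean b C)) * indicator P y + ennreal (mean_dev b Q C) * indicator P y \<partial>lebesgue)"
  proof (intro nn_integral_mono)
    fix y
    have "norm (b y - mean b Q) \<le> norm (b y - mean b C) + mean_dev b Q C"
      using norm_triangle_ineq[of "b y - mean b C" "mean b C - mean b Q"] le by simp
    then have "ennreal (norm (b y - mean b Q)) \<le> ennreal (norm (b y - mean b C)) + ennreal (mean_dev b Q C)"
      using mean_dev_nonneg[of b Q C] by (simp add: ennreal_plus[symmetric] ennreal_leI del: ennreal_plus)
    then show "ennreal (norm (b y - mean b Q)) * indicator P y
      \<le> ennreal (norm (b y - mean b C)) * indicator P y + ennreal (mean_dev b Q C) * indicator P y"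
      by (auto simp: indicator_def)
  qed
  also have "\<dots> = ennreal (mean_dev b C P) * emeasure lebesgue P + ennreal (mean_dev b Q C) * emeasure lebesgue P"
    using cubes_sets[OF P] mean_dev_mult[OF b P, of C] by (subst nn_integral_add) (auto simp: nn_integral_cmult_indicator)
  finally show "(\<integral>\<^sup>+y\<in>P. ennreal (norm (b y - mean b Q)) \<partial>lebesgue)
    \<le> ennreal (mean_dev b C P + mean_dev b Q C) * emeasure lebesgue P"
    using mean_dev_nonneg[of b C P] mean_dev_nonneg[of b Q C] by (simp add: distrib_right)
qed (use mean_dev_nonneg[of b C P] mean_dev_nonneg[of b Q C] in simp)

text \<open>All cells of a root cube down to generation \<open>N\<close>. The truncation keeps the
  tree finite; \<open>N\<close> is sent to infinity only after the estimates.\<close>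

definition dtree :: "real ^ 'n \<Rightarrow> real \<Rightarrow> nat \<Rightarrow> (real ^ 'n) set set" where
  "dtree a l N = (\<Union>k\<le>N. dcube a l k ` cube a l)"

lemma dtree_cubes: "0 < l \<Longrightarrow> dtree a l N \<subseteq> cubes" unfolding dtree_def by (auto simp: dcube_eq_cube intro!: cube_in_cubes)

lemma set_tree_dtree:
  assumes "0 < l"
  shows "set_tree lebesgue (dtree a l N)"
proof
  show "finite (dtree a l N)" using assms by (auto simp: dtree_def intro: finite_dcubes)
  show "P \<subseteq> Q \<or> Q \<subseteq> P \<or> P \<inter> Q = {}" if PQ: "P \<in> dtree a l N" "Q \<in> dtree a l N" for P Q
  proof -
    obtain k x where P: "P = dcube a l k x" using PQ(1) by (auto simp: dtree_def)
    obtain k' y where Q: "Q = dcube a l k' y" using PQ(2) by (auto simp: dtree_def)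
    show ?thesis unfolding P Q by (rule dcube_laminar)
  qed
qed (use dtree_cubes[OF assms, of a N] in \<open>auto intro: cubes_sets cubes_emeasure\<close>)

lemma dtree_parent:
  fixes a :: "real ^ 'n"
  assumes l: "0 < l" and Q: "Q \<in> dtree a l N" "C \<in> dtree a l N" "C \<subset> Q"
  obtains C' where "C' \<in> dtree a l N" "C \<subset> C'" "C' \<subseteq> Q" "measure lebesgue C' = 2 ^ CARD('n) * measure lebesgue C"
proof -
  obtain k x where x: "k \<le> N" "x \<in> cube a l" "Q = dcube a l k x" using Q(1) by (auto simp: dtree_def)
  obtain k' y where y: "k' \<le> N" "y \<in> cube a l" "C = dcube a l k' y" using Q(2) by (auto simp: dtree_def)
  have yQ: "y \<in> dcube a l k x" using Q(3) x y mem_dcube by blast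
  then have Qy: "Q = dcube a l k y" using dcube_eq_iff[OF yQ] x by simp
  have "k < k'"
  proof (rule ccontr)
    assume "\<not> k < k'"
    then have "Q \<subseteq> C" unfolding Qy y(3) by (intro dcube_mono) simp
    then show False using Q(3) by auto
  qed
  then obtain j where j: "k' = Suc j" "k \<le> j" by (cases k') auto
  have m: "measure lebesgue (dcube a l j y) = 2 ^ CARD('n) * measure lebesgue C"
    unfolding y(3) j measure_dcube[OF l] by (simp add: power_mult_distrib[symmetric])
  show thesis
  proof (rule that[of "dcube a l j y"])
    show "dcube a l j y \<in> dtree a l N" using y j by (auto simp: dtree_def)
    have "C \<subseteq> dcube a l j y" unfolding y(3) j by (intro dcube_mono) simp
    moreover have "C \<noteq> dcube a l j y"
    proof
      assume "C = dcube a l j y"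
      then have "measure lebesgue C = 2 ^ CARD('n) * measure lebesgue C" using m by simp
      moreover have "0 < measure lebesgue C" unfolding y(3) measure_dcube[OF l] using l by simp
      ultimately have "(2::real) ^ CARD('n) = 1" by simp
      moreover have "(1::real) < 2 ^ CARD('n)" by (rule one_less_power) auto
      ultimately show False by simp
    qed
    ultimately show "C \<subset> dcube a l j y" by auto
    show "dcube a l j y \<subseteq> Q" unfolding Qy using j by (intro dcube_mono) simp
  qed (rule m)
qed

definition osc_sum :: "(real ^ 'n \<Rightarrow> complex) \<Rightarrow> (real ^ 'n) set set \<Rightarrow> (real ^ 'n) set \<Rightarrow> real ^ 'n \<Rightarrow> ennreal" where
  "osc_sum b \<S> Q x = (\<Sum>R\<in>{R\<in>\<S>. R \<subseteq> Q}. oscillation b R / emeasure lebesgue R * indicator R x)"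

definition stop_cubes :: "(real ^ 'n \<Rightarrow> complex) \<Rightarrow> (real ^ 'n) set set \<Rightarrow> (real ^ 'n) set \<Rightarrow> (real ^ 'n) set set" where
  "stop_cubes b \<P> Q = {P\<in>\<P>. P \<subset> Q \<and> 4 * mean_dev b Q Q < mean_dev b Q P}"

lemma locally_integrable_measurable:
  fixes h :: "real ^ 'n \<Rightarrow> 'b::euclidean_space"
  assumes "locally_integrable h"
  shows "h \<in> borel_measurable lebesgue"
proof -
  have "(\<lambda>x. indicator (cbox (- (\<chi> i. real k)) (\<chi> i. real k)) x *\<^sub>R h x) \<in> borel_measurable lebesgue" for k
  proof -
    have "integrable lebesgue (\<lambda>x. indicator (cbox (- (\<chi> i. real k)) (\<chi> i. real k)) x *\<^sub>R h x)"
      using assms compact_cbox unfolding locally_integrable_def set_integrable_def by blast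
    then show ?thesis by (rule borel_measurable_integrable)
  qed
  moreover have "(\<lambda>k. indicator (cbox (- (\<chi> i. real k)) (\<chi> i. real k)) x *\<^sub>R h x) \<longlonglongrightarrow> h x" for x :: "real ^ 'n"
  proof (rule tendsto_eventually)
    obtain K :: nat where K: "norm x \<le> real K" using real_arch_simple by blast
    have "x \<in> cbox (- (\<chi> i. real k)) (\<chi> i. real k)" if "K \<le> k" for k
    proof -
      have "\<bar>x $ i\<bar> \<le> real k" for i using component_le_norm_cart[of x i] K that by linarith
      then show ?thesis by (auto simp: mem_box_cart abs_le_iff minus_le_iff)
    qed
    then show "\<forall>\<^sub>F k in sequentially. indicator (cbox (- (\<chi> i. real k)) (\<chi> i. real k)) x *\<^sub>R h x = h x"
      unfolding eventually_sequentially by (intro exI[of _ K]) auto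
  qed
  ultimately show ?thesis by (rule borel_measurable_LIMSEQ_metric)
qed

text \<open>The threshold 4 in \<open>stop_cubes\<close> becomes the bound 1/4 by Chebyshev: the
  average over \<open>Q\<close> of the deviation is at least four times its value times the relative
  measure of the stopping cubes.\<close>

lemma stop_tree_dtree:
  fixes a :: "real ^ 'n"
  assumes b: "locally_integrable b" and l: "0 < l" and S0: "S0 \<subseteq> dtree a l N"
    "\<And>Q. Q \<in> S0 \<Longrightarrow> measure lebesgue (\<Union>{P\<in>S0. P \<subset> Q}) \<le> 1 / 4 * measure lebesgue Q"
  shows "stop_tree lebesgue (dtree a l N) (stop_cubes b (dtree a l N)) S0"
proof -
  interpret set_tree lebesgue "dtree a l N" by (rule set_tree_dtree[OF l])
  note cubes = subsetD[OF dtree_cubes[OF l, of a N]]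
  show ?thesis
  proof
    fix Q assume Q: "Q \<in> dtree a l N"
    let ?T = "stop_cubes b (dtree a l N) Q"
    show "?T \<subseteq> {P\<in>dtree a l N. P \<subset> Q}" by (auto simp: stop_cubes_def)
    note [measurable] = locally_integrable_measurable[OF b]
    have fm: "\<Union>?T \<in> fmeasurable lebesgue" by (intro fmeasurable_Union) (auto simp: stop_cubes_def)
    then have em: "emeasure lebesgue (\<Union>?T) = ennreal (measure lebesgue (\<Union>?T))" by (rule emeasure_eq_measure2)
    have 1: "ennreal (4 * mean_dev b Q Q) * emeasure lebesgue P \<le> (\<integral>\<^sup>+y\<in>P. ennreal (norm (b y - mean b Q)) \<partial>lebesgue)"
      if "P \<in> ?T" for P
    proof -
      have "P \<in> cubes" using that cubes by (auto simp: stop_cubes_def)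
      then show ?thesis using that mean_dev_mult[OF b, of P Q, symmetric]
        by (auto simp: stop_cubes_def intro!: mult_right_mono ennreal_leI)
    qed
    have "ennreal (4 * mean_dev b Q Q) * emeasure lebesgue (\<Union>?T) \<le> (\<integral>\<^sup>+y\<in>Q. ennreal (norm (b y - mean b Q)) \<partial>lebesgue)"
      by (rule Union_le_nn_integral) (use 1 in \<open>auto simp: stop_cubes_def\<close>)
    also have "\<dots> = ennreal (mean_dev b Q Q) * emeasure lebesgue Q" using mean_dev_mult[OF b cubes[OF Q]] by simp
    finally have le: "4 * mean_dev b Q Q * measure lebesgue (\<Union>?T) \<le> mean_dev b Q Q * measure lebesgue Q"
      unfolding em cubes_measure(2)[OF cubes[OF Q]]
      using mean_dev_nonneg[of b Q Q] by (simp add: ennreal_mult[symmetric] ennreal_le_iff)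
    show "measure lebesgue (\<Union>?T) \<le> 1 / 4 * measure lebesgue Q"
    \<comment> \<open>With zero oscillation Chebyshev's inequality is void, but then the deviation
      vanishes on every subcube and no cube stops.\<close>
    proof (cases "mean_dev b Q Q = 0")
      case True
      have "?T = {}"
      proof (rule equals0I)
        fix P assume P: "P \<in> ?T"
        then have Pc: "P \<in> cubes" "P \<subseteq> Q" using cubes by (auto simp: stop_cubes_def)
        have "(\<integral>\<^sup>+y\<in>P. ennreal (norm (b y - mean b Q)) \<partial>lebesgue) \<le> (\<integral>\<^sup>+y\<in>Q. ennreal (norm (b y - mean b Q)) \<partial>lebesgue)"
          using Pc by (intro nn_integral_mono) (auto simp: indicator_def)
        also have "\<dots> = 0" using mean_dev_mult[OF b cubes[OF Q], of Q] True by simp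
        finally have "mean_dev b Q P \<le> 0" by (intro mean_dev_le[OF b Pc(1)]) auto
        then show False using P True by (simp add: stop_cubes_def)
      qed
      then show ?thesis by simp
    next
      case False
      then have "0 < mean_dev b Q Q" using mean_dev_nonneg[of b Q Q] by simp
      moreover have "mean_dev b Q Q * (4 * measure lebesgue (\<Union>?T)) \<le> mean_dev b Q Q * measure lebesgue Q"
        using le by (simp add: mult_ac)
      ultimately show ?thesis by (simp add: mult_le_cancel_left_pos)
    qed
  qed (use S0 in auto)
qed

lemma osc_sum_eq:
  assumes b: "locally_integrable b" and S: "\<S> \<subseteq> cubes" "finite \<S>"
  shows "ennreal (\<Sum>R\<in>{R\<in>\<S>. R \<subseteq> Q}. mean_dev b R R * indicator R x) = osc_sum b \<S> Q x"
proof -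
  have "osc_sum b \<S> Q x = (\<Sum>R\<in>{R\<in>\<S>. R \<subseteq> Q}. ennreal (mean_dev b R R * indicator R x))" unfolding osc_sum_def
  proof (rule sum.cong[OF refl])
    fix R assume "R \<in> {R\<in>\<S>. R \<subseteq> Q}"
    then have "R \<in> cubes" using S by auto
    then show "oscillation b R / emeasure lebesgue R * indicator R x = ennreal (mean_dev b R R * indicator R x)"
      using mean_dev_eq[OF b, of R R] by (auto simp: oscillation_def indicator_def)
  qed
  also have "\<dots> = ennreal (\<Sum>R\<in>{R\<in>\<S>. R \<subseteq> Q}. mean_dev b R R * indicator R x)"
    by (intro sum_ennreal mult_nonneg_nonneg mean_dev_nonneg) auto
  finally show ?thesis by simp
qed

text \<open>For each generation the stopping family dominates the average of the deviation over the
  smallest cell containing \<open>x\<close>, with the constant 4 times the dyadic doubling 2^n.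
  These averages recover the deviation itself by differentiation. The families change with
  \<open>N\<close>, which is why a limit inferior appears.\<close>

lemma oscillation_domination:
  fixes a :: "real ^ 'n"
  assumes b: "locally_integrable b" and l: "0 < l" and S0: "S0 \<subseteq> dtree a l N0"
    "\<And>Q. Q \<in> S0 \<Longrightarrow> measure lebesgue (\<Union>{P\<in>S0. P \<subset> Q}) \<le> 1 / 4 * measure lebesgue Q"
  obtains \<S> where "\<And>N. sparse_union lebesgue (\<S> N)" "\<And>N. S0 \<subseteq> \<S> N" "\<And>N. \<S> N \<subseteq> cubes"
    "\<And>Q. Q \<in> S0 \<Longrightarrow> AE x in lebesgue. x \<in> Q \<longrightarrow>
       ennreal (norm (b x - mean b Q)) \<le> liminf (\<lambda>N. ennreal (4 * 2 ^ CARD('n)) * osc_sum b (\<S> N) Q x)"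
proof -
  \<comment> \<open>The depth is at least \<open>N0\<close>, so that the given cubes lie in the tree
    for every \<open>N\<close>.\<close>
  define L where "L N = max N N0" for N
  define \<S> where "\<S> N = stop_tree.stree (stop_cubes b (dtree a l (L N))) S0" for N
  have S0L: "S0 \<subseteq> dtree a l (L N)" for N
  proof -
    have "dtree a l N0 \<subseteq> dtree a l (L N)" unfolding dtree_def L_def by (intro UN_mono) auto
    then show ?thesis using S0(1) by simp
  qed
  have st: "stop_tree lebesgue (dtree a l (L N)) (stop_cubes b (dtree a l (L N))) S0" for N
    using b l S0L S0(2) by (rule stop_tree_dtree)
  have sub: "\<S> N \<subseteq> dtree a l (L N)" for N using stop_tree.stree_sub[OF st] by (auto simp: \<S>_def)
  have fin: "finite (\<S> N)" for N using sub[of N] set_tree.finite_S[OF set_tree_dtree[OF l]] by (rule finite_subset)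
  show thesis
  proof (rule that[of \<S>])
    show "sparse_union lebesgue (\<S> N)" for N unfolding \<S>_def by (rule stop_tree.sparse_union_stree[OF st])
    show S0S: "S0 \<subseteq> \<S> N" for N unfolding \<S>_def using stop_tree.stree.base[OF st] by auto
    show cubes: "\<S> N \<subseteq> cubes" for N using sub[of N] dtree_cubes[OF l, of a "L N"] by simp
    fix Q assume Q: "Q \<in> S0"
    have QN0: "Q \<in> dtree a l N0" using Q S0 by auto
    then have Qroot: "Q \<subseteq> cube a l" using dcube_sub[OF l] by (auto simp: dtree_def)
    let ?\<phi> = "\<lambda>x. ennreal (norm (b x - mean b Q))"
    have [measurable]: "b \<in> borel_measurable lebesgue" using b by (rule locally_integrable_measurable)
    have "AE x in lebesgue. x \<in> cube a l \<longrightarrow> ?\<phi> x \<le> liminf (\<lambda>k. dyadic_avg a l ?\<phi> k x)"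
      by (rule dyadic_differentiation[OF l]) measurable
    then show "AE x in lebesgue. x \<in> Q \<longrightarrow> ?\<phi> x \<le> liminf (\<lambda>N. ennreal (4 * 2 ^ CARD('n)) * osc_sum b (\<S> N) Q x)"
    proof eventually_elim
      case (elim x)
      show ?case
      proof
        assume x: "x \<in> Q"
        then have xr: "x \<in> cube a l" using Qroot by auto
        have "dyadic_avg a l ?\<phi> N x \<le> ennreal (4 * 2 ^ CARD('n)) * osc_sum b (\<S> N) Q x" if N: "N0 \<le> N" for N
        proof -
          have L: "L N = N" using N by (simp add: L_def)
          interpret stop_tree lebesgue "dtree a l N" "stop_cubes b (dtree a l N)" S0 using st[of N] by (simp add: L)
          have S: "\<S> N = stree" by (simp add: \<S>_def L)
          have cub: "R \<in> cubes" if "R \<in> dtree a l N" for R using that dtree_cubes[OF l, of a N] by auto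
          let ?P = "dcube a l N x"
          have P: "?P \<in> dtree a l N" using xr by (auto simp: dtree_def)
          have "mean_dev b Q ?P \<le> (4 * 2 ^ CARD('n)) * (\<Sum>R\<in>{R\<in>stree. R \<subseteq> Q}. mean_dev b R R * indicator R x)"
          proof (rule stree_domination)
            show "4 \<le> (4 * 2 ^ CARD('n) :: real)" by simp
            show "mean_dev b Q P \<le> mean_dev b C P + mean_dev b Q C"
              if "C \<in> dtree a l N" "P \<in> dtree a l N" for Q C P using that cub by (intro mean_dev_triangle b) auto
            show "mean_dev b Q P \<le> 4 * mean_dev b Q Q"
              if "P \<in> dtree a l N" "P \<subset> Q" "P \<notin> stop_cubes b (dtree a l N) Q" for Q P
              using that by (auto simp: stop_cubes_def)
            show "\<exists>C'\<in>dtree a l N. C \<subset> C' \<and> C' \<subseteq> Q \<and> mean_dev b Q C \<le> 4 * 2 ^ CARD('n) / 4 * mean_dev b Q C'"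
              if QC: "Q \<in> dtree a l N" "C \<in> dtree a l N" "C \<subset> Q" for Q C
            proof -
              obtain C' where C': "C' \<in> dtree a l N" "C \<subset> C'" "C' \<subseteq> Q" "measure lebesgue C' = 2 ^ CARD('n) * measure lebesgue C"
                using dtree_parent[OF l QC] by blast
              have "mean_dev b Q C \<le> 2 ^ CARD('n) * mean_dev b Q C'"
              proof (rule mean_dev_le[OF b cub[OF QC(2)]])
                have "(\<integral>\<^sup>+y\<in>C. ennreal (norm (b y - mean b Q)) \<partial>lebesgue) \<le> (\<integral>\<^sup>+y\<in>C'. ennreal (norm (b y - mean b Q)) \<partial>lebesgue)"
                  using C' by (intro nn_integral_mono) (auto simp: indicator_def)
                also have "\<dots> = ennreal (mean_dev b Q C' * measure lebesgue C')"
                  using mean_dev_mult[OF b cub[OF C'(1)], of Q] cubes_measure(2)[OF cub[OF C'(1)]] mean_dev_nonneg[of b Q C']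
                  by (simp add: ennreal_mult)
                also have "mean_dev b Q C' * measure lebesgue C' = 2 ^ CARD('n) * mean_dev b Q C' * measure lebesgue C"
                  by (simp add: C'(4))
                finally show "(\<integral>\<^sup>+y\<in>C. ennreal (norm (b y - mean b Q)) \<partial>lebesgue)
                    \<le> ennreal (2 ^ CARD('n) * mean_dev b Q C') * emeasure lebesgue C"
                  using cubes_measure(2)[OF cub[OF QC(2)]] mean_dev_nonneg[of b Q C'] by (simp add: ennreal_mult)
              qed (use mean_dev_nonneg[of b Q C'] in simp)
              then show ?thesis using C' by auto
            qed
            show "?P \<subseteq> R" if R: "R \<in> dtree a l N" "x \<in> R" for R
            proof -
              obtain k y where k: "k \<le> N" "R = dcube a l k y" using R(1) by (auto simp: dtree_def)
              then have "R = dcube a l k x" using R(2) dcube_eq_iff[of x a l k y] by simp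
              then show ?thesis using dcube_mono[OF k(1), of a l x] by simp
            qed
            show "Q \<in> stree" using Q by (rule stree.base)
          qed (use P x mean_dev_nonneg in auto)
          then have "ennreal (mean_dev b Q ?P) \<le> ennreal (4 * 2 ^ CARD('n)) * osc_sum b (\<S> N) Q x"
            unfolding osc_sum_eq[OF b cubes fin, symmetric] S[symmetric]
            by (subst ennreal_mult[symmetric]) (auto intro!: ennreal_leI sum_nonneg mult_nonneg_nonneg mean_dev_nonneg simp del: zero_le_mult_iff)
          then show ?thesis unfolding dyadic_avg_def mean_dev_eq[OF b cub[OF P], symmetric] .
        qed
        then have "liminf (\<lambda>k. dyadic_avg a l ?\<phi> k x) \<le> liminf (\<lambda>N. ennreal (4 * 2 ^ CARD('n)) * osc_sum b (\<S> N) Q x)"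
          by (intro Liminf_mono) (auto simp: eventually_sequentially)
        with elim xr show "?\<phi> x \<le> liminf (\<lambda>N. ennreal (4 * 2 ^ CARD('n)) * osc_sum b (\<S> N) Q x)" by auto
      qed
    qed
  qed
qed

section \<open>Passage to the limit in the truncated families\<close>

lemma sum_liminf_le:
  fixes u :: "nat \<Rightarrow> 'b \<Rightarrow> ennreal"
  assumes "finite A"
  shows "(\<Sum>Q\<in>A. liminf (\<lambda>N. u N Q)) \<le> liminf (\<lambda>N. \<Sum>Q\<in>A. u N Q)"
proof -
  have "(\<integral>\<^sup>+Q. liminf (\<lambda>N. u N Q) \<partial>count_space A) \<le> liminf (\<lambda>N. \<integral>\<^sup>+Q. u N Q \<partial>count_space A)"
    by (rule nn_integral_liminf) simp
  then show ?thesis using assms by (simp add: nn_integral_count_space_finite)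
qed

lemma cmult_liminf_le:
  fixes c :: ennreal
  shows "c * liminf u \<le> liminf (\<lambda>N. c * u N)" unfolding liminf_SUP_INF SUP_mult_left_ennreal
  by (intro SUP_mono' INF_greatest mult_left_mono INF_lower) auto

lemma osc_sum_measurable [measurable]: "\<S> \<subseteq> cubes \<Longrightarrow> osc_sum b \<S> Q \<in> borel_measurable lebesgue"
  unfolding osc_sum_def[abs_def] by (intro borel_measurable_sum borel_measurable_times_ennreal borel_measurable_const borel_measurable_indicator cubes_sets) auto

text \<open>The hypothesis is uniform over all admissible families, so the bound for the truncated
  sums survives. Fatou is applied in the integral and in the finite sum, and between them the powers
  \<kappa> and \<rho> pass through the limit inferior.\<close>

lemma oscillation_form_tree:
  fixes a :: "real ^ 'n" and F :: "real ^ 'n \<Rightarrow> ennreal"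
  assumes b: "locally_integrable b" and l: "0 < l" and S0: "S0 \<subseteq> dtree a l N0"
    "\<And>Q. Q \<in> S0 \<Longrightarrow> measure lebesgue (\<Union>{P\<in>S0. P \<subset> Q}) \<le> 1 / 4 * measure lebesgue Q"
    and \<kappa>: "0 < \<kappa>" "0 < \<rho>" and [measurable]: "F \<in> borel_measurable lebesgue"
    and bound: "\<And>\<S>. S0 \<subseteq> \<S> \<Longrightarrow> \<S> \<subseteq> cubes \<Longrightarrow> sparse_union lebesgue \<S> \<Longrightarrow>
      (\<Sum>Q\<in>S0. epow (\<integral>\<^sup>+x\<in>Q. epow (osc_sum b \<S> Q x) \<kappa> * F x \<partial>lebesgue) \<rho> * w Q) \<le> B"
  shows "(\<Sum>Q\<in>S0. epow (\<integral>\<^sup>+x\<in>Q. epow (ennreal (norm (b x - mean b Q))) \<kappa> * F x \<partial>lebesgue) \<rho> * w Q)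
    \<le> ennreal ((4 * 2 ^ CARD('n)) powr (\<kappa> * \<rho>)) * B"
proof -
  let ?K = "4 * 2 ^ CARD('n) :: real"
  let ?c = "ennreal (?K powr (\<kappa> * \<rho>))"
  let ?J = "\<lambda>Q. \<integral>\<^sup>+x\<in>Q. epow (ennreal (norm (b x - mean b Q))) \<kappa> * F x \<partial>lebesgue"
  obtain \<S> where S: "\<And>N. sparse_union lebesgue (\<S> N)" "\<And>N. S0 \<subseteq> \<S> N" "\<And>N. \<S> N \<subseteq> cubes"
    and dom: "\<And>Q. Q \<in> S0 \<Longrightarrow> AE x in lebesgue. x \<in> Q \<longrightarrow>
       ennreal (norm (b x - mean b Q)) \<le> liminf (\<lambda>N. ennreal ?K * osc_sum b (\<S> N) Q x)"
    using oscillation_domination[OF b l S0] by blast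
  let ?I = "\<lambda>N Q. \<integral>\<^sup>+x\<in>Q. epow (osc_sum b (\<S> N) Q x) \<kappa> * F x \<partial>lebesgue"
  let ?f = "\<lambda>N Q x. F x * indicator Q x * epow (ennreal ?K * osc_sum b (\<S> N) Q x) \<kappa>"
  have fin: "finite S0" using S0(1) set_tree.finite_S[OF set_tree_dtree[OF l]] by (rule finite_subset)
  have pull: "epow (epow (ennreal ?K) \<kappa> * X) \<rho> = ?c * epow X \<rho>" for X
    unfolding epow_mult epow_epow by (simp only: epow_ennreal zero_le_mult_iff zero_le_numeral zero_le_power simp_thms)
  have Q: "epow (?J Q) \<rho> * w Q \<le> liminf (\<lambda>N. ?c * (epow (?I N Q) \<rho> * w Q))"
    if Q: "Q \<in> S0" for Q
  proof -
    have [measurable]: "Q \<in> sets lebesgue" using Q S0(1) dtree_cubes[OF l, of a N0] cubes_sets by blast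
    have [measurable]: "osc_sum b (\<S> N) Q \<in> borel_measurable lebesgue" for N using S(3) by (rule osc_sum_measurable)
    have "AE x in lebesgue. epow (ennreal (norm (b x - mean b Q))) \<kappa> * F x * indicator Q x \<le> liminf (\<lambda>N. ?f N Q x)"
      using dom[OF Q]
    proof eventually_elim
      case (elim x)
      show ?case
      proof (cases "x \<in> Q")
        case True
        then have "epow (ennreal (norm (b x - mean b Q))) \<kappa> \<le> epow (liminf (\<lambda>N. ennreal ?K * osc_sum b (\<S> N) Q x)) \<kappa>"
          using elim \<kappa> by (intro epow_mono) auto
        also have "\<dots> \<le> liminf (\<lambda>N. epow (ennreal ?K * osc_sum b (\<S> N) Q x) \<kappa>)" using \<kappa> by (intro epow_Liminf_le) auto
        finally have "F x * indicator Q x * epow (ennreal (norm (b x - mean b Q))) \<kappa>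
          \<le> F x * indicator Q x * liminf (\<lambda>N. epow (ennreal ?K * osc_sum b (\<S> N) Q x) \<kappa>)" by (rule mult_left_mono) simp
        also have "\<dots> \<le> liminf (\<lambda>N. ?f N Q x)" by (rule cmult_liminf_le)
        finally show ?thesis by (simp add: mult_ac)
      qed simp
    qed
    then have "?J Q \<le> (\<integral>\<^sup>+x. liminf (\<lambda>N. ?f N Q x) \<partial>lebesgue)" by (rule nn_integral_mono_AE)
    also have "\<dots> \<le> liminf (\<lambda>N. \<integral>\<^sup>+x. ?f N Q x \<partial>lebesgue)" by (intro nn_integral_liminf) measurable
    also have "\<dots> = liminf (\<lambda>N. epow (ennreal ?K) \<kappa> * ?I N Q)"
    proof (intro arg_cong[where f = liminf] ext)
      fix N
      have "(\<integral>\<^sup>+x. ?f N Q x \<partial>lebesgue)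
        = (\<integral>\<^sup>+x. epow (ennreal ?K) \<kappa> * (epow (osc_sum b (\<S> N) Q x) \<kappa> * F x * indicator Q x) \<partial>lebesgue)"
        by (intro nn_integral_cong) (simp only: epow_mult mult_ac)
      also have "\<dots> = epow (ennreal ?K) \<kappa> * ?I N Q" by (intro nn_integral_cmult) measurable
      finally show "(\<integral>\<^sup>+x. ?f N Q x \<partial>lebesgue) = epow (ennreal ?K) \<kappa> * ?I N Q" .
    qed
    finally have "epow (?J Q) \<rho> \<le> epow (liminf (\<lambda>N. epow (ennreal ?K) \<kappa> * ?I N Q)) \<rho>" using \<kappa> by (intro epow_mono) auto
    also have "\<dots> \<le> liminf (\<lambda>N. epow (epow (ennreal ?K) \<kappa> * ?I N Q) \<rho>)" using \<kappa> by (intro epow_Liminf_le) auto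
    finally have "w Q * epow (?J Q) \<rho> \<le> w Q * liminf (\<lambda>N. epow (epow (ennreal ?K) \<kappa> * ?I N Q) \<rho>)"
      by (rule mult_left_mono) simp
    also have "\<dots> \<le> liminf (\<lambda>N. w Q * epow (epow (ennreal ?K) \<kappa> * ?I N Q) \<rho>)" by (rule cmult_liminf_le)
    also have "\<dots> = liminf (\<lambda>N. ?c * (epow (?I N Q) \<rho> * w Q))" unfolding pull by (simp only: mult_ac)
    finally show ?thesis by (simp add: mult.commute)
  qed
  have "(\<Sum>Q\<in>S0. epow (?J Q) \<rho> * w Q) \<le> (\<Sum>Q\<in>S0. liminf (\<lambda>N. ?c * (epow (?I N Q) \<rho> * w Q)))" by (intro sum_mono Q)
  also have "\<dots> \<le> liminf (\<lambda>N. \<Sum>Q\<in>S0. ?c * (epow (?I N Q) \<rho> * w Q))" by (rule sum_liminf_le[OF fin])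
  also have "\<dots> \<le> ?c * B"
  proof -
    have "(\<Sum>Q\<in>S0. ?c * (epow (?I N Q) \<rho> * w Q)) \<le> ?c * B" for N
      unfolding sum_distrib_left[symmetric] by (intro mult_left_mono bound S) simp
    then have "liminf (\<lambda>N. \<Sum>Q\<in>S0. ?c * (epow (?I N Q) \<rho> * w Q))
      \<le> liminf (\<lambda>N. ?c * B)" by (intro Liminf_mono always_eventually) simp
    then show ?thesis by (simp add: Liminf_const)
  qed
  finally show ?thesis .
qed

section \<open>From an arbitrary sparse family to finite trees\<close>

lemma dyadic_descendants_trans:
  assumes "R \<in> dyadic_descendants P" "P \<in> dyadic_descendants Q"
  shows "R \<in> dyadic_descendants Q" using assms(1)
proof (induction rule: dyadic_descendants.induct)
  case self
  show ?case by (rule assms(2))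
next
  case (subdivide a l c)
  then show ?case by (intro dyadic_descendants.subdivide)
qed

lemma common_root:
  assumes D: "dyadic_lattice \<D>" and S: "finite S" "S \<subseteq> \<D>" "S \<noteq> {}"
  obtains Q where "Q \<in> \<D>" "S \<subseteq> dyadic_descendants Q"
proof -
  have "\<exists>Q\<in>\<D>. S \<subseteq> dyadic_descendants Q" using S(1,3,2)
  proof (induction rule: finite_ne_induct)
    case (singleton x)
    then show ?case using dyadic_descendants.self by auto
  next
    case (insert x F)
    then obtain Q where Q: "Q \<in> \<D>" "F \<subseteq> dyadic_descendants Q" by auto
    have "x \<in> \<D>" using insert.prems by simp
    then obtain R where R: "R \<in> \<D>" "Q \<in> dyadic_descendants R" "x \<in> dyadic_descendants R"
      using D Q(1) unfolding dyadic_lattice_def by meson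
    have "P \<in> dyadic_descendants R" if "P \<in> F" for P by (rule dyadic_descendants_trans[OF subsetD[OF Q(2) that] R(2)])
    then show ?case using R by auto
  qed
  then show thesis using that by blast
qed

text \<open>The infinite sum is the supremum over finite subfamilies. Each of these has a common
  root in the lattice and is split by depth modulo a fixed number into classes that are sparse with
  constant 1/4. The sparseness number enters the bound only through the number of classes.\<close>

lemma oscillation_form_reduction:
  fixes b :: "real ^ 'n \<Rightarrow> complex" and F :: "real ^ 'n \<Rightarrow> ennreal"
  assumes b: "locally_integrable b" and D: "dyadic_lattice \<D>" "S \<subseteq> \<D>" "sparse_family \<eta> S" and \<eta>: "0 < \<eta>"
    and \<kappa>: "0 < \<kappa>" "0 < \<rho>" and F: "F \<in> borel_measurable lebesgue"
    and bound: "\<And>\<S> S0. S0 \<subseteq> \<S> \<Longrightarrow> \<S> \<subseteq> cubes \<Longrightarrow> sparse_union lebesgue \<S> \<Longrightarrow>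
      (\<Sum>Q\<in>S0. epow (\<integral>\<^sup>+x\<in>Q. epow (osc_sum b \<S> Q x) \<kappa> * F x \<partial>lebesgue) \<rho> * w Q) \<le> B"
  shows "(\<Sum>\<^sub>\<infinity>Q\<in>S. epow (\<integral>\<^sup>+x\<in>Q. epow (ennreal (norm (b x - mean b Q))) \<kappa> * F x \<partial>lebesgue) \<rho> * w Q)
    \<le> ennreal (real (nat \<lceil>4 / \<eta>\<rceil>) * (4 * 2 ^ CARD('n)) powr (\<kappa> * \<rho>)) * B"
proof -
  \<comment> \<open>The smallest natural number with \<eta> k \<ge> 4, as
    \<open>sparse_generation\<close> requires.\<close>
  define k where "k = nat \<lceil>4 / \<eta>\<rceil>"
  define T where "T Q = epow (\<integral>\<^sup>+x\<in>Q. epow (ennreal (norm (b x - mean b Q))) \<kappa> * F x \<partial>lebesgue) \<rho> * w Q" for Q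
  let ?K = "ennreal ((4 * 2 ^ CARD('n)) powr (\<kappa> * \<rho>))"
  have "4 / \<eta> \<le> real k" unfolding k_def by linarith
  then have k: "4 \<le> \<eta> * real k" using \<eta> by (simp add: field_simps)
  have fin: "sum T A \<le> ennreal (real k) * (?K * B)" if A: "finite A" "A \<subseteq> S" for A
  proof (cases "A = {}")
    case False
    obtain Q0 where Q0: "Q0 \<in> \<D>" "A \<subseteq> dyadic_descendants Q0" using common_root[OF D(1), of A] A D(2) False by blast
    obtain a l where l: "Q0 = cube a l" "0 < l" using Q0(1) D(1) by (auto simp: dyadic_lattice_def cubes_def)
    have "\<exists>n. \<forall>P\<in>A. P \<in> dtree a l n"
    proof -
      have "\<exists>n. P \<in> dtree a l n" if "P \<in> A" for P
        using dyadic_descendants_dcube[of P a l] that Q0(2) l by (auto simp: dtree_def)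
      then obtain n where n: "\<And>P. P \<in> A \<Longrightarrow> P \<in> dtree a l (n P)" by metis
      have "P \<in> dtree a l (Max (n ` A))" if "P \<in> A" for P
      proof -
        have "n P \<le> Max (n ` A)" using A that by auto
        then have "dtree a l (n P) \<subseteq> dtree a l (Max (n ` A))" unfolding dtree_def by (intro UN_mono) auto
        then show ?thesis using n[OF that] by auto
      qed
      then show ?thesis by blast
    qed
    then obtain N where N: "A \<subseteq> dtree a l N" by blast
    interpret set_tree lebesgue A by (rule set_tree.subtree[OF set_tree_dtree[OF l(2)] N])
    obtain E where E: "\<And>Q. Q \<in> S \<Longrightarrow> E Q \<subseteq> Q \<and> E Q \<in> sets lebesgue \<and> \<eta> * measure lebesgue Q \<le> measure lebesgue (E Q)"
      "disjoint_family_on E S" using D(3) by (auto simp: sparse_family_def)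
    have disj: "disjoint_family_on E A" using E(2) A(2) by (rule disjoint_family_on_mono[rotated])
    define gen where "gen i = {R\<in>A. card {P\<in>A. R \<subset> P} mod k = i}" for i
    have gen: "sum T (gen i) \<le> ?K * B" for i unfolding T_def
    proof (rule oscillation_form_tree[OF b l(2) _ _ \<kappa> F])
      show "gen i \<subseteq> dtree a l N" using N by (auto simp: gen_def)
      show "measure lebesgue (\<Union>{P\<in>gen i. P \<subset> Q}) \<le> 1 / 4 * measure lebesgue Q" if "Q \<in> gen i" for Q
        using E(1) A(2) disj \<eta> k that by (intro sparse_generation[where E = E and \<eta> = \<eta> and k = k and i = i]) (auto simp: gen_def)
      show "(\<Sum>Q\<in>gen i. epow (\<integral>\<^sup>+x\<in>Q. epow (osc_sum b \<S> Q x) \<kappa> * F x \<partial>lebesgue) \<rho> * w Q) \<le> B"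
        if "gen i \<subseteq> \<S>" "\<S> \<subseteq> cubes" "sparse_union lebesgue \<S>" for \<S> using that by (rule bound)
    qed
    have k0: "0 < k" using k by (intro gr0I) simp
    have "A = (\<Union>i<k. gen i)" using k0 by (auto simp: gen_def)
    then have "sum T A = (\<Sum>i<k. sum T (gen i))" using A(1) by (subst sum.UNION_disjoint[symmetric]) (auto simp: gen_def)
    also have "\<dots> \<le> (\<Sum>i<k. ?K * B)" by (intro sum_mono gen)
    finally show ?thesis by (simp add: ennreal_of_nat_eq_real_of_nat)
  qed simp
  have "(\<Sum>\<^sub>\<infinity>Q\<in>S. T Q) \<le> ennreal (real k) * (?K * B)" by (subst nonneg_infsum_complete) (auto intro!: SUP_least fin)
  then show ?thesis by (simp add: T_def k_def ennreal_mult mult.assoc)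
qed

section \<open>Estimates for the dominating form\<close>

definition "chain_form_const x0 x1 a \<epsilon> \<delta> n \<rho> i j x y =
     ((\<Prod>l\<le>n. real l + \<delta> + 1) * chain_const x0 x1 a \<epsilon> \<delta> n) powr \<rho> * form_const i j x y"

lemma chain_const_nonneg:
  assumes "0 < x0" "x0 < 1" "0 < x1" "x1 < 1" "0 < \<epsilon>" "0 \<le> \<delta>" "(\<delta> + real n + 1) * \<epsilon> \<le> 1"
  shows "0 \<le> chain_const x0 x1 a \<epsilon> \<delta> n"
proof -
  have b: "0 < mix_exp x0 x1 \<theta> \<and> mix_exp x0 x1 \<theta> < 1" if "0 \<le> \<theta>" "\<theta> \<le> 1" for \<theta>
    using mix_exp_bounds[of x0 x1 \<theta>] assms that by auto
  have 1: "0 \<le> (\<delta> + real l) * \<epsilon>" "(\<delta> + real l) * \<epsilon> \<le> 1" if "l \<le> n" for l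
  proof -
    show "0 \<le> (\<delta> + real l) * \<epsilon>" using assms by simp
    have "(\<delta> + real l) * \<epsilon> \<le> (\<delta> + real n + 1) * \<epsilon>" using that assms by (intro mult_right_mono) auto
    also have "\<dots> \<le> 1" by (rule assms(7))
    finally show "(\<delta> + real l) * \<epsilon> \<le> 1" .
  qed
  show ?thesis unfolding chain_const_def using assms
    by (intro mult_nonneg_nonneg prod_nonneg op_const_nonneg) (auto intro!: op_const_nonneg simp: b 1)
qed

definition "rdf_form_const x0 \<kappa> \<rho> i j x y = (4 * rdf_const x0 \<kappa>) powr \<rho> * form_const i j x y"

context sparse_union
begin

text \<open>The common last step of both bounds. A local bound for \<open>T Q\<close> by a power of
  the integral of \<phi> is inserted into the outer form, and \<rho> rescales the norm of \<phi>
  with weight \<open>v1\<close> to the norm that \<open>form_bound\<close> expects. The local bound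
  is demanded only where \<phi> is integrable, which the outer Muckenhoupt condition
  guarantees.\<close>

lemma form_transfer:
  fixes v1 w :: "'a \<Rightarrow> real" and \<phi> G :: "'a \<Rightarrow> ennreal"
  assumes [measurable]: "v1 \<in> borel_measurable M" "\<phi> \<in> borel_measurable M" "G \<in> borel_measurable M"
    and v: "\<And>z. 0 < v1 z" and w: "w = (\<lambda>z. v1 z powr \<rho>)"
    and \<rho>: "0 < \<rho>" "i + y = \<rho> * e" "i = \<rho> * c" "0 < c"
    and xy: "0 < x" "0 < y" "i < 1" "0 < j" "j < 1" "1 \<le> i + j"
    and Lw: "1 \<le> L" "\<And>Q. Q \<in> S \<Longrightarrow> muckenhoupt M x y w L Q"
    and \<beta>: "1 + (1 - i) / x \<le> \<beta>" "1 + (1 - j) / y \<le> \<beta>"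
    and NG: "nrm M j (\<lambda>z. epow (G z) (j + x) * ennreal (1 / w z)) < top"
    and X: "nrm M c (\<lambda>z. epow (\<phi> z) e * ennreal (v1 z)) \<le> X" "X < top"
    and T: "\<And>Q. Q \<in> S \<Longrightarrow> (integ M Q \<phi>) < top \<Longrightarrow> T Q \<le> ennreal P * epow (integ M Q \<phi>) e" "0 \<le> P"
  shows "(\<Sum>Q\<in>S. epow (T Q) \<rho> * (epow (integ M Q G) (j + x) / epow (emeasure M Q) (x + y)))
    \<le> ennreal (P powr \<rho> * (form_const i j x y * L powr \<beta>)) * epow X \<rho>
      * nrm M j (\<lambda>z. epow (G z) (j + x) * ennreal (1 / w z))"
proof -
  let ?G = "\<lambda>Q. epow (integ M Q G) (j + x) / epow (emeasure M Q) (x + y)"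
  let ?N = "\<integral>\<^sup>+z. epow (epow (\<phi> z) (i + y) * ennreal (w z)) (1 / i) \<partial>M"
  let ?N' = "\<integral>\<^sup>+z. epow (epow (G z) (j + x) * ennreal (1 / w z)) (1 / j) \<partial>M"
  have [measurable]: "w \<in> borel_measurable M" unfolding w by measurable
  have wpos: "0 < w z" for z unfolding w using v[of z] by simp
  have ew: "ennreal (v1 z powr \<rho>) = epow (ennreal (v1 z)) \<rho>" for z using v[of z] by (simp add: epow_ennreal)
  have i0: "0 < i" using \<rho> by simp
  have "epow ?N i = nrm M (\<rho> * c) (\<lambda>z. epow (epow (\<phi> z) e * ennreal (v1 z)) \<rho>)"
    unfolding \<rho>(3)[symmetric] nrm_pos[OF i0] \<rho>(2) w ew epow_mult epow_epow by (simp add: mult.commute)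
  also have "\<dots> = epow (nrm M c (\<lambda>z. epow (\<phi> z) e * ennreal (v1 z))) \<rho>" using \<rho> by (intro nrm_epow) auto
  also have "\<dots> \<le> epow X \<rho>" using X \<rho> by (intro epow_mono) auto
  finally have phi: "epow ?N i \<le> epow X \<rho>" .
  have "epow X \<rho> < top" using X by simp
  with phi have "epow ?N i < top" by (rule le_less_trans)
  then have fin1: "?N < top" by simp
  have fin2: "?N' < top" using NG xy by (simp add: nrm_pos)
  have fin\<phi>: "integ M Q \<phi> < top" if Q: "Q \<in> S" for Q
    by (rule nn_integral_finite_weight[OF _ _ wpos Q Lw(2)[OF Q] i0 xy(2) fin1]) measurable
  have "(\<Sum>Q\<in>S. epow (T Q) \<rho> * ?G Q)
    \<le> (\<Sum>Q\<in>S. ennreal (P powr \<rho>) * (epow (integ M Q \<phi>) (i + y) * epow (integ M Q G) (j + x) / epow (emeasure M Q) (x + y)))"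
  proof (rule sum_mono)
    fix Q assume Q: "Q \<in> S"
    have "epow (T Q) \<rho> \<le> epow (ennreal P * epow (integ M Q \<phi>) e) \<rho>"
      using T(1)[OF Q fin\<phi>[OF Q]] \<rho> by (intro epow_mono) auto
    also have "\<dots> = ennreal (P powr \<rho>) * epow (integ M Q \<phi>) (i + y)"
      using T(2) by (simp add: epow_mult epow_ennreal \<rho>(2) mult.commute)
    finally have "epow (T Q) \<rho> \<le> ennreal (P powr \<rho>) * epow (integ M Q \<phi>) (i + y)" .
    from mult_right_mono[OF this, of "?G Q"]
    show "epow (T Q) \<rho> * ?G Q
      \<le> ennreal (P powr \<rho>) * (epow (integ M Q \<phi>) (i + y) * epow (integ M Q G) (j + x) / epow (emeasure M Q) (x + y))"
      by (simp only: mult.assoc ennreal_times_divide zero_le simp_thms)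
  qed
  also have "\<dots> \<le> ennreal (P powr \<rho>) * (ennreal (form_const i j x y * L powr \<beta>) * epow ?N i * epow ?N' j)"
    unfolding sum_distrib_left[symmetric] using i0 xy Lw \<beta> fin1 fin2 wpos by (intro mult_left_mono form_bound) auto
  also have "\<dots> \<le> ennreal (P powr \<rho>) * (ennreal (form_const i j x y * L powr \<beta>) * epow X \<rho> * epow ?N' j)"
    using phi by (intro mult_left_mono mult_right_mono) auto
  also have "\<dots> = ennreal (P powr \<rho> * (form_const i j x y * L powr \<beta>)) * epow X \<rho> * epow ?N' j"
  proof -
    have "0 \<le> form_const i j x y" using xy by (intro form_const_nonneg) auto
    then show ?thesis by (simp only: ennreal_mult powr_ge_zero mult_nonneg_nonneg mult.assoc)
  qed
  finally show ?thesis by (simp only: nrm_pos[OF xy(4)])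
qed

text \<open>The condition on n, \<delta> and \<epsilon> makes the chain end exactly at \<theta> = 1,
  where the weight is \<open>v1\<close> and the outer form takes over; \<open>i\<close> and
  \<open>i'\<close> differ by the gain \<rho> a of the last multiplication.\<close>

lemma chain_form_bound:
  fixes v0 v1 w :: "'a \<Rightarrow> real" and \<nu> F G :: "'a \<Rightarrow> ennreal"
  assumes meas [measurable]: "v0 \<in> borel_measurable M" "v1 \<in> borel_measurable M"
      "\<nu> \<in> borel_measurable M" "F \<in> borel_measurable M" "G \<in> borel_measurable M"
    and v: "\<And>z. 0 < v0 z" "\<And>z. 0 < v1 z" and w: "w = (\<lambda>z. v1 z powr \<rho>)"
    and x01: "0 < x0" "x0 < 1" "0 < x1" "x1 < 1" and a: "0 \<le> a" "0 \<le> t" "a = 0 \<or> t = 0" "\<epsilon> * (x1 - x0) + a = t"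
    and \<epsilon>: "0 < \<epsilon>" and \<delta>: "0 \<le> \<delta>" "\<delta> < 1"
    and L: "1 \<le> L0" "1 \<le> L1" "\<And>Q. Q \<in> S \<Longrightarrow> muckenhoupt M x0 (1 - x0) v0 L0 Q"
      "\<And>Q. Q \<in> S \<Longrightarrow> muckenhoupt M x1 (1 - x1) v1 L1 Q"
    and H: "nrm M t (\<lambda>z. epow (\<nu> z) (1 + a) * ennreal ((v1 z / v0 z) powr \<epsilon>)) \<le> H" "H < top"
    and NF: "wnrm M x0 v0 F < top"
    and n: "(\<delta> + real n + 1) * \<epsilon> = 1" and fin\<nu>: "\<And>P. P \<in> S \<Longrightarrow> (integ M P \<nu>) < top"
    and \<rho>: "0 < \<rho>" and xy: "0 < x" "0 < y" "y = \<rho> - i'" "i' = \<rho> * x1" "i = i' + \<rho> * a" "i < 1" "0 < j" "j < 1" "1 \<le> i + j"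
    and Lw: "1 \<le> L" "\<And>Q. Q \<in> S \<Longrightarrow> muckenhoupt M x y w L Q"
    and \<beta>: "1 + (1 - i) / x \<le> \<beta>" "1 + (1 - j) / y \<le> \<beta>"
    and NG: "nrm M j (\<lambda>z. epow (G z) (j + x) * ennreal (1 / w z)) < top"
  shows "(\<Sum>Q\<in>S. epow (tail_int \<nu> (1 + a) F (real n + \<delta> + 1) Q) \<rho> * (epow (integ M Q G) (j + x) / epow (emeasure M Q) (x + y)))
    \<le> ennreal (chain_form_const x0 x1 a \<epsilon> \<delta> n \<rho> i j x y
        * (L0 powr chain_exp0 x0 x1 a \<epsilon> \<delta> n * L1 powr chain_exp1 x0 x1 a \<epsilon> \<delta> n) powr \<rho> * L powr \<beta>)
      * epow H ((real n + 1 + \<delta>) * \<rho>) * epow (wnrm M x0 v0 F) \<rho> * nrm M j (\<lambda>z. epow (G z) (j + x) * ennreal (1 / w z))"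
proof -
  define P where "P = (\<Prod>l\<le>n. real l + \<delta> + 1)"
  define C where "C = chain_const x0 x1 a \<epsilon> \<delta> n"
  define E where "E = L0 powr chain_exp0 x0 x1 a \<epsilon> \<delta> n * L1 powr chain_exp1 x0 x1 a \<epsilon> \<delta> n"
  define \<phi> where "\<phi> = chain_fun \<nu> (1 + a) F \<delta> n"
  define N where "N = wnrm M x0 v0 F"
  define X where "X = ennreal (C * E) * epow H (real n + 1 + \<delta>) * N"
  have \<phi>m: "\<phi> \<in> borel_measurable M" unfolding \<phi>_def by measurable
  have iy: "i + y = \<rho> * (1 + a)" "i = \<rho> * (x1 + a)" "0 < x1 + a" using xy x01 a by (simp_all add: algebra_simps)
  have finF: "integ M Q F < top" if Q: "Q \<in> S" for Q
  proof (rule nn_integral_finite_weight[OF meas(1,4) v(1) Q L(3)[OF Q] x01(1)])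
    show "0 < 1 - x0" using x01 by simp
    show "(\<integral>\<^sup>+z. epow (epow (F z) (x0 + (1 - x0)) * ennreal (v0 z)) (1 / x0) \<partial>M) < top"
      using NF x01(1) by (simp add: nrm_pos)
  qed
  have tail: "tail_int \<nu> (1 + a) F (real n + \<delta> + 1) Q \<le> ennreal P * epow (integ M Q \<phi>) (1 + a)" if "Q \<in> S" for Q
    using tail_int_chain[OF meas(4,3) fin\<nu> finF _ \<delta>, of "1 + a" n] a that by (auto simp: P_def \<phi>_def)
  have C0: "0 \<le> C" unfolding C_def using x01 \<epsilon> \<delta> n by (intro chain_const_nonneg) auto
  have P0: "0 \<le> P" unfolding P_def using \<delta> by (intro prod_nonneg) auto
  have chain: "nrm M (x1 + a) (\<lambda>z. epow (\<phi> z) (1 + a) * ennreal (v1 z)) \<le> X"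
  proof -
    have "(\<delta> + real n + 1) * \<epsilon> \<le> 1" using n by simp
    moreover have "v0 z powr (1 - 1) * v1 z powr 1 = v1 z" for z using v(1)[of z] v(2)[of z] by simp
    ultimately show ?thesis using chain_norm[OF meas(1-4) v x01 a \<epsilon> \<delta> L H NF, of n]
      unfolding n \<phi>_def C_def E_def N_def X_def by (simp add: mix_exp_def mult.assoc)
  qed
  have fin: "X < top" using H(2) NF by (simp add: X_def N_def ennreal_mult_less_top)
  note form_transfer[OF meas(2) \<phi>m meas(5) v(2) w \<rho> iy xy(1,2,6-9) Lw \<beta> NG chain fin tail P0]
  also have "ennreal (P powr \<rho> * (form_const i j x y * L powr \<beta>)) * epow X \<rho>
    = ennreal (P powr \<rho> * (form_const i j x y * L powr \<beta>) * (C * E) powr \<rho>) * epow H ((real n + 1 + \<delta>) * \<rho>) * epow N \<rho>"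
  proof -
    have "0 \<le> C * E" using C0 by (simp add: E_def)
    then have "epow X \<rho> = ennreal ((C * E) powr \<rho>) * epow H ((real n + 1 + \<delta>) * \<rho>) * epow N \<rho>"
      unfolding X_def epow_mult epow_epow by (simp only: epow_ennreal)
    moreover have "0 \<le> form_const i j x y" using xy by (intro form_const_nonneg) auto
    ultimately show ?thesis by (simp add: ennreal_mult mult.assoc)
  qed
  also have "P powr \<rho> * (form_const i j x y * L powr \<beta>) * (C * E) powr \<rho>
    = chain_form_const x0 x1 a \<epsilon> \<delta> n \<rho> i j x y * E powr \<rho> * L powr \<beta>"
    using P0 C0 by (simp add: chain_form_const_def P_def C_def E_def powr_mult mult_ac)
  finally show ?thesis by (simp add: E_def N_def)
qed

text \<open>All \<kappa> multiplications by \<nu> happen at once: the distance from x0 to x1 is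
  \<kappa> t, and a single Hoelder inequality against the majorant covers it.\<close>

lemma rdf_form_bound:
  fixes v0 v1 w :: "'a \<Rightarrow> real" and \<nu> F G :: "'a \<Rightarrow> ennreal"
  assumes meas [measurable]: "v0 \<in> borel_measurable M" "v1 \<in> borel_measurable M"
      "\<nu> \<in> borel_measurable M" "F \<in> borel_measurable M" "G \<in> borel_measurable M"
    and v: "\<And>z. 0 < v0 z" "\<And>z. 0 < v1 z" and w: "w = (\<lambda>z. v1 z powr \<rho>)"
    and x01: "0 < x0" "x0 < 1" "0 < x1" "x1 < 1" and t: "0 \<le> t" "x1 = \<kappa> * t + x0"
    and L: "1 \<le> L0" "\<And>Q. Q \<in> S \<Longrightarrow> muckenhoupt M x0 (1 - x0) v0 L0 Q"
    and H: "nrm M t (\<lambda>z. \<nu> z * ennreal ((v1 z / v0 z) powr (1 / \<kappa>))) \<le> H" "H < top"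
    and NF: "wnrm M x0 v0 F < top" "0 < wnrm M x0 v0 F"
    and \<kappa>: "2 \<le> \<kappa>"
    and \<rho>: "0 < \<rho>" and xy: "0 < x" "0 < y" "y = \<rho> - i" "i = \<rho> * x1" "i < 1" "0 < j" "j < 1" "1 \<le> i + j"
    and Lw: "1 \<le> L" "\<And>Q. Q \<in> S \<Longrightarrow> muckenhoupt M x y w L Q"
    and \<beta>: "1 + (1 - i) / x \<le> \<beta>" "1 + (1 - j) / y \<le> \<beta>"
    and NG: "nrm M j (\<lambda>z. epow (G z) (j + x) * ennreal (1 / w z)) < top"
  shows "(\<Sum>Q\<in>S. epow (tail_int \<nu> 1 F \<kappa> Q) \<rho> * (epow (integ M Q G) (j + x) / epow (emeasure M Q) (x + y)))
    \<le> ennreal (rdf_form_const x0 \<kappa> \<rho> i j x y * L0 powr (\<kappa> / (1 - x0) * \<rho>) * L powr \<beta>)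
      * epow H (\<kappa> * \<rho>) * epow (wnrm M x0 v0 F) \<rho> * nrm M j (\<lambda>z. epow (G z) (j + x) * ennreal (1 / w z))"
proof -
  define N where "N = wnrm M x0 v0 F"
  define R where "R = rdf_const x0 \<kappa>"
  define l where "l = L0 powr (\<kappa> / (1 - x0))"
  obtain F' where F' [measurable]: "F' \<in> borel_measurable M" and NF': "wnrm M x0 v0 F' \<le> 4 * N"
    and tail: "\<And>Q. Q \<in> S \<Longrightarrow> (\<integral>\<^sup>+z\<in>Q. epow (\<nu> z) \<kappa> * F' z \<partial>M) < top \<Longrightarrow>
      tail_int \<nu> 1 F \<kappa> Q \<le> ennreal (R * l) * (\<integral>\<^sup>+z\<in>Q. epow (\<nu> z) \<kappa> * F' z \<partial>M)"
  proof (rule tail_int_rdf[OF x01(1,2) meas(1,4,3) v(1) L NF \<kappa>], assumption, goal_cases)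
    case (1 F')
    from 1(2-4) show ?thesis unfolding N_def[symmetric] R_def[symmetric] l_def[symmetric] by (rule 1(1))
  qed
  define \<phi> where "\<phi> z = epow (\<nu> z) \<kappa> * F' z" for z
  have \<phi>m [measurable]: "\<phi> \<in> borel_measurable M" unfolding \<phi>_def[abs_def] by measurable
  have R0: "0 \<le> R * l" by (simp add: R_def rdf_const_def l_def)
  have phi1: "wnrm M x1 v1 \<phi> \<le> epow H \<kappa> * (4 * N)"
  proof -
    let ?h = "\<lambda>z. \<nu> z * ennreal ((v1 z / v0 z) powr (1 / \<kappa>))"
    have "wnrm M x1 v1 \<phi> = nrm M (\<kappa> * t + x0) (\<lambda>z. epow (?h z) \<kappa> * (F' z * ennreal (v0 z)))" unfolding t(2)
    proof (rule nrm_cong)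
      fix z
      have "epow (ennreal ((v1 z / v0 z) powr (1 / \<kappa>))) \<kappa> = ennreal (v1 z / v0 z)"
        using \<kappa> v[of z] by (simp add: epow_ennreal powr_powr)
      moreover have "ennreal (v1 z / v0 z) * ennreal (v0 z) = ennreal (v1 z)"
        using v(1)[of z] v(2)[of z] by (simp add: ennreal_mult[symmetric])
      ultimately show "\<phi> z * ennreal (v1 z) = epow (?h z) \<kappa> * (F' z * ennreal (v0 z))"
        by (simp add: \<phi>_def epow_mult) (metis mult.assoc mult.commute)
    qed
    also have "\<dots> \<le> nrm M (\<kappa> * t) (\<lambda>z. epow (?h z) \<kappa>) * wnrm M x0 v0 F'" using t \<kappa> x01 by (intro nrm_mult) auto
    also have "\<dots> \<le> epow (nrm M t ?h) \<kappa> * (4 * N)" using \<kappa> t NF' by (intro mult_mono nrm_epow_le) auto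
    also have "\<dots> \<le> epow H \<kappa> * (4 * N)" using \<kappa> H by (intro mult_right_mono epow_mono) auto
    finally show ?thesis .
  qed
  then have phi: "nrm M x1 (\<lambda>z. epow (\<phi> z) 1 * ennreal (v1 z)) \<le> epow H \<kappa> * (4 * N)" by simp
  have fin: "epow H \<kappa> * (4 * N) < top" using H(2) NF by (simp add: N_def ennreal_mult_less_top)
  have iy: "i + y = \<rho> * 1" using xy by simp
  have tail': "tail_int \<nu> 1 F \<kappa> Q \<le> ennreal (R * l) * epow (integ M Q \<phi>) 1"
    if "Q \<in> S" "integ M Q \<phi> < top" for Q using tail that by (simp add: \<phi>_def)
  note form_transfer[OF meas(2) \<phi>m meas(5) v(2) w \<rho> iy xy(4) x01(3) xy(1,2,5-8) Lw \<beta> NG phi fin tail' R0]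
  also have "ennreal ((R * l) powr \<rho> * (form_const i j x y * L powr \<beta>)) * epow (epow H \<kappa> * (4 * N)) \<rho>
    = ennreal ((R * l) powr \<rho> * (form_const i j x y * L powr \<beta>) * 4 powr \<rho>) * epow H (\<kappa> * \<rho>) * epow N \<rho>"
  proof -
    have "0 \<le> form_const i j x y" using xy by (intro form_const_nonneg) auto
    then have "ennreal ((R * l) powr \<rho> * (form_const i j x y * L powr \<beta>) * 4 powr \<rho>)
      = ennreal ((R * l) powr \<rho> * (form_const i j x y * L powr \<beta>)) * ennreal (4 powr \<rho>)" by (simp add: ennreal_mult)
    moreover have "epow (epow H \<kappa> * (4 * N)) \<rho> = epow H (\<kappa> * \<rho>) * (ennreal (4 powr \<rho>) * epow N \<rho>)"
      using epow_ennreal[of 4 \<rho>] by (simp add: epow_mult)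
    ultimately show ?thesis by (simp only: mult_ac)
  qed
  also have "(R * l) powr \<rho> * (form_const i j x y * L powr \<beta>) * 4 powr \<rho>
    = rdf_form_const x0 \<kappa> \<rho> i j x y * L0 powr (\<kappa> / (1 - x0) * \<rho>) * L powr \<beta>"
    using R0 by (simp add: rdf_form_const_def R_def l_def powr_mult powr_powr rdf_const_def mult_ac)
  finally show ?thesis by (simp add: N_def)
qed

end

section \<open>Exponents and weights\<close>

lemma mix_exp_alt: "mix_exp u v \<theta> = u - \<theta> * (u - v)" "mix_exp u v (1 - \<theta>) = v + \<theta> * (u - v)"
  by (simp_all add: mix_exp_def algebra_simps)

lemma op_exp_divide:
  assumes "0 < c"
  shows "op_exp x a / c = max ((1 - a) / (c * x)) (1 / (c * (1 - x)))"
proof -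
  have "max u v / c = max (u / c) (v / c)" for u v :: real using assms by (simp add: max_def divide_le_cancel)
  then show ?thesis by (simp add: op_exp_def mult.commute)
qed

context
  fixes p q r :: real and m :: nat
  assumes r: "1 \<le> r" "r < p" "r < q" and m: "1 \<le> m"
begin

private lemma rm: "1 \<le> r * real m" "0 < r * real m" "0 < real m" "0 < p" "0 < q" "0 < r"
proof -
  show "1 \<le> r * real m" using r m mult_mono[of 1 r 1 "real m"] by simp
  then show "0 < r * real m" by linarith
qed (use r m in auto)

lemma bloom_alpha_eq: "bloom_alpha p q m = (1 / (r * real m)) * (r / p - r / q)"
  using rm by (simp add: bloom_alpha_def field_simps)

text \<open>Dividing by m can only shrink a positive \<alpha>, whence the first bound. The second
  one makes 1 + \<alpha> an admissible exponent in the definition of the Bloom weight.\<close>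

lemma bloom_alpha_bounds:
  shows "bloom_alpha p q m \<le> 1 / p - 1 / q \<or> bloom_alpha p q m \<le> 0" "- 1 < bloom_alpha p q m"
proof -
  have e: "bloom_alpha p q m = (1 / p - 1 / q) * (1 / real m)" by (simp add: bloom_alpha_def diff_divide_distrib)
  show "bloom_alpha p q m \<le> 1 / p - 1 / q \<or> bloom_alpha p q m \<le> 0"
  proof (cases "0 \<le> 1 / p - 1 / q")
    case True
    then have "(1 / p - 1 / q) * (1 / real m) \<le> (1 / p - 1 / q) * 1" using m by (intro mult_left_mono) auto
    then show ?thesis by (simp add: e)
  next
    case False
    then have "(1 / p - 1 / q) * (1 / real m) \<le> 0" by (intro mult_nonpos_nonneg) auto
    then show ?thesis by (simp add: e)
  qed
  have "1 / (q * real m) < 1"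
  proof -
    have "q * 1 \<le> q * real m" using r m by (intro mult_left_mono) auto
    then have "1 < q * real m" using r by linarith
    then show ?thesis by simp
  qed
  moreover have "0 < 1 / (p * real m)" using rm by simp
  ultimately show "- 1 < bloom_alpha p q m" unfolding bloom_alpha_def by linarith
qed

context
  fixes k n :: nat and \<delta> \<epsilon> a :: real
  assumes k: "k = nat \<lfloor>r * real m\<rfloor>" and n: "n = k - 1" and \<delta>: "\<delta> = r * real m - real k" and \<epsilon>: "\<epsilon> = 1 / (r * real m)"
    and a: "a = max (bloom_alpha p q m) 0"
begin

lemma bloom_floor: "1 \<le> k" "0 \<le> \<delta>" "\<delta> < 1" "(\<delta> + real n + 1) * \<epsilon> = 1" "real n + \<delta> + 1 = r * real m"
  "of_int \<lfloor>r * real m\<rfloor> = real k"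
proof -
  have 1: "1 \<le> \<lfloor>r * real m\<rfloor>" using rm by simp
  then show e: "of_int \<lfloor>r * real m\<rfloor> = real k" unfolding k by simp
  show k1: "1 \<le> k" using 1 unfolding k by linarith
  show "0 \<le> \<delta>" "\<delta> < 1" unfolding \<delta> e[symmetric] by linarith+
  show rm': "real n + \<delta> + 1 = r * real m" using k1 unfolding n \<delta> by simp
  have "\<delta> + real n + 1 = r * real m" using rm' by simp
  then show "(\<delta> + real n + 1) * \<epsilon> = 1" using rm unfolding \<epsilon> by simp
qed

private lemma mix_first: "mix_exp (r / p) (r / q) \<epsilon> = r / p - bloom_alpha p q m"
  unfolding bloom_alpha_eq \<epsilon> by (rule mix_exp_alt)

private lemma mix_step:
  assumes "l \<in> {1..n}"
  shows "(\<delta> + real (n + 1 - l)) * \<epsilon> = 1 - real l / (r * real m)"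
    and "mix_exp (r / p) (r / q) ((\<delta> + real (n + 1 - l)) * \<epsilon>) = r / q + real l * bloom_alpha p q m"
proof -
  have "\<delta> + real (n + 1 - l) = r * real m - real l" using assms bloom_floor(5) by auto
  then show e: "(\<delta> + real (n + 1 - l)) * \<epsilon> = 1 - real l / (r * real m)" using rm unfolding \<epsilon> by (simp add: field_simps)
  have "mix_exp (r / p) (r / q) (1 - real l / (r * real m)) = r / q + real l * ((1 / (r * real m)) * (r / p - r / q))"
    unfolding mix_exp_alt(2) by simp
  then show "mix_exp (r / p) (r / q) ((\<delta> + real (n + 1 - l)) * \<epsilon>) = r / q + real l * bloom_alpha p q m"
    unfolding e bloom_alpha_eq .
qed

private lemma op_first:
  "op_exp (mix_exp (r / p) (r / q) \<epsilon>) a / p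
    = max ((1 - a) / (r - bloom_alpha p q m * p)) (1 / ((1 + bloom_alpha p q m) * p - r))"
proof -
  have "p * (r / p - bloom_alpha p q m) = r - bloom_alpha p q m * p"
    "p * (1 - (r / p - bloom_alpha p q m)) = (1 + bloom_alpha p q m) * p - r" using rm by (auto simp: field_simps)
  then show ?thesis unfolding mix_first op_exp_divide[OF rm(4)] by simp
qed

private lemma op_step:
  assumes "l \<in> {1..n}"
  shows "op_exp (mix_exp (r / p) (r / q) ((\<delta> + real (n + 1 - l)) * \<epsilon>)) a / q
    = max ((1 - a) / (r + real l * q * bloom_alpha p q m)) (1 / ((1 - real l * bloom_alpha p q m) * q - r))"
proof -
  have "q * (r / q + real l * bloom_alpha p q m) = r + real l * q * bloom_alpha p q m"
    "q * (1 - (r / q + real l * bloom_alpha p q m)) = (1 - real l * bloom_alpha p q m) * q - r"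
    using rm by (auto simp: field_simps)
  then show ?thesis unfolding mix_step(2)[OF assms] op_exp_divide[OF rm(5)] by simp
qed

text \<open>The chain counts upwards from \<theta> = 0, the sums in the \<beta>'s count downwards
  from \<theta> = 1; both are matched by l to n + 1 - l.\<close>

private lemma rev_sum: "(\<Sum>l\<in>{1..n}. g l) = (\<Sum>l\<in>{1..n}. g (n + 1 - l))" for g :: "nat \<Rightarrow> real"
  by (subst sum.atLeastAtMost_rev) simp

text \<open>The division by p combines the power r/p, by which the characteristic of
  \<open>v0\<close> comes from that of \<mu>, with the outer power 1/r. For \<lambda> the same
  consideration gives the division by q.\<close>

lemma chain_exp0_bloom: "chain_exp0 (r / p) (r / q) a \<epsilon> \<delta> n / p = beta_mu1 p q r m"
proof -
  let ?M = "\<lambda>l::nat. max ((1 - a) / (r + real l * q * bloom_alpha p q m)) (1 / ((1 - real l * bloom_alpha p q m) * q - r))"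
  have 1: "op_exp (r / p) 0 / p = max (1 / r) (1 / (p - r))"
  proof -
    have "p * (r / p) = r" "p * (1 - r / p) = p - r" using rm by (auto simp: field_simps)
    then show ?thesis unfolding op_exp_divide[OF rm(4)] by simp
  qed
  have 3: "(\<Sum>l\<in>{1..n}. (1 - (\<delta> + real l) * \<epsilon>) * op_exp (mix_exp (r / p) (r / q) ((\<delta> + real l) * \<epsilon>)) a) / p
    = q / p * (\<Sum>l\<in>{1..n}. real l / (r * real m) * ?M l)"
  proof -
    have "(1 - (\<delta> + real (n + 1 - l)) * \<epsilon>) * op_exp (mix_exp (r / p) (r / q) ((\<delta> + real (n + 1 - l)) * \<epsilon>)) a
      = q * (real l / (r * real m) * ?M l)" if l: "l \<in> {1..n}" for l
    proof -
      have "op_exp (mix_exp (r / p) (r / q) ((\<delta> + real (n + 1 - l)) * \<epsilon>)) a = q * ?M l"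
        unfolding op_step[OF l, symmetric] using rm by simp
      moreover have "1 - (\<delta> + real (n + 1 - l)) * \<epsilon> = real l / (r * real m)" unfolding mix_step(1)[OF l] by simp
      ultimately show ?thesis by (simp only: mult.left_commute)
    qed
    then have e: "(\<Sum>l\<in>{1..n}. (1 - (\<delta> + real l) * \<epsilon>) * op_exp (mix_exp (r / p) (r / q) ((\<delta> + real l) * \<epsilon>)) a)
      = q * (\<Sum>l\<in>{1..n}. real l / (r * real m) * ?M l)"
      unfolding sum_distrib_left by (subst rev_sum) (rule sum.cong[OF refl])
    show ?thesis unfolding e by simp
  qed
  have 2: "\<delta> * (1 - \<epsilon>) * op_exp (mix_exp (r / p) (r / q) \<epsilon>) a / p
    = (1 - 1 / (r * real m)) * (r * real m - real k) * max ((1 - a) / (r - bloom_alpha p q m * p)) (1 / ((1 + bloom_alpha p q m) * p - r))"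
    unfolding op_first[symmetric] by (simp add: \<delta> \<epsilon>)
  show ?thesis unfolding chain_exp0_def add_divide_distrib 1 2 3
    by (simp add: beta_mu1_def Let_def bloom_floor(6) k[symmetric] n a[symmetric])
qed

lemma chain_exp1_bloom: "chain_exp1 (r / p) (r / q) a \<epsilon> \<delta> n / q = beta_lambda1 p q r m"
proof -
  let ?M = "\<lambda>l::nat. max ((1 - a) / (r + real l * q * bloom_alpha p q m)) (1 / ((1 - real l * bloom_alpha p q m) * q - r))"
  have 3: "(\<Sum>l\<in>{1..n}. ((\<delta> + real l) * \<epsilon>) * op_exp (mix_exp (r / p) (r / q) ((\<delta> + real l) * \<epsilon>)) a) / q
    = (\<Sum>l\<in>{1..n}. (1 - real l / (r * real m)) * ?M l)"
  proof -
    have "(\<delta> + real (n + 1 - l)) * \<epsilon> * op_exp (mix_exp (r / p) (r / q) ((\<delta> + real (n + 1 - l)) * \<epsilon>)) a / q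
      = (1 - real l / (r * real m)) * ?M l" if l: "l \<in> {1..n}" for l
      unfolding op_step[OF l, symmetric] mix_step(1)[OF l, symmetric] by simp
    then show ?thesis unfolding sum_divide_distrib by (subst rev_sum) (rule sum.cong[OF refl])
  qed
  have 2: "\<delta> * \<epsilon> * op_exp (mix_exp (r / p) (r / q) \<epsilon>) a / q
    = p / q * (1 / (r * real m)) * (r * real m - real k) * max ((1 - a) / (r - bloom_alpha p q m * p)) (1 / ((1 + bloom_alpha p q m) * p - r))"
    unfolding op_first[symmetric] using rm by (simp add: \<delta> \<epsilon>)
  show ?thesis unfolding chain_exp1_def add_divide_distrib 2 3
    by (simp add: beta_lambda1_def Let_def bloom_floor(6) k[symmetric] n a[symmetric])
qed

end

text \<open>An inequality suffices because \<open>a\<close> may exceed \<alpha>: for negative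
  \<alpha> the estimate is run with a = 0, while the target keeps \<alpha>. The second entry of the
  maximum is attained exactly.\<close>

lemma form_exp_bloom:
  fixes s :: ereal and \<sigma> x y i j a :: real
  assumes s: "ereal q < s" and \<sigma>: "\<sigma> = (if s = \<infinity> then 0 else 1 / real_of_ereal s)"
    and a: "0 \<le> a" "bloom_alpha p q m \<le> a"
    and xy: "x = 1 / q - \<sigma>" "y = 1 / r - 1 / q" "i = 1 / q + a / r" "j = 1 - 1 / q"
  shows "0 < x" "0 \<le> \<sigma>" "max (1 + (1 - i) / x) (1 + (1 - j) / y) / q \<le> beta_lambda2 p q r s m"
proof -
  have s': "s = \<infinity> \<or> (\<exists>s0. s = ereal s0 \<and> q < s0)" using s by (cases s) auto
  show \<sigma>0: "0 \<le> \<sigma>" using s' rm(5) by (auto simp: \<sigma>)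
  show x: "0 < x" using s' rm(5) by (auto simp: \<sigma> xy(1) field_simps)
  have 2: "(1 + (1 - j) / y) / q = 1 / (q - r)" using rm r by (simp add: xy(2,4) field_simps)
  have 1: "(1 + (1 - i) / x) / q \<le> (if s = \<infinity> then 1 - bloom_alpha p q m / r
      else (real_of_ereal s * (1 - bloom_alpha p q m / r) - 1) / (real_of_ereal s - q))" using s'
  proof
    assume si: "s = \<infinity>"
    have "(1 + (1 - i) / x) / q = 1 - a / r" using si rm by (simp add: \<sigma> xy field_simps)
    also have "\<dots> \<le> 1 - bloom_alpha p q m / r" using a rm by (simp add: divide_right_mono)
    finally show ?thesis using si by simp
  next
    assume "\<exists>s0. s = ereal s0 \<and> q < s0"
    then obtain s0 where s0: "s = ereal s0" "q < s0" by blast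
    have sp: "0 < s0" using s0 rm by linarith
    have x': "x = (s0 - q) / (q * s0)" using s0 sp rm by (simp add: \<sigma> xy(1) field_simps)
    have xi: "x + (1 - i) = (s0 * (1 - a / r) - 1) / s0" using s0 sp by (simp add: \<sigma> xy(1,3) field_simps)
    have "(1 + (1 - i) / x) / q = (x + (1 - i)) / (x * q)" using x by (simp add: add_divide_distrib)
    also have "x * q = (s0 - q) / s0" using rm by (simp add: x')
    also have "(x + (1 - i)) / ((s0 - q) / s0) = (s0 * (1 - a / r) - 1) / (s0 - q)" unfolding xi using sp by simp
    also have "\<dots> \<le> (s0 * (1 - bloom_alpha p q m / r) - 1) / (s0 - q)"
      using a rm sp s0 by (intro divide_right_mono diff_right_mono mult_left_mono diff_left_mono) (auto simp: divide_right_mono)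
    finally show ?thesis using s0 by simp
  qed
  have "max u v / q = max (u / q) (v / q)" for u v :: real using rm by (simp add: max_def divide_le_cancel)
  then show "max (1 + (1 - i) / x) (1 + (1 - j) / y) / q \<le> beta_lambda2 p q r s m"
    using 1 2 by (simp add: beta_lambda2_def Let_def)
qed

end

section \<open>From averages over cubes to the Muckenhoupt condition\<close>

lemma muckenhoupt_ge_one:
  assumes [measurable]: "v \<in> borel_measurable M" "Q \<in> sets M" and v: "\<And>z. 0 < v z"
    and Q: "0 < emeasure M Q" "emeasure M Q < top" and xy: "0 < x" "0 < y"
    and m: "muckenhoupt M x y v L Q" and "0 \<le> L"
  shows "1 \<le> L"
proof -
  obtain c where c: "emeasure M Q = ennreal c" "0 < c" using Q by (cases "emeasure M Q") auto
  have "epow (emeasure M Q) (x + y) \<le> ennreal L * epow (emeasure M Q) (x + y)"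
    using Holder_weight[OF assms(1,2) v xy] m unfolding muckenhoupt_def by (rule order_trans)
  then have "ennreal (c powr (x + y)) \<le> ennreal (L * c powr (x + y))"
    using c \<open>0 \<le> L\<close> by (simp add: epow_ennreal ennreal_mult)
  then have "1 * c powr (x + y) \<le> L * c powr (x + y)" using \<open>0 \<le> L\<close> by (simp add: ennreal_le_iff)
  then show ?thesis using c by (simp only: mult_le_cancel_right) simp
qed

text \<open>The \<theta>-th power of the two-average condition, with the measure of the cube moved
  to the other side. At \<tau> = 1 it yields the conditions for \<open>v0\<close> and
  \<open>v1\<close>; a larger \<tau>, from the reverse Hoelder class, yields the off-diagonal
  condition of the outer form.\<close>

lemma avg_muckenhoupt:
  fixes w :: "real ^ 'n \<Rightarrow> real"
  assumes w: "\<And>z. 0 < w z" and Q: "Q \<in> cubes" and par: "0 < \<tau>" "1 < P" "0 < \<theta>" "0 \<le> B"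
    and le: "avg \<tau> (\<lambda>z. ennreal (w z)) Q * avg (1 / (P - 1)) (\<lambda>z. inverse (ennreal (w z))) Q \<le> ennreal B"
  shows "muckenhoupt lebesgue (\<theta> / \<tau>) (\<theta> * (P - 1)) (\<lambda>z. w z powr \<theta>) (B powr \<theta>) Q"
proof -
  define c where "c = measure lebesgue Q"
  have c: "emeasure lebesgue Q = ennreal c" "0 < c" using cubes_measure[OF Q] by (auto simp: c_def)
  define I where "I = (\<integral>\<^sup>+z\<in>Q. ennreal ((w z powr \<theta>) powr (1 / (\<theta> / \<tau>))) \<partial>lebesgue)"
  define J where "J = (\<integral>\<^sup>+z\<in>Q. ennreal ((w z powr \<theta>) powr (- 1 / (\<theta> * (P - 1)))) \<partial>lebesgue)"
  have "I = (\<integral>\<^sup>+z\<in>Q. epow (ennreal (w z)) \<tau> \<partial>lebesgue)"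
    unfolding I_def using w par less_imp_le[OF w] by (simp add: epow_ennreal powr_powr)
  then have 1: "avg \<tau> (\<lambda>z. ennreal (w z)) Q = epow I (1 / \<tau>) / ennreal (c powr (1 / \<tau>))"
    unfolding avg_def c by (simp add: epow_divide[OF c(2)])
  have "J = (\<integral>\<^sup>+z\<in>Q. epow (inverse (ennreal (w z))) (1 / (P - 1)) \<partial>lebesgue)"
  proof -
    have "(w z powr \<theta>) powr (- 1 / (\<theta> * (P - 1))) = (inverse (w z)) powr (1 / (P - 1))" for z
    proof -
      have "\<theta> * (- 1 / (\<theta> * (P - 1))) = - (1 / (P - 1))" using par by simp
      then show ?thesis using w[of z] by (simp add: powr_powr powr_minus inverse_powr)
    qed
    then show ?thesis unfolding J_def using w by (simp add: inverse_ennreal epow_ennreal less_imp_le)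
  qed
  then have 2: "avg (1 / (P - 1)) (\<lambda>z. inverse (ennreal (w z))) Q = epow J (P - 1) / ennreal (c powr (P - 1))"
    unfolding avg_def c using par by (simp add: epow_divide[OF c(2)])
  have "epow I (1 / \<tau>) * epow J (P - 1)
    = epow I (1 / \<tau>) / ennreal (c powr (1 / \<tau>)) * (epow J (P - 1) / ennreal (c powr (P - 1))) * (ennreal (c powr (1 / \<tau>)) * ennreal (c powr (P - 1)))"
  proof -
    have "epow I (1 / \<tau>) / ennreal (c powr (1 / \<tau>)) * ennreal (c powr (1 / \<tau>)) = epow I (1 / \<tau>)"
      "epow J (P - 1) / ennreal (c powr (P - 1)) * ennreal (c powr (P - 1)) = epow J (P - 1)"
      using c by (auto intro!: ennreal_divide_mult)
    then show ?thesis by (metis mult.assoc mult.commute)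
  qed
  also have "\<dots> \<le> ennreal B * (ennreal (c powr (1 / \<tau>)) * ennreal (c powr (P - 1)))"
    using le unfolding 1 2 by (intro mult_right_mono) auto
  finally have "epow (epow I (1 / \<tau>) * epow J (P - 1)) \<theta> \<le> epow (ennreal B * (ennreal (c powr (1 / \<tau>)) * ennreal (c powr (P - 1)))) \<theta>"
    using par by (intro epow_mono) auto
  moreover have "epow (epow I (1 / \<tau>) * epow J (P - 1)) \<theta> = epow I (\<theta> / \<tau>) * epow J (\<theta> * (P - 1))"
    unfolding epow_mult epow_epow by (simp add: mult.commute)
  moreover have "epow (ennreal B * (ennreal (c powr (1 / \<tau>)) * ennreal (c powr (P - 1)))) \<theta>
    = ennreal (B powr \<theta>) * epow (ennreal c) (\<theta> / \<tau> + \<theta> * (P - 1))"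
  proof -
    have "epow (ennreal (c powr u)) \<theta> = epow (ennreal c) (\<theta> * u)" for u
      using c by (simp add: epow_ennreal powr_powr mult.commute)
    then show ?thesis unfolding epow_mult epow_add using par by (simp add: epow_ennreal)
  qed
  ultimately show ?thesis unfolding muckenhoupt_def I_def J_def c(1) by simp
qed

lemma avg_cong_AE:
  assumes "AE x in lebesgue. h x = h' x"
  shows "avg t h Q = avg t h' Q"
proof -
  have "(\<integral>\<^sup>+x\<in>Q. epow (h x) t \<partial>lebesgue) = (\<integral>\<^sup>+x\<in>Q. epow (h' x) t \<partial>lebesgue)"
    using assms by (intro nn_integral_cong_AE) (auto elim: eventually_mono)
  then show ?thesis by (simp add: avg_def)
qed

lemma cube_exhaustion:
  fixes Z :: "(real ^ 'n) set"
  assumes "Z \<in> sets lebesgue" "emeasure lebesgue Z \<noteq> 0"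
  shows "\<exists>K. \<forall>k\<ge>K. emeasure lebesgue (Z \<inter> cube (- (\<chi> i. real k + 1)) (2 * (real k + 1))) \<noteq> 0"
proof -
  let ?Q = "\<lambda>k::nat. cube (- (\<chi> i. real k + 1)) (2 * (real k + 1)) :: (real ^ 'n) set"
  have mono: "?Q k \<subseteq> ?Q k'" if "k \<le> k'" for k k'
  proof
    fix x assume x: "x \<in> ?Q k"
    have "- (real k' + 1) \<le> x $ i \<and> x $ i < - (real k' + 1) + 2 * (real k' + 1)" for i
    proof -
      have "- (real k + 1) \<le> x $ i \<and> x $ i < - (real k + 1) + 2 * (real k + 1)" using x by (simp add: cube_def)
      moreover have "real k \<le> real k'" using that by simp
      ultimately show ?thesis by auto
    qed
    then show "x \<in> ?Q k'" by (simp add: cube_def)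
  qed
  have UN: "Z = (\<Union>k. Z \<inter> ?Q k)"
  proof -
    have "\<exists>k. x \<in> ?Q k" for x
    proof -
      obtain k :: nat where k: "norm x \<le> real k" using real_arch_simple by blast
      have "- (real k + 1) \<le> x $ i \<and> x $ i < - (real k + 1) + 2 * (real k + 1)" for i
      proof -
        have "\<bar>x $ i\<bar> \<le> real k" using component_le_norm_cart[of x i] k by linarith
        then show ?thesis by (auto simp: abs_le_iff)
      qed
      then show ?thesis by (auto simp: cube_def)
    qed
    then show ?thesis by blast
  qed
  have "\<exists>K. emeasure lebesgue (Z \<inter> ?Q K) \<noteq> 0"
  proof (rule ccontr)
    assume "\<nexists>K. emeasure lebesgue (Z \<inter> ?Q K) \<noteq> 0"
    then have "Z \<inter> ?Q k \<in> null_sets lebesgue" for k using assms(1) by (auto simp: null_sets_def)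
    then have "(\<Union>k. Z \<inter> ?Q k) \<in> null_sets lebesgue" by (rule null_sets_UN)
    then show False using UN assms(2) by (auto simp: null_sets_def)
  qed
  then obtain K where K: "emeasure lebesgue (Z \<inter> ?Q K) \<noteq> 0" by blast
  show ?thesis
  proof (intro exI allI impI)
    fix k assume "K \<le> k"
    then have "emeasure lebesgue (Z \<inter> ?Q K) \<le> emeasure lebesgue (Z \<inter> ?Q k)"
      using mono[of K k] assms(1) by (intro emeasure_mono) auto
    then show "emeasure lebesgue (Z \<inter> ?Q k) \<noteq> 0" using K by auto
  qed
qed

text \<open>If the weight vanished on a set of positive measure, a large cube would meet both this
  set and the set of positivity in positive measure. One average is then nonzero and the other
  infinite. That the weight does not vanish almost everywhere is part of the class.\<close>

lemma Ap_positive: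
  fixes w :: "real ^ 'n \<Rightarrow> real"
  assumes w: "w \<in> Ap P" and P: "1 < P"
  shows "AE x in lebesgue. 0 < w x"
proof (rule ccontr)
  assume neg: "\<not> (AE x in lebesgue. 0 < w x)"
  have nn: "0 \<le> w x" for x using w by (simp add: Ap_def weight_def)
  have [measurable]: "w \<in> borel_measurable lebesgue"
    using w by (intro locally_integrable_measurable) (simp add: Ap_def weight_def)
  define Z where "Z = {x. \<not> 0 < w x}"
  define Y where "Y = {x. 0 < w x}"
  have YZ [measurable]: "Y \<in> sets lebesgue" "Z \<in> sets lebesgue"
  proof -
    have "{x\<in>space lebesgue. 0 < w x} \<in> sets lebesgue" "{x\<in>space lebesgue. \<not> 0 < w x} \<in> sets lebesgue" by measurable
    then show "Y \<in> sets lebesgue" "Z \<in> sets lebesgue" by (simp_all add: Y_def Z_def)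
  qed
  have Z: "emeasure lebesgue Z \<noteq> 0" using neg by (subst (asm) AE_iff_measurable[OF YZ(2)]) (auto simp: Z_def)
  have Y: "emeasure lebesgue Y \<noteq> 0"
  proof
    assume "emeasure lebesgue Y = 0"
    then have "AE x in lebesgue. \<not> 0 < w x" by (subst AE_iff_measurable[OF YZ(1)]) (auto simp: Y_def)
    then have "AE x in lebesgue. w x = 0" by eventually_elim (use nn in \<open>auto simp: not_less intro: antisym\<close>)
    then show False using w by (simp add: Ap_def)
  qed
  let ?Q = "\<lambda>k::nat. cube (- (\<chi> i. real k + 1)) (2 * (real k + 1)) :: (real ^ 'n) set"
  obtain K1 where K1: "\<forall>k\<ge>K1. emeasure lebesgue (Z \<inter> ?Q k) \<noteq> 0" using cube_exhaustion[OF YZ(2) Z] by blast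
  obtain K2 where K2: "\<forall>k\<ge>K2. emeasure lebesgue (Y \<inter> ?Q k) \<noteq> 0" using cube_exhaustion[OF YZ(1) Y] by blast
  define Q where "Q = ?Q (max K1 K2)"
  have Qc: "Q \<in> cubes" unfolding Q_def by (intro cube_in_cubes) simp
  have [measurable]: "Q \<in> sets lebesgue" using Qc by (rule cubes_sets)
  have ZQ: "emeasure lebesgue (Z \<inter> Q) \<noteq> 0" unfolding Q_def using K1 max.cobounded1 by blast
  have YQ: "emeasure lebesgue (Y \<inter> Q) \<noteq> 0" unfolding Q_def using K2 max.cobounded2 by blast
  have "avg 1 (\<lambda>x. ennreal (w x)) Q \<noteq> 0"
  proof -
    have "(\<integral>\<^sup>+x\<in>Q. ennreal (w x) \<partial>lebesgue) \<noteq> 0"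
    proof
      assume "(\<integral>\<^sup>+x\<in>Q. ennreal (w x) \<partial>lebesgue) = 0"
      then have "AE x in lebesgue. ennreal (w x) * indicator Q x = 0" by (subst (asm) nn_integral_0_iff_AE) auto
      then have "AE x in lebesgue. \<not> (0 < w x \<and> x \<in> Q)" by eventually_elim (auto simp: indicator_def)
      then have "emeasure lebesgue (Y \<inter> Q) = 0" by (subst (asm) AE_iff_measurable[of "Y \<inter> Q"]) (auto simp: Y_def)
      then show False using YQ by simp
    qed
    then show ?thesis using cubes_emeasure[OF Qc] by (simp add: avg_def ennreal_divide_eq_0_iff)
  qed
  moreover have "avg (1 / (P - 1)) (\<lambda>x. inverse (ennreal (w x))) Q = top"
  proof -
    have "top = (\<integral>\<^sup>+x. top * indicator (Z \<inter> Q) x \<partial>lebesgue)"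
      using ZQ by (subst nn_integral_cmult_indicator) (auto simp: ennreal_top_mult)
    also have "\<dots> \<le> (\<integral>\<^sup>+x\<in>Q. epow (inverse (ennreal (w x))) (1 / (P - 1)) \<partial>lebesgue)"
    proof (intro nn_integral_mono)
      fix x
      have "epow (inverse (ennreal (w x))) (1 / (P - 1)) = top" if "\<not> 0 < w x"
      proof -
        have "w x = 0" using that nn[of x] by simp
        then show ?thesis by simp
      qed
      then show "top * indicator (Z \<inter> Q) x \<le> epow (inverse (ennreal (w x))) (1 / (P - 1)) * indicator Q x"
        by (auto simp: indicator_def Z_def)
    qed
    finally have "(\<integral>\<^sup>+x\<in>Q. epow (inverse (ennreal (w x))) (1 / (P - 1)) \<partial>lebesgue) = top" by (simp add: top_unique)
    then show ?thesis using cubes_emeasure(2)[OF Qc] by (simp add: avg_def ennreal_top_divide)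
  qed
  moreover have "avg 1 (\<lambda>x. ennreal (w x)) Q * avg (1 / (P - 1)) (\<lambda>x. inverse (ennreal (w x))) Q \<le> Ap_const P w"
    unfolding Ap_const_def using Qc by (intro SUP_upper)
  ultimately have "Ap_const P w = top" by (simp add: ennreal_mult_top top_unique)
  then show False using w by (simp add: Ap_def)
qed

text \<open>Changing the weight on a null set makes it positive everywhere, so that real powers of
  either sign behave well; averages do not notice the change.\<close>

lemma Ap_representative:
  fixes w :: "real ^ 'n \<Rightarrow> real"
  assumes w: "w \<in> Ap P" and P: "1 < P"
  obtains w' B where "w' \<in> borel_measurable lebesgue" "\<And>x. 0 < w' x" "AE x in lebesgue. w' x = w x"
    "Ap_const P w = ennreal B" "0 \<le> B"
    "\<And>Q. Q \<in> cubes \<Longrightarrow> avg 1 (\<lambda>x. ennreal (w' x)) Q * avg (1 / (P - 1)) (\<lambda>x. inverse (ennreal (w' x))) Q \<le> ennreal B"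
proof -
  define w' where "w' x = (if 0 < w x then w x else 1)" for x
  have wm [measurable]: "w \<in> borel_measurable lebesgue"
    using w by (intro locally_integrable_measurable) (simp add: Ap_def weight_def)
  have ae: "AE x in lebesgue. w' x = w x" using Ap_positive[OF w P] by eventually_elim (simp add: w'_def)
  have "Ap_const P w \<noteq> top" using w by (auto simp: Ap_def)
  then obtain B where B: "Ap_const P w = ennreal B" "0 \<le> B" by (cases "Ap_const P w") auto
  show thesis
  proof (rule that[OF _ _ ae B])
    show "w' \<in> borel_measurable lebesgue" unfolding w'_def[abs_def] by measurable
    show "0 < w' x" for x by (simp add: w'_def)
    fix Q :: "(real ^ 'n) set" assume Q: "Q \<in> cubes"
    have "avg 1 (\<lambda>x. ennreal (w' x)) Q = avg 1 (\<lambda>x. ennreal (w x)) Q"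
      "avg (1 / (P - 1)) (\<lambda>x. inverse (ennreal (w' x))) Q = avg (1 / (P - 1)) (\<lambda>x. inverse (ennreal (w x))) Q"
      using ae by (auto intro!: avg_cong_AE elim: eventually_mono)
    then show "avg 1 (\<lambda>x. ennreal (w' x)) Q * avg (1 / (P - 1)) (\<lambda>x. inverse (ennreal (w' x))) Q \<le> ennreal B"
      unfolding B(1)[symmetric] Ap_const_def using Q by (auto intro: SUP_upper)
  qed
qed

lemma RH_bound:
  fixes w w' :: "real ^ 'n \<Rightarrow> real"
  assumes w: "w \<in> RH \<tau>" and w': "w' \<in> borel_measurable lebesgue" "\<And>x. 0 < w' x" "AE x in lebesgue. w' x = w x"
  obtains R where "RH_const \<tau> w = ennreal R" "0 \<le> R"
    "\<And>Q. Q \<in> cubes \<Longrightarrow> avg \<tau> (\<lambda>x. ennreal (w' x)) Q \<le> ennreal R * avg 1 (\<lambda>x. ennreal (w' x)) Q"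
proof -
  have "RH_const \<tau> w \<noteq> top" using w by (auto simp: RH_def)
  then obtain R where R: "RH_const \<tau> w = ennreal R" "0 \<le> R" by (cases "RH_const \<tau> w") auto
  show thesis
  proof (rule that[OF R])
    fix Q :: "(real ^ 'n) set" assume Q: "Q \<in> cubes"
    have [measurable]: "Q \<in> sets lebesgue" "w' \<in> borel_measurable lebesgue" using Q w' cubes_sets by auto
    have eq: "avg t (\<lambda>x. ennreal (w' x)) Q = avg t (\<lambda>x. ennreal (w x)) Q" for t
      using w'(3) by (intro avg_cong_AE) (auto elim: eventually_mono)
    have "avg \<tau> (\<lambda>x. ennreal (w' x)) Q / avg 1 (\<lambda>x. ennreal (w' x)) Q \<le> ennreal R"
      unfolding eq R(1)[symmetric] RH_const_def using Q by (auto intro: SUP_upper)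
    moreover have "avg 1 (\<lambda>x. ennreal (w' x)) Q \<noteq> 0"
    proof -
      have "(\<integral>\<^sup>+x\<in>Q. ennreal (w' x) \<partial>lebesgue) \<noteq> 0"
      proof
        assume "(\<integral>\<^sup>+x\<in>Q. ennreal (w' x) \<partial>lebesgue) = 0"
        then have "AE x in lebesgue. ennreal (w' x) * indicator Q x = 0" by (subst (asm) nn_integral_0_iff_AE) auto
        then have "AE x in lebesgue. x \<notin> Q"
        proof eventually_elim
          case (elim x)
          then show ?case using w'(2)[of x] by (auto simp: indicator_def ennreal_eq_0_iff)
        qed
        then have "emeasure lebesgue Q = 0" by (subst (asm) AE_iff_measurable[of Q]) auto
        then show False using cubes_emeasure(1)[OF Q] by simp
      qed
      then show ?thesis using cubes_emeasure[OF Q] by (simp add: avg_def ennreal_divide_eq_0_iff)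
    qed
    moreover have "avg 1 (\<lambda>x. ennreal (w' x)) Q \<noteq> top"
    proof -
      have "locally_integrable w" using w by (simp add: RH_def weight_def)
      then have "integrable lebesgue (\<lambda>x. indicator Q x *\<^sub>R w x)"
        using cubes_integrable[of w, OF _ Q] by (simp add: set_integrable_def)
      then have "(\<integral>\<^sup>+x. ennreal (norm (indicator Q x *\<^sub>R w x)) \<partial>lebesgue) < top"
        unfolding integrable_iff_bounded by simp
      moreover have "(\<integral>\<^sup>+x\<in>Q. ennreal (w' x) \<partial>lebesgue) = (\<integral>\<^sup>+x. ennreal (norm (indicator Q x *\<^sub>R w x)) \<partial>lebesgue)"
      proof (rule nn_integral_cong_AE)
        show "AE x in lebesgue. ennreal (w' x) * indicator Q x = ennreal (norm (indicator Q x *\<^sub>R w x))" using w'(3)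
        proof eventually_elim
          case (elim x)
          then show ?case using w'(2)[of x] by (auto simp: indicator_def)
        qed
      qed
      ultimately have "(\<integral>\<^sup>+x\<in>Q. ennreal (w' x) \<partial>lebesgue) < top" by (simp only:)
      then show ?thesis using cubes_emeasure[OF Q] by (auto simp: avg_def ennreal_divide_eq_top_iff)
    qed
    ultimately show "avg \<tau> (\<lambda>x. ennreal (w' x)) Q \<le> ennreal R * avg 1 (\<lambda>x. ennreal (w' x)) Q"
    proof -
      assume le: "avg \<tau> (\<lambda>x. ennreal (w' x)) Q / avg 1 (\<lambda>x. ennreal (w' x)) Q \<le> ennreal R"
        and ne: "avg 1 (\<lambda>x. ennreal (w' x)) Q \<noteq> 0" "avg 1 (\<lambda>x. ennreal (w' x)) Q \<noteq> top"
      obtain d where d: "avg 1 (\<lambda>x. ennreal (w' x)) Q = ennreal d" "0 < d"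
        using ne by (cases "avg 1 (\<lambda>x. ennreal (w' x)) Q") auto
      show ?thesis using mult_right_mono[OF le, of "ennreal d"] unfolding d(1) ennreal_divide_mult[OF d(2)] by simp
    qed
  qed
qed

section \<open>The Bloom setting\<close>

text \<open>Lets the lemmas about families, such as \<open>muckenhoupt_finite\<close>, be applied to
  an individual cube.\<close>

lemma sparse_union_singleton:
  assumes Q: "Q \<in> cubes"
  shows "sparse_union lebesgue {Q}"
proof -
  interpret set_tree lebesgue "{Q}" using Q by unfold_locales (auto intro: cubes_sets cubes_emeasure)
  have "{P\<in>{Q}. P \<subset> Q'} = {}" if "Q' \<in> {Q}" for Q' using that by auto
  then have "sparse_tree lebesgue {Q}" by unfold_locales (simp only: Union_empty measure_empty, simp)
  then show ?thesis by unfold_locales blast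
qed

text \<open>The situation after passing to positive representatives, with real numbers for the
  weight constants. Bundling these data allows the final estimate to be stated without case
  distinctions on infinite values.\<close>

locale bloom =
  fixes p q r :: real and s :: ereal and m :: nat and \<mu> lam :: "real ^ 'n \<Rightarrow> real" and A B R :: real
  assumes r: "1 \<le> r" "r < p" "r < q" and s: "ereal q < s" and m: "1 \<le> m"
    and meas [measurable]: "\<mu> \<in> borel_measurable lebesgue" "lam \<in> borel_measurable lebesgue"
    and pos: "\<And>x. 0 < \<mu> x" "\<And>x. 0 < lam x"
    and Ap_\<mu>: "\<And>Q. Q \<in> cubes \<Longrightarrow>
        avg 1 (\<lambda>x. ennreal (\<mu> x)) Q * avg (1 / (p / r - 1)) (\<lambda>x. inverse (ennreal (\<mu> x))) Q \<le> ennreal A" "0 \<le> A"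
    and Ap_lam: "\<And>Q. Q \<in> cubes \<Longrightarrow>
        avg 1 (\<lambda>x. ennreal (lam x)) Q * avg (1 / (q / r - 1)) (\<lambda>x. inverse (ennreal (lam x))) Q \<le> ennreal B" "0 \<le> B"
    and RH_lam: "\<And>Q. Q \<in> cubes \<Longrightarrow>
        avg (conjugate_exponent (s / ereal q)) (\<lambda>x. ennreal (lam x)) Q \<le> ennreal R * avg 1 (\<lambda>x. ennreal (lam x)) Q" "0 \<le> R"
begin

text \<open>The reciprocal of s. Together with the definitions below it satisfies i + y = (1 + a)/r
  and j + x = 1 - \<sigma>, the powers in which the integrals of the outer form occur;
  \<open>a\<close> and \<open>t\<close> are the positive and the negative part of \<alpha>, so one
  of them is 0.\<close>

definition "\<sigma> = (if s = \<infinity> then 0 else 1 / real_of_ereal s)"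
definition "\<alpha> = bloom_alpha p q m"
definition "a = max (bloom_alpha p q m) 0"
definition "t = max (- bloom_alpha p q m) 0"
definition "k = nat \<lfloor>r * real m\<rfloor>"
definition "n = k - 1"
definition "\<delta> = r * real m - real k"
definition "\<epsilon> = 1 / (r * real m)"
definition "x = 1 / q - \<sigma>"
definition "y = 1 / r - 1 / q"
definition "i = 1 / q + a / r"
definition "j = 1 - 1 / q"
definition "\<beta> = max (1 + (1 - i) / x) (1 + (1 - j) / y)"
definition "E0 = chain_exp0 (r / p) (r / q) a \<epsilon> \<delta> n"
definition "E1 = chain_exp1 (r / p) (r / q) a \<epsilon> \<delta> n"
definition "v0 z = \<mu> z powr (r / p)"
definition "v1 z = lam z powr (r / q)"
definition "w z = v1 z powr (1 / r)"
definition "\<nu> = bloom_weight p q m \<mu> lam"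

lemma pq: "0 < p" "0 < q" "0 < r" "1 < p" "1 < q" using r by auto

lemma x01: "0 < r / p" "r / p < 1" "0 < r / q" "r / q < 1" using r pq by auto

lemmas floor_facts = bloom_floor[OF r m k_def n_def \<delta>_def \<epsilon>_def a_def]

lemma a_nonneg: "0 \<le> a" "0 \<le> t" "a = 0 \<or> t = 0" "\<alpha> \<le> a" "a = \<alpha> + t" by (auto simp: a_def t_def \<alpha>_def)

lemma form_exps: "0 < x" "0 \<le> \<sigma>" "\<beta> / q \<le> beta_lambda2 p q r s m"
  using form_exp_bloom[OF r m s \<sigma>_def a_nonneg(1) a_nonneg(4)[unfolded \<alpha>_def] x_def y_def i_def j_def]
  by (auto simp: \<beta>_def)

lemma exps: "0 < \<epsilon>" "0 < y" "0 < j" "j < 1" "i < 1" "1 \<le> i + j" "j + x = 1 - \<sigma>" "x + y = 1 / r - \<sigma>" "\<sigma> < 1"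
  "\<epsilon> * (r / q - r / p) + a = t"
proof -
  show "0 < \<epsilon>" using pq m by (simp add: \<epsilon>_def)
  show "0 < y" using r pq by (simp add: y_def field_simps)
  show "0 < j" "j < 1" using pq by (auto simp: j_def)
  show "1 \<le> i + j" using a_nonneg pq by (simp add: i_def j_def)
  show "j + x = 1 - \<sigma>" "x + y = 1 / r - \<sigma>" by (auto simp: j_def x_def y_def)
  show "\<sigma> < 1" using form_exps(1) pq unfolding x_def by (smt (verit) divide_le_eq_1_pos)
  show "\<epsilon> * (r / q - r / p) + a = t" using bloom_alpha_eq[OF r m] a_nonneg(5) by (simp add: \<epsilon>_def \<alpha>_def algebra_simps)
  \<comment> \<open>For positive a one has i \<le> 1/q + (1/p - 1/q) = 1/p, since r \<ge> 1.\<close>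
  show "i < 1"
  proof (cases "a = 0")
    case False
    then have al: "a = bloom_alpha p q m" "0 < a" by (auto simp: a_def)
    then have "a \<le> 1 / p - 1 / q" using bloom_alpha_bounds(1)[OF r m] by auto
    moreover have "a / r \<le> a" using al r by (simp add: divide_le_eq mult_le_cancel_left1)
    ultimately have "i \<le> 1 / p" by (simp add: i_def)
    also have "\<dots> < 1" using pq by simp
    finally show ?thesis .
  qed (use pq in \<open>simp add: i_def\<close>)
qed

lemma tau: "0 < conjugate_exponent (s / ereal q)" "1 / q / conjugate_exponent (s / ereal q) = x"
proof -
  have "s = \<infinity> \<or> (\<exists>s0. s = ereal s0 \<and> q < s0)" using s by (cases s) auto
  then have "0 < conjugate_exponent (s / ereal q) \<and>
    1 / q / conjugate_exponent (s / ereal q) = 1 / q - (if s = \<infinity> then 0 else 1 / real_of_ereal s)"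
  proof
    assume "s = \<infinity>"
    then show ?thesis using pq by (simp add: conjugate_exponent_def)
  next
    assume "\<exists>s0. s = ereal s0 \<and> q < s0"
    then obtain s0 where s0: "s = ereal s0" "q < s0" by blast
    have "conjugate_exponent (s / ereal q) = (s0 / q) / (s0 / q - 1)" using pq s0 by (simp add: conjugate_exponent_def)
    also have "\<dots> = s0 / (s0 - q)" using pq s0 by (simp add: field_simps)
    finally have e: "conjugate_exponent (s / ereal q) = s0 / (s0 - q)" .
    show ?thesis unfolding e using s0 pq by (simp add: field_simps)
  qed
  then show "0 < conjugate_exponent (s / ereal q)" "1 / q / conjugate_exponent (s / ereal q) = x"
    by (auto simp: x_def \<sigma>_def)
qed

lemma v_meas [measurable]: "v0 \<in> borel_measurable lebesgue" "v1 \<in> borel_measurable lebesgue" "w \<in> borel_measurable lebesgue"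
  unfolding v0_def[abs_def] v1_def[abs_def] w_def[abs_def] by measurable

lemma v_pos: "0 < v0 z" "0 < v1 z" "0 < w z" using pos[of z] by (auto simp: v0_def v1_def w_def)

lemma w_eq: "w = (\<lambda>z. lam z powr (1 / q))" using pq by (auto simp: w_def v1_def powr_powr)

text \<open>The third condition joins both hypotheses on \<lambda>: the reverse Hoelder bound
  replaces the average of higher order by a plain one at the cost R, and the A_(q/r) bound does the
  rest.\<close>

lemma muckenhoupt_v:
  assumes "Q \<in> cubes"
  shows "muckenhoupt lebesgue (r / p) (1 - r / p) v0 (A powr (r / p)) Q"
    and "muckenhoupt lebesgue (r / q) (1 - r / q) v1 (B powr (r / q)) Q"
    and "muckenhoupt lebesgue x y w ((R * B) powr (1 / q)) Q"
proof -
  have P: "r / p * (p / r - 1) = 1 - r / p" "r / q * (q / r - 1) = 1 - r / q" "1 / q * (q / r - 1) = y"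
    using pq by (auto simp: field_simps y_def)
  have gt: "1 < p / r" "1 < q / r" using r by auto
  show "muckenhoupt lebesgue (r / p) (1 - r / p) v0 (A powr (r / p)) Q"
    using avg_muckenhoupt[OF pos(1) assms zero_less_one gt(1) x01(1) Ap_\<mu>(2) Ap_\<mu>(1)[OF assms]]
    unfolding P v0_def[abs_def] by simp
  show "muckenhoupt lebesgue (r / q) (1 - r / q) v1 (B powr (r / q)) Q"
    using avg_muckenhoupt[OF pos(2) assms zero_less_one gt(2) x01(3) Ap_lam(2) Ap_lam(1)[OF assms]]
    unfolding P v1_def[abs_def] by simp
  have "avg (conjugate_exponent (s / ereal q)) (\<lambda>x. ennreal (lam x)) Q * avg (1 / (q / r - 1)) (\<lambda>x. inverse (ennreal (lam x))) Q
    \<le> ennreal R * avg 1 (\<lambda>x. ennreal (lam x)) Q * avg (1 / (q / r - 1)) (\<lambda>x. inverse (ennreal (lam x))) Q"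
    using RH_lam(1)[OF assms] by (rule mult_right_mono) simp
  also have "\<dots> \<le> ennreal R * ennreal B" using Ap_lam(1)[OF assms] by (simp add: mult.assoc mult_left_mono)
  also have "\<dots> = ennreal (R * B)" using RH_lam(2) by (simp add: ennreal_mult')
  finally have le: "avg (conjugate_exponent (s / ereal q)) (\<lambda>x. ennreal (lam x)) Q
    * avg (1 / (q / r - 1)) (\<lambda>x. inverse (ennreal (lam x))) Q \<le> ennreal (R * B)" .
  have "0 < 1 / q" "0 \<le> R * B" using pq RH_lam(2) Ap_lam(2) by auto
  from avg_muckenhoupt[OF pos(2) assms tau(1) gt(2) this le]
  show "muckenhoupt lebesgue x y w ((R * B) powr (1 / q)) Q" unfolding tau(2) P w_eq .
qed

lemma powr_ge_one: "0 \<le> c \<Longrightarrow> 0 < e \<Longrightarrow> 1 \<le> c powr e \<Longrightarrow> 1 \<le> (c :: real)"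
  using powr_less_mono2[of e c 1] by (cases "c < 1") auto

text \<open>Tested on the unit cube. Constants at least 1 permit enlarging exponents, for instance
  from \<open>\<beta> / q\<close> to \<open>beta_lambda2\<close>.\<close>

lemma const_ge_one: "1 \<le> A" "1 \<le> B" "1 \<le> R * B" "0 < R"
  "1 \<le> A powr (r / p)" "1 \<le> B powr (r / q)" "1 \<le> (R * B) powr (1 / q)"
proof -
  define Q where "Q = cube (0 :: real ^ 'n) 1"
  have Q: "Q \<in> cubes" by (simp add: Q_def cube_in_cubes)
  note ge = muckenhoupt_ge_one[OF _ cubes_sets[OF Q] _ cubes_emeasure[OF Q]]
  show 1: "1 \<le> A powr (r / p)" by (rule ge[OF v_meas(1) v_pos(1) _ _ muckenhoupt_v(1)[OF Q]]) (use x01 in auto)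
  show 2: "1 \<le> B powr (r / q)" by (rule ge[OF v_meas(2) v_pos(2) _ _ muckenhoupt_v(2)[OF Q]]) (use x01 in auto)
  show 3: "1 \<le> (R * B) powr (1 / q)"
    by (rule ge[OF v_meas(3) v_pos(3) _ _ muckenhoupt_v(3)[OF Q]]) (use form_exps exps in auto)
  have RB: "0 \<le> R * B" using RH_lam(2) Ap_lam(2) by simp
  show "1 \<le> A" by (rule powr_ge_one[OF Ap_\<mu>(2) x01(1) 1])
  show "1 \<le> B" by (rule powr_ge_one[OF Ap_lam(2) x01(3) 2])
  show RB1: "1 \<le> R * B" using pq by (intro powr_ge_one[OF RB _ 3]) simp
  show "0 < R" using RB1 RH_lam(2) by (cases "R = 0") auto
qed

lemma bound_powr:
  "((A powr (r / p)) powr E0 * (B powr (r / q)) powr E1) powr (1 / r) * ((R * B) powr (1 / q)) powr \<beta>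
    \<le> A powr beta_mu1 p q r m * B powr (beta_lambda1 p q r m + beta_lambda2 p q r s m) * R powr beta_lambda2 p q r s m"
  "((R * B) powr (1 / q)) powr \<beta> \<le> B powr beta_lambda2 p q r s m * R powr beta_lambda2 p q r s m"
proof -
  have "((R * B) powr (1 / q)) powr \<beta> = (R * B) powr (\<beta> / q)" by (simp add: powr_powr)
  also have "\<dots> \<le> (R * B) powr beta_lambda2 p q r s m" using const_ge_one(3) form_exps(3) by (intro powr_mono) auto
  also have "\<dots> = B powr beta_lambda2 p q r s m * R powr beta_lambda2 p q r s m"
    using const_ge_one by (simp add: powr_mult mult.commute)
  finally show RB: "((R * B) powr (1 / q)) powr \<beta> \<le> B powr beta_lambda2 p q r s m * R powr beta_lambda2 p q r s m" .
  have e: "r / p * (E * (1 / r)) = E / p" "r / q * (E * (1 / r)) = E / q" for E using pq by auto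
  have "((A powr (r / p)) powr E0 * (B powr (r / q)) powr E1) powr (1 / r)
    = A powr beta_mu1 p q r m * B powr beta_lambda1 p q r m"
    unfolding E0_def E1_def chain_exp0_bloom[OF r m k_def n_def \<delta>_def \<epsilon>_def a_def, symmetric]
      chain_exp1_bloom[OF r m k_def n_def \<delta>_def \<epsilon>_def a_def, symmetric]
    by (simp only: powr_mult powr_powr powr_ge_zero mult.assoc e)
  then have "((A powr (r / p)) powr E0 * (B powr (r / q)) powr E1) powr (1 / r) * ((R * B) powr (1 / q)) powr \<beta>
    \<le> A powr beta_mu1 p q r m * B powr beta_lambda1 p q r m * (B powr beta_lambda2 p q r s m * R powr beta_lambda2 p q r s m)"
    using RB by (simp add: mult_left_mono)
  then show "((A powr (r / p)) powr E0 * (B powr (r / q)) powr E1) powr (1 / r) * ((R * B) powr (1 / q)) powr \<beta>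
    \<le> A powr beta_mu1 p q r m * B powr (beta_lambda1 p q r m + beta_lambda2 p q r s m) * R powr beta_lambda2 p q r s m"
    by (simp add: powr_add mult_ac)
qed

lemma alpha_gt: "- 1 < \<alpha>" using bloom_alpha_bounds(2)[OF r m] by (simp add: \<alpha>_def)

lemma nu_pos: "0 < \<nu> z" using pos[of z] by (simp add: \<nu>_def bloom_weight_def)

lemma nu_meas [measurable]: "\<nu> \<in> borel_measurable lebesgue" unfolding \<nu>_def bloom_weight_def[abs_def] by measurable

text \<open>The defining relation of the Bloom weight: a step of length \<epsilon> = 1/(rm) from
  \<open>v0\<close> towards \<open>v1\<close> is undone exactly by \<nu> to the power 1 + \<alpha>.
  It turns the quantity \<open>H\<close> of the chain into the norm of b.\<close>

lemma nu_powr: "(v1 z / v0 z) powr \<epsilon> = \<nu> z powr (- (1 + \<alpha>))"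
proof -
  have m0: "real m \<noteq> 0" using m by simp
  have "(v1 z / v0 z) powr \<epsilon> = lam z powr (r / q * \<epsilon>) / \<mu> z powr (r / p * \<epsilon>)"
    using pos[of z] by (simp add: v0_def v1_def powr_divide powr_powr)
  moreover have "r / q * \<epsilon> = 1 / (q * real m)" "r / p * \<epsilon> = 1 / (p * real m)" using pq m0 by (auto simp: \<epsilon>_def)
  ultimately have 1: "(v1 z / v0 z) powr \<epsilon> = lam z powr (1 / (q * real m)) / \<mu> z powr (1 / (p * real m))" by (simp only:)
  have "\<nu> z powr (- (1 + \<alpha>)) = (\<mu> z powr (1 / (p * real m)) * lam z powr (- 1 / (q * real m))) powr (- 1)"
  proof -
    have "1 / (1 + \<alpha>) * (1 + \<alpha>) = 1" using alpha_gt by simp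
    then have e: "1 / (1 + \<alpha>) * (- (1 + \<alpha>)) = - 1" by (simp only: mult_minus_right)
    show ?thesis unfolding \<nu>_def bloom_weight_def \<alpha>_def[symmetric] powr_powr e ..
  qed
  also have "\<dots> = lam z powr (1 / (q * real m)) / \<mu> z powr (1 / (p * real m))"
    using pos[of z] by (simp add: powr_minus powr_mult field_simps)
  finally show ?thesis using 1 by (simp only:)
qed

text \<open>The Bloom weight is a product of powers c and d of \<mu> and of the dual weight of
  \<lambda>, and c + d \<le> 1 because rm \<ge> 1. Both functions are integrable on cubes, hence so
  is \<nu>.\<close>

lemma nu_le: "\<nu> z \<le> 1 + \<mu> z + v1 z powr (- 1 / (1 - r / q))"
proof -
  have m0: "0 < real m" using m by simp
  define c where "c = 1 / (p * real m) / (1 + \<alpha>)"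
  define u where "u = v1 z powr (- 1 / (1 - r / q))"
  define d where "d = 1 / (q * real m) / (1 + \<alpha>) * ((q - r) / r)"
  have u0: "0 < u" using v_pos(2)[of z] by (simp add: u_def)
  have cd: "0 \<le> c" "0 \<le> d" using pq m0 alpha_gt r by (auto simp: c_def d_def)
  have ue: "u = lam z powr (- (r / (q - r)))"
  proof -
    have e: "1 - r / q = (q - r) / q" using pq by (simp add: field_simps)
    have "r / q * (- 1 / (1 - r / q)) = - (r / (q - r))" unfolding e using pq by simp
    then show ?thesis unfolding u_def v1_def powr_powr by (simp only:)
  qed
  have "c + d = (1 / (p * real m) + 1 / (q * real m) * ((q - r) / r)) / (1 + \<alpha>)"
    by (simp add: c_def d_def add_divide_distrib)
  also have "1 / (p * real m) + 1 / (q * real m) * ((q - r) / r) = \<alpha> + 1 / (r * real m)"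
    using pq m0 by (simp add: \<alpha>_def bloom_alpha_def field_simps)
  also have "(\<alpha> + 1 / (r * real m)) / (1 + \<alpha>) \<le> 1"
  proof -
    have "1 * 1 \<le> r * real m" using r m by (intro mult_mono) auto
    then have "1 / (r * real m) \<le> 1" by simp
    then show ?thesis using alpha_gt by simp
  qed
  finally have cd1: "c + d \<le> 1" .
  define X where "X = 1 + \<mu> z + u"
  have X: "1 \<le> X" "\<mu> z \<le> X" "u \<le> X" using pos(1)[of z] u0 by (auto simp: X_def)
  have "\<nu> z = \<mu> z powr c * u powr d"
  proof -
    have "- (r / (q - r)) * (X * ((q - r) / r)) = - X" for X using pq r by simp
    from this[of "1 / (q * real m) / (1 + \<alpha>)"]
    have "- (r / (q - r)) * d = - 1 / (q * real m) / (1 + \<alpha>)" by (simp add: d_def)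
    then have "u powr d = lam z powr (- 1 / (q * real m) / (1 + \<alpha>))" by (simp add: ue powr_powr)
    then show ?thesis by (simp add: \<nu>_def bloom_weight_def powr_mult powr_powr c_def \<alpha>_def)
  qed
  also have "\<dots> \<le> X powr c * X powr d" using X cd u0 pos(1)[of z] by (intro mult_mono powr_mono2) auto
  also have "\<dots> = X powr (c + d)" by (simp add: powr_add)
  also have "\<dots> \<le> X powr 1" using X cd1 by (intro powr_mono) auto
  finally show ?thesis using X by (simp add: X_def u_def)
qed

lemma nu_integral:
  assumes Q: "Q \<in> cubes"
  shows "weight_measure \<nu> Q < top" "0 < weight_measure \<nu> Q"
proof -
  have [measurable]: "Q \<in> sets lebesgue" using Q by (rule cubes_sets)
  interpret sparse_union lebesgue "{Q}" by (rule sparse_union_singleton[OF Q])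
  have 1: "(\<integral>\<^sup>+z\<in>Q. ennreal (v0 z powr (1 / (r / p))) \<partial>lebesgue) < top"
    by (rule muckenhoupt_finite(1)[OF v_meas(1) v_pos(1) _ muckenhoupt_v(1)[OF Q]]) simp
  have 2: "(\<integral>\<^sup>+z\<in>Q. ennreal (v1 z powr (- 1 / (1 - r / q))) \<partial>lebesgue) < top"
    by (rule muckenhoupt_finite(2)[OF v_meas(2) v_pos(2) _ muckenhoupt_v(2)[OF Q]]) simp
  have v0: "v0 z powr (1 / (r / p)) = \<mu> z" for z using pq pos(1)[of z] by (simp add: v0_def powr_powr)
  have "weight_measure \<nu> Q \<le> (\<integral>\<^sup>+z. indicator Q z + ennreal (v0 z powr (1 / (r / p))) * indicator Q z
    + ennreal (v1 z powr (- 1 / (1 - r / q))) * indicator Q z \<partial>lebesgue)" unfolding weight_measure_def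
  proof (intro nn_integral_mono)
    fix z
    have "ennreal (\<nu> z) \<le> 1 + ennreal (\<mu> z) + ennreal (v1 z powr (- 1 / (1 - r / q)))"
      using ennreal_leI[OF nu_le[of z]] pos(1)[of z] less_imp_le by (simp add: ennreal_plus)
    then show "ennreal (\<nu> z) * indicator Q z \<le> indicator Q z + ennreal (v0 z powr (1 / (r / p))) * indicator Q z
      + ennreal (v1 z powr (- 1 / (1 - r / q))) * indicator Q z" unfolding v0 by (auto simp: indicator_def)
  qed
  also have "\<dots> = emeasure lebesgue Q + (\<integral>\<^sup>+z\<in>Q. ennreal (v0 z powr (1 / (r / p))) \<partial>lebesgue)
      + (\<integral>\<^sup>+z\<in>Q. ennreal (v1 z powr (- 1 / (1 - r / q))) \<partial>lebesgue)" by (simp add: nn_integral_add)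
  also have "\<dots> < top" using 1 2 cubes_emeasure(2)[OF Q] by simp
  finally show "weight_measure \<nu> Q < top" .
  show "0 < weight_measure \<nu> Q"
    unfolding weight_measure_def using nn_integral_weight_pos[OF nu_meas nu_pos, of Q] by simp
qed

end

lemma epow_conjugate_cancel:
  assumes "0 < A" "0 < B" "0 < c" "0 < D" "A * B = c * D"
  shows "U / ennreal A * (V / ennreal B) * ennreal c = U * (V / ennreal D)"
proof -
  have div: "X / ennreal E = X * ennreal (1 / E)" if "0 < E" for X E
    using that by (simp add: divide_ennreal_def inverse_ennreal inverse_eq_divide)
  have "1 / A * (1 / B) * c = 1 / D" using assms by (simp add: field_simps)
  then have "ennreal (1 / A) * ennreal (1 / B) * ennreal c = ennreal (1 / D)"
    using assms by (simp add: ennreal_mult[symmetric])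
  then show ?thesis using assms(1,2,4) by (simp only: div mult_ac)
qed

lemma nn_integral_eq_0_weight:
  assumes [measurable]: "h \<in> borel_measurable M" "u \<in> borel_measurable M" and u: "\<And>z. 0 < u z"
    and 0: "(\<integral>\<^sup>+z. epow (h z) c * ennreal (u z) \<partial>M) = 0"
  shows "AE z in M. h z = 0"
proof -
  have "AE z in M. epow (h z) c * ennreal (u z) = 0" using 0 by (subst (asm) nn_integral_0_iff_AE) auto
  then show ?thesis
  proof eventually_elim
    case (elim z)
    then show ?case using u[of z] by (auto simp: ennreal_eq_0_iff)
  qed
qed

section \<open>The sparse form in the Bloom setting\<close>

context bloom
begin

definition "q' = conjugate_exponent (ereal q)"

text \<open>All powers of the measure of \<open>Q\<close> in one term of the form are collected
  here: the two averages contribute -1/r and -(1 - \<sigma>), and the factor |Q| contributes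
  1.\<close>

definition "form_wt g Q = epow (\<integral>\<^sup>+z\<in>Q. epow (ennreal (norm (g z :: complex))) (1 / (1 - \<sigma>)) \<partial>lebesgue) (1 - \<sigma>)
  / epow (emeasure lebesgue (Q :: (real ^ 'n) set)) (1 / r - \<sigma>)"

abbreviation "form_int b f Q \<equiv>
  \<integral>\<^sup>+z\<in>Q. epow (ennreal (norm (b z - mean b Q))) (r * real m) * epow (ennreal (norm (f z :: complex))) r \<partial>lebesgue"

definition "K1 = chain_form_const (r / p) (r / q) a \<epsilon> \<delta> n (1 / r) i j x y"
definition "K2 = rdf_form_const (r / p) (r * real m) (1 / r) i j x y"
definition "C1 = A powr beta_mu1 p q r m * B powr (beta_lambda1 p q r m + beta_lambda2 p q r s m) * R powr beta_lambda2 p q r s m"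
definition "C2 = A powr beta_mu2 p r m * B powr beta_lambda2 p q r s m * R powr beta_lambda2 p q r s m"
text \<open>The minimum where both bounds are available, so that one constant obeys both at
  once.\<close>

definition "C = (if q \<le> p \<and> 2 \<le> m then min C1 C2 else C1)"
definition "Nf f = Lp_norm p \<mu> (\<lambda>x. ennreal (norm (f x :: complex)))"
definition "Ng g = Lp_norm q' (\<lambda>x. lam x powr (1 - q')) (\<lambda>x. ennreal (norm (g x :: complex)))"

lemma K_nonneg: "0 \<le> K1" "0 \<le> K2"
  using exps form_exps by (auto simp: K1_def K2_def chain_form_const_def rdf_form_const_def intro!: mult_nonneg_nonneg form_const_nonneg)

lemma C_pos: "0 < C1" "0 < C2" "0 < C" using const_ge_one by (auto simp: C1_def C2_def C_def min_def)

lemma q'_eq: "q' = 1 / j" "1 - q' = - 1 / (q - 1)"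
  using pq by (auto simp: q'_def conjugate_exponent_def j_def field_simps)

lemma norm_f:
  "epow (nrm lebesgue (r / p) (\<lambda>z. epow (ennreal (norm (f z))) r * ennreal (v0 z))) (1 / r) = Nf f"
proof -
  have "ennreal (v0 z) = epow (ennreal (\<mu> z)) (r / p)" for z using pos(1)[of z] by (simp add: v0_def epow_ennreal)
  then have "epow (epow (ennreal (norm (f z))) r * ennreal (v0 z)) (1 / (r / p)) = epow (ennreal (norm (f z))) p * ennreal (\<mu> z)" for z
    using pq by (simp add: epow_mult)
  then show ?thesis using pq unfolding nrm_pos[OF x01(1)] Nf_def Lp_norm_def by simp
qed

lemma norm_g:
  "nrm lebesgue j (\<lambda>z. epow (epow (ennreal (norm (g z))) (1 / (1 - \<sigma>))) (j + x) * ennreal (1 / w z)) = Ng g"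
proof -
  have "epow (epow (epow (ennreal (norm (g z))) (1 / (1 - \<sigma>))) (j + x) * ennreal (1 / w z)) (1 / j)
    = epow (ennreal (norm (g z))) q' * ennreal (lam z powr (1 - q'))" for z
  proof -
    have e: "- (1 / q) * (1 / j) = 1 - q'" using pq unfolding q'_eq(2) by (simp add: j_def field_simps)
    have "1 / w z = lam z powr (- (1 / q))" by (simp add: w_eq powr_minus_divide)
    then have "epow (ennreal (1 / w z)) (1 / j) = ennreal (lam z powr (1 - q'))"
      using e by (simp only: epow_ennreal powr_ge_zero powr_powr)
    moreover have "1 / (1 - \<sigma>) * (j + x) * (1 / j) = q'" using exps(3,7,9) by (simp add: q'_eq(1))
    ultimately show ?thesis unfolding epow_mult epow_epow by (simp only:)
  qed
  then show ?thesis using exps(3) unfolding nrm_pos[OF exps(3)] Ng_def Lp_norm_def by (simp add: q'_eq(1))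
qed

text \<open>The oscillation enters only through the majorant \<nu>h, which puts both kinds of norms
  of b on the same footing. The chain estimate is always available and the majorant estimate in
  addition for q \<le> p and m \<ge> 2; the sum K1 + K2 serves whichever of the two constants is
  smaller.\<close>

lemma tree_bound:
  fixes f g :: "real ^ 'n \<Rightarrow> complex" and \<nu>h :: "real ^ 'n \<Rightarrow> ennreal"
  assumes S: "sparse_union lebesgue \<S>" "\<S> \<subseteq> cubes" "S0 \<subseteq> \<S>"
    and [measurable]: "f \<in> borel_measurable lebesgue" "g \<in> borel_measurable lebesgue" "\<nu>h \<in> borel_measurable lebesgue"
    and osc: "\<And>P. P \<in> \<S> \<Longrightarrow> oscillation b P \<le> epow (integ lebesgue P \<nu>h) (1 + a)"
      "\<And>P. P \<in> \<S> \<Longrightarrow> (integ lebesgue P \<nu>h) < top"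
    and H: "nrm lebesgue t (\<lambda>z. epow (\<nu>h z) (1 + a) * ennreal (\<nu> z powr (- (1 + \<alpha>)))) \<le> H" "H < top"
    and N: "0 < Nf f" "Nf f < top" "Ng g < top"
  shows "(\<Sum>Q\<in>S0. epow (\<integral>\<^sup>+z\<in>Q. epow (osc_sum b \<S> Q z) (r * real m) * epow (ennreal (norm (f z))) r \<partial>lebesgue) (1 / r) * form_wt g Q)
    \<le> ennreal (K1 + K2) * ennreal C * Nf f * Ng g * H ^ m"
proof -
  interpret sparse_union lebesgue \<S> by (rule S(1))
  define F where "F z = epow (ennreal (norm (f z))) r" for z
  define G where "G z = epow (ennreal (norm (g z))) (1 / (1 - \<sigma>))" for z
  have [measurable]: "F \<in> borel_measurable lebesgue" "G \<in> borel_measurable lebesgue"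
    unfolding F_def[abs_def] G_def[abs_def] by measurable
  have fm: "F \<in> borel_measurable lebesgue" "G \<in> borel_measurable lebesgue" "\<nu>h \<in> borel_measurable lebesgue" by measurable
  have muck: "\<And>Q. Q \<in> \<S> \<Longrightarrow> muckenhoupt lebesgue (r / p) (1 - r / p) v0 (A powr (r / p)) Q"
    "\<And>Q. Q \<in> \<S> \<Longrightarrow> muckenhoupt lebesgue (r / q) (1 - r / q) v1 (B powr (r / q)) Q"
    "\<And>Q. Q \<in> \<S> \<Longrightarrow> muckenhoupt lebesgue x y w ((R * B) powr (1 / q)) Q" using S(2) muckenhoupt_v by auto
  have w': "w = (\<lambda>z. v1 z powr (1 / r))" by (simp add: w_def fun_eq_iff)
  have NF: "epow (wnrm lebesgue (r / p) v0 F) (1 / r) = Nf f" unfolding F_def by (rule norm_f)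
  have NFt: "wnrm lebesgue (r / p) v0 F < top" "0 < wnrm lebesgue (r / p) v0 F"
    using N(1,2) unfolding NF[symmetric] by simp_all
  have NG: "nrm lebesgue j (\<lambda>z. epow (G z) (j + x) * ennreal (1 / w z)) = Ng g" unfolding G_def by (rule norm_g)
  have NGt: "nrm lebesgue j (\<lambda>z. epow (G z) (j + x) * ennreal (1 / w z)) < top" using N(3) by (simp add: NG)
  have m0: "0 < real m" "0 < m" using m by auto
  have rm: "r * real m = real n + \<delta> + 1" using floor_facts(5) by simp
  have rm0: "r * real m \<noteq> 0" using pq m0 by simp
  have wt: "form_wt g Q = epow (integ lebesgue Q G) (j + x) / epow (emeasure lebesgue Q) (x + y)" for Q
    by (simp add: form_wt_def G_def exps)
  have tail: "(\<integral>\<^sup>+z\<in>Q. epow (osc_sum b \<S> Q z) (r * real m) * F z \<partial>lebesgue) \<le> tail_int \<nu>h (1 + a) F (r * real m) Q" for Q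
  proof -
    have "osc_sum b \<S> Q z \<le> tail_sum \<nu>h (1 + a) Q z" for z unfolding osc_sum_def tail_sum_def coef_def using osc(1)
      by (intro sum_mono mult_right_mono divide_right_mono_ennreal) auto
    then show ?thesis
      unfolding tail_int_def using rm0 m0 pq by (auto intro!: nn_integral_mono mult_right_mono epow_mono)
  qed
  have le_tail: "(\<Sum>Q\<in>S0. epow (\<integral>\<^sup>+z\<in>Q. epow (osc_sum b \<S> Q z) (r * real m) * epow (ennreal (norm (f z))) r \<partial>lebesgue) (1 / r) * form_wt g Q)
    \<le> (\<Sum>Q\<in>\<S>. epow (tail_int \<nu>h (1 + a) F (r * real m) Q) (1 / r) * (epow (integ lebesgue Q G) (j + x) / epow (emeasure lebesgue Q) (x + y)))"
    (is "?lhs \<le> _")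
  proof -
    have "?lhs \<le> (\<Sum>Q\<in>\<S>. epow (\<integral>\<^sup>+z\<in>Q. epow (osc_sum b \<S> Q z) (r * real m) * F z \<partial>lebesgue) (1 / r) * form_wt g Q)"
      unfolding F_def using finite_S S(3) by (intro sum_mono2) auto
    also have "\<dots> \<le> (\<Sum>Q\<in>\<S>. epow (tail_int \<nu>h (1 + a) F (r * real m) Q) (1 / r) * form_wt g Q)"
      using tail pq by (intro sum_mono mult_right_mono epow_mono) auto
    finally show ?thesis by (simp only: wt)
  qed
  have \<beta>: "1 + (1 - i) / x \<le> \<beta>" "1 + (1 - j) / y \<le> \<beta>" by (auto simp: \<beta>_def)
  have H': "nrm lebesgue t (\<lambda>z. epow (\<nu>h z) (1 + a) * ennreal ((v1 z / v0 z) powr \<epsilon>)) \<le> H"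
    unfolding nu_powr by (rule H(1))
  have y_eq: "y = 1 / r - 1 / q" "1 / q = 1 / r * (r / q)" "i = 1 / q + 1 / r * a" using pq by (auto simp: y_def i_def)
  have r0: "0 < 1 / r" using pq by simp
  define X where "X = Nf f * Ng g * H ^ m"
  have mono: "ennreal u * epow H (real m) * Nf f * Ng g \<le> ennreal v * X" if "u \<le> v" for u v
  proof -
    have "ennreal u * epow H (real m) * Nf f * Ng g = ennreal u * X" by (simp add: X_def epow_nat[OF m0(2)] mult_ac)
    then show ?thesis using that by (simp add: ennreal_leI mult_right_mono)
  qed
  have "(\<Sum>Q\<in>\<S>. epow (tail_int \<nu>h (1 + a) F (real n + \<delta> + 1) Q) (1 / r) * (epow (integ lebesgue Q G) (j + x) / epow (emeasure lebesgue Q) (x + y)))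
    \<le> ennreal (K1 * ((A powr (r / p)) powr E0 * (B powr (r / q)) powr E1) powr (1 / r)
        * ((R * B) powr (1 / q)) powr \<beta>) * epow H ((real n + 1 + \<delta>) * (1 / r)) * Nf f * Ng g"
    using chain_form_bound[OF v_meas(1,2) fm(3,1,2) v_pos(1,2) w' x01 a_nonneg(1-3) exps(10) exps(1) floor_facts(2,3)
        const_ge_one(5,6) muck(1,2) H' H(2) NFt(1) floor_facts(4) osc(2) r0 form_exps(1) exps(2) y_eq exps(5,3,4,6)
        const_ge_one(7) muck(3) \<beta> NGt] unfolding NF NG K1_def E0_def E1_def .
  also have "(real n + 1 + \<delta>) * (1 / r) = real m" using rm pq by (simp add: field_simps)
  also have "ennreal (K1 * ((A powr (r / p)) powr E0 * (B powr (r / q)) powr E1) powr (1 / r)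
        * ((R * B) powr (1 / q)) powr \<beta>) * epow H (real m) * Nf f * Ng g \<le> ennreal (K1 * C1) * X"
    using mult_left_mono[OF bound_powr(1) K_nonneg(1)] by (intro mono) (simp add: C1_def mult.assoc)
  finally have b1: "?lhs \<le> ennreal (K1 * C1) * X" using le_tail unfolding rm by (rule order_trans[rotated])
  have b2: "?lhs \<le> ennreal (K2 * C2) * X" if qp: "q \<le> p" "2 \<le> m"
  proof -
    \<comment> \<open>For q \<le> p the number \<alpha> is not positive; hence a = 0, the operators
      are plain averages and all of the exponent gap is carried by t.\<close>
    have "1 / (p * real m) \<le> 1 / (q * real m)" using qp pq m0 by (intro divide_left_mono mult_right_mono) auto
    then have a0: "a = 0" by (simp add: a_def bloom_alpha_def)
    have i': "i = 1 / r * (r / q)" "y = 1 / r - i" using pq a0 by (auto simp: i_def y_def)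
    have "\<epsilon> * (r / q - r / p) = t" using exps(10) a0 by simp
    then have t: "r / q = r * real m * t + r / p" using rm0 unfolding \<epsilon>_def by (simp add: field_simps)
    \<comment> \<open>The restriction m \<ge> 2 is used here to ensure rm \<ge> 2.\<close>
    have \<kappa>: "2 \<le> r * real m" using qp(2) r mult_mono[of 1 r 2 "real m"] by simp
    have H2: "nrm lebesgue t (\<lambda>z. \<nu>h z * ennreal ((v1 z / v0 z) powr (1 / (r * real m)))) \<le> H"
      using H' by (simp add: a0 \<epsilon>_def)
    have e: "(A powr (r / p)) powr (r * real m / (1 - r / p) * (1 / r)) = A powr beta_mu2 p r m"
    proof -
      have f: "1 - r / p = (p - r) / p" using pq by (simp add: field_simps)
      have "r / p * (r * real m / (1 - r / p) * (1 / r)) = beta_mu2 p r m"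
        unfolding f using pq r by (simp add: beta_mu2_def)
      then show ?thesis unfolding powr_powr by (simp only:)
    qed
    have "(\<Sum>Q\<in>\<S>. epow (tail_int \<nu>h 1 F (r * real m) Q) (1 / r) * (epow (integ lebesgue Q G) (j + x) / epow (emeasure lebesgue Q) (x + y)))
      \<le> ennreal (K2 * A powr beta_mu2 p r m * ((R * B) powr (1 / q)) powr \<beta>) * epow H (r * real m * (1 / r)) * Nf f * Ng g"
      using rdf_form_bound[OF v_meas(1,2) fm(3,1,2) v_pos(1,2) w' x01 a_nonneg(2) t const_ge_one(5) muck(1) H2 H(2)
          NFt \<kappa> r0 form_exps(1) exps(2) i'(2,1) exps(5,3,4,6) const_ge_one(7) muck(3) \<beta> NGt] unfolding NF NG K2_def e .
    also have "r * real m * (1 / r) = real m" using pq by simp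
    also have "ennreal (K2 * A powr beta_mu2 p r m * ((R * B) powr (1 / q)) powr \<beta>) * epow H (real m) * Nf f * Ng g \<le> ennreal (K2 * C2) * X"
      using mult_left_mono[OF bound_powr(2), of "K2 * A powr beta_mu2 p r m"] K_nonneg(2)
      by (intro mono) (simp add: C2_def mult.assoc)
    finally show ?thesis using le_tail unfolding a0 by (simp add: order_trans)
  qed
  have "?lhs \<le> ennreal ((K1 + K2) * C) * X"
  proof (cases "q \<le> p \<and> 2 \<le> m")
    case True
    have "?lhs \<le> ennreal ((K1 + K2) * C1) * X"
      by (rule order_trans[OF b1]) (use K_nonneg C_pos in \<open>auto intro!: mult_right_mono ennreal_leI\<close>)
    moreover have "?lhs \<le> ennreal ((K1 + K2) * C2) * X"
      by (rule order_trans[OF b2]) (use True K_nonneg C_pos in \<open>auto intro!: mult_right_mono ennreal_leI\<close>)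
    ultimately show ?thesis using True by (auto simp: C_def min_def)
  next
    case False
    then have "C = C1" by (auto simp: C_def)
    then show ?thesis by (rule ssubst, intro order_trans[OF b1]) (use K_nonneg C_pos in \<open>auto intro!: mult_right_mono ennreal_leI\<close>)
  qed
  also have "\<dots> = ennreal (K1 + K2) * ennreal C * Nf f * Ng g * H ^ m"
    using K_nonneg C_pos(3) by (simp only: X_def ennreal_mult add_nonneg_nonneg less_imp_le mult.assoc)
  finally show ?thesis .
qed

lemma sparse_form_eq:
  assumes "S \<subseteq> cubes"
  shows "sparse_form S m b r s f g = (\<Sum>\<^sub>\<infinity>Q\<in>S. epow (form_int b f Q) (1 / r) * form_wt g Q)" unfolding sparse_form_def
proof (rule infsum_cong)
  fix Q assume "Q \<in> S"
  then have Q: "Q \<in> cubes" using assms by auto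
  define c where "c = measure lebesgue Q"
  have c: "emeasure lebesgue Q = ennreal c" "0 < c" using cubes_measure[OF Q] by (auto simp: c_def)
  have m0: "0 < m" using m by simp
  have h: "epow (ennreal (u ^ m * v)) r = epow (ennreal u) (r * real m) * epow (ennreal v) r" if "0 \<le> u" "0 \<le> v" for u v :: real
  proof -
    have "ennreal (u ^ m * v) = epow (ennreal u) (real m) * ennreal v"
      using that by (simp add: ennreal_mult ennreal_power epow_nat[OF m0])
    then show ?thesis by (simp add: epow_mult mult.commute)
  qed
  have s': "conjugate_exponent s = 1 / (1 - \<sigma>)"
  proof -
    have "s = \<infinity> \<or> (\<exists>s0. s = ereal s0 \<and> q < s0)" using s by (cases s) auto
    then show ?thesis using pq by (auto simp: conjugate_exponent_def \<sigma>_def field_simps)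
  qed
  have 1: "avg r (\<lambda>x. ennreal (norm (b x - mean b Q) ^ m * norm (f x))) Q
    = epow (form_int b f Q) (1 / r) / ennreal (c powr (1 / r))"
    unfolding avg_def c h[OF norm_ge_zero norm_ge_zero] by (rule epow_divide[OF c(2)])
  have 2: "avg (conjugate_exponent s) (\<lambda>x. ennreal (norm (g x))) Q
    = epow (\<integral>\<^sup>+z\<in>Q. epow (ennreal (norm (g z))) (1 / (1 - \<sigma>)) \<partial>lebesgue) (1 - \<sigma>) / ennreal (c powr (1 - \<sigma>))"
    unfolding avg_def c s' by (simp add: epow_divide[OF c(2)])
  have "c powr (1 / r) * c powr (1 - \<sigma>) = c * c powr (1 / r - \<sigma>)"
  proof -
    have "c powr (1 / r) * c powr (1 - \<sigma>) = c powr (1 + (1 / r - \<sigma>))"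
      by (simp only: powr_add[symmetric]) (simp add: algebra_simps)
    then show ?thesis using c by (simp add: powr_add)
  qed
  then show "avg r (\<lambda>x. ennreal (norm (b x - mean b Q) ^ m * norm (f x))) Q
      * avg (conjugate_exponent s) (\<lambda>x. ennreal (norm (g x))) Q * emeasure lebesgue Q
    = epow (form_int b f Q) (1 / r) * form_wt g Q"
    unfolding 1 2 form_wt_def c(1) epow_ennreal[OF less_imp_le[OF c(2)]] using c(2) by (intro epow_conjugate_cancel) auto
qed

lemma sparse_bound:
  fixes f g :: "real ^ 'n \<Rightarrow> complex"
  assumes b: "locally_integrable b" and D: "dyadic_lattice \<D>" "S \<subseteq> \<D>" "sparse_family \<eta> S" and \<eta>: "0 < \<eta>"
    and fg [measurable]: "f \<in> borel_measurable lebesgue" "g \<in> borel_measurable lebesgue"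
    and N: "0 < Nf f" "Nf f < top" "Ng g < top" and H: "H < top"
    and maj: "\<And>\<S>. sparse_union lebesgue \<S> \<Longrightarrow> \<S> \<subseteq> cubes \<Longrightarrow>
      \<exists>\<nu>h\<in>borel_measurable lebesgue. (\<forall>P\<in>\<S>. oscillation b P \<le> epow (integ lebesgue P \<nu>h) (1 + a) \<and> (integ lebesgue P \<nu>h) < top)
        \<and> nrm lebesgue t (\<lambda>z. epow (\<nu>h z) (1 + a) * ennreal (\<nu> z powr (- (1 + \<alpha>)))) \<le> H"
  shows "sparse_form S m b r s f g
    \<le> ennreal (real (nat \<lceil>4 / \<eta>\<rceil>) * (4 * 2 ^ CARD('n)) powr real m * (K1 + K2)) * ennreal C * Nf f * Ng g * H ^ m"
proof -
  have S: "S \<subseteq> cubes" using D by (auto simp: dyadic_lattice_def)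
  have \<kappa>: "0 < r * real m" "0 < 1 / r" "r * real m * (1 / r) = real m" using pq m by auto
  have "sparse_form S m b r s f g \<le> ennreal (real (nat \<lceil>4 / \<eta>\<rceil>) * (4 * 2 ^ CARD('n)) powr (r * real m * (1 / r)))
      * (ennreal (K1 + K2) * ennreal C * Nf f * Ng g * H ^ m)" unfolding sparse_form_eq[OF S]
  proof (rule oscillation_form_reduction[OF b D \<eta> \<kappa>(1,2)])
    show "(\<lambda>z. epow (ennreal (norm (f z))) r) \<in> borel_measurable lebesgue" by measurable
    fix \<S> S0 :: "(real ^ 'n) set set" assume S': "S0 \<subseteq> \<S>" "\<S> \<subseteq> cubes" "sparse_union lebesgue \<S>"
    obtain \<nu>h where n: "\<nu>h \<in> borel_measurable lebesgue"
      "\<And>P. P \<in> \<S> \<Longrightarrow> oscillation b P \<le> epow (integ lebesgue P \<nu>h) (1 + a)" "\<And>P. P \<in> \<S> \<Longrightarrow> (integ lebesgue P \<nu>h) < top"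
      "nrm lebesgue t (\<lambda>z. epow (\<nu>h z) (1 + a) * ennreal (\<nu> z powr (- (1 + \<alpha>)))) \<le> H" using maj[OF S'(3,2)] by blast
    show "(\<Sum>Q\<in>S0. epow (\<integral>\<^sup>+z\<in>Q. epow (osc_sum b \<S> Q z) (r * real m) * epow (ennreal (norm (f z))) r \<partial>lebesgue) (1 / r) * form_wt g Q)
      \<le> ennreal (K1 + K2) * ennreal C * Nf f * Ng g * H ^ m" by (rule tree_bound[OF S'(3,2,1) fg n(1,2,3,4) H N])
  qed
  also have "\<dots> = ennreal (real (nat \<lceil>4 / \<eta>\<rceil>) * (4 * 2 ^ CARD('n)) powr real m * (K1 + K2)) * ennreal C * Nf f * Ng g * H ^ m"
  proof -
    have "ennreal (real (nat \<lceil>4 / \<eta>\<rceil>) * (4 * 2 ^ CARD('n)) powr real m * (K1 + K2))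
      = ennreal (real (nat \<lceil>4 / \<eta>\<rceil>) * (4 * 2 ^ CARD('n)) powr real m) * ennreal (K1 + K2)"
      using K_nonneg by (intro ennreal_mult) auto
    then show ?thesis unfolding \<kappa>(3) by (simp only: mult.assoc)
  qed
  finally show ?thesis .
qed

text \<open>For p \<le> q the definition of the norm bounds the oscillation by \<open>H\<close>
  times the power 1 + \<alpha> of the weighted measure; distributing \<open>H\<close> as a power
  1/(1 + \<alpha>) onto \<nu> gives the majorant, whose relative size is constant and hence measured
  in L^\<infinity>.\<close>

lemma BMO_majorant:
  assumes pq': "p \<le> q" and H: "H = BMO_norm (\<alpha> * real CARD('n)) \<nu> b" and S: "\<S> \<subseteq> cubes" and Ht: "H < top"
  shows "\<exists>\<nu>h\<in>borel_measurable lebesgue. (\<forall>P\<in>\<S>. oscillation b P \<le> epow (integ lebesgue P \<nu>h) (1 + a) \<and> (integ lebesgue P \<nu>h) < top)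
        \<and> nrm lebesgue t (\<lambda>z. epow (\<nu>h z) (1 + a) * ennreal (\<nu> z powr (- (1 + \<alpha>)))) \<le> H"
proof -
  have "1 / (q * real m) \<le> 1 / (p * real m)" using pq' pq m by (intro divide_left_mono mult_right_mono) auto
  then have "0 \<le> \<alpha>" by (simp add: \<alpha>_def bloom_alpha_def)
  then have a: "a = \<alpha>" "t = 0" by (auto simp: a_def t_def \<alpha>_def)
  have a1: "0 < 1 + \<alpha>" using alpha_gt by simp
  define \<nu>h where "\<nu>h z = epow H (1 / (1 + \<alpha>)) * ennreal (\<nu> z)" for z
  have int: "integ lebesgue P \<nu>h = epow H (1 / (1 + \<alpha>)) * weight_measure \<nu> P" if "P \<in> cubes" for P
    using cubes_sets[OF that] unfolding \<nu>h_def weight_measure_def mult.assoc by (intro nn_integral_cmult) auto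
  show ?thesis
  proof (intro bexI conjI ballI)
    show "\<nu>h \<in> borel_measurable lebesgue" unfolding \<nu>h_def[abs_def] by measurable
    fix P assume "P \<in> \<S>"
    then have P: "P \<in> cubes" using S by auto
    show "integ lebesgue P \<nu>h < top"
      unfolding int[OF P] using nu_integral(1)[OF P] Ht by (simp add: ennreal_mult_less_top)
    define u where "u = epow (weight_measure \<nu> P) (1 + \<alpha>)"
    have "0 < u" "u < top" using nu_integral[OF P] by (simp_all add: u_def)
    then obtain d where "u = ennreal d" "0 < d" by (cases u) auto
    then have d: "epow (weight_measure \<nu> P) (1 + \<alpha>) = ennreal d" "0 < d" by (simp_all only: u_def)
    have "oscillation b P / epow (weight_measure \<nu> P) (1 + \<alpha>) \<le> H"
      unfolding H BMO_norm_def using P by (intro SUP_upper2[of P]) auto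
    then have "oscillation b P / ennreal d * ennreal d \<le> H * ennreal d" unfolding d(1) by (rule mult_right_mono) simp
    then have "oscillation b P \<le> H * epow (weight_measure \<nu> P) (1 + \<alpha>)" by (simp only: ennreal_divide_mult[OF d(2)] d(1))
    also have "\<dots> = epow (integ lebesgue P \<nu>h) (1 + a)" unfolding int[OF P] epow_mult epow_epow a using a1 by simp
    finally show "oscillation b P \<le> epow (integ lebesgue P \<nu>h) (1 + a)" .
  next
    have "epow (\<nu>h z) (1 + a) * ennreal (\<nu> z powr (- (1 + \<alpha>))) = H" for z
    proof -
      have "epow (ennreal (\<nu> z)) (1 + \<alpha>) * ennreal (\<nu> z powr (- (1 + \<alpha>))) = 1"
        using nu_pos[of z] by (simp add: epow_ennreal ennreal_mult[symmetric] powr_add[symmetric])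
      then show ?thesis unfolding \<nu>h_def epow_mult epow_epow a using a1 by (simp add: mult.assoc)
    qed
    then show "nrm lebesgue t (\<lambda>z. epow (\<nu>h z) (1 + a) * ennreal (\<nu> z powr (- (1 + \<alpha>)))) \<le> H"
      by (simp add: nrm_def a(2) esssup_I)
  qed
qed

text \<open>On each cube of the family the majorant is at least \<nu> times the oscillation quotient
  of that cube, so its integral recovers the oscillation. The Bloom relation turns the norm of the
  majorant into an L^t norm with respect to \<nu>.\<close>

lemma sharp_majorant:
  assumes qp: "q \<le> p" and H: "H = Lp_norm (bloom_t p q m) \<nu> (sharp_maximal \<nu> b)" and b: "locally_integrable b"
    and S: "sparse_union lebesgue \<S>" "\<S> \<subseteq> cubes"
  shows "\<exists>\<nu>h\<in>borel_measurable lebesgue. (\<forall>P\<in>\<S>. oscillation b P \<le> epow (integ lebesgue P \<nu>h) (1 + a) \<and> (integ lebesgue P \<nu>h) < top)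
        \<and> nrm lebesgue t (\<lambda>z. epow (\<nu>h z) (1 + a) * ennreal (\<nu> z powr (- (1 + \<alpha>)))) \<le> H"
proof -
  interpret sparse_union lebesgue \<S> by (rule S(1))
  have m0: "0 < real m" using m by simp
  have "1 / (p * real m) \<le> 1 / (q * real m)" using qp pq m0 by (intro divide_left_mono mult_right_mono) auto
  then have a: "a = 0" "t = - \<alpha>" by (auto simp: a_def t_def \<alpha>_def bloom_alpha_def)
  \<comment> \<open>A supremum over the finite family only: it is measurable, bounded, and dominated
    by the sharp maximal function.\<close>
  define T where "T z = (SUP P\<in>\<S>. oscillation b P / weight_measure \<nu> P * indicator P z)" for z
  define \<nu>h where "\<nu>h z = T z * ennreal (\<nu> z)" for z
  have [measurable]: "T \<in> borel_measurable lebesgue" unfolding T_def[abs_def] using finite_S sets_S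
    by (intro borel_measurable_SUP countable_finite borel_measurable_times_ennreal borel_measurable_const borel_measurable_indicator) auto
  have T_sharp: "T z \<le> sharp_maximal \<nu> b z" for z unfolding T_def
  proof (rule SUP_least)
    fix P assume "P \<in> \<S>"
    then show "oscillation b P / weight_measure \<nu> P * indicator P z \<le> sharp_maximal \<nu> b z"
      using S(2) unfolding sharp_maximal_def by (cases "z \<in> P") (auto intro!: SUP_upper2[of P])
  qed
  have fin: "oscillation b P / weight_measure \<nu> P < top" if "P \<in> \<S>" for P
  proof -
    have P: "P \<in> cubes" using that S by auto
    have "oscillation b P < top" unfolding oscillation_def by (rule mean_deviation(1)[OF b P])
    then show ?thesis using nu_integral[OF P] by (auto simp: less_top[symmetric] ennreal_divide_eq_top_iff)
  qed
  have prod: "\<nu>h z * ennreal (\<nu> z powr (- (1 + \<alpha>))) = T z * ennreal (\<nu> z powr (- \<alpha>))" for z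
  proof -
    have "ennreal (\<nu> z) * ennreal (\<nu> z powr (- (1 + \<alpha>))) = ennreal (\<nu> z powr (- \<alpha>))"
    proof -
      have "\<nu> z * \<nu> z powr (- (1 + \<alpha>)) = \<nu> z powr 1 * \<nu> z powr (- (1 + \<alpha>))" using nu_pos[of z] by simp
      also have "\<dots> = \<nu> z powr (- \<alpha>)" by (simp only: powr_add[symmetric]) simp
      finally show ?thesis using nu_pos[of z] by (simp add: ennreal_mult[symmetric])
    qed
    then show ?thesis by (simp only: \<nu>h_def mult.assoc)
  qed
  show ?thesis
  proof (intro bexI conjI ballI)
    show "\<nu>h \<in> borel_measurable lebesgue" unfolding \<nu>h_def[abs_def] by measurable
    fix P assume PS: "P \<in> \<S>"
    then have P: "P \<in> cubes" using S by auto
    have [measurable]: "P \<in> sets lebesgue" using P by (rule cubes_sets)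
    obtain d where d: "weight_measure \<nu> P = ennreal d" "0 < d"
      using nu_integral[OF P] by (cases "weight_measure \<nu> P") auto
    have "oscillation b P = oscillation b P / weight_measure \<nu> P * weight_measure \<nu> P"
      by (simp only: d(1) ennreal_divide_mult[OF d(2)])
    also have "\<dots> = (\<integral>\<^sup>+z. oscillation b P / weight_measure \<nu> P * (ennreal (\<nu> z) * indicator P z) \<partial>lebesgue)"
      unfolding weight_measure_def by (intro nn_integral_cmult[symmetric]) measurable
    also have "\<dots> \<le> integ lebesgue P \<nu>h"
    proof (intro nn_integral_mono)
      fix z
      have "oscillation b P / weight_measure \<nu> P * indicator P z \<le> T z" unfolding T_def using PS by (intro SUP_upper)
      then show "oscillation b P / weight_measure \<nu> P * (ennreal (\<nu> z) * indicator P z) \<le> \<nu>h z * indicator P z"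
        by (cases "z \<in> P") (auto simp: \<nu>h_def intro: mult_right_mono)
    qed
    finally show "oscillation b P \<le> epow (integ lebesgue P \<nu>h) (1 + a)" by (simp add: a)
    define c where "c = (\<Sum>P\<in>\<S>. oscillation b P / weight_measure \<nu> P)"
    have c: "c < top" unfolding c_def using finite_S fin by simp
    have "integ lebesgue P \<nu>h \<le> (\<integral>\<^sup>+z. c * (ennreal (\<nu> z) * indicator P z) \<partial>lebesgue)"
    proof (intro nn_integral_mono)
      fix z
      have "T z \<le> c" unfolding T_def
      proof (rule SUP_least)
        fix P' assume "P' \<in> \<S>"
        then have "oscillation b P' / weight_measure \<nu> P' \<le> c" unfolding c_def using finite_S by (intro member_le_sum) auto
        then show "oscillation b P' / weight_measure \<nu> P' * indicator P' z \<le> c" by (auto simp: indicator_def)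
      qed
      then show "\<nu>h z * indicator P z \<le> c * (ennreal (\<nu> z) * indicator P z)"
        unfolding \<nu>h_def mult.assoc by (rule mult_right_mono) simp
    qed
    also have "\<dots> = c * weight_measure \<nu> P" unfolding weight_measure_def by (intro nn_integral_cmult) measurable
    also have "\<dots> < top" using c nu_integral(1)[OF P] by (simp add: ennreal_mult_less_top)
    finally show "integ lebesgue P \<nu>h < top" .
  next
    have "nrm lebesgue t (\<lambda>z. T z * ennreal (\<nu> z powr (- \<alpha>))) \<le> H"
    proof (cases "p = q")
      case True
      then have al: "\<alpha> = 0" unfolding \<alpha>_def bloom_alpha_def by simp
      have nz: "\<nu> z \<noteq> 0" for z using nu_pos[of z] by simp
      have "nrm lebesgue t (\<lambda>z. T z * ennreal (\<nu> z powr (- \<alpha>))) = esssup lebesgue T" by (simp add: nrm_def a(2) al nz)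
      also have "\<dots> \<le> esssup lebesgue (sharp_maximal \<nu> b)"
      proof (rule esssup_I)
        show "AE z in lebesgue. T z \<le> esssup lebesgue (sharp_maximal \<nu> b)"
          using esssup_AE[of "sharp_maximal \<nu> b" lebesgue] by eventually_elim (use T_sharp order_trans in blast)
      qed measurable
      also have "\<dots> = H" using True by (simp add: H Lp_norm_def bloom_t_def)
      finally show ?thesis .
    next
      case False
      then have "1 / (p * real m) < 1 / (q * real m)" using qp pq m0 by (intro divide_strict_left_mono mult_strict_right_mono) auto
      then have al: "\<alpha> < 0" by (simp add: \<alpha>_def bloom_alpha_def)
      have "epow (T z * ennreal (\<nu> z powr (- \<alpha>))) (1 / (- \<alpha>)) = epow (T z) (- 1 / \<alpha>) * ennreal (\<nu> z)" for z
        using nu_pos[of z] al by (simp add: epow_mult epow_ennreal powr_powr)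
      then have "nrm lebesgue t (\<lambda>z. T z * ennreal (\<nu> z powr (- \<alpha>))) = epow (\<integral>\<^sup>+z. epow (T z) (- 1 / \<alpha>) * ennreal (\<nu> z) \<partial>lebesgue) (- \<alpha>)"
        using al by (simp add: nrm_pos a(2))
      also have "\<dots> \<le> epow (\<integral>\<^sup>+z. epow (sharp_maximal \<nu> b z) (- 1 / \<alpha>) * ennreal (\<nu> z) \<partial>lebesgue) (- \<alpha>)"
      proof (intro epow_mono nn_integral_mono mult_right_mono T_sharp)
        show "0 \<le> - 1 / \<alpha>" using al by (simp add: divide_nonpos_neg)
      qed (use al in auto)
      also have "\<dots> = H" using False by (simp add: H Lp_norm_def bloom_t_def \<alpha>_def)
      finally show ?thesis .
    qed
    moreover have "epow (\<nu>h z) (1 + a) * ennreal (\<nu> z powr (- (1 + \<alpha>))) = T z * ennreal (\<nu> z powr (- \<alpha>))" for z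
      using prod[of z] by (simp only: a(1) add_0_right epow_1)
    ultimately show "nrm lebesgue t (\<lambda>z. epow (\<nu>h z) (1 + a) * ennreal (\<nu> z powr (- (1 + \<alpha>)))) \<le> H" by (simp only:)
  qed
qed

text \<open>Handles vanishing norms apart, since \<open>0 * \<infinity> = 0\<close> would make the
  right-hand side vanish even for infinite norm of b, and since the majorant needs a positive norm
  of f. A zero norm forces the function to vanish almost everywhere because the weights are
  positive.\<close>

lemma sparse_form_zero:
  fixes f g :: "real ^ 'n \<Rightarrow> complex"
  assumes S: "S \<subseteq> cubes" and [measurable]: "f \<in> borel_measurable lebesgue" "g \<in> borel_measurable lebesgue"
    and N: "Nf f = 0 \<or> Ng g = 0"
  shows "sparse_form S m b r s f g = 0" unfolding sparse_form_eq[OF S]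
proof (rule infsum_0)
  fix Q
  from N show "epow (form_int b f Q) (1 / r) * form_wt g Q = 0"
  proof
    assume "Nf f = 0"
    then have 0: "(\<integral>\<^sup>+z. epow (ennreal (norm (f z))) p * ennreal (\<mu> z) \<partial>lebesgue) = 0" by (simp add: Nf_def Lp_norm_def)
    have "AE z in lebesgue. ennreal (norm (f z)) = 0"
      by (rule nn_integral_eq_0_weight[OF _ meas(1) pos(1) 0]) measurable
    then have "AE z in lebesgue. epow (ennreal (norm (b z - mean b Q))) (r * real m) * epow (ennreal (norm (f z))) r * indicator Q z = 0"
      by eventually_elim simp
    then have "form_int b f Q = (\<integral>\<^sup>+z. 0 \<partial>(lebesgue :: (real ^ 'n) measure))" by (rule nn_integral_cong_AE)
    then show ?thesis by simp
  next
    assume "Ng g = 0"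
    then have 0: "(\<integral>\<^sup>+z. epow (ennreal (norm (g z))) q' * ennreal (lam z powr (1 - q')) \<partial>lebesgue) = 0"
      by (simp add: Ng_def Lp_norm_def)
    have "AE z in lebesgue. ennreal (norm (g z)) = 0"
      using pos(2) by (intro nn_integral_eq_0_weight[OF _ _ _ 0]) (auto simp: less_imp_neq[symmetric])
    then have "AE z in lebesgue. epow (ennreal (norm (g z))) (1 / (1 - \<sigma>)) * indicator Q z = 0" by eventually_elim simp
    then have "(\<integral>\<^sup>+z\<in>Q. epow (ennreal (norm (g z))) (1 / (1 - \<sigma>)) \<partial>lebesgue) = (\<integral>\<^sup>+z. 0 \<partial>(lebesgue :: (real ^ 'n) measure))"
      by (rule nn_integral_cong_AE)
    then show ?thesis by (simp add: form_wt_def)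
  qed
qed

end

section \<open>Independence of representatives and conclusion\<close>

lemma Lp_norm_cong_AE:
  assumes "AE x in lebesgue. w x = w' x"
  shows "Lp_norm p w h = Lp_norm p w' h"
proof -
  have "(\<integral>\<^sup>+x. epow (h x) c * ennreal (w x) \<partial>lebesgue) = (\<integral>\<^sup>+x. epow (h x) c * ennreal (w' x) \<partial>lebesgue)" for c
    using assms by (intro nn_integral_cong_AE) (auto elim: eventually_mono)
  then show ?thesis by (simp add: Lp_norm_def)
qed

lemma weight_measure_cong_AE:
  assumes "AE x in lebesgue. w x = w' x"
  shows "weight_measure w = weight_measure w'"
proof
  fix Q
  show "weight_measure w Q = weight_measure w' Q"
    unfolding weight_measure_def using assms by (intro nn_integral_cong_AE) (auto elim: eventually_mono)
qed

theorem theorem5p1: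
  fixes p q r \<eta> :: real and s :: ereal and m :: nat
  assumes "1 \<le> r" and "r < p" and "r < q" and "ereal p < s" and "ereal q < s"
    and "m \<ge> 1" and "0 < \<eta>" and "\<eta> < 1"
  defines "\<alpha> \<equiv> bloom_alpha p q m"
    and "t \<equiv> bloom_t p q m"
    and "\<nu> \<equiv> bloom_weight p q m"
    and "q' \<equiv> conjugate_exponent (ereal q)"
    and "\<tau> \<equiv> conjugate_exponent (s / ereal q)"
    and "\<beta>mu1 \<equiv> beta_mu1 p q r m"
    and "\<beta>mu2 \<equiv> beta_mu2 p r m"
    and "\<beta>lam1 \<equiv> beta_lambda1 p q r m"
    and "\<beta>lam2 \<equiv> beta_lambda2 p q r s m"
  shows "\<exists>(K::real) > 0. \<exists>C :: (real ^ 'n \<Rightarrow> real) \<Rightarrow> (real ^ 'n \<Rightarrow> real) \<Rightarrow> ennreal.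
    \<forall>\<mu> lam. \<mu> \<in> Ap (p / r) \<longrightarrow> lam \<in> Ap (q / r) \<inter> RH \<tau> \<longrightarrow>
      C \<mu> lam \<le> epow (Ap_const (p / r) \<mu>) \<beta>mu1 * epow (Ap_const (q / r) lam) (\<beta>lam1 + \<beta>lam2)
               * epow (RH_const \<tau> lam) \<beta>lam2 \<and>
      (q \<le> p \<and> m \<ge> 2 \<longrightarrow>
        C \<mu> lam \<le> epow (Ap_const (p / r) \<mu>) \<beta>mu2 * epow (Ap_const (q / r) lam) \<beta>lam2
                 * epow (RH_const \<tau> lam) \<beta>lam2) \<and>
      (\<forall>b \<D> S f g. locally_integrable b \<longrightarrow> dyadic_lattice \<D> \<longrightarrow> S \<subseteq> \<D> \<longrightarrow> sparse_family \<eta> S \<longrightarrow>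
        f \<in> Lp_space p \<mu> \<longrightarrow> g \<in> Lp_space q' (\<lambda>x. lam x powr (1 - q')) \<longrightarrow>
        (p \<le> q \<longrightarrow>
          sparse_form S m b r s f g \<le> ennreal K * C \<mu> lam * Lp_norm p \<mu> (\<lambda>x. ennreal (norm (f x)))
            * Lp_norm q' (\<lambda>x. lam x powr (1 - q')) (\<lambda>x. ennreal (norm (g x)))
            * BMO_norm (\<alpha> * real CARD('n)) (\<nu> \<mu> lam) b ^ m) \<and>
        (q \<le> p \<longrightarrow>
          sparse_form S m b r s f g \<le> ennreal K * C \<mu> lam * Lp_norm p \<mu> (\<lambda>x. ennreal (norm (f x)))
            * Lp_norm q' (\<lambda>x. lam x powr (1 - q')) (\<lambda>x. ennreal (norm (g x)))
            * Lp_norm t (\<nu> \<mu> lam) (sharp_maximal (\<nu> \<mu> lam) b) ^ m))"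
proof -
  \<comment> \<open>\<open>bloom.K1\<close> and \<open>bloom.K2\<close> depend on the exponents
    only, not on the weights or on A, B and R, so the constant can be fixed before the weights are
    given; \<open>K\<close> enlarges it to a positive number.\<close>
  define Kc where "Kc = real (nat \<lceil>4 / \<eta>\<rceil>) * (4 * 2 ^ CARD('n)) powr real m * (bloom.K1 p q r s m + bloom.K2 p q r s m)"
  define K where "K = max Kc 0 + 1"
  define C where "C \<mu> lam = (let
      B1 = epow (Ap_const (p / r) \<mu>) \<beta>mu1 * epow (Ap_const (q / r) lam) (\<beta>lam1 + \<beta>lam2) * epow (RH_const \<tau> lam) \<beta>lam2;
      B2 = epow (Ap_const (p / r) \<mu>) \<beta>mu2 * epow (Ap_const (q / r) lam) \<beta>lam2 * epow (RH_const \<tau> lam) \<beta>lam2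
    in if q \<le> p \<and> 2 \<le> m then min B1 B2 else B1)" for \<mu> lam :: "real ^ 'n \<Rightarrow> real"
  have K: "0 < K" "Kc \<le> K" by (auto simp: K_def)
  have main: "(p \<le> q \<longrightarrow>
          sparse_form S m b r s f g \<le> ennreal K * C \<mu> lam * Lp_norm p \<mu> (\<lambda>x. ennreal (norm (f x)))
            * Lp_norm q' (\<lambda>x. lam x powr (1 - q')) (\<lambda>x. ennreal (norm (g x)))
            * BMO_norm (\<alpha> * real CARD('n)) (\<nu> \<mu> lam) b ^ m) \<and>
        (q \<le> p \<longrightarrow>
          sparse_form S m b r s f g \<le> ennreal K * C \<mu> lam * Lp_norm p \<mu> (\<lambda>x. ennreal (norm (f x)))
            * Lp_norm q' (\<lambda>x. lam x powr (1 - q')) (\<lambda>x. ennreal (norm (g x)))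
            * Lp_norm t (\<nu> \<mu> lam) (sharp_maximal (\<nu> \<mu> lam) b) ^ m)"
    if \<mu>: "\<mu> \<in> Ap (p / r)" and lam: "lam \<in> Ap (q / r) \<inter> RH \<tau>"
      and b: "locally_integrable b" and D: "dyadic_lattice \<D>" "S \<subseteq> \<D>" "sparse_family \<eta> S"
      and f: "f \<in> Lp_space p \<mu>" and g: "g \<in> Lp_space q' (\<lambda>x. lam x powr (1 - q'))"
    for \<mu> lam :: "real ^ 'n \<Rightarrow> real" and b f g :: "real ^ 'n \<Rightarrow> complex" and S \<D> :: "(real ^ 'n) set set"
  proof -
    have gt: "1 < p / r" "1 < q / r" using assms(1-3) by auto
    obtain \<mu>' A where \<mu>': "\<mu>' \<in> borel_measurable lebesgue" "\<And>x. 0 < \<mu>' x" "AE x in lebesgue. \<mu>' x = \<mu> x"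
      and A: "Ap_const (p / r) \<mu> = ennreal A" "0 \<le> A"
        "\<And>Q. Q \<in> cubes \<Longrightarrow> avg 1 (\<lambda>x. ennreal (\<mu>' x)) Q * avg (1 / (p / r - 1)) (\<lambda>x. inverse (ennreal (\<mu>' x))) Q \<le> ennreal A"
      using Ap_representative[OF \<mu> gt(1)] by blast
    have lamA: "lam \<in> Ap (q / r)" and lamR: "lam \<in> RH \<tau>" using lam by auto
    obtain lam' B where lam': "lam' \<in> borel_measurable lebesgue" "\<And>x. 0 < lam' x" "AE x in lebesgue. lam' x = lam x"
      and B: "Ap_const (q / r) lam = ennreal B" "0 \<le> B"
        "\<And>Q. Q \<in> cubes \<Longrightarrow> avg 1 (\<lambda>x. ennreal (lam' x)) Q * avg (1 / (q / r - 1)) (\<lambda>x. inverse (ennreal (lam' x))) Q \<le> ennreal B"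
      using Ap_representative[OF lamA gt(2)] by blast
    obtain R where R: "RH_const \<tau> lam = ennreal R" "0 \<le> R"
        "\<And>Q. Q \<in> cubes \<Longrightarrow> avg \<tau> (\<lambda>x. ennreal (lam' x)) Q \<le> ennreal R * avg 1 (\<lambda>x. ennreal (lam' x)) Q"
      using RH_bound[OF lamR lam'] by blast
    \<comment> \<open>The estimates are run for the positive representatives; the norms and the
      weighted measures agree with those of the original weights, which carries the result
      back.\<close>
    interpret bl: bloom p q r s m \<mu>' lam' A B R using assms(1-6) \<mu>' lam' A B R(2,3) by unfold_locales (auto simp: \<tau>_def)
    have C: "C \<mu> lam = ennreal bl.C"
    proof -
      have "epow (Ap_const (p / r) \<mu>) \<beta>mu1 * epow (Ap_const (q / r) lam) (\<beta>lam1 + \<beta>lam2) * epow (RH_const \<tau> lam) \<beta>lam2 = ennreal bl.C1"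
        "epow (Ap_const (p / r) \<mu>) \<beta>mu2 * epow (Ap_const (q / r) lam) \<beta>lam2 * epow (RH_const \<tau> lam) \<beta>lam2 = ennreal bl.C2"
        using A(2) B(2) R(2)
        by (simp_all add: A(1) B(1) R(1) epow_ennreal ennreal_mult bl.C1_def bl.C2_def \<beta>mu1_def \<beta>mu2_def \<beta>lam1_def \<beta>lam2_def)
      then show ?thesis using bl.C_pos by (auto simp: C_def Let_def bl.C_def min_def ennreal_le_iff less_imp_le)
    qed
    have ae: "AE x in lebesgue. bloom_weight p q m \<mu> lam x = bl.\<nu> x"
      using \<mu>'(3) lam'(3) by eventually_elim (simp add: bl.\<nu>_def bloom_weight_def)
    note wm = weight_measure_cong_AE[OF ae]
    have q': "q' = bl.q'" by (simp add: q'_def bl.q'_def)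
    have Nf: "Lp_norm p \<mu> (\<lambda>x. ennreal (norm (f x))) = bl.Nf f"
      unfolding bl.Nf_def using \<mu>'(3) by (intro Lp_norm_cong_AE) (auto elim: eventually_mono)
    have Ng: "Lp_norm q' (\<lambda>x. lam x powr (1 - q')) (\<lambda>x. ennreal (norm (g x))) = bl.Ng g"
      unfolding bl.Ng_def q' using lam'(3) by (intro Lp_norm_cong_AE) (auto elim: eventually_mono)
    have fm: "f \<in> borel_measurable lebesgue" "g \<in> borel_measurable lebesgue" using f g by (auto simp: Lp_space_def)
    have N: "bl.Nf f < top" "bl.Ng g < top" using f g by (simp_all add: Lp_space_def Nf Ng)
    have \<alpha>: "\<alpha> = bl.\<alpha>" by (simp add: \<alpha>_def bl.\<alpha>_def)
    have BMO: "BMO_norm (\<alpha> * real CARD('n)) (\<nu> \<mu> lam) b = BMO_norm (bl.\<alpha> * real CARD('n)) bl.\<nu> b"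
      by (simp add: BMO_norm_def \<nu>_def wm \<alpha>)
    have sharp: "Lp_norm t (\<nu> \<mu> lam) (sharp_maximal (\<nu> \<mu> lam) b) = Lp_norm (bloom_t p q m) bl.\<nu> (sharp_maximal bl.\<nu> b)"
    proof -
      have "sharp_maximal (\<nu> \<mu> lam) b = sharp_maximal bl.\<nu> b" by (simp add: sharp_maximal_def[abs_def] \<nu>_def wm)
      then show ?thesis using Lp_norm_cong_AE[OF ae] by (simp add: \<nu>_def t_def)
    qed
    have Sc: "S \<subseteq> cubes" using D by (auto simp: dyadic_lattice_def)
    have bound: "sparse_form S m b r s f g \<le> ennreal K * C \<mu> lam * bl.Nf f * bl.Ng g * H ^ m"
      if maj: "\<And>\<S>. sparse_union lebesgue \<S> \<Longrightarrow> \<S> \<subseteq> cubes \<Longrightarrow> H < top \<Longrightarrow>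
        \<exists>\<nu>h\<in>borel_measurable lebesgue. (\<forall>P\<in>\<S>. oscillation b P \<le> epow (integ lebesgue P \<nu>h) (1 + bl.a) \<and> (integ lebesgue P \<nu>h) < top)
        \<and> nrm lebesgue bl.t (\<lambda>z. epow (\<nu>h z) (1 + bl.a) * ennreal (bl.\<nu> z powr (- (1 + bl.\<alpha>)))) \<le> H"
      for H :: ennreal
    proof (cases "bl.Nf f = 0 \<or> bl.Ng g = 0")
      case True
      then show ?thesis using bl.sparse_form_zero[OF Sc fm True] by simp
    next
      case False
      then have pos: "0 < bl.Nf f" "0 < bl.Ng g" by (auto simp: zero_less_iff_neq_zero)
      show ?thesis
      \<comment> \<open>With both norms positive, an infinite norm of b makes the right-hand side
        infinite, as all other factors are nonzero.\<close>
      proof (cases "H = top")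
        case True
        have "H ^ m = top" using epow_nat[of m top] assms(6) by (simp add: True)
        then have "ennreal K * C \<mu> lam * bl.Nf f * bl.Ng g * H ^ m = top"
          using K(1) bl.C_pos(3) False unfolding C by (simp add: ennreal_mult_eq_top_iff)
        then show ?thesis by (simp only: top_greatest)
      next
        case False
        then have H: "H < top" by (simp add: less_top)
        have "sparse_form S m b r s f g \<le> ennreal Kc * ennreal bl.C * bl.Nf f * bl.Ng g * H ^ m"
          unfolding Kc_def using maj H by (intro bl.sparse_bound[OF b D assms(7) fm pos(1) N H]) auto
        also have "\<dots> \<le> ennreal K * C \<mu> lam * bl.Nf f * bl.Ng g * H ^ m"
          unfolding C using K(2) by (intro mult_right_mono ennreal_leI) auto
        finally show ?thesis .
      qed
    qed
    show ?thesis unfolding Nf Ng BMO sharp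
    proof (intro conjI impI)
      assume "p \<le> q"
      then show "sparse_form S m b r s f g \<le> ennreal K * C \<mu> lam * bl.Nf f * bl.Ng g * BMO_norm (bl.\<alpha> * real CARD('n)) bl.\<nu> b ^ m"
        by (intro bound bl.BMO_majorant refl)
    next
      assume "q \<le> p"
      then show "sparse_form S m b r s f g \<le> ennreal K * C \<mu> lam * bl.Nf f * bl.Ng g
          * Lp_norm (bloom_t p q m) bl.\<nu> (sharp_maximal bl.\<nu> b) ^ m" by (intro bound bl.sharp_majorant refl b)
    qed
  qed
  show ?thesis
  proof (intro exI[of _ K] exI[of _ C] conjI allI impI K(1))
    fix \<mu> lam :: "real ^ 'n \<Rightarrow> real"
    show "C \<mu> lam \<le> epow (Ap_const (p / r) \<mu>) \<beta>mu1 * epow (Ap_const (q / r) lam) (\<beta>lam1 + \<beta>lam2) * epow (RH_const \<tau> lam) \<beta>lam2"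
      by (simp add: C_def Let_def)
    show "C \<mu> lam \<le> epow (Ap_const (p / r) \<mu>) \<beta>mu2 * epow (Ap_const (q / r) lam) \<beta>lam2 * epow (RH_const \<tau> lam) \<beta>lam2"
      if "q \<le> p \<and> 2 \<le> m" using that by (simp add: C_def Let_def)
  qed (use main in blast)+
qed

end
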